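(* Let $\bar u\in \mathrm{SBV}(0,L)$ be either: (i) $\bar u(x)=\frac aLx$ for some $a>0$, or (ii) $\bar u(x)=c_0x+(a-c_0L)\chi_{(\frac L2,L)}(x)$ with $c_0\in(0,\frac{\sigma_{\mathrm c}}2)$ and $g'(a-c_0L)=2c_0$, or (iii) $\bar u(x)=a\chi_{(\frac L2,L)}(x)$ with $a=s_{\mathrm{frac}}$ (if $s_{\mathrm{frac}}$ is finite). Then for every $\varepsilon>0$ sufficiently small there exists a critical point $(u_\varepsilon,v_\varepsilon)$ of $\mathcal{F}_\varepsilon$, with some boundary value $a_\varepsilon$, such that $a_\varepsilon\to a$ as $\varepsilon\to0$, the energies $\mathcal{F}_\varepsilon(u_\varepsilon,v_\varepsilon)$ are uniformly bounded in $\varepsilon$, and $u_\varepsilon\to\bar u$ in $L^1(0,L)$ as $\varepsilon\to0$.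
   Context: Let $L>0$, $\sigma_{\mathrm c}\in(0,+\infty)$, and let $f$ satisfy: (f1) $f\in C^2([0,1);[0,+\infty))$ and $f^{-1}(0)=\{0\}$; (f2) $\lim_{s\to1^-}(1-s)f(s)=\sigma_{\mathrm c}$; (f3) $\frac{d}{ds}[(1-s)f(s)]>0$ for all $s\in(0,1)$; (f4) $\frac{d}{ds}\left[\frac{(1-s)f'(s)}{f(s)}\right]<0$ for all $s\in(0,1)$; (f5) $\lim_{s\to1^-}\frac{1}{(1-s)^3}\frac{d}{ds}[(1-s)f(s)]=+\infty$; (f6) the map $s\mapsto\sqrt{s}\,f(1-\sqrt{s})$ is convex. Truncation. For $\varepsilon>0$ fix $s_\varepsilon\in(0,1)$ with $s_\varepsilon\uparrow1$ and $\sqrt\varepsilon f(s_\varepsilon)\to1$ as $\varepsilon\to0$. Let $f_\varepsilon(s)=\sqrt\varepsilon f(s)$ for $0\le s\le s_\varepsilon$ and $f_\varepsilon(s)=\psi_\varepsilon(s)$ for $s_\varepsilon<s\le1$, where $\psi_\varepsilon:[0,1]\to[0,1]$ is any function such that: $\psi_\varepsilon\in C^2([0,1])$ is monotone nondecreasing with $\psi_\varepsilon(1)=1$; $\psi_\varepsilon(s_\varepsilon)=\sqrt\varepsilon f(s_\varepsilon)$ and $\psi_\varepsilon'(s_\varepsilon)=\sqrt\varepsilon f'(s_\varepsilon)$; the map $s\mapsto\frac{\psi_\varepsilon'(s)}{1-s}$ is monotone nonincreasing. Extend $f_\varepsilon$ to a $C^1$ function on $\mathbb{R}$ by $f_\varepsilon(s)=\sqrt\varepsilon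 f'(0)s$ for $s<0$ and $f_\varepsilon(s)=1$ for $s>1$. Write $f^2(s):=(f(s))^2$, $f_\varepsilon^2(s):=(f_\varepsilon(s))^2$. Phase-field functionals. For $u,v\in H^1(0,L)$ with $0\le v\le1$ a.e., $$\mathcal{F}_\varepsilon(u,v)=\int_0^L\Bigl(f_\varepsilon^2(v)|u'|^2+\frac{(1-v)^2}{4\varepsilon}+\varepsilon|v'|^2\Bigr)dx,$$ and $\mathcal{F}_\varepsilon(u,v)=+\infty$ for all other $(u,v)\in L^1(0,L)^2$. Critical points. A critical point of $\mathcal{F}_\varepsilon$ (with boundary value $a_\varepsilon\in\mathbb{R}$) is a pair $u_\varepsilon,v_\varepsilon\in H^1(0,L)$ solving in the weak sense $$-\varepsilon v_\varepsilon''+f_\varepsilon(v_\varepsilon)f_\varepsilon'(v_\varepsilon)(u_\varepsilon')^2+\tfrac{v_\varepsilon-1}{4\varepsilon}=0,\qquad \bigl(f_\varepsilon^2(v_\varepsilon)u_\varepsilon'\bigr)'=0\quad\text{in }(0,L),$$ with $u_\varepsilon(0)=0$, $u_\varepsilon(L)=a_\varepsilon$, $v_\varepsilon(0)=v_\varepsilon(L)=1$. Cohesive density. For $s\ge0$, $g(s):=\inf_{(\alpha,\beta)\in\mathcal{U}_s}\mathcal{G}(\alpha,\beta)$ with $$\mathcal{G}(\alpha,\beta)=\int_{-\infty}^{+\infty}\Bigl(f^2(\beta)|\alpha'|^2+\frac{(1-\beta)^2}{4}+|\beta'|^2\Bigr)dt,$$ $\mathcal{U}_s$ being the set of $(\alpha,\beta)\in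 H^1_{\mathrm{loc}}(\mathbb{R})^2$ with $\alpha'\in L^1(\mathbb{R})$, $\left|\int_{\mathbb{R}}\alpha'dt\right|=s$, $0\le\beta\le1$, $\lim_{|t|\to\infty}\beta(t)=1$ (convention: $f(\beta)|\alpha'|=0$ where $\beta=1$ and $\alpha'=0$). Set $s_{\mathrm{frac}}:=\sup\{s: g(s)<1\}\in(0,+\infty]$. The function $g:[0,+\infty)\to[0,+\infty)$ is of class $C^1$ (so in (ii) it is understood that $a-c_0L\ge0$). $\chi_E$ denotes the characteristic function of $E$. *)

theory Defs
  imports "HOL-Analysis.Analysis"
begin

definition test_function :: "real set \<Rightarrow> (real \<Rightarrow> real) \<Rightarrow> bool" where
  "test_function S \<phi> \<longleftrightarrow>
     (\<forall>n x. (deriv ^^ n) \<phi> differentiable (at x)) \<and>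
     compact (closure {x. \<phi> x \<noteq> 0}) \<and> closure {x. \<phi> x \<noteq> 0} \<subseteq> S"

definition locally_integrable_on :: "(real \<Rightarrow> real) \<Rightarrow> real set \<Rightarrow> bool" where
  "locally_integrable_on w S \<longleftrightarrow> (\<forall>K. compact K \<and> K \<subseteq> S \<longrightarrow> w absolutely_integrable_on K)"

definition has_weak_deriv_on :: "(real \<Rightarrow> real) \<Rightarrow> (real \<Rightarrow> real) \<Rightarrow> real set \<Rightarrow> bool" where
  "has_weak_deriv_on u w S \<longleftrightarrow>
     locally_integrable_on u S \<and> locally_integrable_on w S \<and>
     (\<forall>\<phi>. test_function S \<phi> \<longrightarrow>
        (LINT x:S|lebesgue. u x * deriv \<phi> x) = - (LINT x:S|lebesgue. w x * \<phi> x))"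

text \<open>The weak derivative is determined only almost everywhere; every use below is invariant
  under the choice of the representative.\<close>

definition weak_deriv_on :: "real set \<Rightarrow> (real \<Rightarrow> real) \<Rightarrow> real \<Rightarrow> real" where
  "weak_deriv_on S u = (SOME w. has_weak_deriv_on u w S)"

definition L2_on :: "real set \<Rightarrow> (real \<Rightarrow> real) set" where
  "L2_on S = {u. u \<in> borel_measurable (lebesgue_on S) \<and> integrable (lebesgue_on S) (\<lambda>x. (u x)\<^sup>2)}"

definition H1_on :: "real set \<Rightarrow> (real \<Rightarrow> real) set" where
  "H1_on S = {u. u \<in> L2_on S \<and> (\<exists>w \<in> L2_on S. has_weak_deriv_on u w S)}"

definition H1_loc_on :: "real set \<Rightarrow> (real \<Rightarrow> real) set" where
  "H1_loc_on S = {u. (\<forall>K. compact K \<and> K \<subseteq> S \<longrightarrow> u \<in> L2_on K) \<and>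
     (\<exists>w. (\<forall>K. compact K \<and> K \<subseteq> S \<longrightarrow> w \<in> L2_on K) \<and> has_weak_deriv_on u w S)}"

text \<open>At end points belonging to \<open>S\<close> the derivatives are one-sided.\<close>

definition C2_on :: "real set \<Rightarrow> (real \<Rightarrow> real) \<Rightarrow> bool" where
  "C2_on S f \<longleftrightarrow> (\<exists>f' f''.
     (\<forall>x\<in>S. (f has_real_derivative f' x) (at x within S)) \<and>
     (\<forall>x\<in>S. (f' has_real_derivative f'' x) (at x within S)) \<and>
     continuous_on S f'')"

text \<open>Only the values of \<open>f\<close> on \<open>[0,1)\<close> are relevant. In the last clause, \<open>1 - sqrt s\<close> lies
  in \<open>[0,1)\<close> exactly when \<open>0 < s \<le> 1\<close>.\<close>

definition cohesive_degradation :: "real \<Rightarrow> (real \<Rightarrow> real) \<Rightarrow> bool" where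
  "cohesive_degradation \<sigma>c f \<longleftrightarrow>
     C2_on {0..<1} f \<and> (\<forall>s\<in>{0..<1}. 0 \<le> f s) \<and> {s\<in>{0..<1}. f s = 0} = {0} \<and>
     ((\<lambda>s. (1 - s) * f s) \<longlongrightarrow> \<sigma>c) (at_left 1) \<and>
     (\<forall>s\<in>{0<..<1}. deriv (\<lambda>t. (1 - t) * f t) s > 0) \<and>
     (\<forall>s\<in>{0<..<1}. deriv (\<lambda>t. (1 - t) * deriv f t / f t) s < 0) \<and>
     filterlim (\<lambda>s. 1 / (1 - s) ^ 3 * deriv (\<lambda>t. (1 - t) * f t) s) at_top (at_left 1) \<and>
     convex_on {0<..1} (\<lambda>s. sqrt s * f (1 - sqrt s))"

text \<open>\<open>seps \<epsilon>\<close> is the truncation level \<open>s\<^sub>\<epsilon>\<close> and \<open>\<psi> \<epsilon>\<close> the profile used above it. The condition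
  on \<open>\<psi>'(s) / (1 - s)\<close> is imposed on \<open>[s\<^sub>\<epsilon>,1)\<close>, the range on which \<open>\<psi> \<epsilon>\<close> is used: on all of
  \<open>[0,1)\<close> it could not be met for small \<open>\<epsilon>\<close>, since \<open>\<psi>'(s\<^sub>\<epsilon>)\<close> is at least of the order of
  \<open>1 / (1 - s\<^sub>\<epsilon>)\<close> while \<open>\<psi>\<close> takes values in \<open>[0,1]\<close>.\<close>

definition truncation_data ::
    "(real \<Rightarrow> real) \<Rightarrow> (real \<Rightarrow> real) \<Rightarrow> (real \<Rightarrow> real \<Rightarrow> real) \<Rightarrow> bool" where
  "truncation_data f seps \<psi> \<longleftrightarrow>
     (\<forall>\<epsilon>>0. seps \<epsilon> \<in> {0<..<1}) \<and>
     antimono_on {0<..} seps \<and> (seps \<longlongrightarrow> 1) (at_right 0) \<and>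
     ((\<lambda>\<epsilon>. sqrt \<epsilon> * f (seps \<epsilon>)) \<longlongrightarrow> 1) (at_right 0) \<and>
     (\<forall>\<epsilon>>0.
        \<psi> \<epsilon> ` {0..1} \<subseteq> {0..1} \<and> C2_on {0..1} (\<psi> \<epsilon>) \<and> mono_on {0..1} (\<psi> \<epsilon>) \<and> \<psi> \<epsilon> 1 = 1 \<and>
        \<psi> \<epsilon> (seps \<epsilon>) = sqrt \<epsilon> * f (seps \<epsilon>) \<and>
        deriv (\<psi> \<epsilon>) (seps \<epsilon>) = sqrt \<epsilon> * deriv f (seps \<epsilon>) \<and>
        antimono_on {seps \<epsilon>..<1} (\<lambda>s. deriv (\<psi> \<epsilon>) s / (1 - s)))"

definition trunc_f ::
    "(real \<Rightarrow> real) \<Rightarrow> (real \<Rightarrow> real) \<Rightarrow> (real \<Rightarrow> real \<Rightarrow> real) \<Rightarrow> real \<Rightarrow> real \<Rightarrow> real" where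
  "trunc_f f seps \<psi> \<epsilon> s =
     (if s < 0 then sqrt \<epsilon> * vector_derivative f (at 0 within {0..<1}) * s
      else if s \<le> seps \<epsilon> then sqrt \<epsilon> * f s
      else if s \<le> 1 then \<psi> \<epsilon> s
      else 1)"

text \<open>Here and below \<open>h\<close> plays the role of \<open>f\<^sub>\<epsilon>\<close>.\<close>

definition phase_field_energy ::
    "real \<Rightarrow> (real \<Rightarrow> real) \<Rightarrow> real \<Rightarrow> (real \<Rightarrow> real) \<Rightarrow> (real \<Rightarrow> real) \<Rightarrow> ennreal" where
  "phase_field_energy L h \<epsilon> u v =
     (let I = {0<..<L}; u' = weak_deriv_on I u; v' = weak_deriv_on I v in
      if u \<in> H1_on I \<and> v \<in> H1_on I \<and> (AE x in lebesgue_on I. 0 \<le> v x \<and> v x \<le> 1)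
      then \<integral>\<^sup>+x. ennreal ((h (v x))\<^sup>2 * \<bar>u' x\<bar>\<^sup>2 + (1 - v x)\<^sup>2 / (4 * \<epsilon>) + \<epsilon> * \<bar>v' x\<bar>\<^sup>2)
             \<partial>(lebesgue_on I)
      else \<infinity>)"

text \<open>The boundary values of Sobolev functions are those of the continuous representatives, so
  \<open>u\<close> and \<open>v\<close> are taken to be these.\<close>

definition critical_point ::
    "real \<Rightarrow> (real \<Rightarrow> real) \<Rightarrow> real \<Rightarrow> real \<Rightarrow> (real \<Rightarrow> real) \<Rightarrow> (real \<Rightarrow> real) \<Rightarrow> bool" where
  "critical_point L h \<epsilon> b u v \<longleftrightarrow>
     (let I = {0<..<L}; u' = weak_deriv_on I u; v' = weak_deriv_on I v in
      u \<in> H1_on I \<and> v \<in> H1_on I \<and> continuous_on {0..L} u \<and> continuous_on {0..L} v \<and>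
      (\<forall>\<phi>. test_function I \<phi> \<longrightarrow>
        (LINT x:I|lebesgue. \<epsilon> * v' x * deriv \<phi> x
            + h (v x) * deriv h (v x) * (u' x)\<^sup>2 * \<phi> x + (v x - 1) / (4 * \<epsilon>) * \<phi> x) = 0) \<and>
      (\<forall>\<phi>. test_function I \<phi> \<longrightarrow>
        (LINT x:I|lebesgue. (h (v x))\<^sup>2 * u' x * deriv \<phi> x) = 0) \<and>
      u 0 = 0 \<and> u L = b \<and> v 0 = 1 \<and> v L = 1)"

text \<open>\<open>f\<close> blows up at \<open>1\<close>, so it is extended by \<open>\<infinity>\<close> there; the convention \<open>\<infinity> * 0 = 0\<close> of
  \<^typ>\<open>ennreal\<close> makes \<open>f(\<beta>) |\<alpha>'|\<close> vanish where \<open>\<beta> = 1\<close> and \<open>\<alpha>' = 0\<close>.\<close>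

definition f_ext :: "(real \<Rightarrow> real) \<Rightarrow> real \<Rightarrow> ennreal" where
  "f_ext f s = (if s = 1 then \<infinity> else ennreal (f s))"

definition profile_energy ::
    "(real \<Rightarrow> real) \<Rightarrow> (real \<Rightarrow> real) \<Rightarrow> (real \<Rightarrow> real) \<Rightarrow> ennreal" where
  "profile_energy f \<alpha> \<beta> =
     (let \<alpha>' = weak_deriv_on UNIV \<alpha>; \<beta>' = weak_deriv_on UNIV \<beta> in
      \<integral>\<^sup>+t. (f_ext f (\<beta> t) * ennreal \<bar>\<alpha>' t\<bar>)\<^sup>2
            + ennreal ((1 - \<beta> t)\<^sup>2 / 4 + \<bar>\<beta>' t\<bar>\<^sup>2) \<partial>lebesgue)"

text \<open>\<open>\<beta>\<close> is taken to be the continuous representative, which gives the pointwise conditions on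
  it their usual meaning.\<close>

definition profiles :: "real \<Rightarrow> ((real \<Rightarrow> real) \<times> (real \<Rightarrow> real)) set" where
  "profiles s = {(\<alpha>, \<beta>).
     \<alpha> \<in> H1_loc_on UNIV \<and> \<beta> \<in> H1_loc_on UNIV \<and> continuous_on UNIV \<beta> \<and>
     integrable lebesgue (weak_deriv_on UNIV \<alpha>) \<and>
     \<bar>LINT t|lebesgue. weak_deriv_on UNIV \<alpha> t\<bar> = s \<and>
     (\<forall>t. 0 \<le> \<beta> t \<and> \<beta> t \<le> 1) \<and> (\<beta> \<longlongrightarrow> 1) at_top \<and> (\<beta> \<longlongrightarrow> 1) at_bot}"

text \<open>The infimum is finite (at most \<open>1\<close>) for \<open>s \<ge> 0\<close>, so nothing is lost in passing to
  \<^typ>\<open>real\<close>. For \<open>s < 0\<close> there are no profiles and the value is irrelevant.\<close>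

definition cohesive_density :: "(real \<Rightarrow> real) \<Rightarrow> real \<Rightarrow> real" where
  "cohesive_density f s = enn2real (INF (\<alpha>, \<beta>) \<in> profiles s. profile_energy f \<alpha> \<beta>)"

definition s_frac :: "(real \<Rightarrow> real) \<Rightarrow> ereal" where
  "s_frac f = Sup (ereal ` {s. 0 \<le> s \<and> cohesive_density f s < 1})"

end

theory Submission
  imports Defs "HOL-Computational_Algebra.Polynomial"
begin

text \<open>
  The elastic limit needs no construction: for \<open>v = 1\<close> and affine \<open>u\<close> both equations hold, because
  the truncated degradation function has derivative zero at \<open>1\<close> (\<open>constant_critical_point\<close>). The
  other two limits come from a one-parameter family of critical points, indexed by a stress
  \<open>p \<in> (0,\<sigma>c)\<close>, that converge to the function with slope \<open>p / 2\<close> and a jump \<open>S p\<close> at the midpoint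
  (\<open>cohesive_approximation\<close>). It then remains to see that the cohesive limit is exactly
  this one for \<open>p = 2 c\<^sub>0\<close>, and that the fractured limit is approached as \<open>p \<rightarrow> 0\<close>.

  For the cohesive density \<open>g\<close>, let \<open>w v = (1 - v) f v\<close>, a strictly increasing function from \<open>0\<close> to \<open>\<sigma>c\<close>.
  For a profile with minimum \<open>m\<close> put \<open>p = w m\<close> and split \<open>(1 - \<beta>)\<^sup>2 / 4\<close> according to
  \<open>cos\<^sup>2 \<theta> + sin\<^sup>2 \<theta> = 1\<close>, where \<open>cos \<theta> = p / w \<beta>\<close>. Two applications of the inequality between
  arithmetic and geometric means bound the energy of a profile of opening \<open>s\<close> from below by
  \<open>p s + H p\<close>, where \<open>H p\<close> is an explicit integral in \<open>\<theta>\<close> (\<open>profile_energy_lower\<close>). Equality in both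
  inequalities is an autonomous differential equation for \<open>\<theta>\<close>; its solution has the opening \<open>S p\<close>, and
  multiplying \<open>\<alpha>\<close> by a constant gives a quadratic upper bound for all other openings
  (\<open>profile_inf_upper\<close>). Convexity of \<open>s \<mapsto> \<surd>s f (1 - \<surd>s)\<close> makes \<open>(1 - v)\<^sup>2\<close> a convex
  function of \<open>w v\<close>, and integrating its tangent inequality over \<open>\<theta>\<close> gives
  \<open>H q \<ge> H p - S p (q - p)\<close> (\<open>H_tangent\<close>): the slope of \<open>H\<close> is minus the opening. Therefore
  \<open>g (S p) = p S p + H p\<close>, the quadratic upper bound touches \<open>g\<close> from above at \<open>S p\<close> with slope \<open>p\<close>, and
  \<open>g' s = p\<close> forces \<open>s = S p\<close> (\<open>density_deriv_imp_S\<close>). Similarly \<open>s_frac\<close> is the supremum of \<open>S\<close>,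
  approached as \<open>p \<rightarrow> 0\<close> (\<open>s_frac_limit\<close>).

  For the critical points, write \<open>h\<close> for the truncated degradation function. The second equation says
  \<open>u' = \<surd>q / h\<^sup>2 v\<close> for a constant \<open>q\<close>, and then the first has the integral \<open>(\<epsilon> v')\<^sup>2 = G q v\<close>, where
  \<open>G q v = ((1 - v)\<^sup>2 - (1 - m)\<^sup>2) / 4 + q (e m - e v)\<close>, \<open>e = \<epsilon> (1 / h\<^sup>2 - 1)\<close> and \<open>m\<close> is the minimum of \<open>v\<close>.
  Fix \<open>m\<close> with \<open>w m = p\<close> and look for a solution symmetric about \<open>L / 2\<close>. It exists as soon as the time
  \<open>T q\<close> needed to climb from \<open>m\<close> to \<open>1\<close> is \<open>L / 2\<close>. At the threshold \<open>qs\<close> the state \<open>v = 1\<close> becomes an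
  equilibrium, so that \<open>T q\<close> is unbounded as \<open>q\<close> decreases to \<open>qs\<close>, while \<open>T (qs + \<epsilon>)\<close> is small for small
  \<open>\<epsilon>\<close>; a suitable \<open>q\<close> exists in between
  (\<open>travel_time_attained\<close>), and \<open>q \<rightarrow> p\<^sup>2 / 4\<close>. What keeps every estimate uniform in \<open>\<epsilon>\<close> is that the
  truncation \<open>\<psi>\<close>, whose derivative divided by \<open>1 - s\<close> is nonincreasing, is a concave function of
  \<open>(1 - s)\<^sup>2\<close>; this yields \<open>e v \<le> (1 - v)\<^sup>2 / p\<^sup>2\<close> and \<open>G q v \<ge> c (v - m) (1 - v)\<^sup>2\<close> up to \<open>v = 1\<close>.

  Finally \<open>u' = \<surd>q + \<rho>\<close> with \<open>\<rho> = \<surd>q e v / \<epsilon>\<close>. The density \<open>\<rho>\<close> concentrates at \<open>L / 2\<close>, because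
  \<open>|x - L / 2| (1 - v)\<close> is of order \<open>\<epsilon>\<close> (\<open>L1_bound\<close>, \<open>moment_bound\<close>), and its mass converges to \<open>S p\<close> by
  dominated convergence and the substitution \<open>cos \<theta> = p / w v\<close> (\<open>jump_converges\<close>). A diagonal choice
  (\<open>near_infimum_selection\<close>) turns approximations with error \<open>\<delta>\<close> into a family with vanishing error.
\<close>

section \<open>Smooth bump functions\<close>

text \<open>Phrased by recursion on the derivative so that sums, products and affine substitutions preserve it
  by induction; an iterated derivative would need a higher order product rule.\<close>

primrec times_diff :: "nat \<Rightarrow> (real \<Rightarrow> real) \<Rightarrow> bool" where
  "times_diff 0 f \<longleftrightarrow> (\<forall>x. f differentiable (at x))"
| "times_diff (Suc n) f \<longleftrightarrow> (\<forall>x. f differentiable (at x)) \<and> times_diff n (deriv f)"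

lemma times_diff_mono: "times_diff (Suc n) f \<Longrightarrow> times_diff n f"
  by (induction n arbitrary: f) auto

lemma differentiable_imp_DERIV_deriv:
  fixes f :: "real \<Rightarrow> real"
  shows "f differentiable (at x) \<Longrightarrow> (f has_real_derivative deriv f x) (at x)"
  using DERIV_deriv_iff_real_differentiable by blast

lemma times_diff_add:
  "times_diff n f \<Longrightarrow> times_diff n g \<Longrightarrow> times_diff n (\<lambda>x. f x + g x)"
proof (induction n arbitrary: f g)
  case 0
  then show ?case by auto
next
  case (Suc n)
  have "deriv (\<lambda>x. f x + g x) = (\<lambda>x. deriv f x + deriv g x)"
    using Suc.prems by (intro ext DERIV_imp_deriv derivative_intros differentiable_imp_DERIV_deriv) auto
  then show ?case using Suc by auto
qed

lemma times_diff_mult: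
  "times_diff n f \<Longrightarrow> times_diff n g \<Longrightarrow> times_diff n (\<lambda>x. f x * g x)"
proof (induction n arbitrary: f g)
  case 0
  then show ?case by auto
next
  case (Suc n)
  have "deriv (\<lambda>x. f x * g x) = (\<lambda>x. deriv f x * g x + deriv g x * f x)"
    using Suc.prems by (intro ext DERIV_imp_deriv DERIV_mult differentiable_imp_DERIV_deriv) auto
  moreover have "times_diff n f" "times_diff n g"
    using Suc.prems times_diff_mono by blast+
  ultimately show ?case using Suc by (auto intro!: times_diff_add)
qed

lemma DERIV_affine:
  fixes f :: "real \<Rightarrow> real"
  assumes "f differentiable (at (c * x + d))"
  shows "((\<lambda>x. f (c * x + d)) has_real_derivative c * deriv f (c * x + d)) (at x)"
proof -
  have "((\<lambda>x. f (c * x + d)) has_real_derivative deriv f (c * x + d) * c) (at x)"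
    by (rule DERIV_chain2[where g = "\<lambda>x. c * x + d", OF differentiable_imp_DERIV_deriv[OF assms]])
       (auto intro!: derivative_eq_intros)
  then show ?thesis by (simp add: mult.commute)
qed

lemma times_diff_const: "times_diff n (\<lambda>x. c)"
proof (induction n arbitrary: c)
  case (Suc n)
  have "deriv (\<lambda>x. c) = (\<lambda>x. 0)" by (intro ext DERIV_imp_deriv) auto
  then show ?case using Suc by auto
qed auto

lemma times_diff_affine: "times_diff n f \<Longrightarrow> times_diff n (\<lambda>x. f (c * x + d))"
proof (induction n arbitrary: f)
  case 0
  then show ?case using DERIV_affine real_differentiable_def by (simp) blast
next
  case (Suc n)
  have "deriv (\<lambda>x. f (c * x + d)) = (\<lambda>x. c * deriv f (c * x + d))"
    using Suc.prems by (intro ext DERIV_imp_deriv DERIV_affine) auto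
  moreover have "\<forall>x. (\<lambda>x. f (c * x + d)) differentiable (at x)"
    using Suc.prems DERIV_affine real_differentiable_def by (simp) blast
  ultimately show ?case using Suc by (auto intro!: times_diff_mult times_diff_const)
qed

lemma times_diff_imp_iterated:
  "(\<And>n. times_diff n f) \<Longrightarrow> (deriv ^^ n) f differentiable (at x)"
proof (induction n arbitrary: f)
  case 0
  from this[of 0] show ?case by simp
next
  case (Suc n)
  have "times_diff k (deriv f)" for k using Suc.prems[of "Suc k"] by simp
  from Suc.IH[OF this] show ?case by (simp add: funpow_Suc_right del: funpow.simps)
qed

text \<open>Polynomials in \<open>1 / x\<close> are carried along because this class, unlike \<open>exp (- 1 / x)\<close> alone, is
  closed under differentiation.\<close>

definition poly_exp :: "real poly \<Rightarrow> real \<Rightarrow> real" where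
  "poly_exp P x = (if x > 0 then poly P (inverse x) * exp (- inverse x) else 0)"

lemma poly_exp_tendsto_0: "((\<lambda>x. poly_exp P x) \<longlongrightarrow> 0) (at 0)"
proof -
  have pw: "((\<lambda>y::real. y ^ k * exp (- y)) \<longlongrightarrow> 0) at_top" for k
    using tendsto_power_div_exp_0[of k] by (simp add: exp_minus divide_inverse)
  have "((\<lambda>y. \<Sum>i\<le>degree P. coeff P i * (y ^ i * exp (- y))) \<longlongrightarrow> (\<Sum>i\<le>degree P. coeff P i * 0)) at_top"
    by (intro tendsto_intros pw)
  then have "((\<lambda>y. poly P y * exp (- y)) \<longlongrightarrow> 0) at_top"
    by (simp add: poly_altdef sum_distrib_right mult.assoc)
  then have "((\<lambda>x. poly P (inverse x) * exp (- inverse x)) \<longlongrightarrow> 0) (at_right 0)"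
    using filterlim_compose filterlim_inverse_at_top_right by fastforce
  then have R: "(poly_exp P \<longlongrightarrow> 0) (at_right 0)"
    by (rule Lim_transform_eventually)
       (auto simp: eventually_at_filter poly_exp_def)
  have L: "(poly_exp P \<longlongrightarrow> 0) (at_left 0)"
    by (rule tendsto_eventually) (auto simp: eventually_at_filter poly_exp_def)
  show ?thesis using L R filterlim_split_at by blast
qed

lemma poly_exp_has_derivative:
  "(poly_exp P has_real_derivative poly_exp ([:0, 0, 1:] * (P - pderiv P)) x) (at x)"
proof (cases x "0::real" rule: linorder_cases)
  case less
  have "((\<lambda>x. 0) has_real_derivative 0) (at x)" by simp
  then have "(poly_exp P has_real_derivative 0) (at x)"
    by (rule has_field_derivative_transform_within_open[where S="{..<0}"]) (use less in \<open>auto simp: poly_exp_def\<close>)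
  then show ?thesis using less by (simp add: poly_exp_def)
next
  case equal
  have "((\<lambda>h. (poly_exp P (0 + h) - poly_exp P 0) / h) \<longlongrightarrow> 0) (at 0)"
  proof (rule Lim_transform_eventually[OF poly_exp_tendsto_0[of "[:0,1:] * P"]])
    show "\<forall>\<^sub>F h in at 0. poly_exp ([:0,1:] * P) h = (poly_exp P (0 + h) - poly_exp P 0) / h"
      by (auto simp: eventually_at_filter poly_exp_def field_simps)
  qed
  then show ?thesis using equal by (simp add: DERIV_def poly_exp_def)
next
  case greater
  have "((\<lambda>x. poly P (inverse x) * exp (- inverse x)) has_real_derivative
     poly_exp ([:0, 0, 1:] * (P - pderiv P)) x) (at x)"
    using greater
    by (auto intro!: derivative_eq_intros DERIV_chain2[OF poly_DERIV]
        simp: poly_exp_def algebra_simps power2_eq_square)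
  then show ?thesis
    by (rule has_field_derivative_transform_within_open[where S="{0<..}"]) (use greater in \<open>auto simp: poly_exp_def\<close>)
qed

lemma times_diff_poly_exp: "times_diff n (poly_exp P)"
proof (induction n arbitrary: P)
  case 0
  show ?case using poly_exp_has_derivative real_differentiable_def by auto
next
  case (Suc n)
  have "deriv (poly_exp P) = poly_exp ([:0, 0, 1:] * (P - pderiv P))"
    by (intro ext DERIV_imp_deriv poly_exp_has_derivative)
  then show ?case using Suc poly_exp_has_derivative real_differentiable_def by auto
qed

text \<open>The parameter \<open>n\<close> only steepens the two flanks, so that the bumps tend to the indicator of
  \<open>(a,b)\<close> as \<open>n\<close> grows.\<close>

definition bump :: "real \<Rightarrow> real \<Rightarrow> real \<Rightarrow> real \<Rightarrow> real" where
  "bump n a b x = poly_exp 1 (n * x + - (n * a)) * poly_exp 1 (- n * x + n * b)"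

lemma bump_eq:
  "n > 0 \<Longrightarrow> bump n a b x =
    (if a < x \<and> x < b then exp (- inverse (n * (x - a))) * exp (- inverse (n * (b - x))) else 0)"
  by (auto simp: bump_def poly_exp_def algebra_simps)

lemma times_diff_bump: "times_diff k (bump n a b)"
  unfolding bump_def by (intro times_diff_mult times_diff_affine times_diff_poly_exp)

lemma times_diff_test_function:
  assumes "\<And>k. times_diff k \<phi>" "{x. \<phi> x \<noteq> 0} \<subseteq> {a..b}" "{a..b} \<subseteq> S"
  shows "test_function S \<phi>"
proof -
  have "closure {x. \<phi> x \<noteq> 0} \<subseteq> {a..b}"
    using assms(2) by (intro closure_minimal) auto
  moreover have "compact (closure {x. \<phi> x \<noteq> 0})"
    using calculation bounded_subset[OF bounded_closed_interval] by (auto simp: compact_eq_bounded_closed)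
  ultimately show ?thesis using assms times_diff_imp_iterated[of \<phi>]
    by (auto simp: test_function_def)
qed

lemma test_function_bump:
  assumes "n > 0" "{a..b} \<subseteq> S"
  shows "test_function S (bump n a b)"
proof (rule times_diff_test_function[OF times_diff_bump _ assms(2)])
  show "{x. bump n a b x \<noteq> 0} \<subseteq> {a..b}"
    using assms(1) by (auto simp: bump_eq split: if_splits)
qed

lemma bump_bounds: "n > 0 \<Longrightarrow> 0 \<le> bump n a b x \<and> bump n a b x \<le> 1"
  by (auto simp: bump_eq mult_le_one)

lemma bump_tendsto_indicator:
  "(\<lambda>n. bump (real (Suc n)) a b x) \<longlonglongrightarrow> indicator {a<..<b} x"
proof (cases "a < x \<and> x < b")
  case True
  have inv: "(\<lambda>n. inverse (real (Suc n) * c)) \<longlonglongrightarrow> 0" for c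
    using tendsto_mult_right_zero[OF LIMSEQ_inverse_real_of_nat, of "inverse c"]
    by (simp add: mult.commute del: of_nat_Suc)
  have "(\<lambda>n. exp (- inverse (real (Suc n) * (x - a))) * exp (- inverse (real (Suc n) * (b - x))))
     \<longlonglongrightarrow> exp (- 0) * exp (- 0)"
    by (intro tendsto_intros inv)
  then show ?thesis using True by (simp add: bump_eq del: of_nat_Suc)
next
  case False
  then show ?thesis by (auto simp: bump_eq simp del: of_nat_Suc)
qed

section \<open>Weak derivatives\<close>

lemma test_function_continuous:
  assumes "test_function S \<phi>"
  shows "continuous_on T \<phi>" "continuous_on T (deriv \<phi>)"
    "\<And>x. (\<phi> has_real_derivative deriv \<phi> x) (at x)"
proof -
  have 0: "(deriv ^^ 0) \<phi> differentiable (at x)" "(deriv ^^ 1) \<phi> differentiable (at x)" for x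
    using assms unfolding test_function_def by blast+
  then show "continuous_on T \<phi>" "continuous_on T (deriv \<phi>)"
    by (simp_all add: continuous_at_imp_continuous_on differentiable_imp_continuous_within)
  show "(\<phi> has_real_derivative deriv \<phi> x) (at x)" for x
    using 0 differentiable_imp_DERIV_deriv by auto
qed

text \<open>The support is compact in an open interval and therefore stays away from the ends. Integrals
  against test functions thus become integrals over a compact interval in which nothing happens at the
  end points.\<close>

lemma test_function_support:
  assumes "test_function S \<phi>" "open S" "is_interval S" "S \<noteq> {}"
  obtains a b where "a < b" "{a..b} \<subseteq> S" "\<And>x. x \<notin> {a<..<b} \<Longrightarrow> \<phi> x = 0 \<and> deriv \<phi> x = 0"
proof -
  define K where "K = closure {x. \<phi> x \<noteq> 0}"
  have K: "compact K" "K \<subseteq> S" using assms(1) by (auto simp: test_function_def K_def)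
  have z: "\<phi> x = 0" if "x \<notin> K" for x using that closure_subset[of "{x. \<phi> x \<noteq> 0}"] by (auto simp: K_def)
  have dz: "deriv \<phi> x = 0" if "x \<notin> K" for x
  proof -
    have "((\<lambda>x. 0) has_real_derivative 0) (at x)" by simp
    then have "(\<phi> has_real_derivative 0) (at x)"
      by (rule has_field_derivative_transform_within_open[where S="- K"])
         (use that z compact_imp_closed[OF K(1)] in \<open>simp_all add: open_Compl\<close>)
    then show ?thesis by (rule DERIV_imp_deriv)
  qed
  show ?thesis
  proof (cases "K = {}")
    case True
    obtain s where s: "s \<in> S" using assms(4) by blast
    then obtain e where "e > 0" "cball s e \<subseteq> S" using assms(2) unfolding open_contains_cball by meson
    moreover from this have "{s..s + e} \<subseteq> S" by (auto simp: cball_def dist_real_def)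
    ultimately show ?thesis using that[of s "s + e"] dz z True by simp
  next
    case False
    then obtain l r where l: "l \<in> K" "\<And>x. x \<in> K \<Longrightarrow> l \<le> x" and r: "r \<in> K" "\<And>x. x \<in> K \<Longrightarrow> x \<le> r"
      using compact_attains_inf[OF K(1)] compact_attains_sup[OF K(1)] by metis
    have "l \<in> S" "r \<in> S" using subsetD[OF K(2) l(1)] subsetD[OF K(2) r(1)] .
    then obtain e1 e2 where e1: "e1 > 0" "cball l e1 \<subseteq> S" and e2: "e2 > 0" "cball r e2 \<subseteq> S"
      using assms(2) unfolding open_contains_cball by meson
    have "l - e1 \<in> cball l e1" "r + e2 \<in> cball r e2" using e1 e2 by (auto simp: cball_def dist_real_def)
    then have "l - e1 \<in> S" "r + e2 \<in> S" using e1(2) e2(2) by blast+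
    then have "{l - e1..r + e2} \<subseteq> S"
      by (intro subsetI, elim atLeastAtMost_iff[THEN iffD1, THEN conjE]) (rule mem_is_interval_1_I[OF assms(3)])
    moreover have "x \<notin> K" if "x \<notin> {l - e1<..<r + e2}" for x
      using that l(2)[of x] r(2)[of x] e1 e2 by auto
    moreover have "l - e1 < r + e2" using l(2)[OF r(1)] e1 e2 by simp
    ultimately show ?thesis using that[of "l - e1" "r + e2"] dz z by blast
  qed
qed

lemma locally_integrable_onD:
  "locally_integrable_on w S \<Longrightarrow> {a..b} \<subseteq> S \<Longrightarrow> w absolutely_integrable_on {a..b::real}"
  by (auto simp: locally_integrable_on_def)

lemma locally_integrable_on_continuous:
  "continuous_on S w \<Longrightarrow> locally_integrable_on w S"
  unfolding locally_integrable_on_def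
proof (intro allI impI)
  fix K assume w: "continuous_on S w" and K: "compact K \<and> K \<subseteq> S"
  have "integrable lborel (\<lambda>x. indicator K x *\<^sub>R w x)"
    using K continuous_on_subset[OF w] by (intro borel_integrable_compact) auto
  then show "w absolutely_integrable_on K"
    unfolding set_integrable_def
    by (subst integrable_completion) auto
qed

lemma abs_integrable_times_continuous:
  fixes w \<phi> :: "real \<Rightarrow> real"
  assumes "w absolutely_integrable_on {a..b}" "continuous_on {a..b} \<phi>"
  shows "(\<lambda>x. w x * \<phi> x) absolutely_integrable_on {a..b}"
proof -
  have "(\<lambda>x. \<phi> x * w x) absolutely_integrable_on {a..b}"
  proof (rule absolutely_integrable_bounded_measurable_product_real[OF _ _ _ assms(1)])
    show "\<phi> \<in> borel_measurable (lebesgue_on {a..b})"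
      using assms(2) by (simp add: continuous_imp_measurable_on_sets_lebesgue)
    show "bounded (\<phi> ` {a..b})"
      using assms(2) compact_continuous_image compact_imp_bounded by blast
  qed auto
  then show ?thesis by (simp add: mult.commute)
qed

lemma set_integral_supported:
  fixes g :: "real \<Rightarrow> real"
  assumes "{a..b} \<subseteq> S" "\<And>x. x \<notin> {a<..<b} \<Longrightarrow> g x = 0" "g absolutely_integrable_on {a..b}"
  shows "set_integrable lebesgue S g" "(LINT x:S|lebesgue. g x) = integral {a..b} g"
proof -
  have eq: "indicator S x *\<^sub>R g x = indicator {a..b} x *\<^sub>R g x" for x
    using subsetD[OF assms(1), of x] assms(2)[of x]
    by (cases "x \<in> {a<..<b}") (auto simp: indicator_def)
  show "set_integrable lebesgue S g" using assms(3) unfolding set_integrable_def eq .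
  show "(LINT x:S|lebesgue. g x) = integral {a..b} g"
    using set_lebesgue_integral_eq_integral(2)[OF assms(3)] unfolding set_lebesgue_integral_def eq by simp
qed

text \<open>By Lebesgue's differentiation theorem a function is almost everywhere the limit of its means over
  shrinking intervals. This is applied in each interval with rational end points contained in \<open>S\<close>;
  countably many null sets arise.\<close>

lemma zero_of_interval_integrals_zero:
  fixes w :: "real \<Rightarrow> real"
  assumes "open S" "locally_integrable_on w S"
    and zero: "\<And>a b. a < b \<Longrightarrow> {a..b} \<subseteq> S \<Longrightarrow> integral {a..b} w = 0"
  shows "AE x in lebesgue. x \<in> S \<longrightarrow> w x = 0"
proof -
  have loc: "AE x in lebesgue. {c..d} \<subseteq> S \<longrightarrow> c < x \<longrightarrow> x < d \<longrightarrow> w x = 0" for c d :: real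
  proof (cases "{c..d} \<subseteq> S")
    case False
    then show ?thesis by simp
  next
    case True
    define f where "f = (\<lambda>x. if x \<in> {c..d} then w x else 0)"
    have wi: "w integrable_on {c..d}" 
      using locally_integrable_onD[OF assms(2) True] by (auto simp: absolutely_integrable_on_def)
    have "f integrable_on cbox a b" for a b
    proof -
      have "f integrable_on UNIV" unfolding f_def using wi integrable_restrict_UNIV by blast
      then show ?thesis using integrable_on_subcbox by blast
    qed
    then obtain N where N: "negligible N" and
      N2: "\<And>x e. x \<notin> N \<Longrightarrow> 0 < e \<Longrightarrow> \<exists>d>0. \<forall>h. 0 < h \<and> h < d \<longrightarrow>
          norm (integral (cbox x (x + h *\<^sub>R One)) f /\<^sub>R h ^ DIM(real) - f x) < e"
      using integrable_ccontinuous_explicit[of f] by blast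
    have "w x = 0" if x: "x \<notin> N" "c < x" "x < d" for x
    proof (rule ccontr)
      assume "w x \<noteq> 0"
      then obtain d' where d': "d' > 0" "\<And>h. 0 < h \<Longrightarrow> h < d' \<Longrightarrow>
          norm (integral (cbox x (x + h *\<^sub>R One)) f /\<^sub>R h ^ DIM(real) - f x) < \<bar>w x\<bar>"
        using N2[OF x(1), of "\<bar>w x\<bar>"] by auto
      define h where "h = min (d' / 2) (d - x)"
      have h: "0 < h" "h < d'" "x + h \<le> d" using d'(1) x by (auto simp: h_def)
      have "integral {x..x + h} f = integral {x..x + h} w"
        using x h by (intro integral_cong) (auto simp: f_def)
      also have "\<dots> = 0" using x h True by (intro zero) auto
      finally show False using d'(2)[OF h(1,2)] x by (simp add: f_def cbox_interval)
    qed
    then have "negligible {x. \<not> ({c..d} \<subseteq> S \<longrightarrow> c < x \<longrightarrow> x < d \<longrightarrow> w x = 0)}"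
      by (intro negligible_subset[OF N]) auto
    then show ?thesis 
      unfolding eventually_ae_filter
      by (intro bexI[of _ "{x. \<not> ({c..d} \<subseteq> S \<longrightarrow> c < x \<longrightarrow> x < d \<longrightarrow> w x = 0)}"])
         (auto simp: negligible_iff_null_sets)
  qed
  have "AE x in lebesgue. \<forall>c d::rat. {of_rat c..of_rat d} \<subseteq> S \<longrightarrow> of_rat c < x \<longrightarrow> x < of_rat d \<longrightarrow> w x = 0"
    using loc by (simp add: AE_all_countable)
  then show ?thesis
  proof (eventually_elim, safe)
    fix x assume *: "\<forall>c d::rat. {of_rat c..of_rat d} \<subseteq> S \<longrightarrow> of_rat c < x \<longrightarrow> x < of_rat d \<longrightarrow> w x = 0"
      and "x \<in> S"
    then obtain e where e: "e > 0" "cball x e \<subseteq> S" using assms(1) unfolding open_contains_cball by meson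
    obtain c where "x - e < of_rat c" "of_rat c < x" using of_rat_dense[of "x - e" x] e by auto
    moreover obtain d where "x < of_rat d" "of_rat d < x + e" using of_rat_dense[of x "x + e"] e by auto
    ultimately show "w x = 0" using * e(2) by (force simp: cball_def dist_real_def subset_iff abs_le_iff)
  qed
qed

text \<open>Bumps tend boundedly to the indicator of an interval, so all interval integrals of \<open>w\<close> vanish.\<close>

lemma fundamental_lemma_calculus_of_variations:
  fixes w :: "real \<Rightarrow> real"
  assumes "open S" "locally_integrable_on w S"
    and zero: "\<And>\<phi>. test_function S \<phi> \<Longrightarrow> (LINT x:S|lebesgue. w x * \<phi> x) = 0"
  shows "AE x in lebesgue. x \<in> S \<longrightarrow> w x = 0"
proof (rule zero_of_interval_integrals_zero[OF assms(1,2)])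
  fix a b :: real assume ab: "a < b" "{a..b} \<subseteq> S"
  have wi: "w absolutely_integrable_on {a..b}" using locally_integrable_onD[OF assms(2) ab(2)] .
  have cont: "continuous_on {a..b} (bump (real (Suc n)) a b)" for n
    using test_function_continuous(1)[OF test_function_bump[OF _ ab(2)]] by (simp del: of_nat_Suc)
  have int: "(\<lambda>x. w x * bump (real (Suc n)) a b x) absolutely_integrable_on {a..b}" for n
    by (intro abs_integrable_times_continuous wi cont)
  have z: "integral {a..b} (\<lambda>x. w x * bump (real (Suc n)) a b x) = 0" for n
  proof -
    have "(LINT x:S|lebesgue. w x * bump (real (Suc n)) a b x) = integral {a..b} (\<lambda>x. w x * bump (real (Suc n)) a b x)"
      by (rule set_integral_supported(2)[OF ab(2) _ int]) (auto simp: bump_eq simp del: of_nat_Suc)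
    then show ?thesis using zero[OF test_function_bump[OF _ ab(2)]] by (simp del: of_nat_Suc)
  qed
  have "(\<lambda>n. integral {a..b} (\<lambda>x. w x * bump (real (Suc n)) a b x)) \<longlonglongrightarrow>
      integral {a..b} (\<lambda>x. w x * indicator {a<..<b} x)"
  proof (rule dominated_convergence(2))
    show "(\<lambda>x. w x * bump (real (Suc n)) a b x) integrable_on {a..b}" for n
      using int by (auto simp: absolutely_integrable_on_def)
    show "(\<lambda>x. norm (w x)) integrable_on {a..b}" using wi by (auto simp: absolutely_integrable_on_def)
    show "norm (w x * bump (real (Suc n)) a b x) \<le> norm (w x)" for n x
      using bump_bounds[of "real (Suc n)" a b x] by (auto simp: abs_mult mult_left_le simp del: of_nat_Suc)
    show "(\<lambda>n. w x * bump (real (Suc n)) a b x) \<longlonglongrightarrow> w x * indicator {a<..<b} x" for x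
      by (intro tendsto_intros bump_tendsto_indicator)
  qed
  then have "integral {a..b} (\<lambda>x. w x * indicator {a<..<b} x) = 0"
    unfolding z by (simp add: LIMSEQ_const_iff)
  moreover have "integral {a..b} (\<lambda>x. w x * indicator {a<..<b} x) = integral {a..b} w"
    by (rule integral_spike[of "{a, b}"]) (auto simp: indicator_def)
  ultimately show "integral {a..b} w = 0" by simp
qed

lemma set_integrable_times_test:
  assumes "locally_integrable_on w S" "open S" "is_interval S" "S \<noteq> {}" "test_function S \<phi>"
  shows "set_integrable lebesgue S (\<lambda>x. w x * \<phi> x)" "set_integrable lebesgue S (\<lambda>x. w x * deriv \<phi> x)"
proof -
  obtain a b where ab: "a < b" "{a..b} \<subseteq> S" "\<And>x. x \<notin> {a<..<b} \<Longrightarrow> \<phi> x = 0 \<and> deriv \<phi> x = 0"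
    using test_function_support[OF assms(5,2,3,4)] by blast
  have "(\<lambda>x. w x * \<phi> x) absolutely_integrable_on {a..b}" "(\<lambda>x. w x * deriv \<phi> x) absolutely_integrable_on {a..b}"
    using locally_integrable_onD[OF assms(1) ab(2)] test_function_continuous[OF assms(5)]
    by (auto intro!: abs_integrable_times_continuous)
  then show "set_integrable lebesgue S (\<lambda>x. w x * \<phi> x)" "set_integrable lebesgue S (\<lambda>x. w x * deriv \<phi> x)"
    using set_integral_supported(1)[OF ab(2)] ab(3) by force+
qed

lemma weak_deriv_unique:
  assumes "has_weak_deriv_on u w1 S" "has_weak_deriv_on u w2 S" "open S" "is_interval S" "S \<noteq> {}"
  shows "AE x in lebesgue. x \<in> S \<longrightarrow> w1 x = w2 x"
proof -
  have l: "locally_integrable_on w1 S" "locally_integrable_on w2 S"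
    using assms by (auto simp: has_weak_deriv_on_def)
  have "AE x in lebesgue. x \<in> S \<longrightarrow> w1 x - w2 x = 0"
  proof (rule fundamental_lemma_calculus_of_variations[OF assms(3)])
    show "locally_integrable_on (\<lambda>x. w1 x - w2 x) S"
      using l unfolding locally_integrable_on_def by (auto intro!: set_integral_diff)
    fix \<phi> assume t: "test_function S \<phi>"
    have "(LINT x:S|lebesgue. (w1 x - w2 x) * \<phi> x) = (LINT x:S|lebesgue. w1 x * \<phi> x - w2 x * \<phi> x)"
      by (simp add: algebra_simps)
    also have "\<dots> = (LINT x:S|lebesgue. w1 x * \<phi> x) - (LINT x:S|lebesgue. w2 x * \<phi> x)"
      by (intro set_integral_diff set_integrable_times_test[OF _ assms(3-5) t] l)
    also have "\<dots> = 0"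
    proof -
      have "(LINT x:S|lebesgue. u x * deriv \<phi> x) = - (LINT x:S|lebesgue. w1 x * \<phi> x)"
        "(LINT x:S|lebesgue. u x * deriv \<phi> x) = - (LINT x:S|lebesgue. w2 x * \<phi> x)"
        using assms(1,2) t unfolding has_weak_deriv_on_def by blast+
      then show ?thesis by linarith
    qed
    finally show "(LINT x:S|lebesgue. (w1 x - w2 x) * \<phi> x) = 0" .
  qed
  then show ?thesis by simp
qed

text \<open>Any weak derivative computed by hand may replace the one chosen in the definition of the energies.\<close>

lemma weak_deriv_on_AE_eq:
  assumes "has_weak_deriv_on u w S" "open S" "is_interval S" "S \<noteq> {}"
  shows "has_weak_deriv_on u (weak_deriv_on S u) S"
    "AE x in lebesgue. x \<in> S \<longrightarrow> weak_deriv_on S u x = w x"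
proof -
  show *: "has_weak_deriv_on u (weak_deriv_on S u) S"
    unfolding weak_deriv_on_def using someI[of "\<lambda>w. has_weak_deriv_on u w S", OF assms(1)] .
  show "AE x in lebesgue. x \<in> S \<longrightarrow> weak_deriv_on S u x = w x"
    by (rule weak_deriv_unique[OF * assms])
qed

text \<open>Integration by parts: finitely many corners do no harm because \<open>u\<close> is continuous across them.\<close>

lemma has_weak_deriv_on_piecewise_C1:
  fixes u w :: "real \<Rightarrow> real"
  assumes S: "open S" "is_interval S" "S \<noteq> {}"
    and u: "continuous_on S u" and F: "finite F"
    and der: "\<And>x. x \<in> S - F \<Longrightarrow> (u has_real_derivative w x) (at x)"
    and w: "locally_integrable_on w S"
  shows "has_weak_deriv_on u w S"
  unfolding has_weak_deriv_on_def
proof (intro conjI allI impI w locally_integrable_on_continuous[OF u])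
  fix \<phi> assume t: "test_function S \<phi>"
  obtain a b where ab: "a < b" "{a..b} \<subseteq> S" "\<And>x. x \<notin> {a<..<b} \<Longrightarrow> \<phi> x = 0 \<and> deriv \<phi> x = 0"
    using test_function_support[OF t S] by blast
  have cu: "continuous_on {a..b} u" using u ab(2) continuous_on_subset by blast
  note ct = test_function_continuous[OF t]
  have 1: "(\<lambda>x. u x * deriv \<phi> x) absolutely_integrable_on {a..b}"
    by (intro absolutely_integrable_continuous_real continuous_intros cu ct)
  have 2: "(\<lambda>x. w x * \<phi> x) absolutely_integrable_on {a..b}"
    by (intro abs_integrable_times_continuous locally_integrable_onD[OF w ab(2)] ct)
  have "((\<lambda>x. u x * deriv \<phi> x + w x * \<phi> x) has_integral (u b * \<phi> b - u a * \<phi> a)) {a..b}"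
  proof (rule fundamental_theorem_of_calculus_interior_strong[OF F])
    show "continuous_on {a..b} (\<lambda>x. u x * \<phi> x)" by (intro continuous_intros cu ct)
    fix x assume "x \<in> {a<..<b} - F"
    then have "x \<in> S - F" using ab(2) by auto
    from DERIV_mult[OF der[OF this] ct(3)[of x]]
    show "((\<lambda>x. u x * \<phi> x) has_vector_derivative u x * deriv \<phi> x + w x * \<phi> x) (at x)"
      by (simp add: has_real_derivative_iff_has_vector_derivative mult.commute add.commute)
  qed (use ab in auto)
  then have "integral {a..b} (\<lambda>x. u x * deriv \<phi> x + w x * \<phi> x) = 0"
    using ab(3)[of a] ab(3)[of b] by (auto dest: integral_unique)
  moreover have "integral {a..b} (\<lambda>x. u x * deriv \<phi> x + w x * \<phi> x)
      = integral {a..b} (\<lambda>x. u x * deriv \<phi> x) + integral {a..b} (\<lambda>x. w x * \<phi> x)"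
    using 1 2 by (intro Henstock_Kurzweil_Integration.integral_add) (auto simp: absolutely_integrable_on_def)
  moreover have "(LINT x:S|lebesgue. u x * deriv \<phi> x) = integral {a..b} (\<lambda>x. u x * deriv \<phi> x)"
    using ab(3) by (intro set_integral_supported(2)[OF ab(2) _ 1]) auto
  moreover have "(LINT x:S|lebesgue. w x * \<phi> x) = integral {a..b} (\<lambda>x. w x * \<phi> x)"
    using ab(3) by (intro set_integral_supported(2)[OF ab(2) _ 2]) auto
  ultimately show "(LINT x:S|lebesgue. u x * deriv \<phi> x) = - (LINT x:S|lebesgue. w x * \<phi> x)"
    by simp
qed

text \<open>Test with a smooth function that rises from \<open>0\<close> to \<open>1\<close> just right of \<open>x\<close> and falls back just right
  of \<open>y\<close>. Its derivative consists of two approximate Dirac masses, which recover \<open>\<beta> x - \<beta> y\<close> by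
  continuity, while the function itself tends to the indicator of the interval.\<close>

lemma weak_deriv_integral:
  fixes \<beta> w :: "real \<Rightarrow> real"
  assumes cont: "continuous_on UNIV \<beta>" and wd: "has_weak_deriv_on \<beta> w UNIV" and "x < y"
  shows "integral {x..y} w = \<beta> y - \<beta> x"
proof -
  define r where "r k = 1 / real (Suc k)" for k
  define \<eta> where "\<eta> k = bump 1 0 (r k)" for k
  define E where "E k t = integral {-1..t} (\<eta> k)" for k t
  define c where "c k = E k (r k)" for k
  have r0: "0 < r k" "r k \<le> 1" for k by (auto simp: r_def)
  have r_lim: "r \<longlonglongrightarrow> 0" unfolding r_def using LIMSEQ_inverse_real_of_nat by (simp add: inverse_eq_divide)
  have \<eta>c: "continuous_on T (\<eta> k)" for k T unfolding \<eta>_def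
    using test_function_continuous(1)[OF test_function_bump[of 1 0 "r k" UNIV]] by simp
  have \<eta>0: "\<eta> k t = 0" if "t \<le> 0 \<or> t \<ge> r k" for k t using that by (auto simp: \<eta>_def bump_eq)
  have \<eta>pos: "0 \<le> \<eta> k t" for k t using bump_bounds[of 1] by (auto simp: \<eta>_def)
  have E0: "E k t = 0" if "t \<le> 0" for k t
    unfolding E_def using that \<eta>0 by (intro integral_eq_0_iff[THEN iffD2] integral_unique) 
      (auto intro!: has_integral_is_0)
  have E1: "E k t = c k" if "t \<ge> r k" for k t
  proof -
    have "integral {-1..r k} (\<eta> k) + integral {r k..t} (\<eta> k) = integral {-1..t} (\<eta> k)"
      using that r0[of k] by (intro Henstock_Kurzweil_Integration.integral_combine integrable_continuous_real \<eta>c) auto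
    moreover have "integral {r k..t} (\<eta> k) = 0"
      using \<eta>0 by (intro integral_unique has_integral_is_0) auto
    ultimately show ?thesis by (simp add: E_def c_def)
  qed
  have Eder: "(E k has_real_derivative \<eta> k t) (at t)" for k t
  proof (cases "t < 0")
    case True
    have "((\<lambda>x. 0) has_real_derivative 0) (at t)" by simp
    then have "(E k has_real_derivative 0) (at t)"
      by (rule has_field_derivative_transform_within_open[where S="{..<0}"]) (use True E0 in auto)
    then show ?thesis using \<eta>0 True by auto
  next
    case False
    have "(E k has_real_derivative \<eta> k t) (at t within {-1..t+1})"
      unfolding E_def using False by (intro integral_has_real_derivative \<eta>c) auto
    then show ?thesis using False at_within_Icc_at[of "-1" t "t+1"] by simp
  qed
  have Emono: "E k s \<le> E k t" if "s \<le> t" for k s t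
    using Eder \<eta>pos that DERIV_nonneg_imp_nondecreasing by metis
  have c0: "c k > 0" for k
  proof -
    have "integral {-1..r k} (\<eta> k) \<noteq> 0"
    proof
      assume "integral {-1..r k} (\<eta> k) = 0"
      then have "\<forall>t\<in>{-1..r k}. \<eta> k t = 0"
        using integral_eq_0_iff[of "-1" "r k" "\<eta> k"] \<eta>c \<eta>pos r0[of k] by auto
      then have "\<eta> k (r k / 2) = 0" using r0[of k] by auto
      then show False using r0[of k] by (auto simp: \<eta>_def bump_eq)
    qed
    moreover have "integral {-1..r k} (\<eta> k) \<ge> 0" using \<eta>pos by (intro integral_nonneg integrable_continuous_real \<eta>c)
    ultimately show ?thesis by (simp add: c_def E_def)
  qed
  have Ebd: "0 \<le> E k t" "E k t \<le> c k" for k t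
    using E0[of "min t 0" k] Emono[of "min t 0" t k] E1[of k "max t (r k)"] Emono[of t "max t (r k)" k] by auto
  have Etd: "times_diff n (E k)" for n k
  proof (cases n)
    case 0
    then show ?thesis using Eder real_differentiable_def by auto
  next
    case (Suc n')
    have "deriv (E k) = \<eta> k" by (intro ext DERIV_imp_deriv Eder)
    then show ?thesis using Suc Eder real_differentiable_def times_diff_bump by (auto simp: \<eta>_def)
  qed
  define \<phi> where "\<phi> k t = (E k (1 * t + (- x)) + - 1 * E k (1 * t + (- y))) * (1 / c k)" for k t
  have \<phi>eq: "\<phi> k t = (E k (t - x) - E k (t - y)) / c k" for k t by (simp add: \<phi>_def)
  have test: "test_function UNIV (\<phi> k)" for k
  proof (rule times_diff_test_function)
    show "times_diff n (\<phi> k)" for n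
    proof -
      have "times_diff n (\<lambda>t. E k (1 * t + (- x)))" "times_diff n (\<lambda>t. E k (1 * t + (- y)))"
        by (rule times_diff_affine[OF Etd])+
      then have "times_diff n (\<lambda>t. (E k (1 * t + (- x)) + - 1 * E k (1 * t + (- y))) * (1 / c k))"
        by (rule times_diff_mult[OF times_diff_add[OF _ times_diff_mult[OF times_diff_const]] times_diff_const])
      then show ?thesis by (simp add: \<phi>_def[abs_def])
    qed
    show "{t. \<phi> k t \<noteq> 0} \<subseteq> {x..y + 1}"
    proof (rule subsetI, rule ccontr)
      fix t assume t: "t \<in> {t. \<phi> k t \<noteq> 0}" "t \<notin> {x..y+1}"
      then have "t < x \<or> t > y + 1" by auto
      then show False using t(1) E0[of "t - x" k] E0[of "t - y" k] E1[of k "t - x"] E1[of k "t - y"] r0[of k] \<open>x < y\<close>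
        by (auto simp: \<phi>eq)
    qed
  qed auto
  have \<phi>d: "deriv (\<phi> k) t = (\<eta> k (t - x) - \<eta> k (t - y)) / c k" for k t
    unfolding \<phi>eq by (rule DERIV_imp_deriv)
      (auto intro!: derivative_eq_intros DERIV_chain2[OF Eder, where g="\<lambda>t. t - a" for a] simp: c0[THEN less_imp_neq, symmetric])
  have \<phi>0: "\<phi> k t = 0 \<and> deriv (\<phi> k) t = 0" if "t \<notin> {x-1<..<y + 2}" for k t
    using that E0[of "t - x" k] E0[of "t - y" k] E1[of k "t - x"] E1[of k "t - y"] r0[of k] \<open>x < y\<close>
      \<eta>0[of "t - x" k] \<eta>0[of "t - y" k] by (auto simp: \<phi>eq \<phi>d)
  have wi: "w absolutely_integrable_on {x - 1..y + 2}"
    using wd unfolding has_weak_deriv_on_def by (intro locally_integrable_onD) auto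
  \<comment> \<open>the defining identity of the weak derivative, on an interval containing the support\<close>
  have A: "integral {x - 1..y + 2} (\<lambda>t. \<beta> t * deriv (\<phi> k) t) = - integral {x - 1..y + 2} (\<lambda>t. w t * \<phi> k t)" for k
  proof -
    note ct = test_function_continuous[OF test[of k]]
    have "(LINT t:UNIV|lebesgue. \<beta> t * deriv (\<phi> k) t) = integral {x - 1..y + 2} (\<lambda>t. \<beta> t * deriv (\<phi> k) t)"
      using \<phi>0 by (intro set_integral_supported(2) absolutely_integrable_continuous_real continuous_intros ct
          continuous_on_subset[OF cont]) auto
    moreover have "(LINT t:UNIV|lebesgue. w t * \<phi> k t) = integral {x - 1..y + 2} (\<lambda>t. w t * \<phi> k t)"
      using \<phi>0 by (intro set_integral_supported(2) abs_integrable_times_continuous wi ct) auto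
    moreover have "(LINT t:UNIV|lebesgue. \<beta> t * deriv (\<phi> k) t) = - (LINT t:UNIV|lebesgue. w t * \<phi> k t)"
      using wd test[of k] unfolding has_weak_deriv_on_def by blast
    ultimately show ?thesis by simp
  qed
  have B: "(\<lambda>k. integral {x - 1..y + 2} (\<lambda>t. w t * \<phi> k t)) \<longlonglongrightarrow>
     integral {x - 1..y + 2} (\<lambda>t. w t * indicator {x<..y} t)"
  proof (rule dominated_convergence(2))
    show "(\<lambda>t. w t * \<phi> k t) integrable_on {x - 1..y + 2}" for k
      using abs_integrable_times_continuous[OF wi test_function_continuous(1)[OF test[of k]]]
      by (auto simp: absolutely_integrable_on_def)
    show "(\<lambda>t. norm (w t)) integrable_on {x - 1..y + 2}" using wi by (auto simp: absolutely_integrable_on_def)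
    show "norm (w t * \<phi> k t) \<le> norm (w t)" for k t
    proof -
      have "E k (t - x) - E k (t - y) \<ge> 0" using Emono \<open>x < y\<close> by simp
      moreover have "E k (t - x) - E k (t - y) \<le> c k" using Ebd[of k "t - x"] Ebd[of k "t - y"] by linarith
      ultimately have "0 \<le> \<phi> k t" "\<phi> k t \<le> 1" using c0[of k] by (auto simp: \<phi>eq)
      then show ?thesis by (simp add: abs_mult mult_left_le)
    qed
    show "(\<lambda>k. w t * \<phi> k t) \<longlonglongrightarrow> w t * indicator {x<..y} t" for t
    proof (intro tendsto_mult tendsto_const)
      have step: "(\<lambda>k. E k s / c k) \<longlonglongrightarrow> indicator {0<..} s" for s
      proof (cases "s > 0")
        case True
        have "eventually (\<lambda>k. r k < s) sequentially" using order_tendstoD(2)[OF r_lim True] .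
        then have "eventually (\<lambda>k. E k s / c k = indicator {0<..} s) sequentially"
        proof eventually_elim
          case (elim k)
          then show ?case using E1[of k s] c0[of k] True by simp
        qed
        then show ?thesis by (rule tendsto_eventually)
      next
        case False
        then show ?thesis using E0 by auto
      qed
      have "(\<lambda>k. E k (t - x) / c k - E k (t - y) / c k) \<longlonglongrightarrow> indicator {0<..} (t - x) - indicator {0<..} (t - y)"
        by (intro tendsto_intros step)
      moreover have "indicator {0<..} (t - x) - indicator {0<..} (t - y) = (indicator {x<..y} t :: real)"
        using \<open>x < y\<close> by (auto simp: indicator_def)
      ultimately show "(\<lambda>k. \<phi> k t) \<longlonglongrightarrow> indicator {x<..y} t" by (simp add: \<phi>eq diff_divide_distrib)
    qed
  qed
  have B': "integral {x - 1..y + 2} (\<lambda>t. w t * indicator {x<..y} t) = integral {x..y} w"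
  proof -
    have "integral {x - 1..y + 2} (\<lambda>t. w t * indicator {x<..y} t) = integral {x - 1..y + 2} (\<lambda>t. if t \<in> {x..y} then w t else 0)"
      by (rule integral_spike[of "{x}"]) (auto simp: indicator_def)
    also have "\<dots> = integral ({x..y} \<inter> {x - 1..y + 2}) w" by (rule integral_restrict_Int)
    also have "{x..y} \<inter> {x - 1..y + 2} = {x..y}" by auto
    finally show ?thesis .
  qed
  \<comment> \<open>\<open>\<eta> k (t - z) / c k\<close> is an approximate Dirac mass at \<open>z\<close>\<close>
  have C: "(\<lambda>k. integral {x - 1..y + 2} (\<lambda>t. \<beta> t * (\<eta> k (t - z) / c k))) \<longlonglongrightarrow> \<beta> z" if z: "z \<in> {x..y}" for z
  proof (rule LIMSEQ_I)
    fix e :: real assume "e > 0"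
    have "isCont \<beta> z" using cont by (simp add: continuous_on_eq_continuous_at)
    then obtain d where d: "d > 0" "\<And>t. \<bar>t - z\<bar> < d \<Longrightarrow> \<bar>\<beta> t - \<beta> z\<bar> < e / 2"
      using \<open>e > 0\<close> unfolding continuous_at_eps_delta by (metis dist_real_def half_gt_zero)
    obtain N where N: "\<And>k. k \<ge> N \<Longrightarrow> r k < d"
      using order_tendstoD(2)[OF r_lim d(1)] by (auto simp: eventually_sequentially)
    have "norm (integral {x - 1..y + 2} (\<lambda>t. \<beta> t * (\<eta> k (t - z) / c k)) - \<beta> z) < e" if "k \<ge> N" for k
    proof -
      have hi: "((\<lambda>t. \<eta> k (t - z) / c k) has_integral 1) {x - 1..y + 2}"
      proof -
        have "((\<lambda>t. \<eta> k (t - z) / c k) has_integral (E k (y + 2 - z) / c k - E k (x - 1 - z) / c k)) {x - 1..y + 2}"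
          using \<open>x < y\<close> 
          by (intro fundamental_theorem_of_calculus)
             (auto intro!: derivative_eq_intros DERIV_chain2[OF Eder, where g="\<lambda>t. t - a" for a] has_vector_derivative_at_within
                simp: has_real_derivative_iff_has_vector_derivative[symmetric] c0[THEN less_imp_neq, symmetric])
        moreover have "E k (y + 2 - z) = c k" "E k (x - 1 - z) = 0"
          using z r0[of k] by (auto intro!: E0 E1)
        ultimately show ?thesis using c0[of k] by simp
      qed
      have ii: "(\<lambda>t. \<beta> t * (\<eta> k (t - z) / c k)) integrable_on {x - 1..y + 2}"
        by (intro integrable_continuous_real continuous_intros continuous_on_subset[OF cont]
            continuous_on_compose2[OF \<eta>c[of UNIV]]) (auto simp: c0[THEN less_imp_neq, symmetric])
      have "((\<lambda>t. \<beta> t * (\<eta> k (t - z) / c k) - \<beta> z * (\<eta> k (t - z) / c k)) has_integral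
          integral {x - 1..y + 2} (\<lambda>t. \<beta> t * (\<eta> k (t - z) / c k)) - \<beta> z * 1) {x - 1..y + 2}"
        by (intro has_integral_diff integrable_integral ii has_integral_mult_right hi)
      moreover have "((\<lambda>t. e / 2 * (\<eta> k (t - z) / c k)) has_integral e / 2 * 1) {x - 1..y + 2}"
        by (intro has_integral_mult_right hi)
      moreover have "norm (\<beta> t * (\<eta> k (t - z) / c k) - \<beta> z * (\<eta> k (t - z) / c k)) \<le> e / 2 * (\<eta> k (t - z) / c k)" for t
      proof (cases "0 < t - z \<and> t - z < r k")
        case True
        then have "\<bar>\<beta> t - \<beta> z\<bar> \<le> e / 2" using d(2)[of t] N[OF that] by auto
        moreover have "0 \<le> \<eta> k (t - z) / c k" using \<eta>pos c0[of k] by simp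
        ultimately have "\<bar>\<beta> t - \<beta> z\<bar> * \<bar>\<eta> k (t - z) / c k\<bar> \<le> e / 2 * (\<eta> k (t - z) / c k)"
          unfolding abs_of_nonneg[OF \<open>0 \<le> \<eta> k (t - z) / c k\<close>] by (rule mult_right_mono)
        then show ?thesis unfolding left_diff_distrib[symmetric] by (simp add: abs_mult)
      next
        case False
        then show ?thesis using \<eta>0[of "t - z" k] by auto
      qed
      ultimately have "norm (integral {x - 1..y + 2} (\<lambda>t. \<beta> t * (\<eta> k (t - z) / c k)) - \<beta> z * 1) \<le> e / 2 * 1"
        by (metis (no_types, lifting) has_integral_integrable integral_norm_bound_integral integral_unique)
      then show ?thesis using \<open>e > 0\<close> by simp
    qed
    then show "\<exists>N. \<forall>k\<ge>N. norm (integral {x - 1..y + 2} (\<lambda>t. \<beta> t * (\<eta> k (t - z) / c k)) - \<beta> z) < e" by blast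
  qed
  have D: "integral {x - 1..y + 2} (\<lambda>t. \<beta> t * deriv (\<phi> k) t) =
     integral {x - 1..y + 2} (\<lambda>t. \<beta> t * (\<eta> k (t - x) / c k)) - integral {x - 1..y + 2} (\<lambda>t. \<beta> t * (\<eta> k (t - y) / c k))" for k
  proof -
    have ii: "(\<lambda>t. \<beta> t * (\<eta> k (t - z) / c k)) integrable_on {x - 1..y + 2}" for z
      by (intro integrable_continuous_real continuous_intros continuous_on_subset[OF cont]
            continuous_on_compose2[OF \<eta>c[of UNIV]]) (auto simp: c0[THEN less_imp_neq, symmetric])
    show ?thesis by (subst Henstock_Kurzweil_Integration.integral_diff[symmetric, OF ii ii]) (simp add: \<phi>d diff_divide_distrib algebra_simps)
  qed
  have "(\<lambda>k. integral {x - 1..y + 2} (\<lambda>t. \<beta> t * deriv (\<phi> k) t)) \<longlonglongrightarrow> \<beta> x - \<beta> y"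
    unfolding D using \<open>x < y\<close> by (intro tendsto_diff C) auto
  moreover have "(\<lambda>k. integral {x - 1..y + 2} (\<lambda>t. \<beta> t * deriv (\<phi> k) t)) \<longlonglongrightarrow> - integral {x..y} w"
    unfolding A using tendsto_minus[OF B] B' by simp
  ultimately show ?thesis using LIMSEQ_unique by fastforce
qed

section \<open>The degradation function\<close>

lemma continuous_on_interval_exhaust:
  fixes g :: "real \<Rightarrow> real"
  assumes "\<And>q. q < b \<Longrightarrow> continuous_on {a..q} g"
  shows "continuous_on {a..<b} g"
  unfolding continuous_on_eq_continuous_within
proof
  fix x assume x: "x \<in> {a..<b}"
  define q where "q = (x + b) / 2"
  have q: "x < q" "q < b" using x by (auto simp: q_def)
  have "continuous (at x within {a..q}) g"
    using assms[OF q(2)] x q by (auto simp: continuous_on_eq_continuous_within)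
  moreover have "at x within {a..q} = at x within {a..<b}"
    by (rule at_within_nhd[of _ "{..<q}"]) (use q in auto)
  ultimately show "continuous (at x within {a..<b}) g" by simp
qed

lemma continuous_on_interval_left:
  fixes g :: "real \<Rightarrow> real"
  assumes "continuous_on {a..<b} g" "(g \<longlongrightarrow> g b) (at_left b)"
  shows "continuous_on {a..b} g"
  unfolding continuous_on_eq_continuous_within
proof
  fix x assume x: "x \<in> {a..b}"
  show "continuous (at x within {a..b}) g"
  proof (cases "x = b")
    case True
    have "(g \<longlongrightarrow> g b) (at b within {a..b})" 
      by (rule tendsto_within_subset[of _ _ _ "{..b}"]) (use assms(2) in \<open>auto simp: at_within_Iic_at_left\<close>)
    then show ?thesis using True by (simp add: continuous_within)
  next
    case False
    have "at x within {a..<b} = at x within {a..b}"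
      by (rule at_within_nhd[of _ "{..<b}"]) (use x False in auto)
    moreover have "continuous (at x within {a..<b}) g"
      using assms(1) x False by (simp add: continuous_on_eq_continuous_within)
    ultimately show ?thesis by simp
  qed
qed

lemma eventually_at_left_between: "a < b \<Longrightarrow> eventually (\<lambda>x. a < x \<and> x < b) (at_left (b::real))"
  by (auto simp: eventually_at_left)

lemma MVT_open:
  fixes g :: "real \<Rightarrow> real"
  assumes "a < b" "continuous_on {a..b} g" "\<And>x. a < x \<Longrightarrow> x < b \<Longrightarrow> (g has_real_derivative g' x) (at x)"
  shows "\<exists>z>a. z < b \<and> g b - g a = (b - a) * g' z"
proof -
  obtain l z where z: "a < z" "z < b" "(g has_real_derivative l) (at z)" "g b - g a = (b - a) * l"
    using MVT[OF assms(1,2)] assms(3) real_differentiable_def by blast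
  moreover have "l = g' z" using DERIV_unique z(3) assms(3)[OF z(1,2)] by blast
  ultimately show ?thesis by blast
qed

locale cohesive =
  fixes f :: "real \<Rightarrow> real" and \<sigma>c :: real
  assumes \<sigma>c_pos: "\<sigma>c > 0" and degradation: "cohesive_degradation \<sigma>c f"
begin

text \<open>Minimising \<open>f\<^sup>2 v A\<^sup>2 + (1 - v)\<^sup>2 / 4 - p A\<close> over \<open>A\<close> gives a nonnegative value precisely for
  \<open>|p| \<le> w v\<close>: this is the stress that material in the state \<open>v\<close> can carry.\<close>

definition w :: "real \<Rightarrow> real" where "w v = (1 - v) * f v"
definition dw :: "real \<Rightarrow> real" where "dw v = (1 - v) * deriv f v - f v"

lemma f_C1:
  "v \<in> {0<..<1} \<Longrightarrow> (f has_real_derivative deriv f v) (at v)"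
  "continuous_on {0<..<1} (deriv f)" "continuous_on {0..<1} f"
proof -
  obtain f' f'' where d: "\<And>x. x \<in> {0..<1} \<Longrightarrow> (f has_real_derivative f' x) (at x within {0..<1})"
    "\<And>x. x \<in> {0..<1} \<Longrightarrow> (f' has_real_derivative f'' x) (at x within {0..<1})"
    using degradation unfolding cohesive_degradation_def C2_on_def by blast
  have at: "at x within {0..<1} = at x" if "x \<in> {0<..<1}" for x :: real
    by (rule at_within_open_subset[OF that]) auto
  have 1: "(f has_real_derivative f' x) (at x)" if "x \<in> {0<..<1}" for x
    using d(1)[of x] that at[OF that] by simp
  then have 2: "deriv f x = f' x" if "x \<in> {0<..<1}" for x using that DERIV_imp_deriv by blast
  show "v \<in> {0<..<1} \<Longrightarrow> (f has_real_derivative deriv f v) (at v)" using 1 2 by simp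
  have "continuous_on {0..<1} f'" using d(2) DERIV_continuous_on by blast
  then have "continuous_on {0<..<1} f'" by (rule continuous_on_subset) auto
  then show "continuous_on {0<..<1} (deriv f)" by (rule continuous_on_eq) (simp add: 2)
  show "continuous_on {0..<1} f" using d(1) DERIV_continuous_on by blast
qed

lemma f_0 [simp]: "f 0 = 0" and f_pos: "0 < v \<Longrightarrow> v < 1 \<Longrightarrow> f v > 0"
proof -
  have *: "{s\<in>{0..<1}. f s = 0} = {0}" "\<forall>s\<in>{0..<1}. 0 \<le> f s"
    using degradation unfolding cohesive_degradation_def by blast+
  have "(0::real) \<in> {s\<in>{0..<1}. f s = 0}" unfolding *(1) by simp
  then show "f 0 = 0" by simp
  assume v: "0 < v" "v < 1"
  have "v \<notin> {s\<in>{0..<1}. f s = 0}" unfolding *(1) using v by simp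
  then have "f v \<noteq> 0" using v by simp
  moreover have "f v \<ge> 0" using *(2) v by simp
  ultimately show "f v > 0" by simp
qed

lemma w_0 [simp]: "w 0 = 0" by (simp add: w_def)
lemma w_1 [simp]: "w 1 = 0" by (simp add: w_def)

lemma w_pos: "0 < v \<Longrightarrow> v < 1 \<Longrightarrow> w v > 0"
  using f_pos by (simp add: w_def)

lemma f_eq_w: "v < 1 \<Longrightarrow> f v = w v / (1 - v)"
  by (simp add: w_def)

lemma w_deriv: "v \<in> {0<..<1} \<Longrightarrow> (w has_real_derivative dw v) (at v)"
  unfolding w_def[abs_def] dw_def
  by (auto intro!: derivative_eq_intros f_C1(1) simp: algebra_simps)

lemma w_cont: "continuous_on {0..<1} w"
  unfolding w_def[abs_def] by (intro continuous_intros f_C1)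

lemma dw_cont: "continuous_on {0<..<1} dw"
  unfolding dw_def[abs_def] by (intro continuous_intros f_C1 continuous_on_subset[OF f_C1(3)]) auto

lemma dw_pos: "v \<in> {0<..<1} \<Longrightarrow> dw v > 0"
proof -
  assume v: "v \<in> {0<..<1}"
  have "deriv (\<lambda>t. (1 - t) * f t) v > 0"
    using degradation v unfolding cohesive_degradation_def by blast
  moreover have "deriv (\<lambda>t. (1 - t) * f t) v = dw v"
    using DERIV_imp_deriv[OF w_deriv[OF v]] by (simp add: w_def[abs_def])
  ultimately show ?thesis by simp
qed

lemma w_strict_mono: "0 \<le> a \<Longrightarrow> a < b \<Longrightarrow> b < 1 \<Longrightarrow> w a < w b"
  by (rule DERIV_pos_imp_increasing_open)
     (auto intro!: exI[of _ "dw _"] w_deriv dw_pos continuous_on_subset[OF w_cont])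

lemma w_less_iff: "0 \<le> a \<Longrightarrow> a < 1 \<Longrightarrow> 0 \<le> b \<Longrightarrow> b < 1 \<Longrightarrow> w a < w b \<longleftrightarrow> a < b"
  using w_strict_mono[of a b] w_strict_mono[of b a] by (cases a b rule: linorder_cases) auto

lemma w_le_iff: "0 \<le> a \<Longrightarrow> a < 1 \<Longrightarrow> 0 \<le> b \<Longrightarrow> b < 1 \<Longrightarrow> w a \<le> w b \<longleftrightarrow> a \<le> b"
  using w_less_iff[of b a] by linarith

lemma w_limit: "(w \<longlongrightarrow> \<sigma>c) (at_left 1)"
  using degradation unfolding cohesive_degradation_def w_def[abs_def] by blast

lemma w_nonneg: "0 \<le> v \<Longrightarrow> v < 1 \<Longrightarrow> 0 \<le> w v"
  using w_pos[of v] by (cases "v = 0") auto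

lemma w_less: assumes "0 \<le> v" "v < 1" shows "w v < \<sigma>c"
proof -
  define u where "u = (v + 1) / 2"
  have u: "v < u" "u < 1" using assms by (auto simp: u_def)
  have "eventually (\<lambda>x. u < x \<and> x < 1) (at_left 1)" 
    by (rule eventually_at_left_between[OF u(2)])
  then have "eventually (\<lambda>x. w u \<le> w x) (at_left 1)"
  proof eventually_elim
    case (elim x)
    then show ?case using w_strict_mono[of u x] u assms by auto
  qed
  then have "w u \<le> \<sigma>c" by (intro tendsto_lowerbound[OF w_limit]) auto
  then show ?thesis using w_strict_mono[of v u] u assms by simp
qed

text \<open>Up to the factor \<open>- 1 / 2\<close> the quotient is the derivative of \<open>t \<mapsto> w (1 - \<surd>t)\<close> at \<open>t = (1 - v)\<^sup>2\<close>, and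
  this function is convex. As \<open>t\<close> decreases in \<open>v\<close>, the sign turns the monotonicity around.\<close>

lemma dw_ratio_mono:
  assumes "0 < v1" "v1 \<le> v2" "v2 < 1" shows "dw v1 / (1 - v1) \<le> dw v2 / (1 - v2)"
proof (cases "v1 = v2")
  case False
  define W where "W t = sqrt t * f (1 - sqrt t)" for t
  define t1 t2 where "t1 = (1 - v1)\<^sup>2" and "t2 = (1 - v2)\<^sup>2"
  have t: "0 < t2" "t2 < t1" "t1 < 1" "sqrt t1 = 1 - v1" "sqrt t2 = 1 - v2"
    using assms False by (auto simp: t1_def t2_def power_strict_mono power_less_one_iff)
  have conv: "convex_on {0<..1} W"
    using degradation unfolding cohesive_degradation_def W_def[abs_def] by blast
  have WW: "W = (\<lambda>t. w (1 - sqrt t))" by (auto simp: W_def w_def)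
  have der: "(W has_real_derivative - (dw v / (1 - v) / 2)) (at ((1 - v)\<^sup>2) within {0<..1})" if "0 < v" "v < 1" for v
  proof -
    have sq: "sqrt ((1 - v)\<^sup>2) = 1 - v" using that by simp
    have "((\<lambda>t. w (1 - sqrt t)) has_real_derivative dw (1 - sqrt ((1 - v)\<^sup>2)) * (- (inverse (sqrt ((1 - v)\<^sup>2)) / 2))) (at ((1 - v)\<^sup>2))"
      using that sq 
      by (intro DERIV_chain2[where g="\<lambda>t. 1 - sqrt t", OF w_deriv]) (auto intro!: derivative_eq_intros)
    then show ?thesis unfolding WW sq 
      by (simp add: field_simps has_field_derivative_at_within)
  qed
  have d: "(W has_real_derivative - (dw v1 / (1 - v1) / 2)) (at t1 within {0<..1})"
     "(W has_real_derivative - (dw v2 / (1 - v2) / 2)) (at t2 within {0<..1})"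
    using der[of v1] der[of v2] assms by (auto simp: t1_def t2_def)
  have int: "t \<in> interior {0<..1::real}" if "0 < t" "t < 1" for t
    using that by (intro interiorI[of "{0<..<1}"]) auto
  have "W t2 - W t1 \<ge> - (dw v1 / (1 - v1) / 2) * (t2 - t1)"
    by (rule convex_on_imp_above_tangent[OF conv _ _ _ d(1)]) (use t in \<open>auto simp: int\<close>)
  moreover have "W t1 - W t2 \<ge> - (dw v2 / (1 - v2) / 2) * (t1 - t2)"
    by (rule convex_on_imp_above_tangent[OF conv _ _ _ d(2)]) (use t in \<open>auto simp: int\<close>)
  moreover have "- x * (t2 - t1) + - y * (t1 - t2) = (x - y) * (t1 - t2)" for x y
    by (simp add: algebra_simps)
  ultimately have "(dw v1 / (1 - v1) / 2 - dw v2 / (1 - v2) / 2) * (t1 - t2) \<le> 0"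
    by (smt (verit))
  then have "dw v1 / (1 - v1) / 2 - dw v2 / (1 - v2) / 2 \<le> 0"
    using t(2) unfolding mult_le_0_iff by linarith
  moreover have "x / 2 - y / 2 \<le> 0 \<Longrightarrow> x \<le> y" for x y :: real by simp
  ultimately show ?thesis by blast
qed simp

text \<open>The state at which a given stress is critical.\<close>

definition om :: "real \<Rightarrow> real" where "om = inv_into {0..<1} w"

lemma w_image: "w ` {0..<1} = {0..<\<sigma>c}"
proof (intro equalityI subsetI)
  fix p assume p: "p \<in> {0..<\<sigma>c}"
  have "eventually (\<lambda>x. p < w x) (at_left 1)" using w_limit p by (auto intro: order_tendstoD)
  moreover have "eventually (\<lambda>x. 0 < x \<and> x < 1) (at_left (1::real))" 
    by (rule eventually_at_left_between) simp
  ultimately have "eventually (\<lambda>x. p < w x \<and> 0 < x \<and> x < 1) (at_left 1)" by eventually_elim auto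
  then obtain b where b: "p < w b" "0 < b" "b < 1"
    using eventually_happens'[OF trivial_limit_at_left_real] by blast
  have "\<exists>x. 0 \<le> x \<and> x \<le> b \<and> w x = p"
    using b p by (intro IVT') (auto intro: continuous_on_subset[OF w_cont])
  then show "p \<in> w ` {0..<1}" using b by force
qed (use w_less w_nonneg in force)

lemma om_props:
  assumes "0 \<le> p" "p < \<sigma>c"
  shows "0 \<le> om p" "om p < 1" "w (om p) = p"
proof -
  have "p \<in> w ` {0..<1}" using assms w_image by simp
  then show "0 \<le> om p" "om p < 1" "w (om p) = p"
    using inv_into_into[of p w "{0..<1}"] f_inv_into_f[of p w "{0..<1}"] by (auto simp: om_def)
qed

lemma om_w: assumes "0 \<le> v" "v < 1" shows "om (w v) = v"
  using om_props[OF w_nonneg w_less, OF assms assms] w_less_iff[of v "om (w v)"] w_less_iff[of "om (w v)" v] assms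
  by force

lemma om_0 [simp]: "om 0 = 0" using om_w[of 0] by simp

lemma om_pos: "0 < p \<Longrightarrow> p < \<sigma>c \<Longrightarrow> 0 < om p"
  using om_props[of p] by (cases "om p = 0") auto

lemma om_mono: "0 \<le> p \<Longrightarrow> p \<le> q \<Longrightarrow> q < \<sigma>c \<Longrightarrow> om p \<le> om q"
  using om_props[of p] om_props[of q] w_le_iff[of "om p" "om q"] by auto

lemma om_strict_mono: "0 \<le> p \<Longrightarrow> p < q \<Longrightarrow> q < \<sigma>c \<Longrightarrow> om p < om q"
  using om_props[of p] om_props[of q] w_less_iff[of "om p" "om q"] by auto

lemma om_cont: "continuous_on {0..<\<sigma>c} om"
proof (rule continuous_on_interval_exhaust)
  show "continuous_on {0..q} om" if "q < \<sigma>c" for q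
  proof (cases "0 \<le> q")
    case True
    have "continuous_on (w ` {0..om q}) om"
      by (rule continuous_on_inv) (use om_props[OF True that] om_w in \<open>auto intro: continuous_on_subset[OF w_cont]\<close>)
    moreover have "{0..q} \<subseteq> w ` {0..om q}"
    proof
      fix x assume x: "x \<in> {0..q}"
      have "w (om x) = x" "om x \<in> {0..om q}" using x om_props[of x] om_mono[of x q] that by auto
      then show "x \<in> w ` {0..om q}" by force
    qed
    ultimately show ?thesis using continuous_on_subset by blast
  qed auto
qed

lemma om_deriv: assumes "0 < p" "p < \<sigma>c" shows "(om has_real_derivative inverse (dw (om p))) (at p)"
proof (rule DERIV_inverse_function[of w _ _ _ 0 \<sigma>c])
  have o: "om p \<in> {0<..<1}" using om_pos[OF assms] om_props[of p] assms by auto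
  show "(w has_real_derivative dw (om p)) (at (om p))" using w_deriv[OF o] .
  show "dw (om p) \<noteq> 0" using dw_pos[OF o] by simp
  show "isCont om p" using assms by (intro continuous_on_interior[OF om_cont] interiorI[of "{0<..<\<sigma>c}"]) auto
qed (use assms om_props in auto)

text \<open>The squared defect \<open>(1 - v)\<^sup>2\<close> as a function of \<open>p = w v\<close>, and minus its derivative. No state carries
  more than \<open>\<sigma>c\<close>, which is why both are continued by zero.\<close>

definition tau :: "real \<Rightarrow> real" where "tau p = (if p < \<sigma>c then (1 - om p)\<^sup>2 else 0)"
definition D :: "real \<Rightarrow> real" where "D p = (if 0 < p \<and> p < \<sigma>c then 2 * (1 - om p) / dw (om p) else 0)"

lemma om_tendsto: "(om \<longlongrightarrow> 1) (at_left \<sigma>c)"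
proof (rule order_tendstoI)
  fix a :: real assume "a < 1"
  define b where "b = max a 0"
  have b: "0 \<le> b" "b < 1" "a \<le> b" using \<open>a < 1\<close> by (auto simp: b_def)
  have "eventually (\<lambda>x. w b < x \<and> x < \<sigma>c) (at_left \<sigma>c)"
    by (rule eventually_at_left_between[OF w_less[OF b(1,2)]])
  then show "eventually (\<lambda>x. a < om x) (at_left \<sigma>c)"
  proof eventually_elim
    case (elim x)
    then show ?case using om_strict_mono[of "w b" x] w_nonneg[OF b(1,2)] om_w[OF b(1,2)] b by auto
  qed
next
  fix a :: real assume "1 < a"
  have "eventually (\<lambda>x. 0 < x \<and> x < \<sigma>c) (at_left \<sigma>c)"
    by (rule eventually_at_left_between[OF \<sigma>c_pos])
  then show "eventually (\<lambda>x. om x < a) (at_left \<sigma>c)"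
  proof eventually_elim
    case (elim x)
    then show ?case using om_props[of x] \<open>1 < a\<close> by auto
  qed
qed

lemma tau_0 [simp]: "tau 0 = 1" using \<sigma>c_pos by (simp add: tau_def)

lemma tau_bounds: "0 \<le> p \<Longrightarrow> 0 \<le> tau p \<and> tau p \<le> 1"
  using om_props[of p] by (auto simp: tau_def power_le_one)

lemma tau_antimono: "0 \<le> p \<Longrightarrow> p \<le> q \<Longrightarrow> tau q \<le> tau p"
  using om_props[of p] om_props[of q] om_mono[of p q] by (auto simp: tau_def intro!: power_mono)

lemma tau_deriv: assumes "0 < p" "p < \<sigma>c" shows "(tau has_real_derivative - D p) (at p)"
proof -
  have "((\<lambda>p. (1 - om p)\<^sup>2) has_real_derivative - D p) (at p)"
    using assms by (auto intro!: derivative_eq_intros om_deriv simp: D_def field_simps)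
  then show ?thesis
    by (rule has_field_derivative_transform_within_open[where S="{0<..<\<sigma>c}"]) (use assms in \<open>auto simp: tau_def\<close>)
qed

lemma tau_cont: "continuous_on {0..} tau"
proof -
  have "continuous_on {0..\<sigma>c} tau"
  proof (rule continuous_on_interval_left)
    show "continuous_on {0..<\<sigma>c} tau"
      by (rule continuous_on_eq[of _ "\<lambda>p. (1 - om p)\<^sup>2"]) (auto intro!: continuous_intros om_cont simp: tau_def)
    have "((\<lambda>p. (1 - om p)\<^sup>2) \<longlongrightarrow> (1 - 1)\<^sup>2) (at_left \<sigma>c)" by (intro tendsto_intros om_tendsto)
    moreover have "eventually (\<lambda>p. (1 - om p)\<^sup>2 = tau p) (at_left \<sigma>c)"
      by (auto simp: tau_def eventually_at_filter)
    ultimately have "(tau \<longlongrightarrow> (1 - 1)\<^sup>2) (at_left \<sigma>c)" by (rule Lim_transform_eventually)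
    then show "(tau \<longlongrightarrow> tau \<sigma>c) (at_left \<sigma>c)" by (simp add: tau_def)
  qed
  moreover have "continuous_on {\<sigma>c..} tau"
    by (rule continuous_on_eq[of _ "\<lambda>p. 0"]) (auto simp: tau_def)
  ultimately have "continuous_on ({0..\<sigma>c} \<union> {\<sigma>c..}) tau"
    by (intro continuous_on_closed_Un) auto
  then show ?thesis by (rule continuous_on_subset) auto
qed

lemma D_nonneg: "0 \<le> D p"
  using om_props[of p] dw_pos[of "om p"] om_pos[of p] by (auto simp: D_def)

lemma D_pos: "0 < p \<Longrightarrow> p < \<sigma>c \<Longrightarrow> 0 < D p"
  using om_props[of p] dw_pos[of "om p"] om_pos[of p] by (auto simp: D_def)

lemma D_antimono: assumes "0 < p" "p \<le> q" shows "D q \<le> D p"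
proof (cases "q < \<sigma>c")
  case True
  have o: "0 < om p" "om p \<le> om q" "om q < 1" using assms True om_pos om_mono om_props[of q] by auto
  have "D x = 2 / (dw (om x) / (1 - om x))" if "0 < x" "x < \<sigma>c" for x
    using that by (simp add: D_def)
  moreover have "2 / (dw (om q) / (1 - om q)) \<le> 2 / (dw (om p) / (1 - om p))"
    using dw_ratio_mono[OF o] dw_pos[of "om p"] o by (intro divide_left_mono) (auto intro!: mult_pos_pos divide_pos_pos dw_pos)
  ultimately show ?thesis using assms True by simp
next
  case False
  then have "D q = 0" by (simp add: D_def)
  then show ?thesis using D_nonneg by simp
qed

lemma D_cont: "continuous_on {0<..<\<sigma>c} D"
proof (rule continuous_on_eq[of _ "\<lambda>p. 2 * (1 - om p) / dw (om p)"])
  have c: "continuous_on {0<..<\<sigma>c} om" by (rule continuous_on_subset[OF om_cont]) auto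
  have o: "om p \<in> {0<..<1}" if "p \<in> {0<..<\<sigma>c}" for p using that om_pos om_props[of p] by auto
  have "dw (om p) \<noteq> 0" if "p \<in> {0<..<\<sigma>c}" for p using dw_pos[OF o[OF that]] by simp
  then show "continuous_on {0<..<\<sigma>c} (\<lambda>p. 2 * (1 - om p) / dw (om p))"
    by (intro continuous_intros c continuous_on_compose2[OF dw_cont c]) (use o in auto)
qed (auto simp: D_def)

text \<open>\<open>D\<close> is nonincreasing because \<open>dw v / (1 - v)\<close> is nondecreasing. The tangent inequality also holds for \<open>q\<close>
  beyond \<open>\<sigma>c\<close>, since there \<open>tau\<close> has stopped decreasing.\<close>

lemma tau_convex: assumes "0 < p" "0 \<le> q" shows "tau p - D p * (q - p) \<le> tau q"
proof (cases "p < \<sigma>c")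
  case False
  then show ?thesis using tau_bounds[of q] assms by (simp add: tau_def D_def)
next
  case p: True
  have le: "tau p - D p * (q - p) \<le> tau q" if q: "0 \<le> q" "q \<le> \<sigma>c" for q
  proof (cases q p rule: linorder_cases)
    case less
    have "\<exists>z>q. z < p \<and> tau p - tau q = (p - q) * - D z"
      using less p q by (intro MVT_open) (auto intro!: tau_deriv continuous_on_subset[OF tau_cont])
    then obtain z where z: "q < z" "z < p" "tau p - tau q = (p - q) * - D z" by blast
    have "D p * (p - q) \<le> D z * (p - q)" using z less q D_antimono[of z p] by (intro mult_right_mono) auto
    then show ?thesis using z by (simp add: algebra_simps)
  next
    case greater
    have "\<exists>z>p. z < q \<and> tau q - tau p = (q - p) * - D z"
      using greater assms q by (intro MVT_open) (auto intro!: tau_deriv continuous_on_subset[OF tau_cont])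
    then obtain z where z: "p < z" "z < q" "tau q - tau p = (q - p) * - D z" by blast
    have "D z * (q - p) \<le> D p * (q - p)" using z greater assms D_antimono[of p z] by (intro mult_right_mono) auto
    then show ?thesis using z by (simp add: algebra_simps)
  qed auto
  show ?thesis
  proof (cases "q \<le> \<sigma>c")
    case True
    then show ?thesis using le assms by simp
  next
    case False
    have "tau p - D p * (q - p) \<le> tau p - D p * (\<sigma>c - p)"
      using False D_nonneg[of p] by (simp add: mult_left_mono)
    also have "\<dots> \<le> tau \<sigma>c" using le \<sigma>c_pos by simp
    finally show ?thesis using False by (simp add: tau_def)
  qed
qed

end

section \<open>Work and opening of a stationary profile\<close>

lemma integrable_on_antimono:
  fixes g :: "real \<Rightarrow> real"
  assumes "\<And>x y. a \<le> x \<Longrightarrow> x \<le> y \<Longrightarrow> y \<le> b \<Longrightarrow> g y \<le> g x"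
  shows "g integrable_on {a..b}"
proof -
  have "(\<lambda>x. - g x) integrable_on {a..b}"
    using assms by (intro integrable_on_mono_on) (auto simp: mono_on_def)
  then show ?thesis using integrable_neg_iff by blast
qed

lemma cos_quarter: "0 \<le> t \<Longrightarrow> t < pi / 2 \<Longrightarrow> cos t > 0"
  by (intro cos_gt_zero_pi) (auto intro: less_le_trans)

lemma arccos_range:
  assumes "0 \<le> x" "x \<le> 1"
  shows "0 \<le> arccos x" "arccos x \<le> pi / 2" "cos (arccos x) = x"
    "0 < x \<Longrightarrow> arccos x < pi / 2" "x < 1 \<Longrightarrow> 0 < arccos x"
  using assms arccos_le_arccos[of 0 x] arccos_less_arccos[of 0 x] arccos_less_arccos[of x 1]
    arccos_lbound[of x] cos_arccos[of x] by auto

lemma has_integral_step: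
  fixes K :: real
  assumes "0 \<le> A" "A \<le> B"
  shows "((\<lambda>t. if t \<le> A then K else 0) has_integral K * A) {0..B}"
proof -
  have "((\<lambda>t. if t \<in> {0..A} then K else 0) has_integral K * A) {0..B}"
    using has_integral_const_real[of K 0 A] assms
    by (subst has_integral_restrict) (auto simp: mult.commute)
  then show ?thesis by (rule has_integral_eq[rotated]) auto
qed

context cohesive
begin

text \<open>Along a stationary profile of stress \<open>p\<close> one has \<open>w \<beta> = p / cos \<theta>\<close> with \<open>|\<theta>| < arccos (p / \<sigma>c)\<close>; beyond
  this range both integrands vanish. In this variable \<open>S p\<close> is the opening of the
  profile and \<open>H p\<close> its energy minus the work \<open>p S p\<close>.\<close>

definition H :: "real \<Rightarrow> real" where "H p = integral {0..pi/2} (\<lambda>\<theta>. tau (p / cos \<theta>) * cos \<theta>)"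
definition S :: "real \<Rightarrow> real" where "S p = integral {0..pi/2} (\<lambda>\<theta>. D (p / cos \<theta>))"

lemma div_cos_mono:
  assumes "0 \<le> p" "0 \<le> x" "x \<le> y" "y < pi / 2"
  shows "p / cos x \<le> p / cos y"
proof -
  have "0 < cos y" using assms cos_quarter by auto
  moreover have "cos y \<le> cos x" using assms by (intro cos_monotone_0_pi_le) auto
  ultimately show ?thesis using assms(1) by (intro divide_left_mono) auto
qed

lemma H_integrable:
  assumes "0 \<le> p" shows "(\<lambda>\<theta>. tau (p / cos \<theta>) * cos \<theta>) integrable_on {0..pi/2}"
proof (rule integrable_on_antimono)
  fix x y :: real assume xy: "0 \<le> x" "x \<le> y" "y \<le> pi / 2"
  have cx: "0 \<le> cos x" using xy by (intro cos_ge_zero) auto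
  show "tau (p / cos y) * cos y \<le> tau (p / cos x) * cos x"
  proof (cases "y = pi / 2")
    case True
    then have "cos y = 0" by (simp only: cos_pi_half)
    then show ?thesis using tau_bounds[of "p / cos x"] cx assms by simp
  next
    case False
    then have y: "y < pi / 2" using xy by simp
    have "tau (p / cos y) \<le> tau (p / cos x)"
      using div_cos_mono[OF assms xy(1,2) y] cx assms by (intro tau_antimono) auto
    moreover have "cos y \<le> cos x" using xy by (intro cos_monotone_0_pi_le) auto
    moreover have "0 < cos y" using xy y cos_quarter by auto
    ultimately show ?thesis using tau_bounds[of "p / cos x"] cx assms by (intro mult_mono) auto
  qed
qed

lemma D_0 [simp]: "D 0 = 0" by (simp add: D_def)

lemma D_cos_antimono:
  assumes "0 < p" "0 \<le> x" "x \<le> y" "y \<le> pi / 2" shows "D (p / cos y) \<le> D (p / cos x)"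
proof (cases "y = pi / 2")
  case True
  then have "cos y = 0" by (simp only: cos_pi_half)
  then show ?thesis using D_nonneg by simp
next
  case False
  then have y: "y < pi / 2" using assms by simp
  then have "0 < p / cos x" using cos_quarter[of x] assms by auto
  then show ?thesis using div_cos_mono[of p x y] assms y by (intro D_antimono) auto
qed

lemma S_integrable: "0 < p \<Longrightarrow> (\<lambda>\<theta>. D (p / cos \<theta>)) integrable_on {0..pi/2}"
  using D_cos_antimono by (intro integrable_on_antimono) auto

lemma S_nonneg: "0 < p \<Longrightarrow> 0 \<le> S p"
  unfolding S_def by (intro integral_nonneg S_integrable D_nonneg)

lemma S_antimono: assumes "0 < p" "p \<le> q" shows "S q \<le> S p"
  unfolding S_def
proof (intro integral_le S_integrable)
  fix \<theta> assume t: "\<theta> \<in> {0..pi/2}"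
  show "D (q / cos \<theta>) \<le> D (p / cos \<theta>)"
  proof (cases "\<theta> = pi / 2")
    case False
    then have "cos \<theta> > 0" using t cos_quarter by auto
    then show ?thesis using assms by (intro D_antimono divide_right_mono) auto
  next
    case True
    then have "cos \<theta> = 0" by (simp only: cos_pi_half)
    then show ?thesis by simp
  qed
qed (use assms in auto)

lemma D_isCont: assumes "0 < p" "p \<noteq> \<sigma>c" shows "isCont D p"
proof (cases "p < \<sigma>c")
  case True
  then show ?thesis using assms by (intro continuous_on_interior[OF D_cont]) auto
next
  case False
  then have "eventually (\<lambda>x. D x = 0) (nhds p)"
    unfolding eventually_nhds using assms by (intro exI[of _ "{\<sigma>c<..}"]) (auto simp: D_def)
  then show ?thesis by (simp add: isCont_cong)
qed

lemma S_pos: assumes "0 < p" "p < \<sigma>c" shows "0 < S p"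
proof -
  define p0 where "p0 = (p + \<sigma>c) / 2"
  have p0: "p < p0" "p0 < \<sigma>c" "0 < p0" using assms by (auto simp: p0_def)
  define A where "A = arccos (p / p0)"
  have pp: "0 < p / p0" "p / p0 < 1" using p0 assms by auto
  have A: "0 < A" "A < pi / 2" "cos A = p / p0"
    using arccos_range[of "p / p0"] pp by (auto simp: A_def)
  have "((\<lambda>t. if t \<le> A then D p0 else 0) has_integral D p0 * A) {0..pi/2}"
    using A by (intro has_integral_step) auto
  moreover have "(if t \<le> A then D p0 else 0) \<le> D (p / cos t)" if "t \<in> {0..pi/2}" for t
  proof (cases "t \<le> A")
    case True
    have "D (p / cos A) \<le> D (p / cos t)" using D_cos_antimono[of p t A] assms True that A by auto
    then show ?thesis using True A p0 assms by simp
  qed (use D_nonneg in auto)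
  ultimately have "D p0 * A \<le> S p"
    unfolding S_def using has_integral_le integrable_integral[OF S_integrable[OF assms(1)]] by blast
  moreover have "0 < D p0 * A" using D_pos p0 A by simp
  ultimately show ?thesis by simp
qed

text \<open>The integrand is largest at \<open>\<theta> = 0\<close> and vanishes once \<open>p / cos \<theta>\<close> exceeds \<open>\<sigma>c\<close>.\<close>

lemma S_le: assumes "0 < p" "p < \<sigma>c" shows "S p \<le> D p * arccos (p / \<sigma>c)"
proof -
  define A where "A = arccos (p / \<sigma>c)"
  have pp: "0 < p / \<sigma>c" "p / \<sigma>c < 1" using assms by auto
  have A: "0 \<le> A" "A \<le> pi / 2" "cos A = p / \<sigma>c"
    using arccos_range[of "p / \<sigma>c"] pp by (auto simp: A_def)
  have "((\<lambda>t. if t \<le> A then D p else 0) has_integral D p * A) {0..pi/2}"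
    using A by (intro has_integral_step) auto
  moreover have "D (p / cos t) \<le> (if t \<le> A then D p else 0)" if t: "t \<in> {0..pi/2}" for t
  proof (cases "t \<le> A")
    case True
    then show ?thesis using D_cos_antimono[of p 0 t] t assms by simp
  next
    case False
    then have "D (p / cos t) \<le> D (p / cos A)" using D_cos_antimono[of p A t] assms t A by auto
    also have "\<dots> = 0" using A assms by (simp add: D_def)
    finally show ?thesis using False by simp
  qed
  ultimately have "S p \<le> D p * A"
    unfolding S_def using has_integral_le integrable_integral[OF S_integrable[OF assms(1)]] by blast
  then show ?thesis by (simp add: A_def)
qed

lemma S_tendsto_0: "(S \<longlongrightarrow> 0) (at_left \<sigma>c)"
proof (rule tendsto_sandwich[OF _ _ tendsto_const])
  have ev: "eventually (\<lambda>p. \<sigma>c / 2 < p \<and> p < \<sigma>c) (at_left \<sigma>c)"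
    using \<sigma>c_pos by (intro eventually_at_left_between) auto
  show "eventually (\<lambda>p. 0 \<le> S p) (at_left \<sigma>c)"
    using ev by eventually_elim (use \<sigma>c_pos in \<open>auto intro!: S_nonneg\<close>)
  show "eventually (\<lambda>p. S p \<le> D (\<sigma>c / 2) * arccos (p / \<sigma>c)) (at_left \<sigma>c)"
    using ev
  proof eventually_elim
    case (elim p)
    have "0 \<le> arccos (p / \<sigma>c)" using elim \<sigma>c_pos by (intro arccos_range(1)) auto
    then have "D p * arccos (p / \<sigma>c) \<le> D (\<sigma>c / 2) * arccos (p / \<sigma>c)"
      using elim \<sigma>c_pos by (intro mult_right_mono D_antimono) auto
    then show ?case using S_le[of p] elim \<sigma>c_pos by auto
  qed
  have "continuous_on {0..\<sigma>c} (\<lambda>p. D (\<sigma>c / 2) * arccos (p / \<sigma>c))"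
    using \<sigma>c_pos by (intro continuous_intros) (auto intro: order_trans[of "-1" 0])
  then have "((\<lambda>p. D (\<sigma>c / 2) * arccos (p / \<sigma>c)) \<longlongrightarrow> D (\<sigma>c / 2) * arccos (\<sigma>c / \<sigma>c)) (at \<sigma>c within {0..\<sigma>c})"
    using \<sigma>c_pos unfolding continuous_on_def by (elim ballE[of _ _ \<sigma>c]) auto
  moreover have "at \<sigma>c within {0..\<sigma>c} = at_left \<sigma>c" using \<sigma>c_pos by (rule at_within_Icc_at_left)
  ultimately show "((\<lambda>p. D (\<sigma>c / 2) * arccos (p / \<sigma>c)) \<longlongrightarrow> 0) (at_left \<sigma>c)"
    using \<sigma>c_pos by simp
qed

text \<open>\<open>D\<close> is continuous except possibly at \<open>\<sigma>c\<close>, and \<open>p / cos \<theta> = \<sigma>c\<close> for a single \<open>\<theta>\<close> only, so dominated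
  convergence applies.\<close>

lemma S_cont: "continuous_on {0<..<\<sigma>c} S"
  unfolding continuous_on_sequentially
proof (intro allI ballI impI, elim conjE)
  fix x :: "nat \<Rightarrow> real" and a assume a: "a \<in> {0<..<\<sigma>c}" and x: "\<forall>n. x n \<in> {0<..<\<sigma>c}" "x \<longlonglongrightarrow> a"
  define x' where "x' n = max (x n) (a / 2)" for n
  have x': "x' n \<in> {0<..<\<sigma>c}" "a / 2 \<le> x' n" for n using x(1) a by (auto simp: x'_def)
  have "(\<lambda>n. max (x n) (a / 2)) \<longlonglongrightarrow> max a (a / 2)" by (intro tendsto_intros x)
  then have lim: "x' \<longlonglongrightarrow> a" using a by (simp add: x'_def[abs_def] max_def)
  define N where "N = {arccos (a / \<sigma>c), pi / 2}"
  define F where "F p \<theta> = (if \<theta> \<in> N then 0 else D (p / cos \<theta>))" for p \<theta>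
  have neg: "negligible N" by (simp add: N_def)
  have FI: "(F p has_integral S p) {0..pi/2}" if "0 < p" for p
    unfolding S_def by (rule has_integral_spike[OF neg _ integrable_integral[OF S_integrable[OF that]]]) (auto simp: F_def)
  have "(\<lambda>k. integral {0..pi/2} (F (x' k))) \<longlonglongrightarrow> integral {0..pi/2} (F a)"
  proof (rule dominated_convergence(2))
    show "F (x' k) integrable_on {0..pi/2}" for k using FI[of "x' k"] x' by auto
    show "(\<lambda>_. D (a / 2)) integrable_on {0..pi/2}" by (rule integrable_const_ivl)
    show "norm (F (x' k) t) \<le> D (a / 2)" if "t \<in> {0..pi/2}" for k t
    proof (cases "t \<in> N")
      case True
      then show ?thesis using D_nonneg by (simp add: F_def)
    next
      case False
      have "D (x' k / cos t) \<le> D (x' k / cos 0)" using x'[of k] that by (intro D_cos_antimono) auto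
      also have "\<dots> \<le> D (a / 2)" using x'[of k] a by (intro D_antimono) auto
      finally show ?thesis using False D_nonneg by (simp add: F_def)
    qed
    show "(\<lambda>k. F (x' k) t) \<longlonglongrightarrow> F a t" if t: "t \<in> {0..pi/2}" for t
    proof (cases "t \<in> N")
      case False
      then have c: "cos t > 0" using cos_quarter[of t] t by (auto simp: N_def)
      have "a / cos t \<noteq> \<sigma>c"
      proof
        assume "a / cos t = \<sigma>c"
        then have "cos t = a / \<sigma>c" using c \<sigma>c_pos by (simp add: field_simps)
        then have "t = arccos (a / \<sigma>c)" using arccos_cos[of t] t by auto
        then show False using False by (simp add: N_def)
      qed
      then have "isCont D (a / cos t)" using a c by (intro D_isCont) auto
      then have "(\<lambda>k. D (x' k / cos t)) \<longlonglongrightarrow> D (a / cos t)"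
        by (rule isCont_tendsto_compose) (intro tendsto_intros lim, use c in auto)
      then show ?thesis using False by (simp add: F_def)
    qed (simp add: F_def)
  qed
  moreover have "integral {0..pi/2} (F p) = S p" if "0 < p" for p
    using FI[OF that] by (rule integral_unique)
  ultimately have "(\<lambda>k. S (x' k)) \<longlonglongrightarrow> S a"
    using x'(1) a by simp
  moreover have "eventually (\<lambda>k. S (x' k) = (S \<circ> x) k) sequentially"
  proof -
    have "eventually (\<lambda>k. x k > a / 2) sequentially" using order_tendstoD(1)[OF x(2), of "a / 2"] a by auto
    then show ?thesis by eventually_elim (simp add: x'_def)
  qed
  ultimately show "(S \<circ> x) \<longlonglongrightarrow> S a" by (rule Lim_transform_eventually)
qed

lemma S_attains:
  assumes "0 < s" "s < S p1" "0 < p1" "p1 < \<sigma>c"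
  shows "\<exists>p. 0 < p \<and> p < \<sigma>c \<and> S p = s"
proof -
  have "eventually (\<lambda>p. S p < s) (at_left \<sigma>c)" using S_tendsto_0 assms by (auto intro: order_tendstoD)
  then have "eventually (\<lambda>p. S p < s \<and> p1 < p \<and> p < \<sigma>c) (at_left \<sigma>c)"
    using eventually_at_left_between[OF assms(4)] by eventually_elim auto
  then obtain p2 where p2: "S p2 < s" "p1 < p2" "p2 < \<sigma>c"
    using eventually_happens'[OF trivial_limit_at_left_real] by blast
  have "\<exists>x. p1 \<le> x \<and> x \<le> p2 \<and> S x = s"
    using p2 assms by (intro IVT2') (auto intro: continuous_on_subset[OF S_cont])
  then obtain x where "p1 \<le> x" "x \<le> p2" "S x = s" by blast
  then show ?thesis using p2 assms by (intro exI[of _ x]) auto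
qed

text \<open>The tangent inequality for \<open>tau\<close> at \<open>p / cos \<theta>\<close>, multiplied by \<open>cos \<theta>\<close> and integrated.\<close>

lemma H_tangent:
  assumes "0 < p" "0 \<le> q" shows "H p - S p * (q - p) \<le> H q"
proof -
  have "((\<lambda>\<theta>. tau (p / cos \<theta>) * cos \<theta> - D (p / cos \<theta>) * (q - p)) has_integral H p - S p * (q - p)) {0..pi/2}"
    unfolding H_def S_def using assms
    by (intro has_integral_diff has_integral_mult_left integrable_integral H_integrable S_integrable) auto
  moreover have "((\<lambda>\<theta>. tau (q / cos \<theta>) * cos \<theta>) has_integral H q) {0..pi/2}"
    unfolding H_def using assms by (intro integrable_integral H_integrable)
  moreover have "tau (p / cos \<theta>) * cos \<theta> - D (p / cos \<theta>) * (q - p) \<le> tau (q / cos \<theta>) * cos \<theta>"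
    if t: "\<theta> \<in> {0..pi/2}" for \<theta>
  proof (cases "\<theta> = pi / 2")
    case False
    then have c: "cos \<theta> > 0" using t cos_quarter by auto
    have "(tau (p / cos \<theta>) - D (p / cos \<theta>) * (q / cos \<theta> - p / cos \<theta>)) * cos \<theta> \<le> tau (q / cos \<theta>) * cos \<theta>"
      using c assms by (intro mult_right_mono tau_convex) auto
    moreover have "(tau (p / cos \<theta>) - D (p / cos \<theta>) * (q / cos \<theta> - p / cos \<theta>)) * cos \<theta>
      = tau (p / cos \<theta>) * cos \<theta> - D (p / cos \<theta>) * (q - p)"
      using c by (simp add: field_simps)
    ultimately show ?thesis by simp
  next
    case True
    then have "cos \<theta> = 0" by (simp only: cos_pi_half)
    then show ?thesis by simp
  qed
  ultimately show ?thesis using has_integral_le by blast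
qed

lemma integral_cos_quarter: "(cos has_integral 1) {0..pi/2}"
proof -
  have "(cos has_integral (sin (pi/2) - sin 0)) {0..pi/2}"
    by (intro fundamental_theorem_of_calculus)
       (auto intro!: derivative_eq_intros simp: has_real_derivative_iff_has_vector_derivative[symmetric])
  then show ?thesis by simp
qed

lemma H_le_1: "0 \<le> p \<Longrightarrow> H p \<le> 1"
proof (rule has_integral_le[OF _ integral_cos_quarter])
  assume "0 \<le> p"
  then show "((\<lambda>\<theta>. tau (p / cos \<theta>) * cos \<theta>) has_integral H p) {0..pi/2}"
    unfolding H_def by (intro integrable_integral H_integrable)
  fix t :: real assume "t \<in> {0..pi/2}"
  then have "0 \<le> cos t" by (intro cos_ge_zero) auto
  then show "tau (p / cos t) * cos t \<le> cos t"
    using tau_bounds[of "p / cos t"] \<open>0 \<le> p\<close> by (simp add: mult_left_le_one_le)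
qed

lemma H_nonneg: "0 \<le> p \<Longrightarrow> 0 \<le> H p"
  unfolding H_def
proof (intro integral_nonneg H_integrable)
  fix t :: real assume p: "0 \<le> p" and "t \<in> {0..pi/2}"
  then have "0 \<le> cos t" by (intro cos_ge_zero) auto
  then show "0 \<le> tau (p / cos t) * cos t" using tau_bounds[of "p / cos t"] p by simp
qed

lemma H_0: "H 0 = 1"
  using integral_unique[OF integral_cos_quarter] by (simp add: H_def)

lemma H_near_0: assumes "e > 0" shows "\<exists>p0>0. \<forall>p. 0 < p \<and> p < p0 \<longrightarrow> H p > 1 - e"
proof -
  have "(tau \<longlongrightarrow> tau 0) (at 0 within {0..})" using tau_cont unfolding continuous_on_def by (elim ballE[of _ _ 0]) auto
  then have "eventually (\<lambda>x. tau x > 1 - e / 2) (at 0 within {0..})"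
    using assms by (intro order_tendstoD) auto
  then obtain d where d: "d > 0" "\<And>x. 0 < x \<Longrightarrow> x < d \<Longrightarrow> tau x > 1 - e / 2"
    unfolding eventually_at by (auto simp: dist_real_def)
  define p0 where "p0 = e * d / 4"
  have "H p > 1 - e" if p: "0 < p" "p < p0" for p
  proof -
    have "((\<lambda>t. (1 - e / 2) * cos t - p / d) has_integral ((1 - e / 2) * 1 - (pi / 2) *\<^sub>R (p / d))) {0..pi/2}"
      using has_integral_const_real[of "p / d" 0 "pi / 2"]
      by (intro has_integral_diff has_integral_mult_right integral_cos_quarter) auto
    moreover have "((\<lambda>\<theta>. tau (p / cos \<theta>) * cos \<theta>) has_integral H p) {0..pi/2}"
      unfolding H_def using p by (intro integrable_integral H_integrable) auto
    moreover have "(1 - e / 2) * cos t - p / d \<le> tau (p / cos t) * cos t" if t: "t \<in> {0..pi/2}" for t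
    proof (cases "p / d < cos t")
      case True
      then have c: "cos t > 0" using p d by (smt (verit) divide_pos_pos)
      then have "p / cos t < d" using True d by (simp add: field_simps)
      then have "(1 - e / 2) * cos t \<le> tau (p / cos t) * cos t"
        using d(2)[of "p / cos t"] p c by (intro mult_right_mono) auto
      then show ?thesis using p d by (smt (verit) divide_pos_pos)
    next
      case False
      have c: "0 \<le> cos t" using t by (intro cos_ge_zero) auto
      have "(1 - e / 2) * cos t \<le> cos t" using c assms by (simp add: algebra_simps)
      moreover have "0 \<le> tau (p / cos t) * cos t" using c p tau_bounds[of "p / cos t"] by simp
      ultimately show ?thesis using False by simp
    qed
    ultimately have le: "(1 - e / 2) * 1 - (pi / 2) *\<^sub>R (p / d) \<le> H p" using has_integral_le by blast
    have "p / d < e / 4" using p d by (simp add: p0_def field_simps)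
    then have "(pi / 2) * (p / d) < 2 * (e / 4)"
      using pi_less_4 p d by (intro mult_strict_mono) auto
    then show ?thesis using le by simp
  qed
  moreover have "p0 > 0" using assms d by (simp add: p0_def)
  ultimately show ?thesis by blast
qed

text \<open>The function \<open>Q\<close> is the primitive of the factor of \<open>|\<beta>'|\<close> in the lower bound for the energy density.
  For \<open>m > 0\<close>, substituting \<open>cos \<theta> = w m / w v\<close> and integrating by parts leads to the explicit formula
  \<open>Q v = \<Phi> \<theta> / 2 - (1 - v)\<^sup>2 sin \<theta> / 2\<close> with \<open>\<Phi> \<theta>\<close> the partial integral of \<open>H\<close>; differentiating this formula
  avoids any improper substitution at \<open>v = m\<close> and \<open>v = 1\<close>.\<close>

lemma H_potential:
  assumes m: "0 \<le> m" "m < 1"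
  shows "\<exists>Q. continuous_on {m..1} Q \<and>
     (\<forall>v\<in>{m<..<1}. (Q has_real_derivative (1 - v) * sqrt (1 - (w m / w v)\<^sup>2)) (at v)) \<and>
     2 * (Q 1 - Q m) = H (w m)"
proof (cases "m = 0")
  case True
  show ?thesis
    by (rule exI[of _ "\<lambda>v. - (1 - v)\<^sup>2 / 2"])
       (auto intro!: continuous_intros derivative_eq_intros simp: True H_0 field_simps)
next
  case False
  define p where "p = w m"
  have p: "0 < p" "p < \<sigma>c" using w_pos[of m] w_less[of m] m False by (auto simp: p_def)
  define wh where "wh v = (if v < 1 then w v else \<sigma>c)" for v
  define \<theta> where "\<theta> v = arccos (p / wh v)" for v
  define \<Phi> where "\<Phi> t = integral {0..t} (\<lambda>\<theta>. tau (p / cos \<theta>) * cos \<theta>)" for t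
  define Q where "Q v = \<Phi> (\<theta> v) / 2 - (1 - v)\<^sup>2 * sin (\<theta> v) / 2" for v
  have wh_ge: "p \<le> wh v" if "v \<in> {m..1}" for v
    using that m p w_le_iff[of m v] by (auto simp: wh_def p_def)
  have wh_cont: "continuous_on {m..1} wh"
  proof (rule continuous_on_interval_left)
    show "continuous_on {m..<1} wh"
      by (rule continuous_on_eq[of _ w]) (use m in \<open>auto simp: wh_def intro: continuous_on_subset[OF w_cont]\<close>)
    have "eventually (\<lambda>v. w v = wh v) (at_left 1)" by (auto simp: wh_def eventually_at_filter)
    then show "(wh \<longlongrightarrow> wh 1) (at_left 1)" using w_limit Lim_transform_eventually by (fastforce simp: wh_def)
  qed
  have ratio: "0 < p / wh v" "p / wh v \<le> 1" if "v \<in> {m..1}" for v using wh_ge[OF that] p by auto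
  have \<theta>_cont: "continuous_on {m..1} \<theta>"
    unfolding \<theta>_def using ratio wh_ge p
    by (intro continuous_intros wh_cont) (force intro: less_imp_le order_trans[of "-1" 0])+
  have \<theta>_range: "0 \<le> \<theta> v \<and> \<theta> v < pi / 2" if "v \<in> {m..1}" for v
    using ratio[OF that] arccos_range[of "p / wh v"] by (auto simp: \<theta>_def)
  have \<Phi>_cont: "continuous_on {0..pi/2} \<Phi>"
    unfolding \<Phi>_def using H_integrable p by (intro indefinite_integral_continuous_1) auto
  have Q_cont: "continuous_on {m..1} Q"
    unfolding Q_def using \<theta>_range
    by (intro continuous_intros \<theta>_cont continuous_on_compose2[OF \<Phi>_cont \<theta>_cont]) force+
  have \<Phi>_deriv: "(\<Phi> has_real_derivative tau (p / cos t) * cos t) (at t)" if t: "0 < t" "t < pi / 2" for t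
  proof -
    define t1 where "t1 = (t + pi / 2) / 2"
    have t1: "t < t1" "t1 < pi / 2" using t by (auto simp: t1_def)
    have c: "cos x > 0" if "x \<in> {0..t1}" for x using that t1 cos_quarter[of x] by auto
    then have "cos x \<noteq> 0" if "x \<in> {0..t1}" for x using that by force
    then have "continuous_on {0..t1} (\<lambda>\<theta>. tau (p / cos \<theta>) * cos \<theta>)"
      using c p by (intro continuous_intros continuous_on_compose2[OF tau_cont]) (force simp: less_imp_le)+
    then have "(\<Phi> has_real_derivative tau (p / cos t) * cos t) (at t within {0..t1})"
      unfolding \<Phi>_def using t t1 by (intro integral_has_real_derivative) auto
    then show ?thesis using t t1 by (simp add: at_within_Icc_at)
  qed
  have Q_deriv: "(Q has_real_derivative (1 - v) * sqrt (1 - (w m / w v)\<^sup>2)) (at v)" if v: "v \<in> {m<..<1}" for v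
  proof -
    have wv: "wh v = w v" "p < w v" using v m w_less_iff[of m v] by (auto simp: wh_def p_def)
    have r: "0 < p / w v" "p / w v < 1" using wv p by auto
    have der_wh: "(wh has_real_derivative dw v) (at v)"
      by (rule has_field_derivative_transform_within_open[OF w_deriv, of _ "{m<..<1}"]) (use v m in \<open>auto simp: wh_def\<close>)
    define \<theta>' where "\<theta>' = inverse (- sqrt (1 - (p / w v)\<^sup>2)) * (- (p * dw v / (w v)\<^sup>2))"
    have der_\<theta>: "(\<theta> has_real_derivative \<theta>') (at v)"
      unfolding \<theta>_def
    proof -
      have "(arccos has_real_derivative inverse (- sqrt (1 - (p / w v)\<^sup>2))) (at (p / wh v))"
        unfolding wv using r by (intro DERIV_arccos) auto
      moreover have "((\<lambda>v. p / wh v) has_real_derivative - (p * dw v / (w v)\<^sup>2)) (at v)"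
        using wv p by (auto intro!: derivative_eq_intros der_wh simp: power2_eq_square)
      ultimately show "((\<lambda>v. arccos (p / wh v)) has_real_derivative \<theta>') (at v)"
        unfolding \<theta>'_def by (rule DERIV_chain2)
    qed
    have cs: "cos (\<theta> v) = p / w v" "sin (\<theta> v) = sqrt (1 - (p / w v)\<^sup>2)"
      using r sin_arccos[of "p / w v"] by (auto simp: \<theta>_def wv cos_arccos)
    have pos: "0 < \<theta> v" "\<theta> v < pi / 2"
      using r arccos_range[of "p / w v"] by (auto simp: \<theta>_def wv)
    have t: "tau (p / cos (\<theta> v)) = (1 - v)\<^sup>2"
      using om_w[of v] w_less[of v] v m p by (simp add: cs tau_def)
    have "(Q has_real_derivative (tau (p / cos (\<theta> v)) * cos (\<theta> v) * \<theta>') / 2 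
        - ((1 - v)\<^sup>2 * (cos (\<theta> v) * \<theta>') - 2 * (1 - v) * sin (\<theta> v)) / 2) (at v)"
    proof -
      note d1 = DERIV_chain2[OF \<Phi>_deriv[OF pos] der_\<theta>] and d2 = DERIV_chain2[OF DERIV_sin der_\<theta>]
      have d3: "((\<lambda>v. (1 - v)\<^sup>2) has_real_derivative - (2 * (1 - v))) (at v)"
        by (auto intro!: derivative_eq_intros)
      show ?thesis unfolding Q_def
        by (rule DERIV_cong[OF DERIV_diff[OF DERIV_cdivide[OF d1] DERIV_cdivide[OF DERIV_mult[OF d3 d2]]]])
           (simp add: algebra_simps)
    qed
    moreover have "(tau (p / cos (\<theta> v)) * cos (\<theta> v) * \<theta>') / 2 
        - ((1 - v)\<^sup>2 * (cos (\<theta> v) * \<theta>') - 2 * (1 - v) * sin (\<theta> v)) / 2 = (1 - v) * sqrt (1 - (w m / w v)\<^sup>2)"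
      unfolding t unfolding cs(2) by (simp add: p_def field_simps)
    ultimately show ?thesis by simp
  qed
  define A where "A = arccos (p / \<sigma>c)"
  have A: "A = \<theta> 1" by (simp add: A_def \<theta>_def wh_def)
  have A': "0 \<le> A" "A < pi / 2" using \<theta>_range[of 1] m A by auto
  have "\<Phi> A + integral {A..pi/2} (\<lambda>\<theta>. tau (p / cos \<theta>) * cos \<theta>) = H p"
    unfolding \<Phi>_def H_def using A' H_integrable p
    by (intro Henstock_Kurzweil_Integration.integral_combine) auto
  moreover have "integral {A..pi/2} (\<lambda>\<theta>. tau (p / cos \<theta>) * cos \<theta>) = 0"
  proof (intro integral_unique has_integral_is_0)
    fix t assume t: "t \<in> {A..pi/2}"
    show "tau (p / cos t) * cos t = 0"
    proof (cases "t = pi / 2")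
      case False
      then have c: "cos t > 0" using t A' cos_quarter[of t] by auto
      have "cos t \<le> cos A" using t A' by (intro cos_monotone_0_pi_le) auto
      also have "\<dots> = p / \<sigma>c" unfolding A_def using p by (intro cos_arccos) (auto intro: order_trans[of "-1" 0])
      finally have "\<sigma>c \<le> p / cos t" using c p by (simp add: field_simps)
      then show ?thesis by (simp add: tau_def)
    next
      case True
      then have "cos t = 0" by (simp only: cos_pi_half)
      then show ?thesis by simp
    qed
  qed
  ultimately have "2 * Q 1 = H p" by (simp add: Q_def A)
  moreover have "Q m = 0" using p m by (simp add: Q_def \<theta>_def wh_def \<Phi>_def p_def)
  ultimately have "2 * (Q 1 - Q m) = H (w m)" by (simp add: p_def)
  then show ?thesis using Q_cont Q_deriv by blast
qed

end

section \<open>Lower bound for the cohesive density\<close>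

text \<open>A chain rule for \<open>Q \<circ> \<beta>\<close>, kept as an inequality so that absolute continuity is not required. On a
  short interval the mean value theorem and continuity of \<open>q \<circ> \<beta>\<close> give the bound with \<open>q\<close> replaced by
  \<open>q + e\<close>; bisection glues the intervals together, and then \<open>e\<close> tends to \<open>0\<close>.\<close>

lemma weak_deriv_variation_bound:
  fixes \<beta> b' Q q :: "real \<Rightarrow> real"
  assumes \<beta>: "continuous_on UNIV \<beta>" "has_weak_deriv_on \<beta> b' UNIV" "\<And>t. \<beta> t \<in> {m..M}"
    and Q: "continuous_on {m..M} Q" "\<And>v. m < v \<Longrightarrow> v < M \<Longrightarrow> (Q has_real_derivative q v) (at v)"
    and q: "continuous_on {m..M} q" "\<And>v. v \<in> {m..M} \<Longrightarrow> 0 \<le> q v"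
    and xy: "x \<le> y"
  shows "\<bar>Q (\<beta> y) - Q (\<beta> x)\<bar> \<le> integral {x..y} (\<lambda>t. q (\<beta> t) * \<bar>b' t\<bar>)"
proof -
  have q\<beta>: "continuous_on A (\<lambda>t. q (\<beta> t))" for A
    by (rule continuous_on_compose2[OF q(1) continuous_on_subset[OF \<beta>(1)]]) (use \<beta>(3) in auto)
  have b': "b' absolutely_integrable_on {a..b}" for a b
    using \<beta>(2) unfolding has_weak_deriv_on_def by (intro locally_integrable_onD) auto
  have abs_b': "(\<lambda>t. \<bar>b' t\<bar>) absolutely_integrable_on {a..b}" for a b
    using set_integrable_abs[OF b'] .
  have int: "(\<lambda>t. (q (\<beta> t) + e) * \<bar>b' t\<bar>) integrable_on {a..b}" for a b e
  proof -
    have "(\<lambda>t. \<bar>b' t\<bar> * (q (\<beta> t) + e)) absolutely_integrable_on {a..b}"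
      by (intro abs_integrable_times_continuous abs_b' continuous_intros q\<beta>)
    then show ?thesis by (simp add: mult.commute absolutely_integrable_on_def)
  qed
  have \<beta>_diff: "\<bar>\<beta> b - \<beta> a\<bar> \<le> integral {a..b} (\<lambda>t. \<bar>b' t\<bar>)" if "a \<le> b" for a b
  proof (cases "a = b")
    case False
    then have "\<beta> b - \<beta> a = integral {a..b} b'" using weak_deriv_integral[OF \<beta>(1,2)] that by simp
    then show ?thesis using integral_norm_bound_integral[of b' "{a..b}" "\<lambda>t. \<bar>b' t\<bar>"] b' abs_b'
      by (simp add: absolutely_integrable_on_def)
  qed simp
  \<comment> \<open>the slack \<open>e\<close> absorbs the oscillation of \<open>q \<circ> \<beta>\<close> on a short interval\<close>
  have key: "\<bar>Q (\<beta> y) - Q (\<beta> x)\<bar> \<le> integral {x..y} (\<lambda>t. (q (\<beta> t) + e) * \<bar>b' t\<bar>)" if "e > 0" for e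
    using xy
  proof (induction rule: Bolzano)
    case (trans a b c)
    have "integral {a..b} (\<lambda>t. (q (\<beta> t) + e) * \<bar>b' t\<bar>) + integral {b..c} (\<lambda>t. (q (\<beta> t) + e) * \<bar>b' t\<bar>)
      = integral {a..c} (\<lambda>t. (q (\<beta> t) + e) * \<bar>b' t\<bar>)"
      using trans int by (intro Henstock_Kurzweil_Integration.integral_combine) auto
    then show ?case using trans(1,2) by linarith
  next
    case (local t0)
    have "isCont (\<lambda>t. q (\<beta> t)) t0" using q\<beta>[of UNIV] by (simp add: continuous_on_eq_continuous_at)
    then have "\<exists>d>0. \<forall>t. dist t t0 < d \<longrightarrow> dist (q (\<beta> t)) (q (\<beta> t0)) < e / 2"
      using that unfolding continuous_at_eps_delta by (elim allE[of _ "e / 2"]) simp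
    then obtain d where d: "d > 0" "\<And>t. \<bar>t - t0\<bar> < d \<Longrightarrow> \<bar>q (\<beta> t) - q (\<beta> t0)\<bar> < e / 2"
      unfolding dist_real_def by blast
    have "\<bar>Q (\<beta> b) - Q (\<beta> a)\<bar> \<le> integral {a..b} (\<lambda>t. (q (\<beta> t) + e) * \<bar>b' t\<bar>)"
      if ab: "a \<le> t0" "t0 \<le> b" "b - a < d" for a b
    proof -
      have "\<exists>\<xi>. min (\<beta> a) (\<beta> b) \<le> \<xi> \<and> \<xi> \<le> max (\<beta> a) (\<beta> b) \<and> Q (\<beta> b) - Q (\<beta> a) = (\<beta> b - \<beta> a) * q \<xi>"
      proof (cases "\<beta> a" "\<beta> b" rule: linorder_cases)
        case less
        have "\<exists>z>\<beta> a. z < \<beta> b \<and> Q (\<beta> b) - Q (\<beta> a) = (\<beta> b - \<beta> a) * q z"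
          using less \<beta>(3)[of a] \<beta>(3)[of b] by (intro MVT_open Q(2) continuous_on_subset[OF Q(1)]) auto
        then show ?thesis using less by (auto intro: less_imp_le)
      next
        case greater
        have "\<exists>z>\<beta> b. z < \<beta> a \<and> Q (\<beta> a) - Q (\<beta> b) = (\<beta> a - \<beta> b) * q z"
          using greater \<beta>(3)[of a] \<beta>(3)[of b] by (intro MVT_open Q(2) continuous_on_subset[OF Q(1)]) auto
        then obtain z where "\<beta> b < z" "z < \<beta> a" "Q (\<beta> a) - Q (\<beta> b) = (\<beta> a - \<beta> b) * q z" by blast
        then show ?thesis by (intro exI[of _ z]) (auto simp: algebra_simps)
      qed auto
      then obtain \<xi> where \<xi>: "min (\<beta> a) (\<beta> b) \<le> \<xi>" "\<xi> \<le> max (\<beta> a) (\<beta> b)"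
        "Q (\<beta> b) - Q (\<beta> a) = (\<beta> b - \<beta> a) * q \<xi>" by blast
      have "\<exists>s. a \<le> s \<and> s \<le> b \<and> \<beta> s = \<xi>"
      proof (cases "\<beta> a \<le> \<beta> b")
        case True
        then show ?thesis using \<xi> ab by (intro IVT' continuous_on_subset[OF \<beta>(1)]) auto
      next
        case False
        then show ?thesis using \<xi> ab by (intro IVT2' continuous_on_subset[OF \<beta>(1)]) auto
      qed
      then obtain s where s: "a \<le> s" "s \<le> b" "\<beta> s = \<xi>" by blast
      have q\<xi>: "0 \<le> q \<xi>" using q(2) \<beta>(3)[of s] s by auto
      have "\<bar>Q (\<beta> b) - Q (\<beta> a)\<bar> = q \<xi> * \<bar>\<beta> b - \<beta> a\<bar>" using \<xi>(3) q\<xi> by (simp add: abs_mult)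
      also have "\<dots> \<le> q \<xi> * integral {a..b} (\<lambda>t. \<bar>b' t\<bar>)"
        using \<beta>_diff[of a b] ab q\<xi> by (intro mult_left_mono) auto
      also have "\<dots> = integral {a..b} (\<lambda>t. q \<xi> * \<bar>b' t\<bar>)" by simp
      also have "\<dots> \<le> integral {a..b} (\<lambda>t. (q (\<beta> t) + e) * \<bar>b' t\<bar>)"
      proof (intro integral_le int)
        show "(\<lambda>t. q \<xi> * \<bar>b' t\<bar>) integrable_on {a..b}"
          using abs_b' by (intro integrable_on_mult_right) (auto simp: absolutely_integrable_on_def)
        fix t assume t: "t \<in> {a..b}"
        have "\<bar>q (\<beta> t) - q (\<beta> t0)\<bar> < e / 2" "\<bar>q (\<beta> s) - q (\<beta> t0)\<bar> < e / 2"
          using t s ab by (intro d(2); auto)+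
        then have "q \<xi> \<le> q (\<beta> t) + e" unfolding abs_less_iff s(3) by linarith
        then show "q \<xi> * \<bar>b' t\<bar> \<le> (q (\<beta> t) + e) * \<bar>b' t\<bar>" by (intro mult_right_mono) auto
      qed
      finally show ?thesis .
    qed
    then show ?case using d(1) by blast
  qed
  define I0 I1 where "I0 = integral {x..y} (\<lambda>t. q (\<beta> t) * \<bar>b' t\<bar>)" and "I1 = integral {x..y} (\<lambda>t. \<bar>b' t\<bar>)"
  have "integral {x..y} (\<lambda>t. (q (\<beta> t) + e) * \<bar>b' t\<bar>) = I0 + e * I1" for e
  proof -
    have "((\<lambda>t. q (\<beta> t) * \<bar>b' t\<bar> + e * \<bar>b' t\<bar>) has_integral I0 + e * I1) {x..y}"
      unfolding I0_def I1_def using int[of 0] abs_b'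
      by (intro has_integral_add has_integral_mult_right integrable_integral) (auto simp: absolutely_integrable_on_def)
    then show ?thesis by (simp add: algebra_simps integral_unique)
  qed
  then have *: "\<bar>Q (\<beta> y) - Q (\<beta> x)\<bar> \<le> I0 + e * I1" if "e > 0" for e using key[OF that] by simp
  have "((\<lambda>e. I0 + e * I1) \<longlongrightarrow> I0 + 0 * I1) (at_right 0)" by (intro tendsto_intros)
  moreover have "eventually (\<lambda>e. \<bar>Q (\<beta> y) - Q (\<beta> x)\<bar> \<le> I0 + e * I1) (at_right 0)"
    using * by (auto simp: eventually_at_filter)
  ultimately show ?thesis unfolding I0_def[symmetric]
    using tendsto_lowerbound trivial_limit_at_right_real by fastforce
qed

context cohesive
begin

definition profile_inf :: "real \<Rightarrow> ennreal" where
  "profile_inf s = (INF (\<alpha>, \<beta>) \<in> profiles s. profile_energy f \<alpha> \<beta>)"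

lemma slope_cont:
  assumes "0 \<le> m" "m < 1"
  shows "continuous_on {m..1} (\<lambda>v. (1 - v) * sqrt (1 - (w m / w v)\<^sup>2))"
proof (cases "m = 0")
  case False
  show ?thesis
  proof (rule continuous_on_interval_left)
    have "w v \<noteq> 0" if "v \<in> {m..<1}" for v using w_pos[of v] that assms False by auto
    then show "continuous_on {m..<1} (\<lambda>v. (1 - v) * sqrt (1 - (w m / w v)\<^sup>2))"
      using assms by (intro continuous_intros continuous_on_subset[OF w_cont]) auto
    have "((\<lambda>v. (1 - v) * sqrt (1 - (w m / w v)\<^sup>2)) \<longlongrightarrow> (1 - 1) * sqrt (1 - (w m / \<sigma>c)\<^sup>2)) (at_left 1)"
      by (intro tendsto_intros w_limit) (use \<sigma>c_pos in auto)
    then show "((\<lambda>v. (1 - v) * sqrt (1 - (w m / w v)\<^sup>2)) \<longlongrightarrow> (1 - 1) * sqrt (1 - (w m / w 1)\<^sup>2)) (at_left 1)"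
      by simp
  qed
qed (auto intro!: continuous_intros)

lemma ratio_bounds:
  assumes "0 \<le> m" "m < 1" "m \<le> v" "v \<le> 1"
  shows "0 \<le> w m / w v" "w m / w v \<le> 1" "(w m / w v)\<^sup>2 \<le> 1"
proof -
  show 1: "0 \<le> w m / w v" using assms w_nonneg[of m] w_nonneg[of v] by (cases "v = 1") auto
  show 2: "w m / w v \<le> 1"
  proof (cases "v = 1 \<or> v = 0")
    case False
    then show ?thesis using assms w_le_iff[of m v] w_pos[of v] by auto
  qed auto
  show "(w m / w v)\<^sup>2 \<le> 1" using 1 2 by (simp add: power_le_one)
qed

text \<open>Split \<open>(1 - v)\<^sup>2 / 4\<close> in the ratio \<open>cos\<^sup>2 \<theta> : sin\<^sup>2 \<theta>\<close> with \<open>cos \<theta> = w m / w v\<close>, and use \<open>2ab \<le> a\<^sup>2 + b\<^sup>2\<close>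
  for the first part together with \<open>f v A\<close> and for the second together with \<open>B\<close>.\<close>

lemma energy_density_lower:
  assumes m: "0 \<le> m" "m < 1" "m \<le> v" "v \<le> 1"
  shows "ennreal (w m * \<bar>A\<bar> + (1 - v) * sqrt (1 - (w m / w v)\<^sup>2) * \<bar>B\<bar>)
     \<le> (f_ext f v * ennreal \<bar>A\<bar>)\<^sup>2 + ennreal ((1 - v)\<^sup>2 / 4 + \<bar>B\<bar>\<^sup>2)"
proof (cases "v = 1")
  case True
  show ?thesis
  proof (cases "A = 0")
    case False
    then have "(f_ext f v * ennreal \<bar>A\<bar>)\<^sup>2 = \<infinity>"
      using True by (simp add: f_ext_def power2_eq_square ennreal_top_mult)
    then show ?thesis by simp
  qed (use True in auto)
next
  case False
  then have v: "v < 1" using m by simp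
  define x where "x = w m / w v"
  have x: "0 \<le> x" "x \<le> 1" "x\<^sup>2 \<le> 1" using ratio_bounds[OF m] by (auto simp: x_def)
  have 1: "w m * \<bar>A\<bar> \<le> (f v * \<bar>A\<bar>)\<^sup>2 + (1 - v)\<^sup>2 * x\<^sup>2 / 4"
  proof (cases "v = 0")
    case False
    then have "w v > 0" using w_pos v m by simp
    then have "w m = x * w v" by (simp add: x_def)
    also have "\<dots> = x * (1 - v) * f v" by (simp add: w_def)
    finally have "w m = x * (1 - v) * f v" .
    then have "w m * \<bar>A\<bar> = 2 * (f v * \<bar>A\<bar>) * ((1 - v) * x / 2)" by simp
    also have "\<dots> \<le> (f v * \<bar>A\<bar>)\<^sup>2 + ((1 - v) * x / 2)\<^sup>2" by (rule sum_squares_bound)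
    finally show ?thesis by (simp add: power_mult_distrib power_divide)
  qed (use m in \<open>auto simp: x_def\<close>)
  have 2: "(1 - v) * sqrt (1 - x\<^sup>2) * \<bar>B\<bar> \<le> (1 - v)\<^sup>2 * (1 - x\<^sup>2) / 4 + \<bar>B\<bar>\<^sup>2"
  proof -
    have "0 \<le> ((1 - v) * sqrt (1 - x\<^sup>2) / 2 - \<bar>B\<bar>)\<^sup>2" by simp
    also have "\<dots> = (1 - v)\<^sup>2 * (sqrt (1 - x\<^sup>2))\<^sup>2 / 4 + \<bar>B\<bar>\<^sup>2 - (1 - v) * sqrt (1 - x\<^sup>2) * \<bar>B\<bar>"
      by (simp add: power2_eq_square algebra_simps)
    also have "(sqrt (1 - x\<^sup>2))\<^sup>2 = 1 - x\<^sup>2" using x by simp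
    finally show ?thesis by simp
  qed
  have f0: "0 \<le> f v" using f_pos[of v] v m by (cases "v = 0") auto
  have "(f_ext f v * ennreal \<bar>A\<bar>)\<^sup>2 = ennreal ((f v * \<bar>A\<bar>)\<^sup>2)"
    using v f0 by (simp add: f_ext_def ennreal_mult[symmetric] ennreal_power)
  then have eq: "(f_ext f v * ennreal \<bar>A\<bar>)\<^sup>2 + ennreal ((1 - v)\<^sup>2 / 4 + \<bar>B\<bar>\<^sup>2)
     = ennreal ((f v * \<bar>A\<bar>)\<^sup>2 + ((1 - v)\<^sup>2 / 4 + \<bar>B\<bar>\<^sup>2))" by (simp add: ennreal_plus)
  have "w m * \<bar>A\<bar> + (1 - v) * sqrt (1 - x\<^sup>2) * \<bar>B\<bar> \<le> (f v * \<bar>A\<bar>)\<^sup>2 + ((1 - v)\<^sup>2 / 4 + \<bar>B\<bar>\<^sup>2)"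
  proof -
    have "(1 - v)\<^sup>2 * x\<^sup>2 / 4 + (1 - v)\<^sup>2 * (1 - x\<^sup>2) / 4 = (1 - v)\<^sup>2 / 4" by (simp add: algebra_simps add_divide_distrib[symmetric])
    then show ?thesis using 1 2 by linarith
  qed
  then show ?thesis unfolding eq x_def by (rule ennreal_leI)
qed

text \<open>The stress is \<open>p = w m\<close> with \<open>m\<close> the minimum of \<open>\<beta>\<close>. The first term of the density bound
  integrates to at least \<open>p s\<close>. For the second, \<open>\<beta>\<close> descends from \<open>1\<close> to \<open>m\<close> and returns, and each way
  costs at least the increment of the potential \<open>Q\<close>, that is \<open>H p / 2\<close>.\<close>

lemma profile_energy_lower:
  assumes ab: "(\<alpha>, \<beta>) \<in> profiles s" and s: "s > 0"
  shows "\<exists>p. 0 \<le> p \<and> p < \<sigma>c \<and> ennreal (p * s + H p) \<le> profile_energy f \<alpha> \<beta>"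
proof -
  define a' where "a' = weak_deriv_on UNIV \<alpha>"
  define b' where "b' = weak_deriv_on UNIV \<beta>"
  have a'_int: "integrable lebesgue a'" and a'_s: "\<bar>LINT t|lebesgue. a' t\<bar> = s"
    and \<beta>c: "continuous_on UNIV \<beta>" and \<beta>b: "\<And>t. 0 \<le> \<beta> t" "\<And>t. \<beta> t \<le> 1"
    and \<beta>lim: "(\<beta> \<longlongrightarrow> 1) at_top" "(\<beta> \<longlongrightarrow> 1) at_bot" and \<beta>H: "\<beta> \<in> H1_loc_on UNIV"
    using ab by (auto simp: profiles_def a'_def)
  obtain w0 where "has_weak_deriv_on \<beta> w0 UNIV" using \<beta>H unfolding H1_loc_on_def by blast
  then have b'w: "has_weak_deriv_on \<beta> b' UNIV"
    unfolding b'_def by (intro weak_deriv_on_AE_eq(1)) auto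
  have E: "profile_energy f \<alpha> \<beta> = (\<integral>\<^sup>+t. (f_ext f (\<beta> t) * ennreal \<bar>a' t\<bar>)\<^sup>2
            + ennreal ((1 - \<beta> t)\<^sup>2 / 4 + \<bar>b' t\<bar>\<^sup>2) \<partial>lebesgue)"
    by (simp add: profile_energy_def a'_def b'_def Let_def)
  have a'_nn: "ennreal (K * s) \<le> (\<integral>\<^sup>+t. ennreal (K * \<bar>a' t\<bar>) \<partial>lebesgue)" if "K \<ge> 0" for K
  proof -
    have i: "integrable lebesgue (\<lambda>t. K * \<bar>a' t\<bar>)" using a'_int by simp
    have "s \<le> (LINT t|lebesgue. \<bar>a' t\<bar>)" using a'_s integral_abs_bound[of lebesgue a'] by simp
    then have "K * s \<le> (LINT t|lebesgue. K * \<bar>a' t\<bar>)" using that by (simp add: mult_left_mono)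
    then show ?thesis using nn_integral_eq_integral[OF i] that by (simp add: ennreal_leI)
  qed
  show ?thesis
  proof (cases "\<forall>t. \<beta> t = 1")
    case True
    \<comment> \<open>\<open>f\<close> is infinite at \<open>1\<close>, so the integrand is infinite wherever \<open>\<alpha>\<close> has nonzero slope\<close>
    have "ennreal (1 / s * \<bar>a' t\<bar>) \<le> (f_ext f (\<beta> t) * ennreal \<bar>a' t\<bar>)\<^sup>2 + ennreal ((1 - \<beta> t)\<^sup>2 / 4 + \<bar>b' t\<bar>\<^sup>2)" for t
      using True by (cases "a' t = 0") (auto simp: f_ext_def power2_eq_square ennreal_top_mult)
    then have "(\<integral>\<^sup>+t. ennreal (1 / s * \<bar>a' t\<bar>) \<partial>lebesgue) \<le> profile_energy f \<alpha> \<beta>"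
      unfolding E by (intro nn_integral_mono)
    then have "ennreal 1 \<le> profile_energy f \<alpha> \<beta>" using a'_nn[of "1 / s"] s by simp
    then show ?thesis using \<sigma>c_pos by (intro exI[of _ 0]) (simp add: H_0)
  next
    case False
    then obtain t1 where t1: "\<beta> t1 < 1" using \<beta>b(2) by (metis order_le_less)
    have "eventually (\<lambda>t. \<beta> t1 < \<beta> t) at_top" "eventually (\<lambda>t. \<beta> t1 < \<beta> t) at_bot"
      using \<beta>lim t1 by (auto intro: order_tendstoD)
    then obtain T1 T2 where T: "\<And>t. t \<ge> T1 \<Longrightarrow> \<beta> t1 < \<beta> t" "\<And>t. t \<le> T2 \<Longrightarrow> \<beta> t1 < \<beta> t"
      unfolding eventually_at_top_linorder eventually_at_bot_linorder by blast
    have "t1 \<in> {T2..T1}" using T(1)[of t1] T(2)[of t1] by (auto simp: not_less[symmetric])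
    then obtain t0 where t0: "t0 \<in> {T2..T1}" "\<And>t. t \<in> {T2..T1} \<Longrightarrow> \<beta> t0 \<le> \<beta> t"
      using continuous_attains_inf[of "{T2..T1}" \<beta>] continuous_on_subset[OF \<beta>c] by auto
    have min: "\<beta> t0 \<le> \<beta> t" for t
      using t0(2)[of t] t0(2)[OF \<open>t1 \<in> {T2..T1}\<close>] T(1)[of t] T(2)[of t] by force
    define m where "m = \<beta> t0"
    have m: "0 \<le> m" "m < 1" "\<And>t. m \<le> \<beta> t" using \<beta>b min le_less_trans[OF min[of t1] t1] by (auto simp: m_def)
    define q where "q v = (1 - v) * sqrt (1 - (w m / w v)\<^sup>2)" for v
    obtain Q where Q: "continuous_on {m..1} Q" "\<And>v. v\<in>{m<..<1} \<Longrightarrow> (Q has_real_derivative q v) (at v)"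
      "2 * (Q 1 - Q m) = H (w m)"
      using H_potential[OF m(1,2)] unfolding q_def by blast
    have qc: "continuous_on {m..1} q" unfolding q_def using slope_cont[OF m(1,2)] .
    have q0: "0 \<le> q v" if "v \<in> {m..1}" for v
      unfolding q_def using that ratio_bounds[OF m(1,2), of v] by simp
    have \<beta>r: "\<beta> t \<in> {m..1}" for t using m \<beta>b by auto
    have part: "ennreal (w m * s + ((Q (\<beta> x) - Q m) + (Q (\<beta> y) - Q m))) \<le> profile_energy f \<alpha> \<beta>"
      if xy: "x \<le> t0" "t0 \<le> y" for x y
    proof -
      define G where "G t = indicator {x..y} t * (q (\<beta> t) * \<bar>b' t\<bar>)" for t
      have gi: "(\<lambda>t. q (\<beta> t) * \<bar>b' t\<bar>) absolutely_integrable_on {a..b}" for a b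
      proof -
        have "b' absolutely_integrable_on {a..b}"
          using b'w unfolding has_weak_deriv_on_def by (intro locally_integrable_onD) auto
        then have "(\<lambda>t. \<bar>b' t\<bar> * q (\<beta> t)) absolutely_integrable_on {a..b}"
          by (intro abs_integrable_times_continuous set_integrable_abs 
              continuous_on_compose2[OF qc continuous_on_subset[OF \<beta>c]]) (use \<beta>r in auto)
        then show ?thesis by (simp add: mult.commute)
      qed
      have Gi: "integrable lebesgue G" using gi[of x y] unfolding set_integrable_def G_def by simp
      have G0: "0 \<le> G t" for t using q0[OF \<beta>r] by (simp add: G_def)
      have "(LINT t|lebesgue. G t) = integral {x..y} (\<lambda>t. q (\<beta> t) * \<bar>b' t\<bar>)"
        using set_lebesgue_integral_eq_integral(2)[OF gi[of x y]] by (simp add: set_lebesgue_integral_def G_def)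
      also have "\<dots> = integral {x..t0} (\<lambda>t. q (\<beta> t) * \<bar>b' t\<bar>) + integral {t0..y} (\<lambda>t. q (\<beta> t) * \<bar>b' t\<bar>)"
        using xy gi[of x y] by (intro Henstock_Kurzweil_Integration.integral_combine[symmetric]) (auto simp: absolutely_integrable_on_def)
      also have "\<dots> \<ge> \<bar>Q (\<beta> t0) - Q (\<beta> x)\<bar> + \<bar>Q (\<beta> y) - Q (\<beta> t0)\<bar>"
        using Q(1,2) qc q0 xy by (intro add_mono weak_deriv_variation_bound[OF \<beta>c b'w \<beta>r]) auto
      finally have I: "(Q (\<beta> x) - Q m) + (Q (\<beta> y) - Q m) \<le> (LINT t|lebesgue. G t)" by (simp add: m_def)
      have Iz: "0 \<le> (LINT t|lebesgue. G t)" using G0 by simp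
      have ws: "0 \<le> w m * s" using w_nonneg[OF m(1,2)] s by simp
      have "ennreal (w m * s + ((Q (\<beta> x) - Q m) + (Q (\<beta> y) - Q m))) \<le> ennreal (w m * s + (LINT t|lebesgue. G t))"
        using I by (intro ennreal_leI) simp
      also have "\<dots> = ennreal (w m * s) + ennreal (LINT t|lebesgue. G t)" using ws Iz by simp
      also have "\<dots> \<le> (\<integral>\<^sup>+t. ennreal (w m * \<bar>a' t\<bar>) \<partial>lebesgue) + (\<integral>\<^sup>+t. ennreal (G t) \<partial>lebesgue)"
        using a'_nn[of "w m"] w_nonneg[OF m(1,2)] nn_integral_eq_integral[OF Gi] G0 by (intro add_mono) auto
      also have "\<dots> = (\<integral>\<^sup>+t. ennreal (w m * \<bar>a' t\<bar>) + ennreal (G t) \<partial>lebesgue)"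
        using a'_int Gi by (intro nn_integral_add[symmetric]) auto
      also have "\<dots> \<le> profile_energy f \<alpha> \<beta>"
        unfolding E
      proof (rule nn_integral_mono)
        fix t
        have "ennreal (w m * \<bar>a' t\<bar>) + ennreal (G t) = ennreal (w m * \<bar>a' t\<bar> + G t)"
          using G0 w_nonneg[OF m(1,2)] by simp
        also have "\<dots> \<le> ennreal (w m * \<bar>a' t\<bar> + q (\<beta> t) * \<bar>b' t\<bar>)"
          using q0[OF \<beta>r] by (intro ennreal_leI) (auto simp: G_def indicator_def)
        also have "\<dots> \<le> (f_ext f (\<beta> t) * ennreal \<bar>a' t\<bar>)\<^sup>2 + ennreal ((1 - \<beta> t)\<^sup>2 / 4 + \<bar>b' t\<bar>\<^sup>2)"
          unfolding q_def using m \<beta>b by (intro energy_density_lower) auto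
        finally show "ennreal (w m * \<bar>a' t\<bar>) + ennreal (G t) \<le> \<dots>" .
      qed
      finally show ?thesis .
    qed
    have "ennreal (w m * s + H (w m)) \<le> profile_energy f \<alpha> \<beta>"
    proof (cases "profile_energy f \<alpha> \<beta>")
      case (real r)
      have Qlim: "((\<lambda>t. Q (\<beta> t)) \<longlongrightarrow> Q 1) F" if "(\<beta> \<longlongrightarrow> 1) F" for F
        by (rule continuous_on_tendsto_compose[OF Q(1) that]) (use m \<beta>r in auto)
      have "((\<lambda>y. Q (\<beta> (- y))) \<longlongrightarrow> Q 1) at_top"
        using Qlim[OF \<beta>lim(2)] by (simp add: filterlim_at_bot_mirror)
      then have "((\<lambda>y. w m * s + ((Q (\<beta> (- y)) - Q m) + (Q (\<beta> y) - Q m))) \<longlongrightarrow> w m * s + ((Q 1 - Q m) + (Q 1 - Q m))) at_top"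
        by (intro tendsto_intros Qlim \<beta>lim)
      moreover have "eventually (\<lambda>y. w m * s + ((Q (\<beta> (- y)) - Q m) + (Q (\<beta> y) - Q m)) \<le> r) at_top"
        using eventually_ge_at_top[of "\<bar>t0\<bar>"]
      proof eventually_elim
        case (elim y)
        then show ?case using part[of "- y" y] real by auto
      qed
      ultimately have "w m * s + ((Q 1 - Q m) + (Q 1 - Q m)) \<le> r" by (rule tendsto_upperbound) simp
      then show ?thesis using Q(3) real by (simp add: ennreal_leI)
    qed simp
    then show ?thesis using w_nonneg[OF m(1,2)] w_less[OF m(1,2)] by blast
  qed
qed

lemma profile_inf_lower:
  assumes "s > 0" "\<And>p. 0 \<le> p \<Longrightarrow> p < \<sigma>c \<Longrightarrow> C \<le> p * s + H p"
  shows "ennreal C \<le> profile_inf s"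
  unfolding profile_inf_def
proof (rule INF_greatest, clarify)
  fix \<alpha> \<beta> assume "(\<alpha>, \<beta>) \<in> profiles s"
  then obtain p where p: "0 \<le> p" "p < \<sigma>c" "ennreal (p * s + H p) \<le> profile_energy f \<alpha> \<beta>"
    using profile_energy_lower assms(1) by blast
  then show "ennreal C \<le> profile_energy f \<alpha> \<beta>"
    using order_trans[OF ennreal_leI[OF assms(2)[OF p(1,2)]]] by blast
qed

end

section \<open>Autonomous scalar equations\<close>

lemma integral_even:
  fixes F :: "real \<Rightarrow> real"
  assumes "F integrable_on {-a..a}" "0 \<le> a" "\<And>x. x \<in> {0..a} \<Longrightarrow> F (- x) = F x"
  shows "integral {-a..a} F = 2 * integral {0..a} F"
proof -
  have "integral {-a..0} F + integral {0..a} F = integral {-a..a} F"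
    using assms by (intro Henstock_Kurzweil_Integration.integral_combine) auto
  moreover have "integral {-a..0} F = integral {0..a} (\<lambda>x. F (- x))"
    using Henstock_Kurzweil_Integration.integral_reflect_real[where f="\<lambda>x. F (- x)" and a=0 and b=a] by simp
  moreover have "integral {0..a} (\<lambda>x. F (- x)) = integral {0..a} F"
    using assms by (intro integral_cong) auto
  ultimately show ?thesis by simp
qed

text \<open>Separation of variables: \<open>y\<close> is the inverse of a primitive of \<open>1 / K\<close>.\<close>

lemma autonomous_ode:
  fixes K :: "real \<Rightarrow> real"
  assumes A: "A > 0" and K: "continuous_on {-A..A} K" "\<And>x. x \<in> {-A..A} \<Longrightarrow> 0 < K x"
    and even: "\<And>x. x \<in> {-A..A} \<Longrightarrow> K (- x) = K x"
    and T: "T = integral {0..A} (\<lambda>x. 1 / K x)"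
  shows "0 < T \<and> (\<exists>y. y 0 = 0 \<and> y T = A \<and> y (- T) = - A \<and>
    (\<forall>t\<in>{-T..T}. y t \<in> {-A..A} \<and> (y has_real_derivative K (y t)) (at t)))"
proof -
  \<comment> \<open>the continuation of \<open>K\<close> by constants makes \<open>y\<close> differentiable from both sides at \<open>T\<close> and \<open>- T\<close>\<close>
  define K1 where "K1 x = K (max (- A) (min A x))" for x
  have K1c: "continuous_on U K1" for U
    unfolding K1_def using A by (intro continuous_on_compose2[OF K(1)] continuous_intros) auto
  have K1p: "0 < K1 x" for x unfolding K1_def using A by (intro K(2)) auto
  have K1K: "K1 x = K x" if "x \<in> {-A..A}" for x using that by (auto simp: K1_def)
  have ic: "continuous_on U (\<lambda>x. 1 / K1 x)" for U
    using K1p by (intro continuous_intros K1c) (auto simp: less_imp_neq[THEN not_sym])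
  have ii: "(\<lambda>x. 1 / K1 x) integrable_on {a..b}" for a b by (intro integrable_continuous_real ic)
  define B C where "B = A + 1" and "C = A + 1 / 2"
  define \<Theta> where "\<Theta> x = integral {-B..x} (\<lambda>x. 1 / K1 x) - integral {-B..0} (\<lambda>x. 1 / K1 x)" for x
  have \<Theta>d: "(\<Theta> has_real_derivative 1 / K1 x) (at x)" if "-B < x" "x < B" for x
  proof -
    have "(\<Theta> has_real_derivative 1 / K1 x) (at x within {-B..B})"
      unfolding \<Theta>_def using that
      by (auto intro!: derivative_eq_intros integral_has_real_derivative[OF ic])
    then show ?thesis using that by (simp add: at_within_Icc_at)
  qed
  have \<Theta>_less: "\<Theta> x < \<Theta> x'" if "-B < x" "x < x'" "x' < B" for x x'
    using that K1p by (intro DERIV_pos_imp_increasing[OF that(2)]) (auto intro!: exI \<Theta>d)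
  have \<Theta>c: "continuous_on {-C..C} \<Theta>"
    by (intro continuous_at_imp_continuous_on ballI DERIV_isCont[OF \<Theta>d]) (auto simp: B_def C_def)
  have \<Theta>0: "\<Theta> 0 = 0" by (simp add: \<Theta>_def)
  have "integral {-B..0} (\<lambda>x. 1 / K1 x) + integral {0..A} (\<lambda>x. 1 / K1 x) = integral {-B..A} (\<lambda>x. 1 / K1 x)"
    using A by (intro Henstock_Kurzweil_Integration.integral_combine ii) (auto simp: B_def)
  moreover have "integral {0..A} (\<lambda>x. 1 / K1 x) = T"
    unfolding T using A by (intro integral_cong) (auto simp: K1K)
  ultimately have \<Theta>A: "\<Theta> A = T" by (simp add: \<Theta>_def)
  have "integral {-B..-A} (\<lambda>x. 1 / K1 x) + integral {-A..0} (\<lambda>x. 1 / K1 x) = integral {-B..0} (\<lambda>x. 1 / K1 x)"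
    using A by (intro Henstock_Kurzweil_Integration.integral_combine ii) (auto simp: B_def)
  moreover have "integral {-A..0} (\<lambda>x. 1 / K1 x) = T"
  proof -
    have "integral {-A..0} (\<lambda>x. 1 / K1 x) = integral {0..A} (\<lambda>x. 1 / K1 (- x))"
      using Henstock_Kurzweil_Integration.integral_reflect_real[where f="\<lambda>x. 1 / K1 (- x)" and a=0 and b=A] by simp
    also have "\<dots> = T" unfolding T using A by (intro integral_cong) (auto simp: K1K even)
    finally show ?thesis .
  qed
  ultimately have \<Theta>mA: "\<Theta> (- A) = - T" by (simp add: \<Theta>_def)
  have T0: "0 < T" using \<Theta>_less[of 0 A] A \<Theta>0 \<Theta>A by (simp add: B_def)
  define y where "y = inv_into {-C..C} \<Theta>"
  have inj: "inj_on \<Theta> {-C..C}"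
  proof (rule inj_onI)
    fix x x' assume "x \<in> {-C..C}" "x' \<in> {-C..C}" "\<Theta> x = \<Theta> x'"
    then show "x = x'" using \<Theta>_less[of x x'] \<Theta>_less[of x' x] by (cases x x' rule: linorder_cases) (auto simp: B_def C_def)
  qed
  have img: "{\<Theta> (-C)..\<Theta> C} \<subseteq> \<Theta> ` {-C..C}"
  proof
    fix t assume "t \<in> {\<Theta> (-C)..\<Theta> C}"
    then have "\<exists>x. -C \<le> x \<and> x \<le> C \<and> \<Theta> x = t" using \<Theta>c A by (intro IVT') (auto simp: C_def)
    then show "t \<in> \<Theta> ` {-C..C}" by force
  qed
  have y\<Theta>: "y (\<Theta> x) = x" if "x \<in> {-C..C}" for x using inv_into_f_f[OF inj that] by (simp add: y_def)
  have \<Theta>y: "\<Theta> (y t) = t" "y t \<in> {-C..C}" if "t \<in> {\<Theta> (-C)..\<Theta> C}" for t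
    unfolding y_def by (rule f_inv_into_f[OF subsetD[OF img that]], rule inv_into_into[OF subsetD[OF img that]])
  have yc: "continuous_on {\<Theta> (-C)..\<Theta> C} y"
    by (rule continuous_on_subset[OF continuous_on_inv[OF \<Theta>c] img]) (auto simp: y\<Theta>)
  have lims: "\<Theta> (-C) < -T" "T < \<Theta> C"
    using \<Theta>_less[of "-C" "-A"] \<Theta>_less[of A C] A \<Theta>A \<Theta>mA by (auto simp: B_def C_def)
  have yT: "y T = A" "y (- T) = - A" "y 0 = 0"
    using y\<Theta>[of A] y\<Theta>[of "-A"] y\<Theta>[of 0] A by (simp_all add: \<Theta>A \<Theta>mA \<Theta>0 C_def)
  have main: "y t \<in> {-A..A} \<and> (y has_real_derivative K (y t)) (at t)" if t: "t \<in> {-T..T}" for t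
  proof -
    have t': "t \<in> {\<Theta> (-C)..\<Theta> C}" "\<Theta> (-C) < t" "t < \<Theta> C" using t lims by auto
    have yr: "y t \<in> {-A..A}"
    proof (rule ccontr)
      assume "y t \<notin> {-A..A}"
      then have "y t < - A \<or> A < y t" by auto
      then have "\<Theta> (y t) < \<Theta> (- A) \<or> \<Theta> A < \<Theta> (y t)"
        using \<Theta>_less[of "y t" "- A"] \<Theta>_less[of A "y t"] \<Theta>y(2)[OF t'(1)] A by (auto simp: B_def C_def)
      then show False using \<Theta>y(1)[OF t'(1)] t \<Theta>A \<Theta>mA by auto
    qed
    have "(y has_real_derivative inverse (1 / K1 (y t))) (at t)"
    proof (rule DERIV_inverse_function[of \<Theta> _ _ _ "\<Theta> (-C)" "\<Theta> C"])
      show "(\<Theta> has_real_derivative 1 / K1 (y t)) (at (y t))" using yr by (intro \<Theta>d) (auto simp: B_def)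
      show "isCont y t" by (rule continuous_on_interior[OF yc]) (use t' in auto)
      show "1 / K1 (y t) \<noteq> 0" using K1p[of "y t"] by simp
    qed (use t' \<Theta>y in auto)
    then show ?thesis using yr K1K by simp
  qed
  show ?thesis using T0 yT main by blast
qed

lemma ode_monotone:
  fixes y K :: "real \<Rightarrow> real"
  assumes "\<And>t. t \<in> {-T..T} \<Longrightarrow> y t \<in> {-A..A} \<and> (y has_real_derivative K (y t)) (at t)"
    and "\<And>x. x \<in> {-A..A} \<Longrightarrow> 0 < K x" and "-T \<le> s" "s < t" "t \<le> T"
  shows "y s < y t"
  using assms by (intro DERIV_pos_imp_increasing[OF assms(4)]) (metis atLeastAtMost_iff order_trans)

lemma ode_substitution:
  fixes y K F :: "real \<Rightarrow> real"
  assumes y: "\<And>t. t \<in> {-T..T} \<Longrightarrow> y t \<in> {-A..A} \<and> (y has_real_derivative K (y t)) (at t)"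
    and K: "continuous_on {-A..A} K" "\<And>x. x \<in> {-A..A} \<Longrightarrow> 0 < K x"
    and F: "continuous_on {-A..A} F" and st: "-T \<le> s" "s \<le> t" "t \<le> T"
  shows "((\<lambda>\<tau>. F (y \<tau>)) has_integral integral {y s..y t} (\<lambda>x. F x / K x)) {s..t}"
proof -
  have "((\<lambda>\<tau>. K (y \<tau>) *\<^sub>R (F (y \<tau>) / K (y \<tau>))) has_integral integral {y s..y t} (\<lambda>x. F x / K x)) {s..t}"
  proof (rule has_integral_substitution)
    show "y s \<le> y t" using ode_monotone[OF y K(2) st(1) _ st(3)] st(2) by (cases "s = t") (auto intro: less_imp_le)
    show "continuous_on {-A..A} (\<lambda>x. F x / K x)"
      using K F by (intro continuous_intros) (force simp: less_imp_neq)+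
  qed (use st y in \<open>auto intro: has_field_derivative_at_within\<close>)
  moreover have "K (y x) *\<^sub>R (F (y x) / K (y x)) = F (y x)" if "x \<in> {s..t}" for x
  proof -
    have "0 < K (y x)" using y[of x] K(2) that st by auto
    then show ?thesis by simp
  qed
  ultimately show ?thesis by (rule has_integral_eq[rotated])
qed

section \<open>Bounded measurable functions\<close>

lemma integrable_bounded_lebesgue_on:
  fixes u :: "real \<Rightarrow> real"
  assumes "u \<in> borel_measurable lebesgue" "\<And>x. x \<in> K \<Longrightarrow> \<bar>u x\<bar> \<le> C" "K \<in> lmeasurable"
  shows "integrable (lebesgue_on K) u" "u \<in> L2_on K" "u absolutely_integrable_on K"
proof -
  interpret finite_measure "lebesgue_on K" using finite_measure_lebesgue_on[OF assms(3)] .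
  have K: "K \<in> sets lebesgue" using assms(3) by auto
  have m: "u \<in> borel_measurable (lebesgue_on K)" using assms(1) by (rule measurable_restrict_space1)
  show i: "integrable (lebesgue_on K) u"
    using assms(2) by (intro integrable_const_bound[of _ C] m) (auto simp: space_restrict_space)
  have "\<bar>(u x)\<^sup>2\<bar> \<le> C\<^sup>2" if "x \<in> K" for x
    using power_mono[OF assms(2)[OF that], of 2] by simp
  then have "integrable (lebesgue_on K) (\<lambda>x. (u x)\<^sup>2)"
    using m by (intro integrable_const_bound[of _ "C\<^sup>2"]) (auto simp: space_restrict_space)
  then show "u \<in> L2_on K" using m by (simp add: L2_on_def)
  show "u absolutely_integrable_on K"
    using i K by (simp add: set_integrable_def integrable_restrict_space)
qed

lemma nn_integral_lebesgue_has_integral: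
  fixes g :: "real \<Rightarrow> real"
  assumes "\<And>x. 0 \<le> g x" "(g has_integral I) UNIV"
  shows "(\<integral>\<^sup>+x. ennreal (g x) \<partial>lebesgue) = ennreal I" "integrable lebesgue g" "(LINT x|lebesgue. g x) = I"
proof -
  have a: "g absolutely_integrable_on UNIV"
    using assms by (intro nonnegative_absolutely_integrable_1) auto
  then show i: "integrable lebesgue g" by (simp add: set_integrable_def)
  show I: "(LINT x|lebesgue. g x) = I"
    using set_lebesgue_integral_eq_integral(2)[OF a] integral_unique[OF assms(2)] by (simp add: set_lebesgue_integral_def)
  show "(\<integral>\<^sup>+x. ennreal (g x) \<partial>lebesgue) = ennreal I"
    using nn_integral_eq_integral[OF i] assms(1) I by simp
qed

section \<open>Upper bound for the cohesive density\<close>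

context cohesive
begin

text \<open>The profile is \<open>\<beta> = om (p / cos \<theta>)\<close>, where \<open>\<theta>\<close> solves \<open>\<theta>' = K \<theta>\<close> and \<open>K\<close> is chosen so that
  \<open>\<beta>' = (1 - \<beta>) sin \<theta> / 2\<close>, the case of equality in the lower bound. The angle is stopped at
  \<open>a < arccos (p / \<sigma>c)\<close>, before \<open>K\<close> degenerates; there \<open>\<beta>\<close> is already close to \<open>1\<close>, and straight ramps of
  slope \<open>1\<close> complete it at a cost proportional to the remaining gap. For equality \<open>\<alpha>'\<close> would have to
  be \<open>D \<theta>' / 2\<close>, with total increment \<open>S1\<close>; multiplying it by \<open>s / S1\<close> produces the opening \<open>s\<close>, and only
  the part of the energy that is quadratic in \<open>\<alpha>'\<close> changes.\<close>

lemma trial_profile: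
  assumes p: "0 < p" "p < \<sigma>c" and a: "0 < a" "a < arccos (p / \<sigma>c)" and s: "0 \<le> s"
  defines "S1 \<equiv> integral {0..a} (\<lambda>\<theta>. D (p / cos \<theta>))"
  shows "profile_inf s \<le> ennreal (s\<^sup>2 * p / (2 * S1) + p * S1 / 2 + H p + 5 / 2 * (1 - om (p / cos a)))"
proof -
  have pr: "0 < p / \<sigma>c" "p / \<sigma>c < 1" using p by auto
  have a2: "a < pi / 2" using a arccos_range(2)[of "p / \<sigma>c"] pr by auto
  have cosa: "p / \<sigma>c < cos a"
  proof -
    have "cos (arccos (p / \<sigma>c)) < cos a"
      using a arccos_range(2)[of "p / \<sigma>c"] pr by (intro cos_monotone_0_pi) auto
    then show ?thesis using arccos_range(3)[of "p / \<sigma>c"] pr by simp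
  qed
  have cosge: "cos a \<le> cos x" if "x \<in> {-a..a}" for x
  proof -
    have "cos a \<le> cos \<bar>x\<bar>" using that a a2 by (intro cos_monotone_0_pi_le) auto
    then show ?thesis by simp
  qed
  have cpos: "0 < cos x" if "x \<in> {-a..a}" for x using cosge[OF that] cosa pr by linarith
  define X where "X \<theta> = p / cos \<theta>" for \<theta>
  have Xr: "p \<le> X \<theta>" "X \<theta> \<le> X a" "X \<theta> < \<sigma>c" "0 < X \<theta>" if "\<theta> \<in> {-a..a}" for \<theta>
  proof -
    show 1: "X \<theta> \<le> X a" unfolding X_def using cosge[OF that] cpos[OF that] cpos[of a] a p
      by (intro divide_left_mono) auto
    have "X a < \<sigma>c" unfolding X_def using cosa cpos[of a] a p \<sigma>c_pos by (simp add: field_simps)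
    then show "X \<theta> < \<sigma>c" using 1 by simp
    show "p \<le> X \<theta>" unfolding X_def using cpos[OF that] p cos_le_one[of \<theta>] by (simp add: le_divide_eq)
    then show "0 < X \<theta>" using p by simp
  qed
  have Xc: "continuous_on {-a..a} X" unfolding X_def using cpos by (intro continuous_intros) force
  have Xeven: "X (- \<theta>) = X \<theta>" for \<theta> by (simp add: X_def)
  have omr: "0 < om (X \<theta>)" "om (X \<theta>) < 1" "w (om (X \<theta>)) = X \<theta>" "om (X \<theta>) \<le> om (X a)"
    if "\<theta> \<in> {-a..a}" for \<theta>
    using om_props[of "X \<theta>"] om_pos[of "X \<theta>"] Xr[OF that] Xr[of a] om_mono[of "X \<theta>" "X a"] a by auto
  have taur: "tau (X \<theta>) = (1 - om (X \<theta>))\<^sup>2" if "\<theta> \<in> {-a..a}" for \<theta> using Xr[OF that] by (simp add: tau_def)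
  have taup: "0 < tau (X \<theta>)" if "\<theta> \<in> {-a..a}" for \<theta> using omr[OF that] taur[OF that] by simp
  have Dp: "0 < D (X \<theta>)" if "\<theta> \<in> {-a..a}" for \<theta> using D_pos Xr[OF that] by simp
  have DX: "continuous_on {-a..a} (\<lambda>\<theta>. D (X \<theta>))"
    by (rule continuous_on_compose2[OF D_cont Xc]) (use Xr in force)
  have tX: "continuous_on {-a..a} (\<lambda>\<theta>. tau (X \<theta>))"
    by (rule continuous_on_compose2[OF tau_cont Xc]) (use Xr in force)
  have oX: "continuous_on {-a..a} (\<lambda>\<theta>. om (X \<theta>))"
    by (rule continuous_on_compose2[OF om_cont Xc]) (use Xr in force)
  define K where "K \<theta> = tau (X \<theta>) * (cos \<theta>)\<^sup>2 / (p * D (X \<theta>))" for \<theta>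
  have Kc: "continuous_on {-a..a} K"
    unfolding K_def using Dp p by (intro continuous_intros DX tX) force
  have Kp: "0 < K \<theta>" if "\<theta> \<in> {-a..a}" for \<theta>
    unfolding K_def using taup[OF that] cpos[OF that] Dp[OF that] p by simp
  define T where "T = integral {0..a} (\<lambda>x. 1 / K x)"
  have "0 < T \<and> (\<exists>y. y 0 = 0 \<and> y T = a \<and> y (- T) = - a \<and>
    (\<forall>t\<in>{-T..T}. y t \<in> {-a..a} \<and> (y has_real_derivative K (y t)) (at t)))"
    by (rule autonomous_ode[OF a(1) Kc Kp _ T_def]) (simp_all add: K_def Xeven)
  then obtain y where T: "0 < T" and y0: "y T = a" "y (- T) = - a"
    and y: "\<And>t. t \<in> {-T..T} \<Longrightarrow> y t \<in> {-a..a} \<and> (y has_real_derivative K (y t)) (at t)" by blast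
  \<comment> \<open>\<open>\<eta>\<close> is the gap between \<open>1\<close> and \<open>\<beta>\<close> at the cut-off, hence also the length of the ramps\<close>
  define \<eta> where "\<eta> = 1 - om (X a)"
  have \<eta>: "0 < \<eta>" using omr[of a] a by (simp add: \<eta>_def)
  \<comment> \<open>clamping the time freezes \<open>\<theta>\<close> outside \<open>[- T,T]\<close>\<close>
  define cl where "cl t = max (- T) (min T t)" for t
  have clr: "cl t \<in> {-T..T}" for t using T by (auto simp: cl_def)
  have clc: "continuous_on U cl" for U unfolding cl_def by (intro continuous_intros)
  have cl_id: "cl t = t" if "\<bar>t\<bar> \<le> T" for t using that by (auto simp: cl_def)
  have cl_out: "cl t = T * sgn t" if "T < \<bar>t\<bar>" for t using that T by (auto simp: cl_def sgn_if)
  define Y where "Y t = y (cl t)" for t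
  have yc: "continuous_on {-T..T} y" using y by (meson DERIV_isCont continuous_at_imp_continuous_on)
  have Yc: "continuous_on U Y" for U
    unfolding Y_def by (rule continuous_on_compose2[OF yc clc]) (use clr in auto)
  have Yr: "Y t \<in> {-a..a}" for t unfolding Y_def using y clr by blast
  have Y_out: "X (Y t) = X a" if "T < \<bar>t\<bar>" for t
    using y0 cl_out[OF that] that T by (auto simp: Y_def X_def sgn_if split: if_splits)
  have Yd: "(Y has_real_derivative K (Y t)) (at t)" if "\<bar>t\<bar> < T" for t
    unfolding Y_def
    by (rule has_field_derivative_transform_within_open[of y _ _ "{-T<..<T}"])
       (use that y[of t] cl_id in \<open>auto simp: abs_less_iff\<close>)
  have Ylt: "-a < Y t" "Y t < a" if "\<bar>t\<bar> < T" for t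
  proof -
    have "y (- T) < y t" by (rule ode_monotone[OF y Kp]) (use that in auto)
    moreover have "y t < y T" by (rule ode_monotone[OF y Kp]) (use that in auto)
    ultimately show "-a < Y t" "Y t < a" using that y0 by (auto simp: Y_def cl_id)
  qed
  \<comment> \<open>the corners of the profile\<close>
  define F where "F = {-T, T, -(T + \<eta>), T + \<eta>}"
  have S1p: "0 < S1"
  proof -
    have "integral {0..a} (\<lambda>\<theta>. D (X \<theta>)) \<noteq> 0"
    proof
      assume "integral {0..a} (\<lambda>\<theta>. D (X \<theta>)) = 0"
      then have "\<forall>\<theta>\<in>{0..a}. D (X \<theta>) = 0"
        using integral_eq_0_iff[of 0 a "\<lambda>\<theta>. D (X \<theta>)"] continuous_on_subset[OF DX, of "{0..a}"] a D_nonneg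
        by auto
      then show False using Dp[of 0] a by force
    qed
    moreover have "0 \<le> integral {0..a} (\<lambda>\<theta>. D (X \<theta>))"
      using continuous_on_subset[OF DX, of "{0..a}"] a
      by (intro integral_nonneg integrable_continuous_real D_nonneg) auto
    ultimately show ?thesis by (simp add: S1_def X_def)
  qed
  define lam where "lam = s / S1"
  have lam0: "0 \<le> lam" using s S1p by (simp add: lam_def)
  define M where "M x = integral {-a..x} (\<lambda>\<theta>. D (X \<theta>) / 2)" for x
  have DX2: "continuous_on {-a..a} (\<lambda>\<theta>. D (X \<theta>) / 2)" by (intro continuous_intros DX) auto
  have Mc: "continuous_on {-a..a} M"
    unfolding M_def by (intro indefinite_integral_continuous_1 integrable_continuous_real DX2)
  have Md: "(M has_real_derivative D (X x) / 2) (at x)" if "-a < x" "x < a" for x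
  proof -
    have "(M has_real_derivative D (X x) / 2) (at x within {-a..a})"
      unfolding M_def using that by (intro integral_has_real_derivative DX2) auto
    then show ?thesis using that by (simp add: at_within_Icc_at)
  qed
  have Ma: "M a = S1" "M (- a) = 0"
  proof -
    have "M a = 2 * integral {0..a} (\<lambda>\<theta>. D (X \<theta>) / 2)"
      unfolding M_def by (rule integral_even[OF integrable_continuous_real[OF DX2]]) (use a in \<open>auto simp: Xeven\<close>)
    then show "M a = S1" by (simp add: S1_def X_def)
  qed (simp add: M_def)
  define \<alpha> where "\<alpha> t = lam * M (Y t)" for t
  define \<beta> where "\<beta> t = om (X (Y t)) + min \<eta> (\<bar>t\<bar> - \<bar>cl t\<bar>)" for t
  define a' where "a' t = (if \<bar>t\<bar> \<le> T then lam * tau (X (Y t)) * (cos (Y t))\<^sup>2 / (2 * p) else 0)" for t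
  define b' where "b' t = (if \<bar>t\<bar> \<le> T then (1 - om (X (Y t))) * sin (Y t) / 2 else if \<bar>t\<bar> < T + \<eta> then sgn t else 0)" for t
  have \<alpha>c: "continuous_on UNIV \<alpha>"
    unfolding \<alpha>_def by (intro continuous_intros continuous_on_compose2[OF Mc Yc]) (use Yr in auto)
  have omYc: "continuous_on UNIV (\<lambda>t. om (X (Y t)))"
    by (rule continuous_on_compose2[OF oX Yc]) (use Yr in auto)
  have \<beta>c: "continuous_on UNIV \<beta>"
    unfolding \<beta>_def by (intro continuous_intros omYc clc)
  have cl_le: "\<bar>cl t\<bar> \<le> \<bar>t\<bar>" for t using T by (auto simp: cl_def)
  have \<beta>in: "\<beta> t = om (X (Y t))" if "\<bar>t\<bar> \<le> T" for t using that \<eta> by (simp add: \<beta>_def cl_id)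
  have \<beta>out: "\<beta> t = min 1 (1 - \<eta> + (\<bar>t\<bar> - T))" if "T < \<bar>t\<bar>" for t
  proof -
    have "\<bar>cl t\<bar> = T" using cl_out[OF that] that T by (auto simp: sgn_if)
    then show ?thesis using Y_out[OF that] by (simp add: \<beta>_def \<eta>_def)
  qed
  have \<beta>r: "0 \<le> \<beta> t" "\<beta> t \<le> 1" for t
    using omr[OF Yr[of t]] \<eta> cl_le[of t] by (auto simp: \<beta>_def \<eta>_def)
  have \<beta>1: "\<beta> t = 1" if "T + \<eta> \<le> \<bar>t\<bar>" for t using that \<beta>out[of t] \<eta> by simp
  have m\<beta>: "b' \<in> borel_measurable lebesgue" and m\<alpha>: "a' \<in> borel_measurable lebesgue"
  proof -
    have [measurable]: "Y \<in> borel_measurable borel" "(\<lambda>t. om (X (Y t))) \<in> borel_measurable borel"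
      using Yc omYc by (auto intro: borel_measurable_continuous_onI)
    have [measurable]: "(\<lambda>t. tau (X (Y t))) \<in> borel_measurable borel"
      by (rule borel_measurable_continuous_onI, rule continuous_on_compose2[OF tX Yc]) (use Yr in auto)
    have [measurable]: "(\<lambda>t. cos (Y t)) \<in> borel_measurable borel" "(\<lambda>t. sin (Y t)) \<in> borel_measurable borel"
      by (auto intro!: borel_measurable_continuous_onI continuous_intros Yc)
    have [measurable]: "(sgn :: real \<Rightarrow> real) \<in> borel_measurable borel"
      by (simp add: sgn_if[abs_def])
    have "a' \<in> borel_measurable borel" unfolding a'_def[abs_def] by measurable
    moreover have "b' \<in> borel_measurable borel" unfolding b'_def[abs_def] by measurable
    ultimately show "a' \<in> borel_measurable lebesgue" "b' \<in> borel_measurable lebesgue"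
      by (auto intro: measurable_completion)
  qed
  have taule: "tau (X (Y t)) \<le> 1" for t using tau_bounds[of "X (Y t)"] Xr[OF Yr] less_imp_le by blast
  have cossq: "(cos x)\<^sup>2 \<le> 1" for x :: real by (simp add: abs_square_le_1)
  have ab: "0 \<le> a' t" "a' t \<le> lam / (2 * p)" for t
  proof -
    show "0 \<le> a' t" using taup[OF Yr[of t]] lam0 p by (simp add: a'_def)
    have "tau (X (Y t)) * (cos (Y t))\<^sup>2 \<le> 1" 
      using taule[of t] cossq[of "Y t"] taup[OF Yr[of t]] by (intro mult_le_one) auto
    then have "lam * (tau (X (Y t)) * (cos (Y t))\<^sup>2) \<le> lam * 1" using lam0 by (rule mult_left_mono)
    then show "a' t \<le> lam / (2 * p)" using lam0 p by (simp add: a'_def field_simps)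
  qed
  have bb: "\<bar>b' t\<bar> \<le> 1" for t
  proof -
    have "\<bar>(1 - om (X (Y t))) * sin (Y t)\<bar> \<le> 1 * 1"
      unfolding abs_mult using omr[OF Yr[of t]] by (intro mult_mono) auto
    then show ?thesis by (auto simp: b'_def sgn_if)
  qed
  have a'b: "\<bar>a' t\<bar> \<le> lam / (2 * p)" for t using ab[of t] by simp
  have loc: "locally_integrable_on a' UNIV" "locally_integrable_on b' UNIV"
    unfolding locally_integrable_on_def
    using integrable_bounded_lebesgue_on(3)[OF m\<alpha> a'b] integrable_bounded_lebesgue_on(3)[OF m\<beta> bb] lmeasurable_compact by blast+
  have ad: "(\<alpha> has_real_derivative a' t) (at t)" if "t \<notin> F" for t
  proof (cases "\<bar>t\<bar> < T")
    case True
    have "((\<lambda>t. lam * M (Y t)) has_real_derivative lam * (D (X (Y t)) / 2 * K (Y t))) (at t)"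
      by (intro DERIV_cmult DERIV_chain2[OF Md Yd] Ylt True)
    moreover have "lam * (D (X (Y t)) / 2 * K (Y t)) = a' t"
      using True Dp[OF Yr[of t]] p by (simp add: a'_def K_def field_simps)
    ultimately show ?thesis by (simp add: \<alpha>_def[abs_def])
  next
    case False
    then have t: "T < \<bar>t\<bar>" using that by (auto simp: F_def)
    have "((\<lambda>t. lam * M (Y (T * sgn t))) has_real_derivative 0) (at t)" if "T < \<bar>t\<bar>" for t
    proof -
      have "((\<lambda>x. lam * M (Y (T * sgn t))) has_real_derivative 0) (at t)" by simp
      then show ?thesis
        by (rule has_field_derivative_transform_within_open[where S="{x. 0 < x * sgn t}"])
           (use that T in \<open>auto simp: sgn_if zero_less_mult_iff split: if_splits intro!: open_Collect_less continuous_intros\<close>)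
    qed
    from this[OF t] have "(\<alpha> has_real_derivative 0) (at t)"
    proof (rule has_field_derivative_transform_within_open[where S="{x. T < \<bar>x\<bar>}"])
      fix x assume "x \<in> {x. T < \<bar>x\<bar>}"
      then show "lam * M (Y (T * sgn x)) = \<alpha> x"
        using cl_out[of x] T by (auto simp: \<alpha>_def Y_def cl_id sgn_if)
    qed (use t in \<open>auto intro!: open_Collect_less continuous_intros\<close>)
    then show ?thesis using t by (simp add: a'_def)
  qed
  have bd: "(\<beta> has_real_derivative b' t) (at t)" if "t \<notin> F" for t
  proof (cases "\<bar>t\<bar> < T")
    case True
    note c = cpos[OF Yr[of t]]
    have X': "(X has_real_derivative p * sin (Y t) / (cos (Y t))\<^sup>2) (at (Y t))"
      unfolding X_def using c by (auto intro!: derivative_eq_intros simp: power2_eq_square)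
    have o': "(om has_real_derivative inverse (dw (om (X (Y t))))) (at (X (Y t)))"
      using Xr[OF Yr[of t]] by (intro om_deriv) auto
    have "((\<lambda>t. om (X (Y t))) has_real_derivative
        inverse (dw (om (X (Y t)))) * (p * sin (Y t) / (cos (Y t))\<^sup>2 * K (Y t))) (at t)"
      by (intro DERIV_chain2[OF o' DERIV_chain2[OF X' Yd[OF True]]])
    moreover have "inverse (dw (om (X (Y t)))) * (p * sin (Y t) / (cos (Y t))\<^sup>2 * K (Y t)) = b' t"
    proof -
      have dwp: "0 < dw (om (X (Y t)))" using omr[OF Yr[of t]] by (intro dw_pos) auto
      have "D (X (Y t)) = 2 * (1 - om (X (Y t))) / dw (om (X (Y t)))" using Xr[OF Yr[of t]] by (simp add: D_def)
      then have Keq: "K (Y t) = (1 - om (X (Y t)))\<^sup>2 * (cos (Y t))\<^sup>2 * dw (om (X (Y t))) / (p * (2 * (1 - om (X (Y t)))))"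
        using dwp by (simp add: K_def taur[OF Yr])
      have alg: "inverse d * (p * sn / c\<^sup>2 * (e\<^sup>2 * c\<^sup>2 * d / (p * (2 * e)))) = e * sn / 2"
        if "0 < d" "0 < c" "0 < e" for d c e sn :: real
        using that p by (simp add: field_simps power2_eq_square)
      have bt: "b' t = (1 - om (X (Y t))) * sin (Y t) / 2" using True by (simp add: b'_def)
      show ?thesis unfolding bt Keq by (rule alg) (use dwp c omr[OF Yr[of t]] in auto)
    qed
    ultimately have "((\<lambda>t. om (X (Y t))) has_real_derivative b' t) (at t)" by simp
    then show ?thesis
      by (rule has_field_derivative_transform_within_open[where S="{x. \<bar>x\<bar> < T}"])
         (use True \<beta>in in \<open>auto intro!: open_Collect_less continuous_intros\<close>)
  next
    case False
    then have t: "T < \<bar>t\<bar>" "\<bar>t\<bar> \<noteq> T + \<eta>" using that by (auto simp: F_def)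
    show ?thesis
    proof (cases "\<bar>t\<bar> < T + \<eta>")
      case True
      have "t \<noteq> 0" using t T by auto
      have d: "((\<lambda>x. 1 - \<eta> + (sgn t * x - T)) has_real_derivative sgn t) (at t)"
        by (auto intro!: derivative_eq_intros)
      have "(\<beta> has_real_derivative sgn t) (at t)"
      proof (rule has_field_derivative_transform_within_open[OF d, where S="{x. T < sgn t * x} \<inter> {x. sgn t * x < T + \<eta>}"])
        show "open ({x. T < sgn t * x} \<inter> {x. sgn t * x < T + \<eta>})"
          by (intro open_Int open_Collect_less continuous_intros)
        show "t \<in> {x. T < sgn t * x} \<inter> {x. sgn t * x < T + \<eta>}"
          using t True by (simp add: abs_sgn mult.commute)
        fix x assume x: "x \<in> {x. T < sgn t * x} \<inter> {x. sgn t * x < T + \<eta>}"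
        then have "\<bar>x\<bar> = sgn t * x" using T \<open>t \<noteq> 0\<close> by (auto simp: sgn_if split: if_splits)
        then show "1 - \<eta> + (sgn t * x - T) = \<beta> x" using x \<beta>out[of x] by simp
      qed
      then show ?thesis using t True by (simp add: b'_def)
    next
      case False
      have "((\<lambda>t. 1) has_real_derivative 0) (at t)" by simp
      then have "(\<beta> has_real_derivative 0) (at t)"
        by (rule has_field_derivative_transform_within_open[where S="{x. T + \<eta> < \<bar>x\<bar>}"])
           (use t False \<beta>1 in \<open>auto intro!: open_Collect_less continuous_intros\<close>)
      then show ?thesis using t False by (simp add: b'_def)
    qed
  qed
  have finF: "finite F" by (simp add: F_def)
  have wa: "has_weak_deriv_on \<alpha> a' UNIV" and wb: "has_weak_deriv_on \<beta> b' UNIV"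
    using ad bd \<alpha>c \<beta>c loc by (intro has_weak_deriv_on_piecewise_C1[OF _ _ _ _ finF]; auto)+
  have AEa: "AE t in lebesgue. weak_deriv_on UNIV \<alpha> t = a' t" and AEb: "AE t in lebesgue. weak_deriv_on UNIV \<beta> t = b' t"
    using weak_deriv_on_AE_eq(2)[OF wa] weak_deriv_on_AE_eq(2)[OF wb] by auto
  have contb: "u \<in> L2_on U" if "continuous_on UNIV u" "compact U" for u U :: "_"
  proof -
    have "compact (u ` U)" using that continuous_on_subset compact_continuous_image by blast
    then obtain C where "\<And>x. x \<in> U \<Longrightarrow> \<bar>u x\<bar> \<le> C"
      using compact_imp_bounded bounded_iff by (metis imageI real_norm_def)
    moreover have "u \<in> borel_measurable lebesgue"
      using that(1) by (intro measurable_completion) (simp add: borel_measurable_continuous_onI)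
    ultimately show ?thesis using integrable_bounded_lebesgue_on(2) lmeasurable_compact[OF that(2)] by blast
  qed
  have H1a: "\<alpha> \<in> H1_loc_on UNIV" unfolding H1_loc_on_def
    using contb[OF \<alpha>c] wa integrable_bounded_lebesgue_on(2)[OF m\<alpha> a'b] lmeasurable_compact by blast
  have H1b: "\<beta> \<in> H1_loc_on UNIV" unfolding H1_loc_on_def
    using contb[OF \<beta>c] wb integrable_bounded_lebesgue_on(2)[OF m\<beta> bb] lmeasurable_compact by blast
  have a'hi: "(a' has_integral s) UNIV"
  proof -
    have "(a' has_integral \<alpha> T - \<alpha> (- T)) {-T..T}"
      by (rule fundamental_theorem_of_calculus_interior_strong[OF finF])
         (use T ad continuous_on_subset[OF \<alpha>c] in \<open>auto simp: has_real_derivative_iff_has_vector_derivative\<close>)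
    moreover have "\<alpha> T - \<alpha> (- T) = s" using Ma y0 S1p T by (simp add: \<alpha>_def Y_def cl_id lam_def)
    ultimately have "((\<lambda>t. if t \<in> {-T..T} then a' t else 0) has_integral s) UNIV"
      by (subst has_integral_restrict_UNIV) simp
    then show ?thesis by (rule has_integral_eq[rotated]) (auto simp: a'_def abs_le_iff)
  qed
  have a'i: "integrable lebesgue a'" "(LINT t|lebesgue. a' t) = s"
    using nn_integral_lebesgue_has_integral(2,3)[OF ab(1) a'hi] by auto
  have AEa': "AE t in lebesgue. a' t = weak_deriv_on UNIV \<alpha> t" using AEa by eventually_elim simp
  have mwa: "weak_deriv_on UNIV \<alpha> \<in> borel_measurable lebesgue"
    using borel_measurable_AE[OF m\<alpha> AEa'] .
  have prof: "(\<alpha>, \<beta>) \<in> profiles s"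
  proof -
    have "integrable lebesgue (weak_deriv_on UNIV \<alpha>)"
      using integrable_cong_AE[OF mwa m\<alpha> AEa] a'i by simp
    moreover have "(LINT t|lebesgue. weak_deriv_on UNIV \<alpha> t) = s"
      using integral_cong_AE[OF mwa m\<alpha> AEa] a'i by simp
    moreover have "(\<beta> \<longlongrightarrow> 1) at_top" 
      using \<beta>1 by (intro tendsto_eventually eventually_at_top_linorderI[of "T + \<eta>"]) auto
    moreover have "(\<beta> \<longlongrightarrow> 1) at_bot" 
      using \<beta>1 by (intro tendsto_eventually) (auto simp: eventually_at_bot_linorder intro!: exI[of _ "- (T + \<eta>)"])
    ultimately show ?thesis using H1a H1b \<beta>c \<beta>r s by (simp add: profiles_def)
  qed
  \<comment> \<open>the energy density as a function of the angle; on the ramps it is at most \<open>1 / 4 + 1\<close>\<close>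
  define En where "En \<theta> = tau (X \<theta>) * (lam\<^sup>2 * (cos \<theta>)\<^sup>2 + 1 + (sin \<theta>)\<^sup>2) / 4" for \<theta>
  define G where "G t = (if \<bar>t\<bar> \<le> T then En (Y t) else if \<bar>t\<bar> \<le> T + \<eta> then 5 / 4 else 0)" for t
  have G0: "0 \<le> G t" for t using taup[OF Yr[of t]] by (simp add: G_def En_def)
  have pw: "(f_ext f (\<beta> t) * ennreal \<bar>a' t\<bar>)\<^sup>2 + ennreal ((1 - \<beta> t)\<^sup>2 / 4 + \<bar>b' t\<bar>\<^sup>2) \<le> ennreal (G t)" for t
  proof (cases "\<bar>t\<bar> \<le> T")
    case True
    define v where "v = om (X (Y t))"
    have v: "0 < v" "v < 1" "w v = X (Y t)" "\<beta> t = v" using omr[OF Yr[of t]] \<beta>in[OF True] by (auto simp: v_def)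
    have fv: "0 < f v" "f v = X (Y t) / (1 - v)" using f_pos[OF v(1,2)] f_eq_w[OF v(2)] v(3) by simp_all
    have c: "0 < cos (Y t)" using cpos[OF Yr] .
    have "f_ext f (\<beta> t) * ennreal \<bar>a' t\<bar> = ennreal (f v * a' t)"
      using v fv(1) ab(1)[of t] by (simp add: f_ext_def ennreal_mult)
    then have "(f_ext f (\<beta> t) * ennreal \<bar>a' t\<bar>)\<^sup>2 = ennreal ((f v * a' t)\<^sup>2)"
      using fv(1) ab(1)[of t] by (simp add: ennreal_power)
    also have "f v * a' t = lam * (1 - v) * cos (Y t) / 2"
    proof -
      have at: "a' t = lam * (1 - v)\<^sup>2 * (cos (Y t))\<^sup>2 / (2 * p)" using True by (simp add: a'_def taur[OF Yr] v_def)
      have ft: "f v = p / cos (Y t) / (1 - v)" using fv(2) by (simp add: X_def)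
      have "p / c / e * (lam * e\<^sup>2 * c\<^sup>2 / (2 * p)) = lam * e * c / 2" if "0 < c" "0 < e" for c e :: real
        using that p by (simp add: power2_eq_square)
      then show ?thesis unfolding at ft using c v by simp
    qed
    finally have "(f_ext f (\<beta> t) * ennreal \<bar>a' t\<bar>)\<^sup>2 + ennreal ((1 - \<beta> t)\<^sup>2 / 4 + \<bar>b' t\<bar>\<^sup>2)
      = ennreal ((lam * (1 - v) * cos (Y t) / 2)\<^sup>2 + ((1 - v)\<^sup>2 / 4 + ((1 - v) * sin (Y t) / 2)\<^sup>2))"
      using True v by (simp add: b'_def v_def[symmetric] ennreal_plus power_divide)
    also have "(lam * (1 - v) * cos (Y t) / 2)\<^sup>2 + ((1 - v)\<^sup>2 / 4 + ((1 - v) * sin (Y t) / 2)\<^sup>2) = G t"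
      using True by (simp add: G_def En_def taur[OF Yr] v_def[symmetric] field_simps power2_eq_square)
    finally show ?thesis by simp
  next
    case False
    then have t: "T < \<bar>t\<bar>" by simp
    have az: "a' t = 0" using False by (simp add: a'_def)
    show ?thesis
    proof (cases "\<bar>t\<bar> < T + \<eta>")
      case True
      have "\<bar>b' t\<bar> = 1" using False True t T by (auto simp: b'_def sgn_if)
      moreover have "(1 - \<beta> t)\<^sup>2 \<le> 1" using \<beta>r[of t] by (simp add: power_le_one)
      ultimately have "(1 - \<beta> t)\<^sup>2 / 4 + \<bar>b' t\<bar>\<^sup>2 \<le> G t" using False True by (simp add: G_def)
      then show ?thesis unfolding az by (simp add: ennreal_leI del: ennreal_plus)
    next
      case F2: False
      then show ?thesis using False az \<beta>1[of t] t by (simp add: b'_def)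
    qed
  qed
  have cosne: "cos x \<noteq> 0" if "x \<in> {-a..a}" for x using cpos[OF that] by simp
  define DI where "DI = integral {0..a} (\<lambda>\<theta>. p * D (X \<theta>) * (sin \<theta>)\<^sup>2 / (cos \<theta>)\<^sup>2)"
  have Pc: "continuous_on {-a..a} (\<lambda>\<theta>. p * D (X \<theta>) * (sin \<theta>)\<^sup>2 / (cos \<theta>)\<^sup>2)"
    using cpos by (intro continuous_intros DX) force
  have Enc: "continuous_on {-a..a} En" unfolding En_def by (intro continuous_intros tX) auto
  have Enint: "integral {-a..a} (\<lambda>\<theta>. En \<theta> / K \<theta>) = (lam\<^sup>2 + 1) * p * S1 / 2 + DI"
  proof -
    have "integral {-a..a} (\<lambda>\<theta>. En \<theta> / K \<theta>) =
       integral {-a..a} (\<lambda>\<theta>. (lam\<^sup>2 + 1) * p / 4 * D (X \<theta>) + (p * D (X \<theta>) * (sin \<theta>)\<^sup>2 / (cos \<theta>)\<^sup>2) * (1 / 2))"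
    proof (rule integral_cong)
      fix \<theta> assume t: "\<theta> \<in> {-a..a}"
      have "En \<theta> / K \<theta> = p * D (X \<theta>) * (lam\<^sup>2 * (cos \<theta>)\<^sup>2 + ((sin \<theta>)\<^sup>2 + (cos \<theta>)\<^sup>2) + (sin \<theta>)\<^sup>2) / (4 * (cos \<theta>)\<^sup>2)"
        using taup[OF t] Dp[OF t] cpos[OF t] p by (simp add: En_def K_def)
      also have "\<dots> = (lam\<^sup>2 + 1) * p / 4 * D (X \<theta>) + (p * D (X \<theta>) * (sin \<theta>)\<^sup>2 / (cos \<theta>)\<^sup>2) * (1 / 2)"
        using cpos[OF t] by (simp add: field_simps del: sin_cos_squared_add sin_cos_squared_add2 sin_cos_squared_add3)
      finally show "En \<theta> / K \<theta> = \<dots>" .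
    qed
    also have "\<dots> = 2 * integral {0..a} (\<lambda>\<theta>. (lam\<^sup>2 + 1) * p / 4 * D (X \<theta>) + (p * D (X \<theta>) * (sin \<theta>)\<^sup>2 / (cos \<theta>)\<^sup>2) * (1 / 2))"
      by (rule integral_even) (use a cosne in \<open>auto simp: Xeven intro!: integrable_continuous_real continuous_intros DX Pc\<close>)
    also have "integral {0..a} (\<lambda>\<theta>. (lam\<^sup>2 + 1) * p / 4 * D (X \<theta>) + (p * D (X \<theta>) * (sin \<theta>)\<^sup>2 / (cos \<theta>)\<^sup>2) * (1 / 2))
       = (lam\<^sup>2 + 1) * p / 4 * S1 + DI * (1 / 2)"
      unfolding DI_def S1_def X_def[symmetric] using a
      by (intro integral_unique has_integral_add has_integral_mult_right has_integral_mult_left integrable_integral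
           integrable_continuous_real continuous_on_subset[OF DX] continuous_on_subset[OF Pc]) auto
    finally show ?thesis by (simp add: algebra_simps)
  qed
  \<comment> \<open>integration by parts: \<open>- sin \<theta> tau (p / cos \<theta>)\<close> has the derivative integrand of \<open>DI\<close> minus integrand of \<open>H\<close>\<close>
  have DIH: "DI \<le> H p"
  proof -
    have tc: "continuous_on {0..a} (\<lambda>\<theta>. tau (X \<theta>) * cos \<theta>)"
      using a by (intro continuous_intros continuous_on_subset[OF tX]) auto
    have "((\<lambda>\<theta>. p * D (X \<theta>) * (sin \<theta>)\<^sup>2 / (cos \<theta>)\<^sup>2 - tau (X \<theta>) * cos \<theta>) has_integral
        - (sin a * tau (X a)) - - (sin 0 * tau (X 0))) {0..a}"
    proof (rule fundamental_theorem_of_calculus)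
      fix x assume x: "x \<in> {0..a}"
      then have x': "x \<in> {-a..a}" by auto
      have X': "(X has_real_derivative p * sin x / (cos x)\<^sup>2) (at x)"
        unfolding X_def using cpos[OF x'] by (auto intro!: derivative_eq_intros simp: power2_eq_square)
      have t': "(tau has_real_derivative - D (X x)) (at (X x))" using Xr[OF x'] by (intro tau_deriv) auto
      have "((\<lambda>\<theta>. - (sin \<theta> * tau (X \<theta>))) has_real_derivative - (cos x * tau (X x) + - D (X x) * (p * sin x / (cos x)\<^sup>2) * sin x)) (at x)"
        by (intro DERIV_minus DERIV_mult DERIV_sin DERIV_chain2[OF t' X'])
      then have "((\<lambda>\<theta>. - (sin \<theta> * tau (X \<theta>))) has_real_derivative p * D (X x) * (sin x)\<^sup>2 / (cos x)\<^sup>2 - tau (X x) * cos x) (at x)"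
        by (rule DERIV_cong) (simp add: power2_eq_square algebra_simps)
      then show "((\<lambda>\<theta>. - (sin \<theta> * tau (X \<theta>))) has_vector_derivative p * D (X x) * (sin x)\<^sup>2 / (cos x)\<^sup>2 - tau (X x) * cos x) (at x within {0..a})"
        by (simp add: has_real_derivative_iff_has_vector_derivative has_vector_derivative_at_within)
    qed (use a in auto)
    moreover have "((\<lambda>\<theta>. p * D (X \<theta>) * (sin \<theta>)\<^sup>2 / (cos \<theta>)\<^sup>2 - tau (X \<theta>) * cos \<theta>) has_integral
        DI - integral {0..a} (\<lambda>\<theta>. tau (X \<theta>) * cos \<theta>)) {0..a}"
      unfolding DI_def using a
      by (intro has_integral_diff integrable_integral integrable_continuous_real tc continuous_on_subset[OF Pc]) auto
    ultimately have "DI - integral {0..a} (\<lambda>\<theta>. tau (X \<theta>) * cos \<theta>) = - (sin a * tau (X a))"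
      by (auto dest: has_integral_unique)
    moreover have "0 \<le> sin a * tau (X a)" using taup[of a] a a2 by (intro mult_nonneg_nonneg sin_ge_zero) auto
    moreover have "integral {0..a} (\<lambda>\<theta>. tau (X \<theta>) * cos \<theta>) \<le> H p"
      unfolding H_def X_def
    proof (rule integral_subset_le)
      show "(\<lambda>\<theta>. tau (p / cos \<theta>) * cos \<theta>) integrable_on {0..pi / 2}" using H_integrable p by simp
      show "(\<lambda>\<theta>. tau (p / cos \<theta>) * cos \<theta>) integrable_on {0..a}" using tc unfolding X_def by (rule integrable_continuous_real)
      show "\<forall>x\<in>{0..pi/2}. 0 \<le> tau (p / cos x) * cos x"
      proof
        fix x :: real assume "x \<in> {0..pi/2}"
        then have "0 \<le> cos x" by (intro cos_ge_zero) auto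
        then show "0 \<le> tau (p / cos x) * cos x" using tau_bounds[of "p / cos x"] p by simp
      qed
    qed (use a2 in auto)
    ultimately show ?thesis by linarith
  qed
  have GI: "(G has_integral 5 / 4 * \<eta> + ((lam\<^sup>2 + 1) * p * S1 / 2 + DI) + 5 / 4 * \<eta>) UNIV"
  proof -
    have "((\<lambda>t. En (y t)) has_integral integral {y (-T)..y T} (\<lambda>x. En x / K x)) {-T..T}"
      using T by (intro ode_substitution[OF y Kc Kp Enc]) auto
    then have I1: "(G has_integral (lam\<^sup>2 + 1) * p * S1 / 2 + DI) {-T..T}"
      unfolding y0 Enint by (rule has_integral_eq[rotated]) (auto simp: G_def Y_def cl_id abs_le_iff)
    have I2: "(G has_integral 5 / 4 * \<eta>) {T..T + \<eta>}"
      by (rule has_integral_spike[of "{T}" _ _ "\<lambda>x. 5 / 4"])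
         (use has_integral_const_real[of "5/4::real" T "T + \<eta>"] \<eta> T in \<open>auto simp: G_def mult.commute\<close>)
    have I3: "(G has_integral 5 / 4 * \<eta>) {-(T + \<eta>)..-T}"
      by (rule has_integral_spike[of "{-T}" _ _ "\<lambda>x. 5 / 4"])
         (use has_integral_const_real[of "5/4::real" "-(T + \<eta>)" "-T"] \<eta> T in \<open>auto simp: G_def mult.commute\<close>)
    have "(G has_integral 5 / 4 * \<eta> + ((lam\<^sup>2 + 1) * p * S1 / 2 + DI) + 5 / 4 * \<eta>) {-(T + \<eta>)..T + \<eta>}"
      using T \<eta> by (intro has_integral_combine[OF _ _ has_integral_combine[OF _ _ I3 I1] I2]) auto
    then have "((\<lambda>t. if t \<in> {-(T + \<eta>)..T + \<eta>} then G t else 0) has_integral 5 / 4 * \<eta> + ((lam\<^sup>2 + 1) * p * S1 / 2 + DI) + 5 / 4 * \<eta>) UNIV"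
      by (subst has_integral_restrict_UNIV)
    then show ?thesis by (rule has_integral_eq[rotated]) (use \<eta> in \<open>auto simp: G_def\<close>)
  qed
  have "profile_inf s \<le> profile_energy f \<alpha> \<beta>"
    unfolding profile_inf_def using prof by (intro INF_lower2[of "(\<alpha>, \<beta>)"]) auto
  also have "\<dots> = (\<integral>\<^sup>+t. (f_ext f (\<beta> t) * ennreal \<bar>a' t\<bar>)\<^sup>2 + ennreal ((1 - \<beta> t)\<^sup>2 / 4 + \<bar>b' t\<bar>\<^sup>2) \<partial>lebesgue)"
    unfolding profile_energy_def Let_def
    by (rule nn_integral_cong_AE) (use AEa AEb in eventually_elim, simp)
  also have "\<dots> \<le> (\<integral>\<^sup>+t. ennreal (G t) \<partial>lebesgue)" by (rule nn_integral_mono) (rule pw)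
  also have "\<dots> = ennreal (5 / 4 * \<eta> + ((lam\<^sup>2 + 1) * p * S1 / 2 + DI) + 5 / 4 * \<eta>)"
    by (rule nn_integral_lebesgue_has_integral(1)[OF G0 GI])
  also have "\<dots> \<le> ennreal (s\<^sup>2 * p / (2 * S1) + p * S1 / 2 + H p + 5 / 2 * (1 - om (p / cos a)))"
  proof (rule ennreal_leI)
    have "lam\<^sup>2 * p * S1 / 2 = s\<^sup>2 * p / (2 * S1)" using S1p by (simp add: lam_def power2_eq_square field_simps)
    then have eq: "(lam\<^sup>2 + 1) * p * S1 / 2 = s\<^sup>2 * p / (2 * S1) + p * S1 / 2" by (simp add: algebra_simps add_divide_distrib)
    show "5 / 4 * \<eta> + ((lam\<^sup>2 + 1) * p * S1 / 2 + DI) + 5 / 4 * \<eta>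
      \<le> s\<^sup>2 * p / (2 * S1) + p * S1 / 2 + H p + 5 / 2 * (1 - om (p / cos a))"
      unfolding eq \<eta>_def X_def using DIH by linarith
  qed
  finally show ?thesis .
qed

text \<open>Let the cut-off angle of the trial profile tend to \<open>arccos (p / \<sigma>c)\<close>.\<close>

lemma profile_inf_upper:
  assumes p: "0 < p" "p < \<sigma>c" and s: "0 \<le> s"
  shows "profile_inf s \<le> ennreal (s\<^sup>2 * p / (2 * S p) + p * S p / 2 + H p)"
proof -
  define A where "A = arccos (p / \<sigma>c)"
  have pr: "0 < p / \<sigma>c" "p / \<sigma>c < 1" using p by auto
  have A: "0 < A" "A < pi / 2" "cos A = p / \<sigma>c" using arccos_range[of "p / \<sigma>c"] pr by (auto simp: A_def)
  define S1 where "S1 a = integral {0..a} (\<lambda>\<theta>. D (p / cos \<theta>))" for a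
  define h where "h a = s\<^sup>2 * p / (2 * S1 a) + p * S1 a / 2 + H p + 5 / 2 * sqrt (tau (p / cos a))" for a
  have "continuous_on {0..pi/2} S1"
    unfolding S1_def using S_integrable p by (intro indefinite_integral_continuous_1) auto
  then have Sc: "continuous_on {0..A} S1" by (rule continuous_on_subset) (use A in auto)
  have "S1 A + integral {A..pi/2} (\<lambda>\<theta>. D (p / cos \<theta>)) = S p"
    unfolding S1_def S_def using A S_integrable p
    by (intro Henstock_Kurzweil_Integration.integral_combine) auto
  moreover have "integral {A..pi/2} (\<lambda>\<theta>. D (p / cos \<theta>)) = 0"
  proof (intro integral_unique has_integral_is_0)
    fix t assume t: "t \<in> {A..pi/2}"
    have "D (p / cos t) \<le> D (p / cos A)" using t A p by (intro D_cos_antimono) auto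
    also have "\<dots> = 0" using A p by (simp add: D_def)
    finally show "D (p / cos t) = 0" using D_nonneg[of "p / cos t"] by simp
  qed
  ultimately have SA: "S1 A = S p" by simp
  have Sp: "0 < S p" using S_pos p by simp
  have lim1: "(S1 \<longlongrightarrow> S p) (at_left A)"
  proof -
    have "(S1 \<longlongrightarrow> S1 A) (at A within {0..A})" using Sc A unfolding continuous_on_def by (elim ballE[of _ _ A]) auto
    then show ?thesis using A SA by (simp add: at_within_Icc_at_left)
  qed
  have "cos A \<noteq> 0" using A p \<sigma>c_pos by simp
  then have "((\<lambda>a. p / cos a) \<longlongrightarrow> p / cos A) (at_left A)" by (intro tendsto_intros)
  then have lim2: "((\<lambda>a. p / cos a) \<longlongrightarrow> \<sigma>c) (at_left A)" using A p by simp
  have ev: "eventually (\<lambda>a. 0 < a \<and> a < A) (at_left A)" using A by (intro eventually_at_left_between) auto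
  have "((\<lambda>a. tau (p / cos a)) \<longlongrightarrow> tau \<sigma>c) (at_left A)"
  proof (rule continuous_on_tendsto_compose[OF tau_cont lim2])
    show "\<forall>\<^sub>F a in at_left A. p / cos a \<in> {0..}"
      using ev by eventually_elim (use A p cos_quarter in \<open>force intro!: divide_nonneg_nonneg less_imp_le\<close>)
  qed (use \<sigma>c_pos in auto)
  then have "(h \<longlongrightarrow> s\<^sup>2 * p / (2 * S p) + p * S p / 2 + H p + 5 / 2 * sqrt (tau \<sigma>c)) (at_left A)"
    unfolding h_def using Sp by (intro tendsto_intros lim1) auto
  then have "(h \<longlongrightarrow> s\<^sup>2 * p / (2 * S p) + p * S p / 2 + H p) (at_left A)" by (simp add: tau_def)
  then have "((\<lambda>a. ennreal (h a)) \<longlongrightarrow> ennreal (s\<^sup>2 * p / (2 * S p) + p * S p / 2 + H p)) (at_left A)"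
    by (rule tendsto_ennrealI)
  moreover have "eventually (\<lambda>a. profile_inf s \<le> ennreal (h a)) (at_left A)"
    using ev
  proof eventually_elim
    case (elim a)
    have c: "cos A < cos a" using elim A by (intro cos_monotone_0_pi) auto
    have "0 < cos a" using c A pr by simp
    then have x: "0 < p / cos a" "p / cos a < \<sigma>c" using c A p \<sigma>c_pos by (auto simp: field_simps)
    then have "sqrt (tau (p / cos a)) = 1 - om (p / cos a)" using om_props[of "p / cos a"] by (simp add: tau_def)
    then show ?case using trial_profile[OF p _ _ s, of a] elim by (simp add: h_def S1_def A_def)
  qed
  ultimately show ?thesis by (rule tendsto_lowerbound) simp
qed

end

section \<open>Slope of the density and fracture threshold\<close>

context cohesive
begin

lemma cohesive_density_profile_inf: "cohesive_density f s = enn2real (profile_inf s)"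
  by (simp add: cohesive_density_def profile_inf_def)

lemma density_upper:
  assumes p: "0 < p" "p < \<sigma>c" and s: "0 \<le> s"
  shows "cohesive_density f s \<le> s\<^sup>2 * p / (2 * S p) + p * S p / 2 + H p"
proof -
  have "0 \<le> s\<^sup>2 * p / (2 * S p) + p * S p / 2 + H p"
    using S_pos[OF p] H_nonneg[of p] p by simp
  moreover have "enn2real (profile_inf s) \<le> enn2real (ennreal (s\<^sup>2 * p / (2 * S p) + p * S p / 2 + H p))"
    by (rule enn2real_mono[OF profile_inf_upper[OF assms]]) simp
  ultimately show ?thesis by (simp add: cohesive_density_profile_inf)
qed

lemma density_lower:
  assumes s: "0 < s" and C: "\<And>p. 0 \<le> p \<Longrightarrow> p < \<sigma>c \<Longrightarrow> C \<le> p * s + H p"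
  shows "C \<le> cohesive_density f s"
proof (cases "0 \<le> C")
  case True
  have "profile_inf s \<le> ennreal (s\<^sup>2 * (\<sigma>c / 2) / (2 * S (\<sigma>c / 2)) + (\<sigma>c / 2) * S (\<sigma>c / 2) / 2 + H (\<sigma>c / 2))"
    using \<sigma>c_pos s by (intro profile_inf_upper) auto
  then have "profile_inf s < top" using ennreal_less_top le_less_trans by blast
  then have "enn2real (ennreal C) \<le> enn2real (profile_inf s)"
    by (intro enn2real_mono profile_inf_lower[OF s C])
  then show ?thesis using True by (simp add: cohesive_density_profile_inf)
next
  case False
  moreover have "0 \<le> cohesive_density f s" by (simp add: cohesive_density_def)
  ultimately show ?thesis by simp
qed

text \<open>At the opening \<open>S p\<close> the quadratic upper bound becomes \<open>p S p + H p\<close>, and by the tangent inequality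
  no other \<open>q\<close> gives a smaller value of the lower bound \<open>q S p + H q\<close>.\<close>

lemma density_at_S:
  assumes p: "0 < p" "p < \<sigma>c"
  shows "cohesive_density f (S p) = p * S p + H p"
proof (rule antisym)
  have Sp: "0 < S p" using S_pos[OF p] .
  then have "(S p)\<^sup>2 * p / (2 * S p) + p * S p / 2 = p * S p" by (simp add: power2_eq_square field_simps)
  then show "cohesive_density f (S p) \<le> p * S p + H p" using density_upper[OF p, of "S p"] Sp by simp
  show "p * S p + H p \<le> cohesive_density f (S p)"
  proof (rule density_lower[OF Sp])
    fix q assume "0 \<le> q" "q < \<sigma>c"
    then show "p * S p + H p \<le> q * S p + H q" using H_tangent[OF p(1), of q] by (simp add: algebra_simps)
  qed
qed

lemma H_\<sigma>c: "H \<sigma>c = 0"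
  unfolding H_def
proof (intro integral_unique has_integral_is_0)
  fix t :: real assume t: "t \<in> {0..pi/2}"
  show "tau (\<sigma>c / cos t) * cos t = 0"
  proof (cases "t = pi / 2")
    case True
    then have "cos t = 0" by (simp only: cos_pi_half)
    then show ?thesis by simp
  next
    case False
    then have "0 < cos t" "cos t \<le> 1" using t cos_quarter by auto
    then have "\<sigma>c \<le> \<sigma>c / cos t" using \<sigma>c_pos by (simp add: le_divide_eq)
    then show ?thesis by (simp add: tau_def)
  qed
qed

text \<open>Profiles with stress close to \<open>\<sigma>c\<close> cost almost nothing: \<open>H p \<le> S p (\<sigma>c - p)\<close> and \<open>S p \<rightarrow> 0\<close>.\<close>

lemma density_0: "cohesive_density f 0 = 0"
proof -
  have "cohesive_density f 0 \<le> 0"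
  proof (rule tendsto_lowerbound)
    have "((\<lambda>p. p * S p / 2 + S p * (\<sigma>c - p)) \<longlongrightarrow> \<sigma>c * 0 / 2 + 0 * (\<sigma>c - \<sigma>c)) (at_left \<sigma>c)"
      by (intro tendsto_intros S_tendsto_0) auto
    then show "((\<lambda>p. p * S p / 2 + S p * (\<sigma>c - p)) \<longlongrightarrow> 0) (at_left \<sigma>c)" by simp
    show "eventually (\<lambda>p. cohesive_density f 0 \<le> p * S p / 2 + S p * (\<sigma>c - p)) (at_left \<sigma>c)"
      using eventually_at_left_between[OF \<sigma>c_pos]
    proof eventually_elim
      case (elim p)
      have "H p - S p * (\<sigma>c - p) \<le> 0" using H_tangent[of p \<sigma>c] elim \<sigma>c_pos by (simp add: H_\<sigma>c)
      then show ?case using density_upper[of p 0] elim by simp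
    qed
  qed simp
  moreover have "0 \<le> cohesive_density f 0" by (simp add: cohesive_density_def)
  ultimately show ?thesis by simp
qed

text \<open>If \<open>s\<close> exceeds all openings, the tangent to \<open>H\<close> at a small \<open>q\<close>, where \<open>H q\<close> is almost \<open>1\<close>, lies below
  \<open>H\<close> and has a slope of at most \<open>s\<close> in absolute value.\<close>

lemma density_ge_1:
  assumes s: "0 < s" and le: "\<And>p. 0 < p \<Longrightarrow> p < \<sigma>c \<Longrightarrow> S p \<le> s"
  shows "1 \<le> cohesive_density f s"
proof (rule density_lower[OF s])
  fix p assume p: "0 \<le> p" "p < \<sigma>c"
  show "1 \<le> p * s + H p"
  proof (rule field_le_epsilon)
    fix e :: real assume "0 < e"
    then obtain p0 where p0: "p0 > 0" "\<And>p. 0 < p \<Longrightarrow> p < p0 \<Longrightarrow> H p > 1 - e" using H_near_0 by blast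
    define q where "q = min (p0 / 2) (\<sigma>c / 2)"
    have q: "0 < q" "q < p0" "q < \<sigma>c" using p0 \<sigma>c_pos by (auto simp: q_def)
    have "S q * (p - q) \<le> S q * p" using S_pos[of q] q by (intro mult_left_mono) auto
    also have "\<dots> \<le> s * p" using le[of q] q p by (intro mult_right_mono) auto
    finally show "1 \<le> p * s + H p + e" using H_tangent[of q p] q p p0(2)[of q] by (simp add: mult.commute)
  qed
qed

lemma density_le_1:
  assumes s: "0 \<le> s" and le: "\<And>p. 0 < p \<Longrightarrow> p < \<sigma>c \<Longrightarrow> S p \<le> s0"
  shows "cohesive_density f s \<le> 1"
proof (rule tendsto_lowerbound)
  define K where "K = S (\<sigma>c / 2)"
  have K: "0 < K" using S_pos \<sigma>c_pos by (simp add: K_def)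
  have "((\<lambda>p. s\<^sup>2 * p / (2 * K) + p * s0 / 2 + 1) \<longlongrightarrow> s\<^sup>2 * 0 / (2 * K) + 0 * s0 / 2 + 1) (at_right 0)"
    by (intro tendsto_intros) (use K in auto)
  then show "((\<lambda>p. s\<^sup>2 * p / (2 * K) + p * s0 / 2 + 1) \<longlongrightarrow> 1) (at_right 0)" by simp
  have "eventually (\<lambda>p. 0 < p \<and> p < \<sigma>c / 2) (at_right 0)"
    using \<sigma>c_pos by (auto simp: eventually_at_right[of 0 "\<sigma>c"] intro!: exI[of _ "\<sigma>c / 2"])
  then show "eventually (\<lambda>p. cohesive_density f s \<le> s\<^sup>2 * p / (2 * K) + p * s0 / 2 + 1) (at_right 0)"
  proof eventually_elim
    case (elim p)
    have "K \<le> S p" unfolding K_def using elim by (intro S_antimono) auto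
    then have "s\<^sup>2 * p / (2 * S p) \<le> s\<^sup>2 * p / (2 * K)" using K elim by (intro divide_left_mono) auto
    moreover have "p * S p / 2 \<le> p * s0 / 2" using le[of p] elim \<sigma>c_pos by simp
    ultimately show ?case using density_upper[of p s] H_le_1[of p] elim s \<sigma>c_pos by linarith
  qed
qed simp

text \<open>If \<open>s\<close> is an opening \<open>S p\<close>, the quadratic upper bound minus the density is minimal at \<open>s\<close>, so the two
  slopes \<open>p\<close> and \<open>d\<close> agree. If \<open>s\<close> exceeds all openings, the density is at its maximal value \<open>1\<close>, and the
  slope would be \<open>0\<close>. At \<open>s = 0\<close> the slope would be at least \<open>\<sigma>c\<close>, since the density is at least
  \<open>p S p\<close> at \<open>S p\<close>, and \<open>S p \<rightarrow> 0\<close> as \<open>p \<rightarrow> \<sigma>c\<close>.\<close>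

lemma density_deriv_imp_S:
  assumes s: "0 \<le> s" and d: "0 < d" "d < \<sigma>c"
    and der: "(cohesive_density f has_real_derivative d) (at s within {0..})"
  shows "S d = s"
proof (cases "s = 0")
  case True
  define c where "c = (d + \<sigma>c) / 2"
  have c: "d < c" "c < \<sigma>c" using d by (auto simp: c_def)
  have "((\<lambda>y. cohesive_density f y / y) \<longlongrightarrow> d) (at 0 within {0..})"
    using der True unfolding has_field_derivative_iff by (simp add: density_0)
  then have "eventually (\<lambda>y. cohesive_density f y / y < c) (at 0 within {0..})" using c by (auto intro: order_tendstoD)
  then obtain e where e: "e > 0" "\<And>y. 0 < y \<Longrightarrow> y < e \<Longrightarrow> cohesive_density f y / y < c"
    unfolding eventually_at by (auto simp: dist_real_def)
  have "eventually (\<lambda>p. S p < e) (at_left \<sigma>c)" using S_tendsto_0 e by (auto intro: order_tendstoD)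
  then have "eventually (\<lambda>p. S p < e \<and> c < p \<and> p < \<sigma>c) (at_left \<sigma>c)"
    using eventually_at_left_between[OF c(2)] by eventually_elim auto
  then obtain p where p: "S p < e" "c < p" "p < \<sigma>c"
    using eventually_happens'[OF trivial_limit_at_left_real] by blast
  have p0: "0 < p" using p c d by simp
  have Sp: "0 < S p" using S_pos p0 p by simp
  have "p * S p \<le> cohesive_density f (S p)" using density_at_S[OF p0 p(3)] H_nonneg[of p] p0 by simp
  then have "p \<le> cohesive_density f (S p) / S p" using Sp by (simp add: le_divide_eq)
  then show ?thesis using e(2)[OF Sp p(1)] p by simp
next
  case False
  then have s: "0 < s" using s by simp
  have "at s within {0..} = at s" using s by (intro at_within_interior interiorI[of "{0<..}"]) auto
  then have der: "(cohesive_density f has_real_derivative d) (at s)" using der by simp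
  show ?thesis
  proof (cases "\<exists>p. 0 < p \<and> p < \<sigma>c \<and> s < S p")
    case True
    then obtain p where p: "0 < p" "p < \<sigma>c" "S p = s" using S_attains s by blast
    define q where "q y = y\<^sup>2 * p / (2 * s) + p * s / 2 + H p" for y
    have d1: "((\<lambda>y. q y - cohesive_density f y) has_real_derivative p - d) (at s)"
      unfolding q_def using s by (auto intro!: derivative_eq_intros der)
    have m: "\<forall>y. \<bar>s - y\<bar> < s \<longrightarrow> q s - cohesive_density f s \<le> q y - cohesive_density f y"
    proof (intro allI impI)
      fix y assume "\<bar>s - y\<bar> < s"
      then have "cohesive_density f y \<le> q y" unfolding q_def using density_upper[OF p(1,2), of y] p by simp
      moreover have "q s = cohesive_density f s"
        using density_at_S[OF p(1,2)] p s by (simp add: q_def power2_eq_square field_simps)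
      ultimately show "q s - cohesive_density f s \<le> q y - cohesive_density f y" by simp
    qed
    have "p - d = 0" by (rule DERIV_local_min[OF d1 s m])
    then show ?thesis using p by simp
  next
    case False
    then have le: "S p \<le> s" if "0 < p" "p < \<sigma>c" for p using that by force
    have "\<forall>y. \<bar>s - y\<bar> < s \<longrightarrow> cohesive_density f y \<le> cohesive_density f s"
    proof (intro allI impI)
      fix y assume "\<bar>s - y\<bar> < s"
      then have "cohesive_density f y \<le> 1" using density_le_1[of y s] le by simp
      then show "cohesive_density f y \<le> cohesive_density f s" using density_ge_1[OF s le] by linarith
    qed
    then have "d = 0" using DERIV_local_max[OF der s] by simp
    then show ?thesis using d by simp
  qed
qed

text \<open>For positive openings below \<open>S p\<close> the density is below \<open>p S p + H p \<le> H 0 = 1\<close>, and above all openings it is at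
  least \<open>1\<close>. As \<open>S\<close> is nonincreasing, its supremum is approached for small \<open>p\<close>.\<close>

lemma s_frac_limit:
  assumes a: "ereal a = s_frac f"
  shows "\<And>p. 0 < p \<Longrightarrow> p < \<sigma>c \<Longrightarrow> S p \<le> a"
    and "\<And>\<delta>. 0 < \<delta> \<Longrightarrow> \<exists>p. 0 < p \<and> p < \<sigma>c \<and> p < \<delta> \<and> \<bar>S p - a\<bar> < \<delta>"
proof -
  show le: "S p \<le> a" if p: "0 < p" "p < \<sigma>c" for p
  proof (rule dense_le_bounded[OF S_pos[OF p]])
    fix s assume s: "0 < s" "s < S p"
    obtain p1 where p1: "0 < p1" "p1 < \<sigma>c" "S p1 = s" using S_attains[OF s p] by blast
    have "cohesive_density f s = p1 * s + H p1" using density_at_S[OF p1(1,2)] p1(3) by simp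
    also have "\<dots> \<le> p * s + H p" using H_tangent[OF p1(1), of p] p p1 by (simp add: algebra_simps)
    also have "\<dots> < p * S p + H p" using s p by simp
    also have "\<dots> \<le> 1" using H_tangent[OF p(1), of 0] by (simp add: H_0 algebra_simps)
    finally have "ereal s \<le> s_frac f" unfolding s_frac_def using s by (intro Sup_upper) auto
    then show "s \<le> a" unfolding a[symmetric] by simp
  qed
  fix \<delta> :: real assume \<delta>: "0 < \<delta>"
  have "ereal (a - \<delta>) < s_frac f" unfolding a[symmetric] using \<delta> by simp
  then obtain s where s: "0 \<le> s" "cohesive_density f s < 1" "a - \<delta> < s"
    unfolding s_frac_def less_Sup_iff by auto
  have "\<exists>p. 0 < p \<and> p < \<sigma>c \<and> s < S p"
  proof (cases "s = 0")
    case True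
    then show ?thesis using S_pos[of "\<sigma>c / 2"] \<sigma>c_pos by (intro exI[of _ "\<sigma>c / 2"]) auto
  next
    case False
    then show ?thesis using density_ge_1[of s] s by force
  qed
  then obtain p1 where p1: "0 < p1" "p1 < \<sigma>c" "s < S p1" by blast
  define p where "p = min p1 (\<delta> / 2)"
  have p: "0 < p" "p < \<sigma>c" "p < \<delta>" "p \<le> p1" using p1 \<delta> by (auto simp: p_def)
  have "S p1 \<le> S p" using p by (intro S_antimono) auto
  then show "\<exists>p. 0 < p \<and> p < \<sigma>c \<and> p < \<delta> \<and> \<bar>S p - a\<bar> < \<delta>"
    using p p1 s le[OF p(1,2)] \<delta> by (intro exI[of _ p]) auto
qed

end

section \<open>The truncated degradation function\<close>

lemma has_real_derivative_glue:
  assumes "(h has_real_derivative d) (at x within {..x})" "(h has_real_derivative d) (at x within {x..})"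
  shows "(h has_real_derivative d) (at (x::real))"
  using assms unfolding has_field_derivative_iff at_within_Iic_at_left at_within_Ici_at_right
  by (rule filterlim_split_at)

text \<open>Convexity of \<open>x \<mapsto> 1 / x\<^sup>2\<close>, between \<open>1\<close> and \<open>b\<close>.\<close>

lemma inverse_square_chord:
  fixes b \<theta> :: real
  assumes "0 < b" "0 \<le> \<theta>" "\<theta> \<le> 1"
  shows "1 / (1 - \<theta> + \<theta> * b)\<^sup>2 \<le> 1 - \<theta> + \<theta> * (1 / b\<^sup>2)"
proof -
  define x where "x = 1 - \<theta> + \<theta> * b"
  have x: "0 < x"
  proof (cases "\<theta> = 0")
    case False
    then have "0 < \<theta> * b" using assms by simp
    then show ?thesis using assms(3) by (simp add: x_def)
  qed (simp add: x_def)
  have "(1 - \<theta> + \<theta> / b) * x - 1 = \<theta> * (1 - \<theta>) * (b - 1)\<^sup>2 / b"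
    using assms(1) by (simp add: x_def field_simps power2_eq_square)
  also have "\<dots> \<ge> 0" using assms by simp
  finally have "1 / x \<le> 1 - \<theta> + \<theta> / b" using x by (simp add: field_simps)
  then have "(1 / x)\<^sup>2 \<le> (1 - \<theta> + \<theta> / b)\<^sup>2" using x by (intro power_mono) auto
  also have "\<dots> = 1 - \<theta> + \<theta> * (1 / b)\<^sup>2 - \<theta> * (1 - \<theta>) * (1 / b - 1)\<^sup>2"
    using assms(1) by (simp add: field_simps power2_eq_square)
  also have "\<dots> \<le> 1 - \<theta> + \<theta> * (1 / b)\<^sup>2" using assms by simp
  finally show ?thesis by (simp add: x_def power_divide)
qed

locale truncated = cohesive +
  fixes seps :: "real \<Rightarrow> real" and \<psi> :: "real \<Rightarrow> real \<Rightarrow> real"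
  assumes truncation: "truncation_data f seps \<psi>"
begin

lemma f_strict_mono: assumes "0 \<le> a" "a < b" "b < 1" shows "f a < f b"
proof (cases "a = 0")
  case True
  then show ?thesis using f_pos[of b] assms by simp
next
  case False
  have "w a / (1 - a) < w b / (1 - b)"
    using w_strict_mono[OF assms] w_pos[of a] assms False by (intro frac_less) auto
  then show ?thesis using f_eq_w[of a] f_eq_w[of b] assms by simp
qed

context
  fixes \<epsilon> :: real
  assumes \<epsilon>: "\<epsilon> > 0"
begin

definition h :: "real \<Rightarrow> real" where "h = trunc_f f seps \<psi> \<epsilon>"
abbreviation "se \<equiv> seps \<epsilon>"
text \<open>\<open>\<psi> \<epsilon>\<close> is prescribed on \<open>[0,1]\<close> only, so that \<open>deriv\<close> says nothing about it at \<open>1\<close>; there the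
  one-sided derivative is the relevant one.\<close>

definition d\<psi> :: "real \<Rightarrow> real" where
  "d\<psi> = (SOME d. continuous_on {0..1} d \<and> (\<forall>v\<in>{0..1}. (\<psi> \<epsilon> has_real_derivative d v) (at v within {0..1})))"
definition dh :: "real \<Rightarrow> real" where
  "dh v = (if v \<le> se then sqrt \<epsilon> * deriv f v else if v \<le> 1 then d\<psi> v else 0)"

lemma se: "0 < se" "se < 1"
  using truncation \<epsilon> unfolding truncation_data_def by auto

lemma \<psi>_props:
  "\<psi> \<epsilon> ` {0..1} \<subseteq> {0..1}" "mono_on {0..1} (\<psi> \<epsilon>)" "\<psi> \<epsilon> 1 = 1" "\<psi> \<epsilon> se = sqrt \<epsilon> * f se"
  "deriv (\<psi> \<epsilon>) se = sqrt \<epsilon> * deriv f se" "antimono_on {se..<1} (\<lambda>s. deriv (\<psi> \<epsilon>) s / (1 - s))"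
  "C2_on {0..1} (\<psi> \<epsilon>)"
  using truncation \<epsilon> unfolding truncation_data_def by blast+

lemma d\<psi>: "continuous_on {0..1} d\<psi>" "v \<in> {0..1} \<Longrightarrow> (\<psi> \<epsilon> has_real_derivative d\<psi> v) (at v within {0..1})"
proof -
  obtain d d' where d: "\<forall>v\<in>{0..1}. (\<psi> \<epsilon> has_real_derivative d v) (at v within {0..1})"
    "\<forall>v\<in>{0..1}. (d has_real_derivative d' v) (at v within {0..1})"
    using \<psi>_props(7) unfolding C2_on_def by blast
  have "continuous_on {0..1} d" using d(2) DERIV_continuous_on by blast
  then have "\<exists>d. continuous_on {0..1} d \<and> (\<forall>v\<in>{0..1}. (\<psi> \<epsilon> has_real_derivative d v) (at v within {0..1}))"
    using d(1) by blast
  from someI_ex[OF this] show "continuous_on {0..1} d\<psi>"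
    "v \<in> {0..1} \<Longrightarrow> (\<psi> \<epsilon> has_real_derivative d\<psi> v) (at v within {0..1})"
    unfolding d\<psi>_def by blast+
qed

lemma \<psi>_cont: "continuous_on {0..1} (\<psi> \<epsilon>)"
  using d\<psi>(2) DERIV_continuous_on by blast

lemma \<psi>_deriv: "0 < v \<Longrightarrow> v < 1 \<Longrightarrow> (\<psi> \<epsilon> has_real_derivative d\<psi> v) (at v)"
  using d\<psi>(2)[of v] by (simp add: at_within_Icc_at)

lemma deriv_\<psi>: "0 < v \<Longrightarrow> v < 1 \<Longrightarrow> deriv (\<psi> \<epsilon>) v = d\<psi> v"
  using \<psi>_deriv DERIV_imp_deriv by blast

lemma d\<psi>_ratio: "se \<le> x \<Longrightarrow> x \<le> y \<Longrightarrow> y < 1 \<Longrightarrow> d\<psi> y / (1 - y) \<le> d\<psi> x / (1 - x)"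
  using monotone_onD[OF \<psi>_props(6), of x y] deriv_\<psi>[of x] deriv_\<psi>[of y] se by auto

lemma \<psi>_mono: "0 \<le> x \<Longrightarrow> x \<le> y \<Longrightarrow> y \<le> 1 \<Longrightarrow> \<psi> \<epsilon> x \<le> \<psi> \<epsilon> y"
  using \<psi>_props(2) by (auto simp: mono_on_def)

lemma d\<psi>_nonneg: assumes "0 < v" "v < 1" shows "0 \<le> d\<psi> v"
proof (rule ccontr)
  assume "\<not> 0 \<le> d\<psi> v"
  then have "d\<psi> v < 0" by simp
  from DERIV_neg_dec_right[OF \<psi>_deriv[OF assms] this]
  obtain e where e: "e > 0" "\<And>x. 0 < x \<Longrightarrow> x < e \<Longrightarrow> \<psi> \<epsilon> (v + x) < \<psi> \<epsilon> v" by blast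
  define x where "x = min (e / 2) (1 - v)"
  have "0 < x" "x < e" "v + x \<le> 1" using e assms by (auto simp: x_def)
  then show False using e(2)[of x] \<psi>_mono[of v "v + x"] assms by simp
qed

text \<open>The quotient \<open>d\<psi> v / (1 - v)\<close> is bounded as \<open>v \<rightarrow> 1\<close>. Hence the truncated function has no corner at \<open>1\<close>.\<close>

lemma d\<psi>_1: "d\<psi> 1 = 0"
proof -
  have "eventually (\<lambda>v. se < v \<and> v < 1) (at_left 1)" using se by (intro eventually_at_left_between)
  then have ev: "eventually (\<lambda>v. 0 \<le> d\<psi> v \<and> d\<psi> v \<le> d\<psi> se / (1 - se) * (1 - v)) (at_left 1)"
  proof eventually_elim
    case (elim v)
    then show ?case using d\<psi>_nonneg[of v] d\<psi>_ratio[of se v] se by (simp add: pos_divide_le_eq)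
  qed
  have 1: "eventually (\<lambda>v. 0 \<le> d\<psi> v) (at_left 1)" "eventually (\<lambda>v. d\<psi> v \<le> d\<psi> se / (1 - se) * (1 - v)) (at_left 1)"
    using ev by (auto elim: eventually_mono)
  have "((\<lambda>v. d\<psi> se / (1 - se) * (1 - v)) \<longlongrightarrow> d\<psi> se / (1 - se) * (1 - 1)) (at_left 1)" by (intro tendsto_intros)
  then have "(d\<psi> \<longlongrightarrow> 0) (at_left 1)"
    using tendsto_sandwich[OF 1(1) 1(2) tendsto_const] by simp
  moreover have "(d\<psi> \<longlongrightarrow> d\<psi> 1) (at 1 within {0..1})" using d\<psi>(1) unfolding continuous_on_def by auto
  then have "(d\<psi> \<longlongrightarrow> d\<psi> 1) (at_left 1)" by (simp add: at_within_Icc_at_left)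
  ultimately show ?thesis using tendsto_unique[OF trivial_limit_at_left_real] by blast
qed

lemma h_low: "0 \<le> v \<Longrightarrow> v \<le> se \<Longrightarrow> h v = sqrt \<epsilon> * f v"
  by (simp add: h_def trunc_f_def)

lemma h_high: "se \<le> v \<Longrightarrow> v \<le> 1 \<Longrightarrow> h v = \<psi> \<epsilon> v"
  using se \<psi>_props(4) by (auto simp: h_def trunc_f_def)

lemma h_1: "h 1 = 1" using h_high[of 1] se \<psi>_props(3) by simp

lemma h_deriv: assumes v: "0 < v" shows "(h has_real_derivative dh v) (at v)"
proof -
  have flow: "((\<lambda>v. sqrt \<epsilon> * f v) has_real_derivative sqrt \<epsilon> * deriv f v) (at v)" if "0 < v" "v < 1" for v
    using that by (intro DERIV_cmult f_C1(1)) auto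
  consider "v < se" | "v = se" | "se < v" "v < 1" | "v = 1" | "1 < v" by linarith
  then show ?thesis
  proof cases
    case 1
    have "(h has_real_derivative sqrt \<epsilon> * deriv f v) (at v)"
      by (rule has_field_derivative_transform_within_open[OF flow, of _ "{0<..<se}"])
         (use 1 v se h_low in auto)
    then show ?thesis using 1 by (simp add: dh_def)
  next
    case 2
    have "(h has_real_derivative sqrt \<epsilon> * deriv f se) (at se)"
    proof (rule has_real_derivative_glue)
      show "(h has_real_derivative sqrt \<epsilon> * deriv f se) (at se within {..se})"
        by (rule has_field_derivative_transform_within[OF has_field_derivative_at_within[OF flow], where d=se])
           (use se h_low in \<open>auto simp: dist_real_def\<close>)
      have "(\<psi> \<epsilon> has_real_derivative sqrt \<epsilon> * deriv f se) (at se)"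
        using \<psi>_deriv[of se] deriv_\<psi>[of se] \<psi>_props(5) se by simp
      then show "(h has_real_derivative sqrt \<epsilon> * deriv f se) (at se within {se..})"
        by (rule has_field_derivative_transform_within[OF has_field_derivative_at_within, where d="1 - se"])
           (use se h_high in \<open>auto simp: dist_real_def\<close>)
    qed
    then show ?thesis using 2 by (simp add: dh_def)
  next
    case 3
    have "(h has_real_derivative d\<psi> v) (at v)"
      by (rule has_field_derivative_transform_within_open[OF \<psi>_deriv, of _ "{se<..<1}"])
         (use 3 v se h_high in auto)
    then show ?thesis using 3 by (simp add: dh_def)
  next
    case 4
    have "(h has_real_derivative 0) (at 1)"
    proof (rule has_real_derivative_glue)
      have "(\<psi> \<epsilon> has_real_derivative 0) (at 1 within {0..1})" using d\<psi>(2)[of 1] d\<psi>_1 by simp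
      then have "(\<psi> \<epsilon> has_real_derivative 0) (at_left 1)" by (simp add: at_within_Icc_at_left)
      then have "(\<psi> \<epsilon> has_real_derivative 0) (at 1 within {..1})" by (simp add: at_within_Iic_at_left)
      then show "(h has_real_derivative 0) (at 1 within {..1})"
        by (rule has_field_derivative_transform_within[where d="1 - se"])
           (use se h_high in \<open>auto simp: dist_real_def\<close>)
      have "((\<lambda>v. 1) has_real_derivative 0) (at 1 within {1..})" by simp
      then show "(h has_real_derivative 0) (at 1 within {1..})"
        by (rule has_field_derivative_transform_within[where d=1])
           (use se h_1 in \<open>auto simp: h_def trunc_f_def\<close>)
    qed
    then show ?thesis using 4 se d\<psi>_1 by (simp add: dh_def)
  next
    case 5
    have "((\<lambda>v. 1) has_real_derivative 0) (at v)" by simp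
    then have "(h has_real_derivative 0) (at v)"
      by (rule has_field_derivative_transform_within_open[where S="{1<..}"])
         (use 5 se in \<open>auto simp: h_def trunc_f_def\<close>)
    then show ?thesis using 5 se by (simp add: dh_def)
  qed
qed

lemma deriv_h: "0 < v \<Longrightarrow> deriv h v = dh v"
  using h_deriv DERIV_imp_deriv by blast

lemma h_cont: "continuous_on {0<..} h"
  using h_deriv by (meson DERIV_isCont continuous_at_imp_continuous_on greaterThan_iff)

lemma dh_cont: assumes "0 < a" "a \<le> se" shows "continuous_on {a..1} dh"
proof -
  have "continuous_on {a..se} dh"
    by (rule continuous_on_eq[of _ "\<lambda>v. sqrt \<epsilon> * deriv f v"])
       (use se assms in \<open>auto simp: dh_def intro!: continuous_intros continuous_on_subset[OF f_C1(2)]\<close>)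
  moreover have "continuous_on {se..1} dh"
  proof (rule continuous_on_eq[of _ d\<psi>])
    show "continuous_on {se..1} d\<psi>" using se by (intro continuous_on_subset[OF d\<psi>(1)]) auto
    fix v assume "v \<in> {se..1}"
    then show "d\<psi> v = dh v" using deriv_\<psi>[of se] \<psi>_props(5) se by (auto simp: dh_def)
  qed
  ultimately have "continuous_on ({a..se} \<union> {se..1}) dh"
    by (intro continuous_on_closed_Un) auto
  then show ?thesis by (rule continuous_on_subset) auto
qed

lemma h_mono: assumes "0 \<le> x" "x \<le> y" "y \<le> 1" shows "h x \<le> h y"
proof -
  have lo: "h x \<le> h y" if "0 \<le> x" "x \<le> y" "y \<le> se" for x y
    using that f_strict_mono[of x y] se h_low[of x] h_low[of y] \<epsilon> by (cases "x = y") (auto intro: less_imp_le)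
  have hi: "h x \<le> h y" if "se \<le> x" "x \<le> y" "y \<le> 1" for x y
    using that \<psi>_mono[of x y] se h_high[of x] h_high[of y] by auto
  show ?thesis
    using lo[of x y] hi[of x y] lo[of x se] hi[of se y] assms by linarith
qed

lemma h_pos: assumes "0 < v" "v \<le> 1" shows "0 < h v"
proof -
  have "0 < h (min v se)" using assms se f_pos[of "min v se"] \<epsilon> h_low[of "min v se"] by auto
  also have "\<dots> \<le> h v" using assms se by (intro h_mono) auto
  finally show ?thesis .
qed

lemma h_le_1: "0 \<le> v \<Longrightarrow> v \<le> 1 \<Longrightarrow> h v \<le> 1"
  using h_mono[of v 1] h_1 by simp

text \<open>As a function of \<open>t = (1 - s)\<^sup>2\<close>, \<open>\<psi>\<close> has the derivative \<open>- d\<psi> s / (2 (1 - s))\<close>, which is nonincreasing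
  in \<open>t\<close>. So \<open>\<psi>\<close> is concave in \<open>t\<close> and lies above its chord between the truncation level and \<open>1\<close>. The proof
  compares \<open>\<psi>\<close> with its tangent in \<open>t\<close> at the given point.\<close>

lemma \<psi>_chord:
  assumes v: "se \<le> v" "v \<le> 1"
  shows "1 - ((1 - v) / (1 - se))\<^sup>2 * (1 - h se) \<le> h v"
proof (cases "v = se \<or> v = 1")
  case True
  then show ?thesis using se h_1 by auto
next
  case False
  then have v: "se < v" "v < 1" using v by auto
  define r where "r = d\<psi> v / (1 - v)"
  define z where "z s = \<psi> \<epsilon> s + r / 2 * (1 - s)\<^sup>2" for s
  have zc: "continuous_on {0..1} z" unfolding z_def by (intro continuous_intros \<psi>_cont)
  have zd: "(z has_real_derivative d\<psi> s - r * (1 - s)) (at s)" if "0 < s" "s < 1" for s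
    unfolding z_def using that by (auto intro!: derivative_eq_intros \<psi>_deriv simp: field_simps)
  have 1: "z se \<le> z v"
  proof (rule DERIV_nonneg_imp_increasing_open[of se v z])
    fix s assume s: "se < s" "s < v"
    have "r \<le> d\<psi> s / (1 - s)" using d\<psi>_ratio[of s v] s v by (simp add: r_def)
    then have "0 \<le> d\<psi> s - r * (1 - s)" using s v by (simp add: pos_le_divide_eq)
    then show "\<exists>y. (z has_real_derivative y) (at s) \<and> 0 \<le> y" using zd[of s] s v se by auto
  qed (use v se in \<open>auto intro: continuous_on_subset[OF zc]\<close>)
  have 2: "z 1 \<le> z v"
  proof (rule DERIV_nonpos_imp_decreasing_open[of v 1 z])
    fix s assume s: "v < s" "s < 1"
    have "d\<psi> s / (1 - s) \<le> r" using d\<psi>_ratio[of v s] s v by (simp add: r_def)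
    then have "d\<psi> s - r * (1 - s) \<le> 0" using s v by (simp add: pos_divide_le_eq)
    then show "\<exists>y. (z has_real_derivative y) (at s) \<and> y \<le> 0" using zd[of s] s v se by auto
  qed (use v se in \<open>auto intro: continuous_on_subset[OF zc]\<close>)
  define A B where "A = (1 - se)\<^sup>2" and "B = (1 - v)\<^sup>2"
  have AB: "0 < B" "B < A" using v se by (auto simp: A_def B_def intro!: power_strict_mono)
  have e1: "h se + r / 2 * A \<le> h v + r / 2 * B" using 1 h_high[of se] h_high[of v] v se by (simp add: z_def A_def B_def)
  have e2: "1 \<le> h v + r / 2 * B" using 2 h_high[of v] v se \<psi>_props(3) by (simp add: z_def B_def)
  have "r / 2 * (A - B) \<le> h v - h se" using e1 by (simp add: right_diff_distrib)
  then have "(r / 2 * (A - B)) * B \<le> (h v - h se) * B" using AB by (intro mult_right_mono) auto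
  moreover have "(1 - h v) * (A - B) \<le> (r / 2 * B) * (A - B)" using e2 AB by (intro mult_right_mono) auto
  moreover have "(r / 2 * (A - B)) * B = (r / 2 * B) * (A - B)" by simp
  ultimately have "(1 - h v) * (A - B) \<le> (h v - h se) * B" by linarith
  then have "(1 - h v) * A \<le> B * (1 - h se)" by (simp add: algebra_simps)
  then have "1 - h v \<le> B / A * (1 - h se)" using AB by (simp add: field_simps)
  then show ?thesis by (simp add: A_def B_def power_divide)
qed

text \<open>Normalised to vanish at \<open>1\<close>: in \<open>1 / h\<^sup>2 = 1 + e / \<epsilon>\<close> the first summand is the response of the intact
  material, the second the additional strain caused by the damage.\<close>

definition e :: "real \<Rightarrow> real" where "e v = \<epsilon> * (1 / (h v)\<^sup>2 - 1)"

lemma e_low: assumes "0 < v" "v \<le> se" shows "e v = 1 / (f v)\<^sup>2 - \<epsilon>"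
  using assms h_low[of v] \<epsilon> f_pos[of v] se by (simp add: e_def power_mult_distrib field_simps)

lemma e_1 [simp]: "e 1 = 0" by (simp add: e_def h_1)

lemma e_nonneg: assumes "0 < v" "v \<le> 1" shows "0 \<le> e v"
proof -
  have "(h v)\<^sup>2 \<le> 1" using h_pos[OF assms] h_le_1[of v] assms by (simp add: power_le_one)
  then show ?thesis using h_pos[OF assms] \<epsilon> by (simp add: e_def)
qed

lemma e_antimono: assumes "0 < x" "x \<le> y" "y \<le> 1" shows "e y \<le> e x"
proof -
  have "(h x)\<^sup>2 \<le> (h y)\<^sup>2" using h_mono[of x y] h_pos[of x] assms by (intro power_mono) auto
  then have "1 / (h y)\<^sup>2 \<le> 1 / (h x)\<^sup>2" using h_pos[of x] h_pos[of y] assms by (intro divide_left_mono) auto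
  then show ?thesis using \<epsilon> by (simp add: e_def)
qed

text \<open>Insert the chord bound for \<open>\<psi>\<close> into the convex function \<open>1 / x\<^sup>2\<close>.\<close>

lemma e_high: assumes v: "se \<le> v" "v \<le> 1" shows "e v \<le> ((1 - v) / (1 - se))\<^sup>2 * e se"
proof -
  define \<theta> where "\<theta> = ((1 - v) / (1 - se))\<^sup>2"
  have th: "0 \<le> \<theta>" "\<theta> \<le> 1" using v se by (auto simp: \<theta>_def power_le_one)
  have hs: "0 < h se" using h_pos[of se] se by simp
  have "1 - \<theta> + \<theta> * h se \<le> h v" using \<psi>_chord[OF v] by (simp add: \<theta>_def algebra_simps)
  moreover have x: "0 < 1 - \<theta> + \<theta> * h se"
  proof (cases "\<theta> = 0")
    case False
    then have "0 < \<theta> * h se" using th hs by simp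
    then show ?thesis using th by simp
  qed simp
  ultimately have "(1 - \<theta> + \<theta> * h se)\<^sup>2 \<le> (h v)\<^sup>2" by (intro power_mono) auto
  then have "1 / (h v)\<^sup>2 \<le> 1 / (1 - \<theta> + \<theta> * h se)\<^sup>2"
    using x h_pos[of v] v se by (intro divide_left_mono) auto
  also have "\<dots> \<le> 1 - \<theta> + \<theta> * (1 / (h se)\<^sup>2)" by (rule inverse_square_chord[OF hs th])
  finally have "1 / (h v)\<^sup>2 - 1 \<le> \<theta> * (1 / (h se)\<^sup>2 - 1)" by (simp add: algebra_simps)
  then have "\<epsilon> * (1 / (h v)\<^sup>2 - 1) \<le> \<epsilon> * (\<theta> * (1 / (h se)\<^sup>2 - 1))" using \<epsilon> by (intro mult_left_mono) auto
  then show ?thesis by (simp add: e_def \<theta>_def mult.left_commute)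
qed

text \<open>Below the truncation level \<open>1 / f\<^sup>2 v = (1 - v)\<^sup>2 / w\<^sup>2 v\<close>; above it \<open>e\<close> decays at least as fast as
  \<open>(1 - v)\<^sup>2\<close> by the previous bound.\<close>

lemma e_le: assumes v: "0 < v" "v \<le> 1" shows "e v \<le> (1 - v)\<^sup>2 / (w (min v se))\<^sup>2"
proof (cases "v \<le> se")
  case True
  have "1 / (f v)\<^sup>2 = (1 - v)\<^sup>2 / (w v)\<^sup>2" using True se v by (simp add: w_def power_mult_distrib)
  then show ?thesis using e_low[of v] True v \<epsilon> by (simp add: min_def)
next
  case False
  then have v': "se \<le> v" by simp
  have "1 / (f se)\<^sup>2 = (1 - se)\<^sup>2 / (w se)\<^sup>2" using se by (simp add: w_def power_mult_distrib)
  then have "e se \<le> (1 - se)\<^sup>2 / (w se)\<^sup>2" using e_low[of se] se \<epsilon> by simp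
  then have "((1 - v) / (1 - se))\<^sup>2 * e se \<le> ((1 - v) / (1 - se))\<^sup>2 * ((1 - se)\<^sup>2 / (w se)\<^sup>2)"
    by (intro mult_left_mono) auto
  also have "\<dots> = (1 - v)\<^sup>2 / (w se)\<^sup>2" using se by (simp add: power_divide)
  finally show ?thesis using e_high[OF v' v(2)] False by (simp add: min_def)
qed

lemma e_deriv: assumes "0 < v" "v \<le> 1" shows "(e has_real_derivative - 2 * \<epsilon> * dh v / h v ^ 3) (at v)"
proof -
  have h0: "h v \<noteq> 0" using h_pos[OF assms] by simp
  have h2: "((\<lambda>v. (h v)\<^sup>2) has_real_derivative 2 * h v * dh v) (at v)"
    using h_deriv[OF assms(1)] by (auto intro!: derivative_eq_intros)
  show ?thesis unfolding e_def[abs_def]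
    by (rule DERIV_cong[OF DERIV_cmult[OF DERIV_diff[OF DERIV_divide[OF DERIV_const h2] DERIV_const]]])
       (use h0 in \<open>simp_all add: power2_eq_square power3_eq_cube field_simps\<close>)
qed

lemma e_cont: "continuous_on {0<..1} e"
  using e_deriv by (meson DERIV_isCont continuous_at_imp_continuous_on greaterThanAtMost_iff)

end

end

section \<open>The travel time\<close>

context cohesive
begin

text \<open>Since \<open>dw v / (1 - v)\<close> is nondecreasing, \<open>w\<close> grows on \<open>[m,u]\<close> at least as fast as
  \<open>- dw m (1 - v)\<^sup>2 / (2 (1 - m))\<close>.\<close>

lemma w_gap:
  assumes m: "0 < m" and u: "m \<le> u" "u < 1"
  shows "dw m / (2 * \<sigma>c) * (u - m) \<le> 1 - (w m / w u)\<^sup>2"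
proof -
  define c0 where "c0 = dw m / (1 - m)"
  define z where "z v = w v + c0 / 2 * (1 - v)\<^sup>2" for v
  have m1: "m < 1" using u by simp
  have c0: "0 < c0" using dw_pos[of m] m m1 by (simp add: c0_def)
  have zd: "(z has_real_derivative dw v - c0 * (1 - v)) (at v)" if "0 < v" "v < 1" for v
    unfolding z_def using that by (auto intro!: derivative_eq_intros w_deriv simp: field_simps)
  have "z m \<le> z u"
  proof (rule DERIV_nonneg_imp_nondecreasing[OF u(1)])
    fix v assume v: "m \<le> v" "v \<le> u"
    have "c0 \<le> dw v / (1 - v)" using dw_ratio_mono[of m v] v u m by (simp add: c0_def)
    then have "0 \<le> dw v - c0 * (1 - v)" using v u by (simp add: pos_le_divide_eq)
    then show "\<exists>y. (z has_real_derivative y) (at v) \<and> 0 \<le> y" using zd[of v] v u m by auto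
  qed
  then have 1: "c0 / 2 * ((1 - m)\<^sup>2 - (1 - u)\<^sup>2) \<le> w u - w m" by (simp add: z_def algebra_simps)
  have "(1 - m) * (u - m) \<le> (2 - m - u) * (u - m)" using u by (intro mult_right_mono) auto
  also have "\<dots> = (1 - m)\<^sup>2 - (1 - u)\<^sup>2" by (simp add: power2_eq_square algebra_simps)
  finally have "c0 / 2 * ((1 - m) * (u - m)) \<le> c0 / 2 * ((1 - m)\<^sup>2 - (1 - u)\<^sup>2)" using c0 by (intro mult_left_mono) auto
  also have "c0 / 2 * ((1 - m) * (u - m)) = dw m / 2 * (u - m)" 
  proof -
    have "c0 * (1 - m) = dw m" using m1 by (simp add: c0_def)
    moreover have "c0 / 2 * ((1 - m) * (u - m)) = c0 * (1 - m) / 2 * (u - m)" by simp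
    ultimately show ?thesis by simp
  qed
  finally have 2: "dw m / 2 * (u - m) \<le> w u - w m" using 1 by simp
  have wm: "0 < w m" "w m \<le> w u" "w u < \<sigma>c" using w_pos[of m] w_le_iff[of m u] w_less[of u] m m1 u by auto
  have "dw m / (2 * \<sigma>c) * (u - m) = dw m / 2 * (u - m) / \<sigma>c" by simp
  also have "\<dots> \<le> (w u - w m) / \<sigma>c" using 2 \<sigma>c_pos by (intro divide_right_mono) auto
  also have "\<dots> \<le> (w u - w m) / w u" using wm by (intro divide_left_mono) auto
  also have "\<dots> = 1 - w m / w u" using wm by (simp add: field_simps)
  also have "\<dots> \<le> 1 - (w m / w u)\<^sup>2"
  proof -
    have "(w m / w u)\<^sup>2 \<le> w m / w u" unfolding power2_eq_square using wm by (intro mult_left_le) auto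
    then show ?thesis by simp
  qed
  finally show ?thesis .
qed

end

context truncated
begin

context
  fixes \<epsilon> m :: real
  assumes \<epsilon>: "\<epsilon> > 0" and m: "0 < m" "m < 1" and mse: "(1 + m) / 2 \<le> seps \<epsilon>"
begin

text \<open>The right-hand side of the first integral \<open>(\<epsilon> v')\<^sup>2 = G q v\<close> of the Euler-Lagrange equations when
  \<open>h\<^sup>2 v u' = \<surd>q\<close> and \<open>v\<close> has the minimum \<open>m\<close>.\<close>

definition G :: "real \<Rightarrow> real \<Rightarrow> real" where
  "G q v = ((1 - v)\<^sup>2 - (1 - m)\<^sup>2) / 4 + q * (e \<epsilon> m - e \<epsilon> v)"
text \<open>For \<open>q > qs\<close> the function \<open>G q\<close> has a simple zero at \<open>m\<close>. With \<open>v = m + y\<^sup>2\<close> one gets \<open>G q v = y\<^sup>2 k q y\<close>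
  with \<open>k\<close> positive and continuous, so that \<open>y\<close> solves an autonomous equation without a singularity at the minimum of \<open>v\<close>. The value of \<open>B\<close>
  at \<open>0\<close> is its limit.\<close>

definition B :: "real \<Rightarrow> real" where
  "B y = (if y = 0 then 2 * deriv f m / f m ^ 3 else (e \<epsilon> m - e \<epsilon> (m + y\<^sup>2)) / y\<^sup>2)"
definition k :: "real \<Rightarrow> real \<Rightarrow> real" where
  "k q y = q * B y - (2 * (1 - m) - y\<^sup>2) / 4"
text \<open>The value of \<open>q\<close> for which \<open>G q 1 = 0\<close>, that is, for which \<open>v = 1\<close> is an equilibrium.\<close>

definition qs :: real where "qs = (1 - m)\<^sup>2 / (4 * e \<epsilon> m)"
text \<open>The length of the interval on which \<open>v\<close> grows from \<open>m\<close> to \<open>1\<close>.\<close>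

definition T :: "real \<Rightarrow> real" where
  "T q = 2 * \<epsilon> * integral {0..sqrt (1 - m)} (\<lambda>y. 1 / sqrt (k q y))"

lemma m_less_se: "m < seps \<epsilon>" using m mse by (simp add: field_simps)

lemma wm: "0 < w m" "w m < \<sigma>c" using w_pos w_less m by auto

lemma y_range: "\<bar>y\<bar> \<le> sqrt (1 - m) \<longleftrightarrow> m + y\<^sup>2 \<le> 1"
proof -
  have "\<bar>y\<bar> \<le> sqrt (1 - m) \<longleftrightarrow> sqrt (y\<^sup>2) \<le> sqrt (1 - m)" by simp
  also have "\<dots> \<longleftrightarrow> y\<^sup>2 \<le> 1 - m" by (rule real_sqrt_le_iff)
  finally show ?thesis by auto
qed

lemma e_m: "e \<epsilon> m = 1 / (f m)\<^sup>2 - \<epsilon>" using e_low[OF \<epsilon>] m m_less_se by simp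

lemma e_m_pos: "0 < e \<epsilon> m"
proof -
  have "h \<epsilon> m < h \<epsilon> (seps \<epsilon>)"
    using h_low[OF \<epsilon>, of m] h_low[OF \<epsilon>, of "seps \<epsilon>"] m m_less_se se[OF \<epsilon>] f_strict_mono[of m "seps \<epsilon>"] \<epsilon> by simp
  then have "h \<epsilon> m < 1" using h_le_1[OF \<epsilon>, of "seps \<epsilon>"] se[OF \<epsilon>] by simp
  moreover have "0 < h \<epsilon> m" using h_pos[OF \<epsilon>] m by simp
  ultimately have "0 < (h \<epsilon> m)\<^sup>2" "(h \<epsilon> m)\<^sup>2 < 1" by (auto simp: power_less_one_iff)
  then have "1 < 1 / (h \<epsilon> m)\<^sup>2" by (simp add: less_divide_eq)
  then show ?thesis using \<epsilon> by (simp add: e_def[OF \<epsilon>])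
qed

lemma inv_f_m: "1 / (f m)\<^sup>2 = (1 - m)\<^sup>2 / (w m)\<^sup>2"
  using m by (simp add: w_def power_mult_distrib)

lemma qs_ge: "(w m)\<^sup>2 / 4 \<le> qs"
proof -
  have "e \<epsilon> m \<le> (1 - m)\<^sup>2 / (w m)\<^sup>2" using e_m inv_f_m \<epsilon> by simp
  then have "e \<epsilon> m * (w m)\<^sup>2 \<le> (1 - m)\<^sup>2" using wm by (simp add: pos_le_divide_eq)
  then show ?thesis using e_m_pos by (simp add: qs_def field_simps)
qed

lemma qs_pos: "0 < qs" using e_m_pos m by (simp add: qs_def)

lemma qs_e: "qs * e \<epsilon> m = (1 - m)\<^sup>2 / 4" using e_m_pos by (simp add: qs_def)

lemma G_k: "y\<^sup>2 * k q y = G q (m + y\<^sup>2)"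
proof (cases "y = 0")
  case False
  then have "y\<^sup>2 * (q * B y) = q * (e \<epsilon> m - e \<epsilon> (m + y\<^sup>2))" by (simp add: B_def)
  moreover have "- (y\<^sup>2 * ((2 * (1 - m) - y\<^sup>2) / 4)) = ((1 - (m + y\<^sup>2))\<^sup>2 - (1 - m)\<^sup>2) / 4"
    by (simp add: power2_eq_square field_simps)
  ultimately show ?thesis by (simp add: k_def G_def right_diff_distrib)
qed (simp add: G_def)

lemma e_mono_m: "m \<le> v \<Longrightarrow> v \<le> 1 \<Longrightarrow> e \<epsilon> v \<le> e \<epsilon> m"
  using e_antimono[OF \<epsilon>] m by simp

lemma B_cont: "continuous_on {- sqrt (1 - m)..sqrt (1 - m)} B"
proof (intro continuous_at_imp_continuous_on ballI)
  fix y assume y: "y \<in> {- sqrt (1 - m)..sqrt (1 - m)}"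
  then have v: "m + y\<^sup>2 \<le> 1" using y_range[of y] by auto
  have v0: "0 < m + y\<^sup>2" using m by (simp add: add_pos_nonneg)
  show "isCont B y"
  proof (cases "y = 0")
    case False
    have e1: "isCont (e \<epsilon>) (m + y\<^sup>2)" using e_deriv[OF \<epsilon> v0 v] by (rule DERIV_isCont)
    have e2: "isCont (\<lambda>x. e \<epsilon> (m + x\<^sup>2)) y"
      by (rule isCont_o2[where f="\<lambda>x. m + x\<^sup>2", OF _ e1]) (intro continuous_intros)
    have "isCont (\<lambda>y. (e \<epsilon> m - e \<epsilon> (m + y\<^sup>2)) / y\<^sup>2) y"
      using False by (intro continuous_intros e2) auto
    moreover have "eventually (\<lambda>x. B x = (e \<epsilon> m - e \<epsilon> (m + x\<^sup>2)) / x\<^sup>2) (nhds y)"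
      unfolding eventually_nhds using False by (intro exI[of _ "- {0}"]) (auto simp: B_def)
    ultimately show ?thesis using isCont_cong by fastforce
  next
    case True
    have "((\<lambda>t. (e \<epsilon> (m + t) - e \<epsilon> m) / t) \<longlongrightarrow> - 2 * \<epsilon> * dh \<epsilon> m / h \<epsilon> m ^ 3) (at 0)"
      using e_deriv[OF \<epsilon>, of m] m by (simp add: DERIV_def)
    moreover have "filterlim (\<lambda>y::real. y\<^sup>2) (at 0) (at 0)"
    proof -
      have "((\<lambda>y::real. y\<^sup>2) \<longlongrightarrow> 0\<^sup>2) (at 0)" by (intro tendsto_intros)
      then show ?thesis by (auto simp: filterlim_at eventually_at_filter)
    qed
    ultimately have "((\<lambda>y. (e \<epsilon> (m + y\<^sup>2) - e \<epsilon> m) / y\<^sup>2) \<longlongrightarrow> - 2 * \<epsilon> * dh \<epsilon> m / h \<epsilon> m ^ 3) (at 0)"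
      by (rule filterlim_compose)
    then have "((\<lambda>y. - ((e \<epsilon> (m + y\<^sup>2) - e \<epsilon> m) / y\<^sup>2)) \<longlongrightarrow> - (- 2 * \<epsilon> * dh \<epsilon> m / h \<epsilon> m ^ 3)) (at 0)"
      by (rule tendsto_minus)
    moreover have "- (- 2 * \<epsilon> * dh \<epsilon> m / h \<epsilon> m ^ 3) = B 0"
    proof -
      have "h \<epsilon> m = sqrt \<epsilon> * f m" "dh \<epsilon> m = sqrt \<epsilon> * deriv f m"
        using h_low[OF \<epsilon>, of m] m m_less_se by (auto simp: dh_def[OF \<epsilon>])
      moreover have "(sqrt \<epsilon>) ^ 3 = \<epsilon> * sqrt \<epsilon>" using \<epsilon> by (simp add: power3_eq_cube)
      ultimately show ?thesis using \<epsilon> by (simp add: B_def power_mult_distrib)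
    qed
    ultimately have "((\<lambda>y. - ((e \<epsilon> (m + y\<^sup>2) - e \<epsilon> m) / y\<^sup>2)) \<longlongrightarrow> B 0) (at 0)" by simp
    then have "(B \<longlongrightarrow> B 0) (at 0)"
      by (rule Lim_transform_eventually) (auto simp: eventually_at_filter B_def minus_divide_left)
    then show ?thesis using True by (simp add: isCont_def)
  qed
qed

lemma k_cont: "continuous_on {- sqrt (1 - m)..sqrt (1 - m)} (k q)"
  unfolding k_def[abs_def] by (intro continuous_intros B_cont) auto

lemma k_even: "k q (- y) = k q y" by (simp add: k_def B_def)

lemma G_mono: "q0 \<le> q \<Longrightarrow> m \<le> v \<Longrightarrow> v \<le> 1 \<Longrightarrow> G q0 v \<le> G q v"
  using e_mono_m[of v] by (simp add: G_def mult_right_mono)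

text \<open>Below the truncation level the bound is an identity at \<open>q = p\<^sup>2 / 4 \<le> qs\<close>. Above the level, at
  \<open>q = qs\<close>, both \<open>(1 - v)\<^sup>2\<close> and the bound for \<open>e v\<close> arise from their values at the level by the same factor.\<close>

lemma G_lower:
  assumes q: "qs \<le> q" and v: "m \<le> v" "v \<le> 1"
  shows "(1 - v)\<^sup>2 / 4 * (1 - (w m / w (min v (seps \<epsilon>)))\<^sup>2) \<le> G q v"
proof -
  have low: "(1 - v)\<^sup>2 / 4 * (1 - (w m / w v)\<^sup>2) \<le> G q v" if v: "m \<le> v" "v \<le> seps \<epsilon>" and q: "qs \<le> q" for v q
  proof -
    have v1: "v < 1" "0 < v" using v se[OF \<epsilon>] m by auto
    have "e \<epsilon> v = 1 / (f v)\<^sup>2 - \<epsilon>" using e_low[OF \<epsilon>, of v] v m by simp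
    also have "1 / (f v)\<^sup>2 = (1 - v)\<^sup>2 / (w v)\<^sup>2" using v1 by (simp add: w_def power_mult_distrib)
    finally have ev: "e \<epsilon> m - e \<epsilon> v = (1 - m)\<^sup>2 / (w m)\<^sup>2 - (1 - v)\<^sup>2 / (w v)\<^sup>2" using e_m inv_f_m by simp
    have "(w m)\<^sup>2 / 4 * ((1 - m)\<^sup>2 / (w m)\<^sup>2 - (1 - v)\<^sup>2 / (w v)\<^sup>2) = (1 - m)\<^sup>2 / 4 - (1 - v)\<^sup>2 / 4 * (w m / w v)\<^sup>2"
      using wm by (simp add: power_divide right_diff_distrib)
    then have "G ((w m)\<^sup>2 / 4) v = ((1 - v)\<^sup>2 - (1 - m)\<^sup>2) / 4 + ((1 - m)\<^sup>2 / 4 - (1 - v)\<^sup>2 / 4 * (w m / w v)\<^sup>2)"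
      unfolding G_def ev by simp
    then have "(1 - v)\<^sup>2 / 4 * (1 - (w m / w v)\<^sup>2) = G ((w m)\<^sup>2 / 4) v"
      by (simp add: right_diff_distrib diff_divide_distrib)
    also have "\<dots> \<le> G q v" using qs_ge q v v1 by (intro G_mono) auto
    finally show ?thesis .
  qed
  show ?thesis
  proof (cases "v \<le> seps \<epsilon>")
    case True
    then show ?thesis using low[OF v(1) True q] by (simp add: min_def)
  next
    case False
    define s where "s = seps \<epsilon>"
    have s: "m < s" "s < v" "s < 1" using m_less_se False se[OF \<epsilon>] by (auto simp: s_def)
    define \<theta> where "\<theta> = ((1 - v) / (1 - s))\<^sup>2"
    have Gv: "G qs u = (1 - u)\<^sup>2 / 4 - qs * e \<epsilon> u" for u
      using qs_e unfolding G_def right_diff_distrib diff_divide_distrib by linarith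
    have "\<theta> * ((1 - s)\<^sup>2 / 4 * (1 - (w m / w s)\<^sup>2)) \<le> \<theta> * G qs s"
      using low[of s qs] s by (intro mult_left_mono) (auto simp: s_def \<theta>_def)
    also have "\<dots> = (1 - v)\<^sup>2 / 4 - qs * (\<theta> * e \<epsilon> s)" using s by (simp add: Gv \<theta>_def power_divide field_simps)
    also have "\<dots> \<le> G qs v"
      using e_high[OF \<epsilon>, of v] False v qs_pos unfolding Gv by (simp add: \<theta>_def s_def)
    also have "\<dots> \<le> G q v" using q v by (rule G_mono)
    finally have "\<theta> * ((1 - s)\<^sup>2 / 4 * (1 - (w m / w s)\<^sup>2)) \<le> G q v" .
    moreover have "\<theta> * ((1 - s)\<^sup>2 / 4 * (1 - (w m / w s)\<^sup>2)) = (1 - v)\<^sup>2 / 4 * (1 - (w m / w s)\<^sup>2)"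
      using s by (simp add: \<theta>_def power_divide)
    ultimately have "(1 - v)\<^sup>2 / 4 * (1 - (w m / w s)\<^sup>2) \<le> G q v" by (simp only:)
    moreover have "min v (seps \<epsilon>) = s" using False by (simp add: min_def s_def)
    ultimately show ?thesis by (simp only:)
  qed
qed

text \<open>This is what the distance between \<open>m\<close> and the truncation level is used for.\<close>

lemma half_gap: assumes "m \<le> v" "v \<le> 1" shows "(v - m) / 2 \<le> min v (seps \<epsilon>) - m"
  using assms mse by (auto simp: min_def field_simps)

lemma tendsto_at_right_continuous:
  fixes g :: "real \<Rightarrow> real"
  assumes "continuous_on {- sqrt (1 - m)..sqrt (1 - m)} g"
  shows "(g \<longlongrightarrow> g 0) (at_right 0)"
proof -
  have s: "0 < sqrt (1 - m)" using m by simp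
  have "isCont g 0" by (rule continuous_on_interior[OF assms]) (use s in auto)
  then show ?thesis unfolding isCont_def by (rule tendsto_mono[rotated]) (simp add: at_le)
qed

text \<open>\<open>B\<close> and \<open>k\<close> are quotients with denominator \<open>y\<^sup>2\<close>; bounds for them extend to \<open>y = 0\<close> by continuity.\<close>

lemma nonzero_suffices:
  assumes g: "continuous_on {- sqrt (1 - m)..sqrt (1 - m)} g" "continuous_on {- sqrt (1 - m)..sqrt (1 - m)} g'"
    and le: "\<And>y. y \<noteq> 0 \<Longrightarrow> \<bar>y\<bar> \<le> sqrt (1 - m) \<Longrightarrow> g y \<le> (g' y :: real)"
    and y: "\<bar>y\<bar> \<le> sqrt (1 - m)"
  shows "g y \<le> g' y"
proof (cases "y = 0")
  case True
  have s: "0 < sqrt (1 - m)" using m by simp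
  have "eventually (\<lambda>y. g y \<le> g' y) (at_right 0)"
    unfolding eventually_at_right[OF s] using le s by (intro exI[of _ "sqrt (1 - m)"]) auto
  then have "g 0 \<le> g' 0"
    by (rule tendsto_le[OF trivial_limit_at_right_real tendsto_at_right_continuous[OF g(2)] tendsto_at_right_continuous[OF g(1)]])
  then show ?thesis using True by simp
qed (use le y in auto)

text \<open>The decisive estimate: the constant depends neither on \<open>\<epsilon>\<close> nor on \<open>q\<close>, and the bound degenerates at
  \<open>v = 1\<close> only quadratically.\<close>

lemma k_lower:
  assumes q: "qs \<le> q" and y: "\<bar>y\<bar> \<le> sqrt (1 - m)"
  shows "dw m / (16 * \<sigma>c) * (1 - (m + y\<^sup>2))\<^sup>2 \<le> k q y"
proof (rule nonzero_suffices[OF _ k_cont _ y])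
  show "continuous_on {- sqrt (1 - m)..sqrt (1 - m)} (\<lambda>y. dw m / (16 * \<sigma>c) * (1 - (m + y\<^sup>2))\<^sup>2)"
    by (intro continuous_intros)
  fix y :: real assume y: "y \<noteq> 0" "\<bar>y\<bar> \<le> sqrt (1 - m)"
  define v where "v = m + y\<^sup>2"
  have v: "m \<le> v" "v \<le> 1" using y_range[of y] y by (auto simp: v_def)
  define u where "u = min v (seps \<epsilon>)"
  have u: "m \<le> u" "u < 1" using v m_less_se se[OF \<epsilon>] by (auto simp: u_def)
  have dm: "0 < dw m" using dw_pos m by simp
  have "dw m / (2 * \<sigma>c) * ((v - m) / 2) \<le> dw m / (2 * \<sigma>c) * (u - m)"
    using half_gap[OF v] dm \<sigma>c_pos by (intro mult_left_mono) (auto simp: u_def)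
  also have "\<dots> \<le> 1 - (w m / w u)\<^sup>2" by (rule w_gap[OF m(1) u])
  finally have "(1 - v)\<^sup>2 / 4 * (dw m / (2 * \<sigma>c) * ((v - m) / 2)) \<le> (1 - v)\<^sup>2 / 4 * (1 - (w m / w u)\<^sup>2)"
    by (intro mult_left_mono) auto
  also have "\<dots> \<le> G q v" using G_lower[OF q v] by (simp add: u_def)
  also have "\<dots> = y\<^sup>2 * k q y" by (simp add: G_k v_def)
  finally have "y\<^sup>2 * (dw m / (16 * \<sigma>c) * (1 - v)\<^sup>2) \<le> y\<^sup>2 * k q y"
    by (simp add: v_def mult_ac)
  then show "dw m / (16 * \<sigma>c) * (1 - (m + y\<^sup>2))\<^sup>2 \<le> k q y"
    unfolding v_def by (rule mult_left_le_imp_le) (use y in simp)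
qed

lemma B_lower:
  assumes y: "\<bar>y\<bar> \<le> sqrt (1 - m)"
  shows "(1 - m) / (2 * (w m)\<^sup>2) \<le> B y"
proof (rule nonzero_suffices[OF _ B_cont _ y])
  show "continuous_on {- sqrt (1 - m)..sqrt (1 - m)} (\<lambda>y. (1 - m) / (2 * (w m)\<^sup>2))" by (rule continuous_on_const)
  fix y :: real assume y: "y \<noteq> 0" "\<bar>y\<bar> \<le> sqrt (1 - m)"
  define v where "v = m + y\<^sup>2"
  have v: "m \<le> v" "v \<le> 1" using y_range[of y] y by (auto simp: v_def)
  define u where "u = min v (seps \<epsilon>)"
  have u: "m \<le> u" "u < 1" "u \<le> seps \<epsilon>" "u \<le> v" using v m_less_se se[OF \<epsilon>] by (auto simp: u_def)
  have "e \<epsilon> u = 1 / (f u)\<^sup>2 - \<epsilon>" using e_low[OF \<epsilon>, of u] u m by simp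
  also have "1 / (f u)\<^sup>2 = (1 - u)\<^sup>2 / (w u)\<^sup>2" using u by (simp add: w_def power_mult_distrib)
  also have "(1 - u)\<^sup>2 / (w u)\<^sup>2 \<le> (1 - u)\<^sup>2 / (w m)\<^sup>2"
    using wm w_le_iff[of m u] u m by (intro divide_left_mono power_mono mult_pos_pos) auto
  finally have "(1 - m)\<^sup>2 / (w m)\<^sup>2 - (1 - u)\<^sup>2 / (w m)\<^sup>2 \<le> e \<epsilon> m - e \<epsilon> u" using e_m inv_f_m by simp
  then have "((1 - m)\<^sup>2 - (1 - u)\<^sup>2) / (w m)\<^sup>2 \<le> e \<epsilon> m - e \<epsilon> u" by (simp add: diff_divide_distrib)
  moreover have "(1 - m) * (u - m) \<le> (1 - m)\<^sup>2 - (1 - u)\<^sup>2"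
  proof -
    have "(1 - m) * (u - m) \<le> (2 - m - u) * (u - m)" using u by (intro mult_right_mono) auto
    also have "\<dots> = (1 - m)\<^sup>2 - (1 - u)\<^sup>2" by (simp add: power2_eq_square algebra_simps)
    finally show ?thesis .
  qed
  moreover have "(1 - m) * ((v - m) / 2) \<le> (1 - m) * (u - m)"
    using half_gap[OF v] m by (intro mult_left_mono) (auto simp: u_def)
  ultimately have "(1 - m) * ((v - m) / 2) / (w m)\<^sup>2 \<le> e \<epsilon> m - e \<epsilon> u"
    by (meson divide_right_mono order_trans zero_le_power2)
  also have "\<dots> \<le> e \<epsilon> m - e \<epsilon> v" using e_antimono[OF \<epsilon>, of u v] u v m by simp
  finally have "y\<^sup>2 * ((1 - m) / (2 * (w m)\<^sup>2)) \<le> e \<epsilon> m - e \<epsilon> (m + y\<^sup>2)" by (simp add: v_def mult_ac)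
  then show "(1 - m) / (2 * (w m)\<^sup>2) \<le> B y" using y by (simp add: B_def pos_le_divide_eq mult.commute)
qed

lemma k_diff:
  assumes q: "qs \<le> q" and y: "\<bar>y\<bar> \<le> sqrt (1 - m)"
  shows "(q - qs) * ((1 - m) / (2 * (w m)\<^sup>2)) \<le> k q y"
proof -
  have "0 \<le> dw m / (16 * \<sigma>c) * (1 - (m + y\<^sup>2))\<^sup>2" using dw_pos[of m] m \<sigma>c_pos by simp
  then have "0 \<le> k qs y" using k_lower[OF order_refl y] by linarith
  moreover have "(q - qs) * ((1 - m) / (2 * (w m)\<^sup>2)) \<le> (q - qs) * B y"
    using B_lower[OF y] q by (intro mult_left_mono) auto
  moreover have "k q y = k qs y + (q - qs) * B y" by (simp add: k_def algebra_simps)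
  ultimately show ?thesis by simp
qed

lemma k_pos: assumes "qs < q" "\<bar>y\<bar> \<le> sqrt (1 - m)" shows "0 < k q y"
proof -
  have "0 < (q - qs) * ((1 - m) / (2 * (w m)\<^sup>2))" using assms m wm by simp
  then show ?thesis using k_diff[of q y] assms by simp
qed

lemma G_upper:
  assumes q: "qs \<le> q" and v: "m \<le> v" "v \<le> 1"
  shows "G q v \<le> (1 - v)\<^sup>2 / 4 + (q - qs) * e \<epsilon> m"
proof -
  have "0 \<le> q * e \<epsilon> v" using q qs_pos e_nonneg[OF \<epsilon>, of v] v m by simp
  moreover have "G q v = (1 - v)\<^sup>2 / 4 + (q - qs) * e \<epsilon> m - q * e \<epsilon> v"
    using qs_e by (simp add: G_def algebra_simps diff_divide_distrib)
  ultimately show ?thesis by simp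
qed

lemma e_le_p: assumes v: "m \<le> v" "v \<le> 1" shows "e \<epsilon> v \<le> (1 - v)\<^sup>2 / (w m)\<^sup>2"
proof -
  have "w m \<le> w (min v (seps \<epsilon>))" using w_le_iff[of m "min v (seps \<epsilon>)"] m v m_less_se se[OF \<epsilon>] by auto
  then have "(1 - v)\<^sup>2 / (w (min v (seps \<epsilon>)))\<^sup>2 \<le> (1 - v)\<^sup>2 / (w m)\<^sup>2"
    using wm by (intro divide_left_mono power_mono mult_pos_pos) auto
  then show ?thesis using e_le[OF \<epsilon>, of v] v m by simp
qed

lemma inv_sqrt_k_cont: "qs < q \<Longrightarrow> continuous_on {- sqrt (1 - m)..sqrt (1 - m)} (\<lambda>y. 1 / sqrt (k q y))"
  using k_pos[of q] by (intro continuous_intros k_cont) (force simp: abs_le_iff)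

lemma T_cont: assumes "qs < q1" shows "continuous_on {q1..q2} T"
proof -
  define Y where "Y = sqrt (1 - m)"
  have "continuous_on ({q1..q2} \<times> cbox 0 Y) (\<lambda>(q, y). 1 / sqrt (k q y))"
    unfolding case_prod_beta
  proof (intro continuous_intros)
    have Bs: "continuous_on ({q1..q2} \<times> cbox 0 Y) (\<lambda>x. B (snd x))"
      by (rule continuous_on_compose2[OF B_cont]) (use m in \<open>auto simp: Y_def intro: order_trans[of _ 0] intro!: continuous_intros\<close>)
    show "continuous_on ({q1..q2} \<times> cbox 0 Y) (\<lambda>x. k (fst x) (snd x))"
      unfolding k_def by (intro continuous_intros Bs) auto
    show "\<forall>x\<in>{q1..q2} \<times> cbox 0 Y. sqrt (k (fst x) (snd x)) \<noteq> 0"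
    proof
      fix x assume "x \<in> {q1..q2} \<times> cbox 0 Y"
      then have "0 < k (fst x) (snd x)" using assms by (intro k_pos) (auto simp: Y_def)
      then show "sqrt (k (fst x) (snd x)) \<noteq> 0" by simp
    qed
  qed
  then have "continuous_on {q1..q2} (\<lambda>q. integral (cbox 0 Y) (\<lambda>y. 1 / sqrt (k q y)))"
    by (intro integral_continuous_on_param) auto
  then show ?thesis unfolding T_def[abs_def] Y_def[symmetric] by (intro continuous_intros) simp
qed

lemma T_upper:
  assumes "qs < q"
  shows "T q \<le> 2 * \<epsilon> * (sqrt (1 - m) / sqrt ((q - qs) * ((1 - m) / (2 * (w m)\<^sup>2))))"
proof -
  define Y b where "Y = sqrt (1 - m)" and "b = (q - qs) * ((1 - m) / (2 * (w m)\<^sup>2))"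
  have b: "0 < b" using assms m wm by (simp add: b_def)
  have Y: "0 \<le> Y" using m by (simp add: Y_def)
  have "integral {0..Y} (\<lambda>y. 1 / sqrt (k q y)) \<le> integral {0..Y} (\<lambda>y. 1 / sqrt b)"
  proof (rule integral_le)
    show "(\<lambda>y. 1 / sqrt (k q y)) integrable_on {0..Y}"
      using Y by (intro integrable_continuous_real continuous_on_subset[OF inv_sqrt_k_cont[OF assms]]) (auto simp: Y_def)
    fix y assume "y \<in> {0..Y}"
    then have "b \<le> k q y" unfolding b_def using assms by (intro k_diff) (auto simp: Y_def)
    then show "1 / sqrt (k q y) \<le> 1 / sqrt b" using b by (intro divide_left_mono) auto
  qed (rule integrable_const_ivl)
  also have "\<dots> = Y / sqrt b" using Y by simp
  finally show ?thesis unfolding T_def Y_def[symmetric] b_def[symmetric] using \<epsilon> by (intro mult_left_mono) auto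
qed

text \<open>From \<open>G q v \<le> (1 - v)\<^sup>2 / 4 + K\<^sup>2\<close> the speed of \<open>v\<close> is at most \<open>((1 - v) / 2 + K) / \<epsilon>\<close>; the travel time
  diverges logarithmically as \<open>q\<close> decreases to \<open>qs\<close>.\<close>

lemma T_lower:
  assumes q: "qs < q" and K: "K = sqrt ((q - qs) * e \<epsilon> m)"
  shows "2 * \<epsilon> * ln ((1 - m) / (2 * K)) \<le> T q"
proof -
  define Y where "Y = sqrt (1 - m)"
  have Y: "0 \<le> Y" using m by (simp add: Y_def)
  have K0: "0 < K" using q e_m_pos by (simp add: K)
  have K2: "K\<^sup>2 = (q - qs) * e \<epsilon> m" using q e_m_pos by (simp add: K)
  have pos: "0 < (1 - (m + y\<^sup>2)) / 2 + K" if "y \<in> {0..Y}" for y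
  proof -
    have "m + y\<^sup>2 \<le> 1" using that y_range[of y] by (auto simp: Y_def)
    then have "0 \<le> (1 - (m + y\<^sup>2)) / 2" by simp
    then show ?thesis using K0 by (rule add_nonneg_pos)
  qed
  have "((\<lambda>y. y / ((1 - (m + y\<^sup>2)) / 2 + K)) has_integral
      - ln ((1 - (m + Y\<^sup>2)) / 2 + K) - - ln ((1 - (m + 0\<^sup>2)) / 2 + K)) {0..Y}"
  proof (rule fundamental_theorem_of_calculus[OF Y])
    fix y assume y: "y \<in> {0..Y}"
    have "((\<lambda>y. - ln ((1 - (m + y\<^sup>2)) / 2 + K)) has_real_derivative y / ((1 - (m + y\<^sup>2)) / 2 + K)) (at y)"
      using pos[OF y] by (auto intro!: derivative_eq_intros)
    then show "((\<lambda>y. - ln ((1 - (m + y\<^sup>2)) / 2 + K)) has_vector_derivative y / ((1 - (m + y\<^sup>2)) / 2 + K)) (at y within {0..Y})"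
      by (simp add: has_real_derivative_iff_has_vector_derivative has_vector_derivative_at_within)
  qed
  moreover have "m + Y\<^sup>2 = 1" using m by (simp add: Y_def)
  ultimately have I: "((\<lambda>y. y / ((1 - (m + y\<^sup>2)) / 2 + K)) has_integral ln ((1 - m) / 2 + K) - ln K) {0..Y}" by simp
  have "ln ((1 - m) / 2 + K) - ln K \<le> integral {0..Y} (\<lambda>y. 1 / sqrt (k q y))"
  proof (rule has_integral_le[OF I integrable_integral])
    show "(\<lambda>y. 1 / sqrt (k q y)) integrable_on {0..Y}"
      using Y by (intro integrable_continuous_real continuous_on_subset[OF inv_sqrt_k_cont[OF q]]) (auto simp: Y_def)
    fix y assume y: "y \<in> {0..Y}"
    define v where "v = m + y\<^sup>2"
    have v: "m \<le> v" "v \<le> 1" using y_range[of y] y by (auto simp: v_def Y_def)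
    have kp: "0 < k q y" using k_pos[OF q, of y] y by (auto simp: Y_def)
    have "y\<^sup>2 * k q y \<le> (1 - v)\<^sup>2 / 4 + K\<^sup>2" using G_upper[of q v] q v by (simp add: G_k v_def K2)
    also have "\<dots> \<le> ((1 - v) / 2 + K)\<^sup>2" using v K0 by (simp add: power2_sum power_divide)
    finally have "(y * sqrt (k q y))\<^sup>2 \<le> ((1 - v) / 2 + K)\<^sup>2" using kp by (simp add: power_mult_distrib)
    moreover have "0 \<le> (1 - v) / 2 + K" using v K0 by simp
    ultimately have "y * sqrt (k q y) \<le> (1 - v) / 2 + K" by (rule power2_le_imp_le)
    then show "y / ((1 - (m + y\<^sup>2)) / 2 + K) \<le> 1 / sqrt (k q y)"
      using pos[OF y] kp by (simp add: v_def field_simps)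
  qed
  moreover have "ln ((1 - m) / (2 * K)) \<le> ln ((1 - m) / 2 + K) - ln K"
  proof -
    have "ln ((1 - m) / (2 * K)) = ln ((1 - m) / 2) - ln K" using m K0 by (simp add: ln_div ln_mult)
    also have "ln ((1 - m) / 2) \<le> ln ((1 - m) / 2 + K)" using m K0 by (intro ln_mono) auto
    finally show ?thesis by simp
  qed
  ultimately show ?thesis unfolding T_def Y_def[symmetric] using \<epsilon> by (intro mult_left_mono) auto
qed

text \<open>Intermediate value theorem between \<open>qs + \<epsilon>\<close>, where the travel time is at most \<open>L / 2\<close>, and a point
  so close to \<open>qs\<close> that the logarithmic lower bound exceeds \<open>L / 2\<close>.\<close>

lemma travel_time_attained:
  assumes L: "0 < L" and small: "2 * \<epsilon> * (sqrt (1 - m) / sqrt (\<epsilon> * ((1 - m) / (2 * (w m)\<^sup>2)))) \<le> L / 2"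
  shows "\<exists>q. qs < q \<and> q \<le> qs + \<epsilon> \<and> T q = L / 2"
proof -
  \<comment> \<open>chosen so that \<open>2 \<epsilon> ln ((1 - m) / (2 K0)) = L / 2\<close>\<close>
  define K0 where "K0 = (1 - m) / 2 * exp (- (L / (4 * \<epsilon>)))"
  have K0: "0 < K0" using m by (simp add: K0_def)
  define d where "d = min \<epsilon> (K0\<^sup>2 / e \<epsilon> m)"
  have d: "0 < d" "d \<le> \<epsilon>" using \<epsilon> K0 e_m_pos by (auto simp: d_def)
  define K where "K = sqrt (d * e \<epsilon> m)"
  have K: "0 < K" using d e_m_pos by (simp add: K_def)
  have "d * e \<epsilon> m \<le> K0\<^sup>2 / e \<epsilon> m * e \<epsilon> m" using e_m_pos by (intro mult_right_mono) (auto simp: d_def)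
  then have "K \<le> K0" using e_m_pos K0 real_sqrt_le_mono[of "d * e \<epsilon> m" "K0\<^sup>2"] by (simp add: K_def)
  then have "(1 - m) / (2 * K0) \<le> (1 - m) / (2 * K)" using K m by (intro divide_left_mono) auto
  then have "ln ((1 - m) / (2 * K0)) \<le> ln ((1 - m) / (2 * K))" using K0 m by (intro ln_mono) auto
  moreover have "(1 - m) / (2 * K0) = exp (L / (4 * \<epsilon>))" using m by (simp add: K0_def exp_minus field_simps)
  ultimately have "L / (4 * \<epsilon>) \<le> ln ((1 - m) / (2 * K))" by simp
  then have "2 * \<epsilon> * (L / (4 * \<epsilon>)) \<le> 2 * \<epsilon> * ln ((1 - m) / (2 * K))" using \<epsilon> by (intro mult_left_mono) auto
  also have "\<dots> \<le> T (qs + d)" using d by (intro T_lower) (auto simp: K_def)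
  finally have low: "L / 2 \<le> T (qs + d)" using \<epsilon> by simp
  have up: "T (qs + \<epsilon>) \<le> L / 2" using T_upper[of "qs + \<epsilon>"] \<epsilon> small by simp
  have "\<exists>x. qs + d \<le> x \<and> x \<le> qs + \<epsilon> \<and> T x = L / 2"
    using low up d by (intro IVT2' T_cont) auto
  then obtain x where "qs + d \<le> x" "x \<le> qs + \<epsilon>" "T x = L / 2" by blast
  then show ?thesis using d by (intro exI[of _ x]) auto
qed

end

end

section \<open>The critical point with a prescribed minimum\<close>

lemma integral_cong_AE_integrable:
  fixes R L :: "real \<Rightarrow> real"
  assumes "integrable lebesgue R" "AE x in lebesgue. L x = R x"
  shows "(LINT x|lebesgue. L x) = (LINT x|lebesgue. R x)"
proof (rule integral_cong_AE[OF _ _ assms(2)])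
  show R: "R \<in> borel_measurable lebesgue" using assms(1) by simp
  have "AE x in lebesgue. R x = L x" using assms(2) by eventually_elim simp
  then show "L \<in> borel_measurable lebesgue" using borel_measurable_AE[OF R] by blast
qed

lemma continuous_on_interval_L2:
  fixes g :: "real \<Rightarrow> real"
  assumes g: "continuous_on {a..b} g"
  shows "g \<in> L2_on {a<..<b}" "locally_integrable_on g {a<..<b}"
    "integrable (lebesgue_on {a<..<b}) g" "(LINT x|lebesgue_on {a<..<b}. g x) = integral {a..b} g"
proof -
  interpret finite_measure "lebesgue_on {a<..<b}" by (rule finite_measure_lebesgue_on) simp
  have c: "continuous_on {a<..<b} g" by (rule continuous_on_subset[OF g]) auto
  have m: "g \<in> borel_measurable (lebesgue_on {a<..<b})"
    using c by (simp add: continuous_imp_measurable_on_sets_lebesgue)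
  obtain C where "\<forall>x\<in>{a..b}. \<bar>g x\<bar> \<le> C"
    using compact_imp_bounded[OF compact_continuous_image[OF g]] by (auto simp: bounded_iff)
  then have C: "\<And>x. x \<in> {a..b} \<Longrightarrow> \<bar>g x\<bar> \<le> C" by blast
  show i: "integrable (lebesgue_on {a<..<b}) g"
    using C by (intro integrable_const_bound[of _ C] m) (auto simp: space_restrict_space)
  have "\<bar>(g x)\<^sup>2\<bar> \<le> C\<^sup>2" if "x \<in> {a..b}" for x
    using power_mono[OF C[OF that], of 2] by simp
  then have "integrable (lebesgue_on {a<..<b}) (\<lambda>x. (g x)\<^sup>2)"
    using m by (intro integrable_const_bound[of _ "C\<^sup>2"]) (auto simp: space_restrict_space)
  then show "g \<in> L2_on {a<..<b}" using m by (simp add: L2_on_def)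
  show "locally_integrable_on g {a<..<b}" by (rule locally_integrable_on_continuous[OF c])
  have "(LINT x|lebesgue_on {a<..<b}. g x) = integral {a<..<b} g"
    by (rule lebesgue_integral_eq_integral[OF i]) simp
  then show "(LINT x|lebesgue_on {a<..<b}. g x) = integral {a..b} g"
    by (simp add: integral_open_interval_real)
qed

context truncated
begin

context
  fixes \<epsilon> m q L :: real
  assumes \<epsilon>: "\<epsilon> > 0" and m: "0 < m" "m < 1" and mse: "(1 + m) / 2 \<le> seps \<epsilon>"
    and q: "qs \<epsilon> m < q" and L: "L > 0" and TL: "T \<epsilon> m q = L / 2"
begin

abbreviation Y where "Y \<equiv> sqrt (1 - m)"
text \<open>The speed of \<open>y = \<plusminus> \<surd>(v - m)\<close>, so that \<open>y' = KK y\<close>.\<close>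

definition KK :: "real \<Rightarrow> real" where "KK z = sqrt (k \<epsilon> m q z) / (2 * \<epsilon>)"
text \<open>The solution centred at the minimum of \<open>v\<close>; the actual one is shifted to the midpoint \<open>L / 2\<close>.\<close>

definition yy :: "real \<Rightarrow> real" where
  "yy = (SOME y. y 0 = 0 \<and> y (L / 2) = Y \<and> y (- (L / 2)) = - Y \<and>
    (\<forall>t\<in>{-(L / 2)..L / 2}. y t \<in> {-Y..Y} \<and> (y has_real_derivative KK (y t)) (at t)))"
definition y :: "real \<Rightarrow> real" where "y x = yy (x - L / 2)"
definition v :: "real \<Rightarrow> real" where "v x = m + (y x)\<^sup>2"
definition dv :: "real \<Rightarrow> real" where "dv x = 2 * y x * KK (y x)"
definition du :: "real \<Rightarrow> real" where "du x = sqrt q / (h \<epsilon> (v x))\<^sup>2"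
definition u :: "real \<Rightarrow> real" where "u x = integral {0..x} du"

lemmas P = \<epsilon> m mse

lemma Y_pos: "0 < Y" using m by simp

lemma q_pos: "0 < q" using qs_pos[OF P] q by simp

lemma KK: "continuous_on {-Y..Y} KK" "z \<in> {-Y..Y} \<Longrightarrow> 0 < KK z" "KK (- z) = KK z"
proof -
  show "continuous_on {-Y..Y} KK" unfolding KK_def[abs_def] using \<epsilon> by (intro continuous_intros k_cont[OF P]) auto
  show "z \<in> {-Y..Y} \<Longrightarrow> 0 < KK z" using k_pos[OF P q, of z] \<epsilon> by (auto simp: KK_def abs_le_iff)
  show "KK (- z) = KK z" by (simp add: KK_def k_even[OF P])
qed

lemma yy: "yy 0 = 0" "yy (L / 2) = Y" "yy (- (L / 2)) = - Y"
  "t \<in> {-(L / 2)..L / 2} \<Longrightarrow> yy t \<in> {-Y..Y} \<and> (yy has_real_derivative KK (yy t)) (at t)"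
proof -
  have "integral {0..Y} (\<lambda>z. 1 / KK z) = integral {0..Y} (\<lambda>z. 2 * \<epsilon> * (1 / sqrt (k \<epsilon> m q z)))"
    by (simp add: KK_def)
  also have "\<dots> = T \<epsilon> m q" unfolding T_def[OF P] by (rule integral_mult_right)
  finally have "L / 2 = integral {0..Y} (\<lambda>z. 1 / KK z)" using TL by simp
  from autonomous_ode[OF Y_pos KK(1) KK(2) KK(3) this]
  have "\<exists>y. y 0 = 0 \<and> y (L / 2) = Y \<and> y (- (L / 2)) = - Y \<and>
    (\<forall>t\<in>{-(L / 2)..L / 2}. y t \<in> {-Y..Y} \<and> (y has_real_derivative KK (y t)) (at t))" by blast
  from someI_ex[OF this, folded yy_def]
  show "yy 0 = 0" "yy (L / 2) = Y" "yy (- (L / 2)) = - Y"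
    "t \<in> {-(L / 2)..L / 2} \<Longrightarrow> yy t \<in> {-Y..Y} \<and> (yy has_real_derivative KK (yy t)) (at t)" by blast+
qed

lemma y: "y 0 = - Y" "y (L / 2) = 0" "y L = Y"
  "x \<in> {0..L} \<Longrightarrow> y x \<in> {-Y..Y}" "x \<in> {0..L} \<Longrightarrow> (y has_real_derivative KK (y x)) (at x)"
proof -
  show "y 0 = - Y" "y (L / 2) = 0" "y L = Y" using yy(1-3) by (simp_all add: y_def)
  assume "x \<in> {0..L}"
  then have x: "x - L / 2 \<in> {-(L / 2)..L / 2}" by auto
  show "y x \<in> {-Y..Y}" using yy(4)[OF x] by (simp add: y_def)
  have "((\<lambda>x. yy (x - L / 2)) has_real_derivative KK (yy (x - L / 2)) * 1) (at x)"
    using yy(4)[OF x] by (intro DERIV_chain2[where g="\<lambda>x. x - L / 2"]) (auto intro!: derivative_eq_intros)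
  then show "(y has_real_derivative KK (y x)) (at x)" by (simp add: y_def[abs_def])
qed

lemma y_less: assumes "0 \<le> a" "a < b" "b \<le> L" shows "y a < y b"
proof (rule DERIV_pos_imp_increasing[OF assms(2)])
  fix x assume "a \<le> x" "x \<le> b"
  then have x: "x \<in> {0..L}" using assms by auto
  show "\<exists>d. (y has_real_derivative d) (at x) \<and> 0 < d"
    by (intro exI conjI) (rule y(5)[OF x], rule KK(2)[OF y(4)[OF x]])
qed

lemma y_le: "0 \<le> a \<Longrightarrow> a \<le> b \<Longrightarrow> b \<le> L \<Longrightarrow> y a \<le> y b"
  using y_less[of a b] by (cases "a = b") auto

lemma y_sign: "x \<in> {0..L} \<Longrightarrow> x < L / 2 \<Longrightarrow> y x < 0" "x \<in> {0..L} \<Longrightarrow> L / 2 < x \<Longrightarrow> 0 < y x"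
  "x \<in> {0..L} \<Longrightarrow> L / 2 \<le> x \<Longrightarrow> 0 \<le> y x" "x \<in> {0..L} \<Longrightarrow> x \<le> L / 2 \<Longrightarrow> y x \<le> 0"
  using y_less[of x "L / 2"] y_less[of "L / 2" x] y_le[of x "L / 2"] y_le[of "L / 2" x] y(2) L by auto

lemma y_cont: "continuous_on {0..L} y"
  using y(5) by (meson DERIV_isCont continuous_at_imp_continuous_on)

lemma y_substitution:
  assumes F: "continuous_on {-Y..Y} F" and ab: "0 \<le> a" "a \<le> b" "b \<le> L"
  shows "((\<lambda>x. F (y x)) has_integral integral {y a..y b} (\<lambda>z. F z / KK z)) {a..b}"
proof -
  have ne: "KK z \<noteq> 0" if "z \<in> {-Y..Y}" for z using KK(2)[OF that] by simp
  have "((\<lambda>x. KK (y x) *\<^sub>R (F (y x) / KK (y x))) has_integral integral {y a..y b} (\<lambda>z. F z / KK z)) {a..b}"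
  proof (rule has_integral_substitution[OF ab(2) y_le[OF ab]])
    show "y ` {a..b} \<subseteq> {-Y..Y}"
    proof
      fix z assume "z \<in> y ` {a..b}"
      then obtain x where x: "z = y x" "x \<in> {0..L}" using ab by auto
      show "z \<in> {-Y..Y}" unfolding x(1) by (rule y(4)[OF x(2)])
    qed
    show "continuous_on {-Y..Y} (\<lambda>z. F z / KK z)" using ne by (intro continuous_intros F KK) auto
    fix x assume "x \<in> {a..b}"
    then have "x \<in> {0..L}" using ab by auto
    then show "(y has_real_derivative KK (y x)) (at x within {a..b})"
      by (rule has_field_derivative_at_within[OF y(5)])
  qed
  moreover have "KK (y x) *\<^sub>R (F (y x) / KK (y x)) = F (y x)" if "x \<in> {a..b}" for x
  proof -
    have "x \<in> {0..L}" using that ab by auto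
    then have "KK (y x) \<noteq> 0" using ne y(4) by blast
    then show ?thesis by simp
  qed
  ultimately show ?thesis by (rule has_integral_eq[rotated])
qed

lemma v_range: assumes "x \<in> {0..L}" shows "m \<le> v x" "v x \<le> 1" "0 < v x"
proof -
  have "\<bar>y x\<bar> \<le> Y" using y(4)[OF assms] by auto
  then show "v x \<le> 1" using y_range[OF P] by (simp add: v_def)
  show "m \<le> v x" by (simp add: v_def)
  then show "0 < v x" using m by simp
qed

lemma v_ends: "v 0 = 1" "v L = 1" "v (L / 2) = m"
  using y(1-3) m by (simp_all add: v_def)

lemma v_deriv: "x \<in> {0..L} \<Longrightarrow> (v has_real_derivative dv x) (at x)"
  unfolding v_def[abs_def] dv_def by (auto intro!: derivative_eq_intros y(5))

lemma v_cont: "continuous_on {0..L} v"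
  unfolding v_def[abs_def] by (intro continuous_intros y_cont)

lemma dv_cont: "continuous_on {0..L} dv"
  unfolding dv_def[abs_def] using y(4)
  by (intro continuous_intros y_cont continuous_on_compose2[OF KK(1) y_cont]) auto

lemma hv_cont: "continuous_on {0..L} (\<lambda>x. h \<epsilon> (v x))"
  by (rule continuous_on_compose2[OF h_cont[OF \<epsilon>] v_cont]) (use v_range in auto)

lemma hv_pos: "x \<in> {0..L} \<Longrightarrow> 0 < h \<epsilon> (v x)"
  using h_pos[OF \<epsilon>] v_range by blast

lemma du_cont: "continuous_on {0..L} du"
  unfolding du_def[abs_def] using hv_pos by (intro continuous_intros hv_cont) force

lemma G_eq: "G \<epsilon> m q (v x) = (y x)\<^sup>2 * k \<epsilon> m q (y x)"
  by (simp add: G_k[OF P] v_def)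

lemma k_y_pos: "x \<in> {0..L} \<Longrightarrow> 0 < k \<epsilon> m q (y x)"
  using k_pos[OF P q, of "y x"] y(4)[of x] by auto

lemma dv_sq: assumes "x \<in> {0..L}" shows "(\<epsilon> * dv x)\<^sup>2 = G \<epsilon> m q (v x)"
  using k_y_pos[OF assms] \<epsilon> by (simp add: dv_def KK_def G_eq power_mult_distrib)

lemma dv_right: assumes "x \<in> {0..L}" "L / 2 \<le> x" shows "0 \<le> dv x" "dv x = sqrt (G \<epsilon> m q (v x)) / \<epsilon>"
proof -
  show 0: "0 \<le> dv x" using y_sign(3)[OF assms] KK(2)[OF y(4)[OF assms(1)]] by (simp add: dv_def)
  have "0 \<le> \<epsilon> * dv x" using 0 \<epsilon> by simp
  then have "\<epsilon> * dv x = sqrt ((\<epsilon> * dv x)\<^sup>2)" unfolding real_sqrt_abs by simp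
  then have "\<epsilon> * dv x = sqrt (G \<epsilon> m q (v x))" unfolding dv_sq[OF assms(1)] .
  then show "dv x = sqrt (G \<epsilon> m q (v x)) / \<epsilon>" using \<epsilon> by (simp add: field_simps)
qed

lemma dv_left: assumes "x \<in> {0..L}" "x \<le> L / 2" shows "dv x \<le> 0" "dv x = - sqrt (G \<epsilon> m q (v x)) / \<epsilon>"
proof -
  show 0: "dv x \<le> 0" using y_sign(4)[OF assms] KK(2)[OF y(4)[OF assms(1)]] by (simp add: dv_def mult_le_0_iff)
  have "0 \<le> \<epsilon> * (- dv x)" using 0 \<epsilon> by (intro mult_nonneg_nonneg) auto
  then have "\<epsilon> * (- dv x) = sqrt ((\<epsilon> * (- dv x))\<^sup>2)" unfolding real_sqrt_abs by (rule abs_of_nonneg[symmetric])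
  also have "(\<epsilon> * (- dv x))\<^sup>2 = (\<epsilon> * dv x)\<^sup>2" by (simp add: power2_eq_square)
  finally have "\<epsilon> * (- dv x) = sqrt (G \<epsilon> m q (v x))" unfolding dv_sq[OF assms(1)] .
  then show "dv x = - sqrt (G \<epsilon> m q (v x)) / \<epsilon>" using \<epsilon> by (simp add: field_simps)
qed

text \<open>The value which the Euler-Lagrange equation prescribes for \<open>(\<epsilon> v')'\<close>.\<close>

definition EL :: "real \<Rightarrow> real" where
  "EL x = h \<epsilon> (v x) * dh \<epsilon> (v x) * (du x)\<^sup>2 + (v x - 1) / (4 * \<epsilon>)"

lemma G_deriv: assumes "x \<in> {0..L}"
  shows "(G \<epsilon> m q has_real_derivative 2 * \<epsilon> * EL x) (at (v x))"
proof -
  have h0: "h \<epsilon> (v x) > 0" using hv_pos[OF assms] .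
  have "((\<lambda>w. ((1 - w)\<^sup>2 - (1 - m)\<^sup>2) / 4 + q * (e \<epsilon> m - e \<epsilon> w)) has_real_derivative
     - (1 - v x) / 2 + q * (0 - - 2 * \<epsilon> * dh \<epsilon> (v x) / h \<epsilon> (v x) ^ 3)) (at (v x))"
  proof (rule DERIV_add)
    show "((\<lambda>w. ((1 - w)\<^sup>2 - (1 - m)\<^sup>2) / 4) has_real_derivative - (1 - v x) / 2) (at (v x))"
      by (auto intro!: derivative_eq_intros simp: field_simps)
  qed (intro DERIV_cmult DERIV_diff DERIV_const e_deriv[OF \<epsilon> v_range(3,2)[OF assms]])
  moreover have "- (1 - v x) / 2 + q * (0 - - 2 * \<epsilon> * dh \<epsilon> (v x) / h \<epsilon> (v x) ^ 3) = 2 * \<epsilon> * EL x"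
    using h0 \<epsilon> q_pos by (simp add: EL_def du_def power_divide field_simps power2_eq_square power3_eq_cube)
  ultimately show ?thesis by (simp add: G_def[OF P, abs_def])
qed

text \<open>Differentiate the first integral and divide by \<open>v'\<close>. This fails at \<open>L / 2\<close>, where \<open>v' = 0\<close>; one point is
  harmless for weak derivatives because \<open>\<epsilon> v'\<close> is continuous there.\<close>

lemma dv_deriv:
  assumes x: "x \<in> {0<..<L} - {L / 2}"
  shows "((\<lambda>x. \<epsilon> * dv x) has_real_derivative EL x) (at x)"
proof -
  have xL: "x \<in> {0..L}" using x by auto
  define s :: real where "s = (if L / 2 < x then 1 else - 1)"
  have y0: "y x \<noteq> 0" using y_sign(1,2)[OF xL] x by (cases "x < L / 2") auto
  have Gp: "0 < G \<epsilon> m q (v x)" using k_y_pos[OF xL] y0 by (simp add: G_eq)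
  have dvx: "dv x = s * sqrt (G \<epsilon> m q (v x)) / \<epsilon>"
    using dv_right(2)[OF xL] dv_left(2)[OF xL] by (auto simp: s_def)
  have "((\<lambda>x. s * sqrt (G \<epsilon> m q (v x))) has_real_derivative
      s * (inverse (sqrt (G \<epsilon> m q (v x))) / 2 * (2 * \<epsilon> * EL x * dv x))) (at x)"
    by (intro DERIV_cmult DERIV_chain2[where f = sqrt and g = "\<lambda>x. G \<epsilon> m q (v x)", OF DERIV_real_sqrt[OF Gp]]
          DERIV_chain2[OF G_deriv[OF xL] v_deriv[OF xL]])
  moreover have "s * (inverse (sqrt (G \<epsilon> m q (v x))) / 2 * (2 * \<epsilon> * EL x * dv x)) = EL x"
    using Gp \<epsilon> by (simp add: dvx s_def)
  ultimately have d: "((\<lambda>x. s * sqrt (G \<epsilon> m q (v x))) has_real_derivative EL x) (at x)" by (simp only:)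
  show ?thesis
  proof (rule has_field_derivative_transform_within_open[OF d, where S="if L / 2 < x then {L / 2<..<L} else {0<..<L / 2}"])
    fix z assume z: "z \<in> (if L / 2 < x then {L / 2<..<L} else {0<..<L / 2})"
    then have "z \<in> {0..L}" using L by (auto split: if_splits)
    then show "s * sqrt (G \<epsilon> m q (v z)) = \<epsilon> * dv z"
      using dv_right(2)[of z] dv_left(2)[of z] z \<epsilon> by (auto simp: s_def split: if_splits)
  qed (use x in auto)
qed

lemma EL_cont: "continuous_on {0..L} EL"
proof -
  have "continuous_on {0..L} (\<lambda>x. dh \<epsilon> (v x))"
    by (rule continuous_on_compose2[OF dh_cont[OF \<epsilon>, of m] v_cont]) (use m m_less_se[OF P] v_range in auto)
  then show ?thesis unfolding EL_def[abs_def] using \<epsilon> by (intro continuous_intros hv_cont du_cont v_cont) auto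
qed

lemma u_deriv: "x \<in> {0..L} \<Longrightarrow> (u has_real_derivative du x) (at x within {0..L})"
  unfolding u_def[abs_def] by (intro integral_has_real_derivative du_cont)

lemma u_cont: "continuous_on {0..L} u"
  using u_deriv DERIV_continuous_on by blast

abbreviation "I \<equiv> {0<..<L}"

lemma I_props: "open I" "is_interval I" "I \<noteq> {}" using L by (auto simp: is_interval_oo)

lemma weak_derivs:
  "has_weak_deriv_on u du I" "has_weak_deriv_on v dv I" "has_weak_deriv_on (\<lambda>x. \<epsilon> * dv x) EL I"
proof -
  have sub: "I \<subseteq> {0..L}" by auto
  show "has_weak_deriv_on u du I"
  proof (rule has_weak_deriv_on_piecewise_C1[OF I_props continuous_on_subset[OF u_cont sub] finite.emptyI])
    fix x assume "x \<in> I - {}"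
    then show "(u has_real_derivative du x) (at x)" using u_deriv[of x] by (auto simp: at_within_Icc_at)
  qed (rule continuous_on_interval_L2(2)[OF du_cont])
  show "has_weak_deriv_on v dv I"
    by (rule has_weak_deriv_on_piecewise_C1[OF I_props continuous_on_subset[OF v_cont sub] finite.emptyI])
       (use v_deriv continuous_on_interval_L2(2)[OF dv_cont] in auto)
  have "continuous_on {0..L} (\<lambda>x. \<epsilon> * dv x)" by (intro continuous_intros dv_cont)
  then show "has_weak_deriv_on (\<lambda>x. \<epsilon> * dv x) EL I"
    by (intro has_weak_deriv_on_piecewise_C1[OF I_props, of _ "{L / 2}"] dv_deriv
         continuous_on_interval_L2(2)[OF EL_cont] continuous_on_subset[OF _ sub]) auto
qed

lemma H1: "u \<in> H1_on I" "v \<in> H1_on I"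
  unfolding H1_on_def
  using continuous_on_interval_L2(1)[OF u_cont] continuous_on_interval_L2(1)[OF v_cont]
    continuous_on_interval_L2(1)[OF du_cont] continuous_on_interval_L2(1)[OF dv_cont] weak_derivs(1,2) by blast+

lemma weak_AE: "AE x in lebesgue. x \<in> I \<longrightarrow> weak_deriv_on I u x = du x"
  "AE x in lebesgue. x \<in> I \<longrightarrow> weak_deriv_on I v x = dv x"
  using weak_deriv_on_AE_eq(2)[OF weak_derivs(1) I_props] weak_deriv_on_AE_eq(2)[OF weak_derivs(2) I_props] .

lemma critical: "critical_point L (h \<epsilon>) \<epsilon> (u L) u v"
proof -
  define u' v' where "u' = weak_deriv_on I u" and "v' = weak_deriv_on I v"
  have 1: "(LINT x:I|lebesgue. \<epsilon> * v' x * deriv \<phi> x + h \<epsilon> (v x) * deriv (h \<epsilon>) (v x) * (u' x)\<^sup>2 * \<phi> x + (v x - 1) / (4 * \<epsilon>) * \<phi> x) = 0"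
    if t: "test_function I \<phi>" for \<phi>
  proof -
    have l: "locally_integrable_on (\<lambda>x. \<epsilon> * dv x) I" "locally_integrable_on EL I"
      using weak_derivs(3) by (auto simp: has_weak_deriv_on_def)
    note si = set_integrable_times_test(2)[OF l(1) I_props t] set_integrable_times_test(1)[OF l(2) I_props t]
    have "(LINT x:I|lebesgue. \<epsilon> * dv x * deriv \<phi> x + EL x * \<phi> x) = 0"
      using set_integral_add(2)[OF si] weak_derivs(3) t unfolding has_weak_deriv_on_def by simp
    moreover have "(LINT x:I|lebesgue. \<epsilon> * v' x * deriv \<phi> x + h \<epsilon> (v x) * deriv (h \<epsilon>) (v x) * (u' x)\<^sup>2 * \<phi> x + (v x - 1) / (4 * \<epsilon>) * \<phi> x)
      = (LINT x:I|lebesgue. \<epsilon> * dv x * deriv \<phi> x + EL x * \<phi> x)"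
      unfolding set_lebesgue_integral_def
    proof (rule integral_cong_AE_integrable)
      show "integrable lebesgue (\<lambda>x. indicator I x *\<^sub>R (\<epsilon> * dv x * deriv \<phi> x + EL x * \<phi> x))"
        using set_integral_add(1)[OF si] unfolding set_integrable_def .
      show "AE x in lebesgue. indicator I x *\<^sub>R (\<epsilon> * v' x * deriv \<phi> x + h \<epsilon> (v x) * deriv (h \<epsilon>) (v x) * (u' x)\<^sup>2 * \<phi> x + (v x - 1) / (4 * \<epsilon>) * \<phi> x)
         = indicator I x *\<^sub>R (\<epsilon> * dv x * deriv \<phi> x + EL x * \<phi> x)"
        using weak_AE
      proof eventually_elim
        case (elim x)
        show ?case
        proof (cases "x \<in> I")
          case True
          then have "deriv (h \<epsilon>) (v x) = dh \<epsilon> (v x)" using v_range[of x] by (intro deriv_h[OF \<epsilon>]) auto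
          then show ?thesis using elim True by (simp add: u'_def v'_def EL_def algebra_simps)
        qed simp
      qed
    qed
    ultimately show ?thesis by simp
  qed
  have 2: "(LINT x:I|lebesgue. (h \<epsilon> (v x))\<^sup>2 * u' x * deriv \<phi> x) = 0" if t: "test_function I \<phi>" for \<phi>
  proof -
    have wd: "has_weak_deriv_on (\<lambda>x. sqrt q) (\<lambda>x. 0) I"
      by (rule has_weak_deriv_on_piecewise_C1[OF I_props _ finite.emptyI])
         (auto intro: locally_integrable_on_continuous)
    then have l: "locally_integrable_on (\<lambda>x. sqrt q) I" by (auto simp: has_weak_deriv_on_def)
    note si = set_integrable_times_test(2)[OF l I_props t]
    have "(LINT x:I|lebesgue. sqrt q * deriv \<phi> x) = - (LINT x:I|lebesgue. 0 * \<phi> x)"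
      using wd t unfolding has_weak_deriv_on_def by blast
    then have "(LINT x:I|lebesgue. sqrt q * deriv \<phi> x) = 0" by (simp add: set_lebesgue_integral_def)
    moreover have "(LINT x:I|lebesgue. (h \<epsilon> (v x))\<^sup>2 * u' x * deriv \<phi> x) = (LINT x:I|lebesgue. sqrt q * deriv \<phi> x)"
      unfolding set_lebesgue_integral_def
    proof (rule integral_cong_AE_integrable)
      show "integrable lebesgue (\<lambda>x. indicator I x *\<^sub>R (sqrt q * deriv \<phi> x))"
        using si unfolding set_integrable_def .
      show "AE x in lebesgue. indicator I x *\<^sub>R ((h \<epsilon> (v x))\<^sup>2 * u' x * deriv \<phi> x) = indicator I x *\<^sub>R (sqrt q * deriv \<phi> x)"
        using weak_AE
      proof eventually_elim
        case (elim x)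
        show ?case
        proof (cases "x \<in> I")
          case True
          then have "h \<epsilon> (v x) \<noteq> 0" using hv_pos[of x] by auto
          then show ?thesis using elim True by (simp add: u'_def du_def)
        qed simp
      qed
    qed
    ultimately show ?thesis by simp
  qed
  show ?thesis
    unfolding critical_point_def Let_def
    using 1 2 H1 u_cont v_cont v_ends by (simp add: u'_def v'_def u_def)
qed

text \<open>The part of \<open>u'\<close> in excess of the constant \<open>\<surd>q\<close>; it becomes the jump, and \<open>J\<close> is its mass.\<close>

definition \<rho> :: "real \<Rightarrow> real" where "\<rho> x = sqrt q * e \<epsilon> (v x) / \<epsilon>"
definition J :: real where "J = 4 * sqrt q * integral {0..Y} (\<lambda>z. e \<epsilon> (m + z\<^sup>2) / sqrt (k \<epsilon> m q z))"

lemma du_\<rho>: "du x = sqrt q + \<rho> x"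
  using \<epsilon> by (simp add: du_def \<rho>_def e_def[OF \<epsilon>] right_diff_distrib diff_divide_distrib)

lemma z_range: "z \<in> {-Y..Y} \<Longrightarrow> m \<le> m + z\<^sup>2 \<and> m + z\<^sup>2 \<le> 1 \<and> 0 < m + z\<^sup>2"
  using y_range[OF P, of z] m by (auto simp: abs_le_iff add_pos_nonneg)

lemma e_z_cont: "continuous_on {-Y..Y} (\<lambda>z. e \<epsilon> (m + z\<^sup>2))"
  by (rule continuous_on_compose2[OF e_cont[OF \<epsilon>]]) (use z_range in \<open>auto intro!: continuous_intros\<close>)

lemma \<rho>_cont: "continuous_on {0..L} \<rho>"
proof -
  have "continuous_on {0..L} (\<lambda>x. du x - sqrt q)" by (intro continuous_intros du_cont)
  then show ?thesis by (simp add: du_\<rho>)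
qed

lemma \<rho>_nonneg: "x \<in> {0..L} \<Longrightarrow> 0 \<le> \<rho> x"
  using e_nonneg[OF \<epsilon>, of "v x"] v_range[of x] q_pos \<epsilon> by (simp add: \<rho>_def)

lemma sqrt_k_ne: "z \<in> {-Y..Y} \<Longrightarrow> sqrt (k \<epsilon> m q z) \<noteq> 0"
  using k_pos[OF P q, of z] by (auto simp: abs_le_iff)

lemma \<rho>_integral: "(\<rho> has_integral J) {0..L}"
proof -
  define F where "F z = sqrt q * e \<epsilon> (m + z\<^sup>2) / \<epsilon>" for z
  have Fc: "continuous_on {-Y..Y} F" unfolding F_def using \<epsilon> by (intro continuous_intros e_z_cont) auto
  have FK: "F z / KK z = 2 * sqrt q * (e \<epsilon> (m + z\<^sup>2) / sqrt (k \<epsilon> m q z))" for z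
    using \<epsilon> by (simp add: F_def KK_def)
  have c: "continuous_on {-Y..Y} (\<lambda>z. 2 * sqrt q * (e \<epsilon> (m + z\<^sup>2) / sqrt (k \<epsilon> m q z)))"
    using sqrt_k_ne by (intro continuous_intros e_z_cont k_cont[OF P]) auto
  have "((\<lambda>x. F (y x)) has_integral integral {y 0..y L} (\<lambda>z. F z / KK z)) {0..L}"
    using L by (intro y_substitution[OF Fc]) auto
  moreover have "integral {y 0..y L} (\<lambda>z. F z / KK z) = 2 * integral {0..Y} (\<lambda>z. 2 * sqrt q * (e \<epsilon> (m + z\<^sup>2) / sqrt (k \<epsilon> m q z)))"
    unfolding y(1,3) FK using Y_pos
    by (intro integral_even integrable_continuous_real c) (auto simp: k_even[OF P])
  moreover have "integral {0..Y} (\<lambda>z. 2 * sqrt q * (e \<epsilon> (m + z\<^sup>2) / sqrt (k \<epsilon> m q z)))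
     = 2 * sqrt q * integral {0..Y} (\<lambda>z. e \<epsilon> (m + z\<^sup>2) / sqrt (k \<epsilon> m q z))"
    by (rule integral_mult_right)
  moreover have "F (y x) = \<rho> x" for x by (simp add: F_def \<rho>_def v_def)
  ultimately show ?thesis by (simp add: J_def mult.assoc)
qed

lemma u_L: "u L = sqrt q * L + J"
proof -
  have "((\<lambda>x. sqrt q + \<rho> x) has_integral L * sqrt q + J) {0..L}"
    using has_integral_const_real[of "sqrt q" 0 L] L by (intro has_integral_add \<rho>_integral) auto
  then show ?thesis by (simp add: u_def du_\<rho>[abs_def] integral_unique mult.commute)
qed

text \<open>By the first integral the three terms are controlled by \<open>\<surd>q u'\<close>, whose integral is \<open>\<surd>q u L\<close>, and by
  \<open>|v'| ((1 - v) / 2 + K)\<close>, which is a derivative on each half of the interval.\<close>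

lemma energy: "phase_field_energy L (h \<epsilon>) \<epsilon> u v \<le> ennreal (2 * sqrt q * u L + 1 + 4 * sqrt ((q - qs \<epsilon> m) * e \<epsilon> m))"
proof -
  define K where "K = sqrt ((q - qs \<epsilon> m) * e \<epsilon> m)"
  have em: "0 < e \<epsilon> m" using e_m_pos[OF P] .
  have K0: "0 \<le> K" and K2: "K\<^sup>2 = (q - qs \<epsilon> m) * e \<epsilon> m" using q em by (auto simp: K_def)
  define Z where "Z x = 2 * sqrt q * du x + 2 * \<bar>dv x\<bar> * ((1 - v x) / 2 + K)" for x
  have Zc: "continuous_on {0..L} Z" unfolding Z_def by (intro continuous_intros du_cont dv_cont v_cont) auto
  have du0: "0 \<le> du x" for x using q_pos by (simp add: du_def)
  have pw: "(h \<epsilon> (v x))\<^sup>2 * \<bar>du x\<bar>\<^sup>2 + (1 - v x)\<^sup>2 / (4 * \<epsilon>) + \<epsilon> * \<bar>dv x\<bar>\<^sup>2 \<le> Z x" if x: "x \<in> {0..L}" for x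
  proof -
    have hp: "0 < h \<epsilon> (v x)" using hv_pos[OF x] .
    have 1: "(h \<epsilon> (v x))\<^sup>2 * \<bar>du x\<bar>\<^sup>2 = sqrt q * du x" using hp by (simp add: du_def power_divide power2_eq_square)
    have "G \<epsilon> m q (v x) = (1 - v x)\<^sup>2 / 4 + (q - qs \<epsilon> m) * e \<epsilon> m - q * e \<epsilon> (v x)"
      using qs_e[OF P] by (simp add: G_def[OF P] algebra_simps diff_divide_distrib)
    then have "(1 - v x)\<^sup>2 / 4 \<le> G \<epsilon> m q (v x) + q * e \<epsilon> (v x)" using K2 zero_le_power2[of K] by linarith
    then have "(1 - v x)\<^sup>2 / 4 / \<epsilon> \<le> (G \<epsilon> m q (v x) + q * e \<epsilon> (v x)) / \<epsilon>" using \<epsilon> by (intro divide_right_mono) auto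
    then have "(1 - v x)\<^sup>2 / (4 * \<epsilon>) \<le> G \<epsilon> m q (v x) / \<epsilon> + q * e \<epsilon> (v x) / \<epsilon>" by (simp add: add_divide_distrib)
    also have "G \<epsilon> m q (v x) / \<epsilon> = \<epsilon> * \<bar>dv x\<bar>\<^sup>2" using dv_sq[OF x] \<epsilon> by (simp add: power_mult_distrib power2_eq_square field_simps)
    also have "q * e \<epsilon> (v x) / \<epsilon> = sqrt q * \<rho> x" using q_pos by (simp add: \<rho>_def mult.assoc[symmetric])
    finally have 2: "(1 - v x)\<^sup>2 / (4 * \<epsilon>) \<le> \<epsilon> * \<bar>dv x\<bar>\<^sup>2 + sqrt q * \<rho> x" .
    have "sqrt q * \<rho> x \<le> sqrt q * du x" using q_pos by (intro mult_left_mono) (auto simp: du_\<rho>)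
    moreover have "\<epsilon> * \<bar>dv x\<bar>\<^sup>2 \<le> \<bar>dv x\<bar> * ((1 - v x) / 2 + K)"
    proof -
      have "(\<epsilon> * \<bar>dv x\<bar>)\<^sup>2 = G \<epsilon> m q (v x)" using dv_sq[OF x] by (simp add: power_mult_distrib)
      also have "\<dots> \<le> (1 - v x)\<^sup>2 / 4 + K\<^sup>2" unfolding K2 using q v_range[OF x] by (intro G_upper[OF P]) auto
      also have "\<dots> \<le> ((1 - v x) / 2 + K)\<^sup>2" using v_range[OF x] K0 by (simp add: power2_sum power_divide)
      finally have "\<epsilon> * \<bar>dv x\<bar> \<le> (1 - v x) / 2 + K"
        by (rule power2_le_imp_le) (use v_range[OF x] K0 in simp)
      then have "\<bar>dv x\<bar> * (\<epsilon> * \<bar>dv x\<bar>) \<le> \<bar>dv x\<bar> * ((1 - v x) / 2 + K)" by (intro mult_left_mono) auto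
      then show ?thesis by (simp add: power2_eq_square mult_ac)
    qed
    ultimately show ?thesis unfolding 1 Z_def using 2 by linarith
  qed
  have Z0: "0 \<le> Z x" if x: "x \<in> {0..L}" for x
    unfolding Z_def using v_range[OF x] K0 du0[of x] q_pos by (intro add_nonneg_nonneg mult_nonneg_nonneg) auto
  define \<Phi> where "\<Phi> x = - (1 - v x)\<^sup>2 / 4 + K * v x" for x
  have \<Phi>d: "(\<Phi> has_real_derivative dv x * ((1 - v x) / 2 + K)) (at x)" if "x \<in> {0..L}" for x
    unfolding \<Phi>_def by (auto intro!: derivative_eq_intros v_deriv[OF that] simp: field_simps)
  have \<Phi>L: "\<Phi> 0 - \<Phi> (L / 2) \<le> 1 / 4 + K" "\<Phi> L - \<Phi> (L / 2) \<le> 1 / 4 + K"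
  proof -
    have "(1 - m)\<^sup>2 / 4 + K * (1 - m) \<le> 1 / 4 + K * 1"
      using m K0 by (intro add_mono mult_left_mono divide_right_mono) (auto simp: power_le_one)
    then show "\<Phi> 0 - \<Phi> (L / 2) \<le> 1 / 4 + K" "\<Phi> L - \<Phi> (L / 2) \<le> 1 / 4 + K"
      by (simp_all add: \<Phi>_def v_ends right_diff_distrib)
  qed
  have I1: "((\<lambda>x. dv x * ((1 - v x) / 2 + K)) has_integral \<Phi> (L / 2) - \<Phi> 0) {0..L / 2}"
    using \<Phi>d L by (intro fundamental_theorem_of_calculus)
      (auto simp: has_real_derivative_iff_has_vector_derivative intro: has_vector_derivative_at_within)
  have I2: "((\<lambda>x. dv x * ((1 - v x) / 2 + K)) has_integral \<Phi> L - \<Phi> (L / 2)) {L / 2..L}"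
    using \<Phi>d L by (intro fundamental_theorem_of_calculus)
      (auto simp: has_real_derivative_iff_has_vector_derivative intro: has_vector_derivative_at_within)
  have "((\<lambda>x. \<bar>dv x\<bar> * ((1 - v x) / 2 + K)) has_integral - (\<Phi> (L / 2) - \<Phi> 0)) {0..L / 2}"
    by (rule has_integral_eq[rotated, OF has_integral_neg[OF I1]]) (use dv_left(1) L in auto)
  moreover have "((\<lambda>x. \<bar>dv x\<bar> * ((1 - v x) / 2 + K)) has_integral \<Phi> L - \<Phi> (L / 2)) {L / 2..L}"
    by (rule has_integral_eq[rotated, OF I2]) (use dv_right(1) L in auto)
  ultimately have I3: "((\<lambda>x. \<bar>dv x\<bar> * ((1 - v x) / 2 + K)) has_integral (- (\<Phi> (L / 2) - \<Phi> 0) + (\<Phi> L - \<Phi> (L / 2)))) {0..L}"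
    using L by (intro has_integral_combine[of 0 "L / 2" L]) auto
  have "(du has_integral u L) {0..L}" unfolding u_def by (intro integrable_integral integrable_continuous_real du_cont)
  then have "((\<lambda>x. 2 * sqrt q * du x + 2 * (\<bar>dv x\<bar> * ((1 - v x) / 2 + K))) has_integral
     2 * sqrt q * u L + 2 * (- (\<Phi> (L / 2) - \<Phi> 0) + (\<Phi> L - \<Phi> (L / 2)))) {0..L}"
    by (intro has_integral_add has_integral_mult_right I3)
  then have "integral {0..L} Z = 2 * sqrt q * u L + 2 * (- (\<Phi> (L / 2) - \<Phi> 0) + (\<Phi> L - \<Phi> (L / 2)))"
    unfolding Z_def by (simp add: integral_unique mult.assoc)
  then have Zle: "integral {0..L} Z \<le> 2 * sqrt q * u L + 1 + 4 * K" using \<Phi>L by simp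
  have "AE x in lebesgue_on I. 0 \<le> v x \<and> v x \<le> 1"
    using v_range by (intro AE_I2) (auto simp: space_restrict_space less_imp_le)
  then have "phase_field_energy L (h \<epsilon>) \<epsilon> u v = (\<integral>\<^sup>+x. ennreal ((h \<epsilon> (v x))\<^sup>2 * \<bar>weak_deriv_on I u x\<bar>\<^sup>2
      + (1 - v x)\<^sup>2 / (4 * \<epsilon>) + \<epsilon> * \<bar>weak_deriv_on I v x\<bar>\<^sup>2) \<partial>(lebesgue_on I))"
    unfolding phase_field_energy_def Let_def using H1 by simp
  also have "\<dots> \<le> (\<integral>\<^sup>+x. ennreal (Z x) \<partial>(lebesgue_on I))"
  proof (rule nn_integral_mono_AE)
    have "AE x in lebesgue. x \<in> I \<longrightarrow> weak_deriv_on I u x = du x \<and> weak_deriv_on I v x = dv x"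
      using weak_AE by eventually_elim auto
    then have "AE x in lebesgue_on I. weak_deriv_on I u x = du x \<and> weak_deriv_on I v x = dv x"
      by (subst AE_restrict_space_iff) auto
    moreover have "AE x in lebesgue_on I. x \<in> I" by (intro AE_I2) (auto simp: space_restrict_space)
    ultimately show "AE x in lebesgue_on I. ennreal ((h \<epsilon> (v x))\<^sup>2 * \<bar>weak_deriv_on I u x\<bar>\<^sup>2
      + (1 - v x)\<^sup>2 / (4 * \<epsilon>) + \<epsilon> * \<bar>weak_deriv_on I v x\<bar>\<^sup>2) \<le> ennreal (Z x)"
    proof eventually_elim
      case (elim x)
      then show ?case using pw[of x] by (intro ennreal_leI) simp
    qed
  qed
  also have "\<dots> = ennreal (integral {0..L} Z)"
    using continuous_on_interval_L2(3,4)[OF Zc] Z0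
    by (subst nn_integral_eq_integral) (auto intro!: AE_I2 simp: space_restrict_space)
  also have "\<dots> \<le> ennreal (2 * sqrt q * u L + 1 + 4 * K)" by (rule ennreal_leI[OF Zle])
  finally show ?thesis by (simp add: K_def)
qed

text \<open>The constant of the uniform lower bound for \<open>k\<close>.\<close>

definition ck :: real where "ck = dw m / (16 * \<sigma>c)"

lemma ck_pos: "0 < ck" using dw_pos[of m] m \<sigma>c_pos by (simp add: ck_def)

lemma sqrt_k_lower: assumes "z \<in> {-Y..Y}" shows "sqrt ck * (1 - (m + z\<^sup>2)) \<le> sqrt (k \<epsilon> m q z)"
proof -
  have "ck * (1 - (m + z\<^sup>2))\<^sup>2 \<le> k \<epsilon> m q z" unfolding ck_def using assms q by (intro k_lower[OF P]) (auto simp: abs_le_iff)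
  then have "sqrt (ck * (1 - (m + z\<^sup>2))\<^sup>2) \<le> sqrt (k \<epsilon> m q z)" by (rule real_sqrt_le_mono)
  then show ?thesis using z_range[OF assms] by (simp add: real_sqrt_mult)
qed

text \<open>On the way from \<open>L / 2\<close> to \<open>x\<close> the speed of \<open>y\<close> is at least a multiple of \<open>(1 - v x) / \<epsilon>\<close>, while \<open>y\<close>
  moves by at most \<open>Y\<close>.\<close>

lemma distance_bound: assumes x: "x \<in> {0..L}" shows "\<bar>x - L / 2\<bar> * (1 - v x) \<le> 2 * \<epsilon> * Y / sqrt ck"
proof (cases "v x = 1")
  case True
  then show ?thesis using \<epsilon> Y_pos ck_pos by simp
next
  case False
  then have vx: "0 < 1 - v x" using v_range[OF x] by simp
  define C where "C = 2 * \<epsilon> / (sqrt ck * (1 - v x))"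
  have C0: "0 < C" using \<epsilon> ck_pos vx by (simp add: C_def)
  have bd: "1 / KK z \<le> C" if z: "z \<in> {-Y..Y}" "\<bar>z\<bar> \<le> \<bar>y x\<bar>" for z
  proof -
    have "z\<^sup>2 \<le> (y x)\<^sup>2" using z(2) by (simp add: abs_le_square_iff)
    then have "sqrt ck * (1 - v x) \<le> sqrt ck * (1 - (m + z\<^sup>2))" using ck_pos by (intro mult_left_mono) (auto simp: v_def)
    also have "\<dots> \<le> sqrt (k \<epsilon> m q z)" by (rule sqrt_k_lower[OF z(1)])
    finally have le: "sqrt ck * (1 - v x) \<le> sqrt (k \<epsilon> m q z)" .
    have cp: "0 < sqrt ck * (1 - v x)" using ck_pos vx by simp
    have kp: "0 < sqrt (k \<epsilon> m q z)" by (rule less_le_trans[OF cp le])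
    have "1 / KK z = 2 * \<epsilon> / sqrt (k \<epsilon> m q z)" by (simp add: KK_def)
    also have "\<dots> \<le> C" unfolding C_def by (rule divide_left_mono[OF le]) (use \<epsilon> mult_pos_pos[OF cp kp] in \<open>simp_all add: mult.commute\<close>)
    finally show ?thesis .
  qed
  have ci: "(\<lambda>z. 1 / KK z) integrable_on {a..b}" if "{a..b} \<subseteq> {-Y..Y}" for a b
  proof -
    have "KK z \<noteq> 0" if "z \<in> {-Y..Y}" for z using KK(2)[OF that] by simp
    then have "continuous_on {-Y..Y} (\<lambda>z. 1 / KK z)" by (intro continuous_intros KK) auto
    then show ?thesis using that by (intro integrable_continuous_real) (rule continuous_on_subset)
  qed
  have yr: "y x \<in> {-Y..Y}" by (rule y(4)[OF x])
  have "\<bar>x - L / 2\<bar> \<le> C * Y"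
  proof (cases "L / 2 \<le> x")
    case True
    have y0: "0 \<le> y x" using y_sign(3)[OF x True] .
    have "((\<lambda>t. 1) has_integral integral {y (L / 2)..y x} (\<lambda>z. 1 / KK z)) {L / 2..x}"
      using True x L y_substitution[of "\<lambda>z. 1" "L / 2" x] by auto
    moreover have "((\<lambda>t. 1) has_integral (x - L / 2)) {L / 2..x}"
      using has_integral_const_real[of "1::real" "L / 2" x] True by simp
    ultimately have "integral {y (L / 2)..y x} (\<lambda>z. 1 / KK z) = x - L / 2" by (rule has_integral_unique)
    then have "x - L / 2 = integral {0..y x} (\<lambda>z. 1 / KK z)" by (simp only: y(2))
    also have "\<dots> \<le> integral {0..y x} (\<lambda>z. C)"
      using y0 yr Y_pos by (intro integral_le ci bd) auto
    also have "\<dots> = C * y x" using y0 by simp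
    also have "\<dots> \<le> C * Y" using yr C0 by simp
    finally show ?thesis using True by simp
  next
    case False
    then have xl: "x \<le> L / 2" by simp
    have y0: "y x \<le> 0" using y_sign(4)[OF x xl] .
    have "((\<lambda>t. 1) has_integral integral {y x..y (L / 2)} (\<lambda>z. 1 / KK z)) {x..L / 2}"
      using xl x L y_substitution[of "\<lambda>z. 1" x "L / 2"] by auto
    moreover have "((\<lambda>t. 1) has_integral (L / 2 - x)) {x..L / 2}"
      using has_integral_const_real[of "1::real" x "L / 2"] xl by simp
    ultimately have "integral {y x..y (L / 2)} (\<lambda>z. 1 / KK z) = L / 2 - x" by (rule has_integral_unique)
    then have "L / 2 - x = integral {y x..0} (\<lambda>z. 1 / KK z)" by (simp only: y(2))
    also have "\<dots> \<le> integral {y x..0} (\<lambda>z. C)"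
      using y0 yr Y_pos by (intro integral_le ci bd) auto
    also have "\<dots> = C * (- y x)" using y0 by simp
    also have "\<dots> \<le> C * Y" using yr C0 by (intro mult_left_mono) auto
    finally show ?thesis using xl by simp
  qed
  then have "\<bar>x - L / 2\<bar> * (1 - v x) \<le> C * Y * (1 - v x)" using vx by (intro mult_right_mono) auto
  also have "\<dots> = 2 * \<epsilon> * Y / sqrt ck" using vx by (simp add: C_def)
  finally show ?thesis .
qed

lemma defect_integral: "integral {0..L} (\<lambda>x. 1 - v x) \<le> 4 * \<epsilon> * Y / sqrt ck"
proof -
  define F where "F z = 1 - (m + z\<^sup>2)" for z
  have Fc: "continuous_on {-Y..Y} F" unfolding F_def by (intro continuous_intros)
  have "((\<lambda>x. F (y x)) has_integral integral {-Y..Y} (\<lambda>z. F z / KK z)) {0..L}"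
    using y_substitution[OF Fc, of 0 L] L by (simp add: y(1,3))
  then have "integral {0..L} (\<lambda>x. 1 - v x) = integral {-Y..Y} (\<lambda>z. F z / KK z)"
    by (simp add: F_def v_def integral_unique)
  also have "\<dots> \<le> integral {-Y..Y} (\<lambda>z. 2 * \<epsilon> / sqrt ck)"
  proof (rule integral_le)
    have "KK z \<noteq> 0" if "z \<in> {-Y..Y}" for z using KK(2)[OF that] by simp
    then show "(\<lambda>z. F z / KK z) integrable_on {-Y..Y}" by (intro integrable_continuous_real continuous_intros KK Fc) auto
    fix z assume z: "z \<in> {-Y..Y}"
    have kp: "0 < sqrt (k \<epsilon> m q z)" using KK(2)[OF z] \<epsilon> by (simp add: KK_def zero_less_divide_iff)
    have "F z * sqrt ck \<le> sqrt (k \<epsilon> m q z)" using sqrt_k_lower[OF z] by (simp add: F_def mult.commute)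
    then have "2 * \<epsilon> * (F z * sqrt ck) \<le> 2 * \<epsilon> * sqrt (k \<epsilon> m q z)" using \<epsilon> by (intro mult_left_mono) auto
    then have "(2 * \<epsilon> * F z) / sqrt (k \<epsilon> m q z) \<le> 2 * \<epsilon> / sqrt ck" using kp ck_pos by (simp add: field_simps)
    moreover have "F z / KK z = (2 * \<epsilon> * F z) / sqrt (k \<epsilon> m q z)" by (simp add: KK_def)
    ultimately show "F z / KK z \<le> 2 * \<epsilon> / sqrt ck" by simp
  qed (rule integrable_const_ivl)
  also have "\<dots> = 4 * \<epsilon> * Y / sqrt ck" using Y_pos by simp
  finally show ?thesis .
qed

text \<open>\<open>\<rho>\<close> is bounded by a multiple of \<open>(1 - v)\<^sup>2 / \<epsilon>\<close>. One factor \<open>1 - v\<close> absorbs \<open>|x - L / 2|\<close> at the price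
  of \<open>\<epsilon>\<close>, and the other has an integral of order \<open>\<epsilon>\<close>.\<close>

lemma moment_bound:
  "integral {0..L} (\<lambda>x. \<bar>x - L / 2\<bar> * \<rho> x) \<le> sqrt q * 2 * Y / (sqrt ck * (w m)\<^sup>2) * (4 * \<epsilon> * Y / sqrt ck)"
proof -
  define C where "C = sqrt q * 2 * Y / (sqrt ck * (w m)\<^sup>2)"
  have C0: "0 \<le> C" using q_pos Y_pos ck_pos by (simp add: C_def)
  have "integral {0..L} (\<lambda>x. \<bar>x - L / 2\<bar> * \<rho> x) \<le> integral {0..L} (\<lambda>x. C * (1 - v x))"
  proof (rule integral_le)
    show "(\<lambda>x. \<bar>x - L / 2\<bar> * \<rho> x) integrable_on {0..L}"
      by (intro integrable_continuous_real continuous_intros \<rho>_cont)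
    show "(\<lambda>x. C * (1 - v x)) integrable_on {0..L}"
      by (intro integrable_continuous_real continuous_intros v_cont)
    fix x assume x: "x \<in> {0..L}"
    have "\<rho> x \<le> sqrt q * ((1 - v x)\<^sup>2 / (w m)\<^sup>2) / \<epsilon>"
      unfolding \<rho>_def using e_le_p[OF P v_range(1,2)[OF x]] q_pos \<epsilon> by (intro divide_right_mono mult_left_mono) auto
    then have "\<bar>x - L / 2\<bar> * \<rho> x \<le> \<bar>x - L / 2\<bar> * (sqrt q * ((1 - v x)\<^sup>2 / (w m)\<^sup>2) / \<epsilon>)"
      by (intro mult_left_mono) auto
    also have "\<dots> = (\<bar>x - L / 2\<bar> * (1 - v x)) * (sqrt q * (1 - v x) / ((w m)\<^sup>2 * \<epsilon>))"
      by (simp add: power2_eq_square)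
    also have "\<dots> \<le> (2 * \<epsilon> * Y / sqrt ck) * (sqrt q * (1 - v x) / ((w m)\<^sup>2 * \<epsilon>))"
      using distance_bound[OF x] v_range[OF x] q_pos \<epsilon> by (intro mult_right_mono) auto
    also have "\<dots> = C * (1 - v x)" using \<epsilon> by (simp add: C_def)
    finally show "\<bar>x - L / 2\<bar> * \<rho> x \<le> C * (1 - v x)" .
  qed
  also have "\<dots> = C * integral {0..L} (\<lambda>x. 1 - v x)" by (rule integral_mult_right)
  also have "\<dots> \<le> C * (4 * \<epsilon> * Y / sqrt ck)" using defect_integral C0 by (intro mult_left_mono)
  finally show ?thesis by (simp add: C_def)
qed

text \<open>Let \<open>R = u - \<surd>q x\<close>, the primitive of \<open>\<rho>\<close>. To the left of \<open>L / 2\<close> the error is \<open>R\<close>, to the right \<open>J - R\<close>;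
  integration by parts turns both into moments of \<open>\<rho>\<close> about \<open>L / 2\<close>.\<close>

lemma L1_bound:
  "(\<integral>\<^sup>+x. ennreal \<bar>u x - (sqrt q * x + J * indicator {L / 2<..<L} x)\<bar> \<partial>(lebesgue_on I))
    \<le> ennreal (integral {0..L} (\<lambda>x. \<bar>x - L / 2\<bar> * \<rho> x))"
proof -
  define R where "R x = u x - sqrt q * x" for x
  have R_eq: "R x = integral {0..x} \<rho>" if x: "x \<in> {0..L}" for x
  proof -
    have "(\<rho> has_integral integral {0..x} \<rho>) {0..x}"
      using x by (intro integrable_integral integrable_continuous_real continuous_on_subset[OF \<rho>_cont]) auto
    then have "((\<lambda>x. sqrt q + \<rho> x) has_integral x * sqrt q + integral {0..x} \<rho>) {0..x}"
      using has_integral_const_real[of "sqrt q" 0 x] x by (intro has_integral_add) auto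
    then have "u x = x * sqrt q + integral {0..x} \<rho>" by (simp add: u_def du_\<rho>[abs_def] integral_unique)
    then show ?thesis by (simp add: R_def)
  qed
  have R0: "0 \<le> R x" if x: "x \<in> {0..L}" for x
    unfolding R_eq[OF x] using x \<rho>_nonneg
    by (intro integral_nonneg integrable_continuous_real continuous_on_subset[OF \<rho>_cont]) auto
  have RJ: "R x \<le> J" if x: "x \<in> {0..L}" for x
  proof -
    have "integral {0..x} \<rho> + integral {x..L} \<rho> = integral {0..L} \<rho>"
      using x by (intro Henstock_Kurzweil_Integration.integral_combine integrable_continuous_real \<rho>_cont) auto
    moreover have "0 \<le> integral {x..L} \<rho>"
      using x \<rho>_nonneg by (intro integral_nonneg integrable_continuous_real continuous_on_subset[OF \<rho>_cont]) auto
    ultimately show ?thesis using R_eq[OF x] integral_unique[OF \<rho>_integral] by simp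
  qed
  have Rc: "continuous_on {0..L} R" unfolding R_def by (intro continuous_intros u_cont)
  have Rd: "(R has_real_derivative \<rho> x) (at x)" if x: "x \<in> {0<..<L}" for x
  proof -
    have "(u has_real_derivative du x) (at x)" using u_deriv[of x] x by (auto simp: at_within_Icc_at)
    then show ?thesis unfolding R_def by (auto intro!: derivative_eq_intros simp: du_\<rho>)
  qed
  have RL: "R L = J" by (simp add: R_def u_L)
  have iR: "(R has_integral integral {a..b} R) {a..b}" if "0 \<le> a" "b \<le> L" for a b
    using that by (intro integrable_integral integrable_continuous_real continuous_on_subset[OF Rc]) auto
  have im: "((\<lambda>x. \<bar>x - L / 2\<bar> * \<rho> x) has_integral integral {a..b} (\<lambda>x. \<bar>x - L / 2\<bar> * \<rho> x)) {a..b}" if "0 \<le> a" "b \<le> L" for a b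
    using that by (intro integrable_integral integrable_continuous_real continuous_intros continuous_on_subset[OF \<rho>_cont]) auto
  have left: "integral {0..L / 2} R = integral {0..L / 2} (\<lambda>x. \<bar>x - L / 2\<bar> * \<rho> x)"
  proof -
    have "((\<lambda>x. \<bar>x - L / 2\<bar> * \<rho> x - R x) has_integral (L / 2 - L / 2) * R (L / 2) - (L / 2 - 0) * R 0) {0..L / 2}"
    proof (rule fundamental_theorem_of_calculus_interior)
      show "continuous_on {0..L / 2} (\<lambda>x. (L / 2 - x) * R x)" using L by (intro continuous_intros continuous_on_subset[OF Rc]) auto
      fix x assume x: "x \<in> {0<..<L / 2}"
      then have "((\<lambda>x. (L / 2 - x) * R x) has_real_derivative \<bar>x - L / 2\<bar> * \<rho> x - R x) (at x)"
        using L by (auto intro!: derivative_eq_intros Rd simp: algebra_simps)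
      then show "((\<lambda>x. (L / 2 - x) * R x) has_vector_derivative \<bar>x - L / 2\<bar> * \<rho> x - R x) (at x)"
        by (simp add: has_real_derivative_iff_has_vector_derivative)
    qed (use L in auto)
    moreover have "((\<lambda>x. \<bar>x - L / 2\<bar> * \<rho> x - R x) has_integral
        integral {0..L / 2} (\<lambda>x. \<bar>x - L / 2\<bar> * \<rho> x) - integral {0..L / 2} R) {0..L / 2}"
      using L by (intro has_integral_diff im iR) auto
    moreover have "R 0 = 0" using R_eq[of 0] L by simp
    ultimately show ?thesis by (auto dest: has_integral_unique)
  qed
  have right: "integral {L / 2..L} (\<lambda>x. J - R x) = integral {L / 2..L} (\<lambda>x. \<bar>x - L / 2\<bar> * \<rho> x)"
  proof -
    have "((\<lambda>x. (J - R x) - \<bar>x - L / 2\<bar> * \<rho> x) has_integral (L - L / 2) * (J - R L) - (L / 2 - L / 2) * (J - R (L / 2))) {L / 2..L}"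
    proof (rule fundamental_theorem_of_calculus_interior)
      show "continuous_on {L / 2..L} (\<lambda>x. (x - L / 2) * (J - R x))" using L by (intro continuous_intros continuous_on_subset[OF Rc]) auto
      fix x assume x: "x \<in> {L / 2<..<L}"
      then have "((\<lambda>x. (x - L / 2) * (J - R x)) has_real_derivative (J - R x) - \<bar>x - L / 2\<bar> * \<rho> x) (at x)"
        using L by (auto intro!: derivative_eq_intros Rd simp: algebra_simps)
      then show "((\<lambda>x. (x - L / 2) * (J - R x)) has_vector_derivative (J - R x) - \<bar>x - L / 2\<bar> * \<rho> x) (at x)"
        by (simp add: has_real_derivative_iff_has_vector_derivative)
    qed (use L in auto)
    moreover have "((\<lambda>x. (J - R x) - \<bar>x - L / 2\<bar> * \<rho> x) has_integral
        integral {L / 2..L} (\<lambda>x. J - R x) - integral {L / 2..L} (\<lambda>x. \<bar>x - L / 2\<bar> * \<rho> x)) {L / 2..L}"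
      using L by (intro has_integral_diff im integrable_integral integrable_continuous_real continuous_intros continuous_on_subset[OF Rc]) auto
    ultimately show ?thesis using RL by (auto dest: has_integral_unique)
  qed
  define W where "W x = (if x \<le> L / 2 then R x else J - R x)" for x
  have W0: "0 \<le> W x" if "x \<in> {0..L}" for x using R0[OF that] RJ[OF that] by (simp add: W_def)
  have W1: "(W has_integral integral {0..L / 2} R) {0..L / 2}"
    by (rule has_integral_eq[rotated, OF iR]) (use L in \<open>auto simp: W_def\<close>)
  have W2: "(W has_integral integral {L / 2..L} (\<lambda>x. J - R x)) {L / 2..L}"
  proof (rule has_integral_spike[of "{L / 2}"])
    show "((\<lambda>x. J - R x) has_integral integral {L / 2..L} (\<lambda>x. J - R x)) {L / 2..L}"
      using L by (intro integrable_integral integrable_continuous_real continuous_intros continuous_on_subset[OF Rc]) auto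
  qed (auto simp: W_def)
  have "integral {0..L / 2} (\<lambda>x. \<bar>x - L / 2\<bar> * \<rho> x) + integral {L / 2..L} (\<lambda>x. \<bar>x - L / 2\<bar> * \<rho> x)
     = integral {0..L} (\<lambda>x. \<bar>x - L / 2\<bar> * \<rho> x)"
    using L by (intro Henstock_Kurzweil_Integration.integral_combine integrable_continuous_real continuous_intros \<rho>_cont) auto
  moreover have "(W has_integral integral {0..L / 2} R + integral {L / 2..L} (\<lambda>x. J - R x)) {0..L}"
    using L by (intro has_integral_combine[OF _ _ W1 W2]) auto
  ultimately have WI: "(W has_integral integral {0..L} (\<lambda>x. \<bar>x - L / 2\<bar> * \<rho> x)) {0..L}"
    using left right by simp
  define W' where "W' x = (if x \<in> {0..L} then W x else 0)" for x
  have "(W' has_integral integral {0..L} (\<lambda>x. \<bar>x - L / 2\<bar> * \<rho> x)) UNIV"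
    unfolding W'_def using WI by (subst has_integral_restrict_UNIV)
  then have n: "(\<integral>\<^sup>+x. ennreal (W' x) \<partial>lebesgue) = ennreal (integral {0..L} (\<lambda>x. \<bar>x - L / 2\<bar> * \<rho> x))"
    by (rule nn_integral_lebesgue_has_integral(1)[rotated]) (simp add: W'_def W0)
  have "(\<integral>\<^sup>+x. ennreal \<bar>u x - (sqrt q * x + J * indicator {L / 2<..<L} x)\<bar> \<partial>(lebesgue_on I))
     = (\<integral>\<^sup>+x. ennreal \<bar>u x - (sqrt q * x + J * indicator {L / 2<..<L} x)\<bar> * indicator I x \<partial>lebesgue)"
    by (rule nn_integral_restrict_space) auto
  also have "\<dots> \<le> (\<integral>\<^sup>+x. ennreal (W' x) \<partial>lebesgue)"
  proof (rule nn_integral_mono)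
    fix x
    show "ennreal \<bar>u x - (sqrt q * x + J * indicator {L / 2<..<L} x)\<bar> * indicator I x \<le> ennreal (W' x)"
    proof (cases "x \<in> I")
      case True
      then have xL: "x \<in> {0..L}" by auto
      have "\<bar>u x - (sqrt q * x + J * indicator {L / 2<..<L} x)\<bar> = W' x"
        using R0[OF xL] RJ[OF xL] True xL by (auto simp: W'_def W_def R_def indicator_def)
      then show ?thesis using True by simp
    qed simp
  qed
  finally show ?thesis unfolding n .
qed

end

end

section \<open>Convergence of the jump\<close>

context cohesive
begin

text \<open>The function \<open>k\<close> for \<open>q = p\<^sup>2 / 4\<close> and \<open>\<epsilon> \<rightarrow> 0\<close>, where \<open>e\<close> tends to \<open>1 / f\<^sup>2\<close>.\<close>

definition k0 :: "real \<Rightarrow> real \<Rightarrow> real" where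
  "k0 m z = (w m)\<^sup>2 / 4 * (1 / (f m)\<^sup>2 - 1 / (f (m + z\<^sup>2))\<^sup>2) / z\<^sup>2 - (2 * (1 - m) - z\<^sup>2) / 4"

lemma k0_eq:
  assumes m: "0 < m" "m < 1" and z: "z \<noteq> 0" "m + z\<^sup>2 < 1"
  shows "z\<^sup>2 * k0 m z = ((1 - (m + z\<^sup>2)) / 2)\<^sup>2 * (1 - (w m / w (m + z\<^sup>2))\<^sup>2)"
proof -
  define v where "v = m + z\<^sup>2"
  have v: "0 < v" "v < 1" using m z by (auto simp: v_def add_pos_nonneg)
  have wm: "0 < w m" using w_pos m by simp
  have fi: "1 / (f x)\<^sup>2 = (1 - x)\<^sup>2 / (w x)\<^sup>2" if "x < 1" for x using that by (simp add: w_def power_mult_distrib)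
  have "z\<^sup>2 * k0 m z = (w m)\<^sup>2 / 4 * (1 / (f m)\<^sup>2 - 1 / (f v)\<^sup>2) - z\<^sup>2 * (2 * (1 - m) - z\<^sup>2) / 4"
  proof -
    have "z\<^sup>2 * (a / z\<^sup>2 - b / 4) = a - z\<^sup>2 * b / 4" for a b using z(1) by (simp add: right_diff_distrib)
    then show ?thesis by (simp only: k0_def v_def)
  qed
  also have "(w m)\<^sup>2 / 4 * (1 / (f m)\<^sup>2 - 1 / (f v)\<^sup>2) = (1 - m)\<^sup>2 / 4 - (1 - v)\<^sup>2 / 4 * (w m / w v)\<^sup>2"
    using wm m v by (simp add: fi power_divide right_diff_distrib)
  also have "z\<^sup>2 * (2 * (1 - m) - z\<^sup>2) / 4 = (1 - m)\<^sup>2 / 4 - (1 - v)\<^sup>2 / 4"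
    by (simp add: v_def power2_eq_square field_simps)
  finally show ?thesis by (simp add: v_def power_divide right_diff_distrib)
qed

text \<open>The substitution \<open>m + z\<^sup>2 = om (p / cos \<theta>)\<close> turns \<open>\<surd>k0\<close> into \<open>(1 - v) sin \<theta> / (2 z)\<close> and the integrand
  into \<open>D (p / cos \<theta>)\<close>.\<close>

lemma jump_integral:
  assumes m: "0 < m" "m < 1"
  shows "integral {0..sqrt (1 - m)} (\<lambda>z. 2 * w m * (1 / (f (m + z\<^sup>2))\<^sup>2 / sqrt (k0 m z))) = S (w m)"
proof -
  define p where "p = w m"
  have p: "0 < p" "p < \<sigma>c" using w_pos w_less m by (auto simp: p_def)
  have omp: "om p = m" using om_w m by (simp add: p_def)
  define A where "A = arccos (p / \<sigma>c)"
  have pr: "0 < p / \<sigma>c" "p / \<sigma>c < 1" using p by auto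
  have A: "0 < A" "A < pi / 2" "cos A = p / \<sigma>c" using arccos_range[of "p / \<sigma>c"] pr by (auto simp: A_def)
  define Y where "Y = sqrt (1 - m)"
  define g where "g z = 2 * p * (1 / (f (m + z\<^sup>2))\<^sup>2 / sqrt (k0 m z))" for z
  define X where "X \<theta> = p / cos \<theta>" for \<theta>
  define \<Psi> where "\<Psi> \<theta> = sqrt (om (X \<theta>) - m)" for \<theta>
  define \<Psi>' where "\<Psi>' \<theta> = inverse (sqrt (om (X \<theta>) - m)) / 2 * (inverse (dw (om (X \<theta>))) * (p * sin \<theta> / (cos \<theta>)\<^sup>2))" for \<theta>
  have c: "0 < cos \<theta>" "cos \<theta> < 1" "p / \<sigma>c < cos \<theta>" if "\<theta> \<in> {0<..<A}" for \<theta>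
  proof -
    show "0 < cos \<theta>" using that A cos_quarter[of \<theta>] by auto
    show "cos \<theta> < 1" using cos_monotone_0_pi[of 0 \<theta>] that A by auto
    show "p / \<sigma>c < cos \<theta>" using cos_monotone_0_pi[of \<theta> A] that A by auto
  qed
  have Xr: "p < X \<theta>" "X \<theta> < \<sigma>c" if "\<theta> \<in> {0<..<A}" for \<theta>
    using c[OF that] p \<sigma>c_pos by (auto simp: X_def field_simps)
  have omr: "m < om (X \<theta>)" "om (X \<theta>) < 1" "w (om (X \<theta>)) = X \<theta>" if "\<theta> \<in> {0<..<A}" for \<theta>
    using om_strict_mono[of p "X \<theta>"] om_props[of "X \<theta>"] Xr[OF that] p omp by auto
  have sp: "0 < sin \<theta>" if "\<theta> \<in> {0<..<A}" for \<theta> using that A by (intro sin_gt_zero) auto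
  have dwp: "0 < dw (om (X \<theta>))" if "\<theta> \<in> {0<..<A}" for \<theta> using omr[OF that] m by (intro dw_pos) auto
  have \<Psi>d: "(\<Psi> has_real_derivative \<Psi>' \<theta>) (at \<theta>)" if t: "\<theta> \<in> {0<..<A}" for \<theta>
  proof -
    have X': "(X has_real_derivative p * sin \<theta> / (cos \<theta>)\<^sup>2) (at \<theta>)"
      unfolding X_def using c[OF t] by (auto intro!: derivative_eq_intros simp: power2_eq_square)
    have o': "(om has_real_derivative inverse (dw (om (X \<theta>)))) (at (X \<theta>))"
      using Xr[OF t] p by (intro om_deriv) auto
    have "((\<lambda>\<theta>. om (X \<theta>) - m) has_real_derivative inverse (dw (om (X \<theta>))) * (p * sin \<theta> / (cos \<theta>)\<^sup>2)) (at \<theta>)"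
      using DERIV_diff[OF DERIV_chain2[OF o' X'] DERIV_const[of m]] by simp
    moreover have "(sqrt has_real_derivative inverse (sqrt (om (X \<theta>) - m)) / 2) (at (om (X \<theta>) - m))"
      using omr[OF t] by (intro DERIV_real_sqrt) auto
    ultimately show ?thesis unfolding \<Psi>_def[abs_def] \<Psi>'_def
      by (rule DERIV_chain2[where f = sqrt and g = "\<lambda>\<theta>. om (X \<theta>) - m", rotated])
  qed
  have val: "\<bar>\<Psi>' \<theta>\<bar> * g (\<Psi> \<theta>) = D (X \<theta>)" if t: "\<theta> \<in> {0<..<A}" for \<theta>
  proof -
    define v z where "v = om (X \<theta>)" and "z = \<Psi> \<theta>"
    have v: "m < v" "v < 1" "w v = X \<theta>" using omr[OF t] by (auto simp: v_def)
    have z: "0 < z" "z\<^sup>2 = v - m" using v by (auto simp: z_def \<Psi>_def v_def)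
    have mz: "m + z\<^sup>2 = v" using z by simp
    have rat: "w m / w v = cos \<theta>" using v p c[OF t] by (simp add: X_def p_def)
    have "z\<^sup>2 * k0 m z = ((1 - v) / 2)\<^sup>2 * (1 - (cos \<theta>)\<^sup>2)"
      using k0_eq[OF m, of z] z v unfolding mz rat by simp
    also have "1 - (cos \<theta>)\<^sup>2 = (sin \<theta>)\<^sup>2" by (simp add: sin_squared_eq)
    finally have "k0 m z = ((1 - v) / 2)\<^sup>2 * (sin \<theta>)\<^sup>2 / z\<^sup>2" using z(1) by (simp add: eq_divide_eq mult.commute)
    then have "k0 m z = ((1 - v) / 2 * sin \<theta> / z)\<^sup>2" by (simp only: power_mult_distrib power_divide)
    then have sk: "sqrt (k0 m z) = (1 - v) / 2 * sin \<theta> / z" using v sp[OF t] z(1) by simp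
    have fv: "1 / (f v)\<^sup>2 = (1 - v)\<^sup>2 * (cos \<theta>)\<^sup>2 / p\<^sup>2"
      using v c[OF t] p f_eq_w[OF v(2)] by (simp add: X_def power_divide power_mult_distrib)
    have gz: "g z = 2 * p * ((1 - v)\<^sup>2 * (cos \<theta>)\<^sup>2 / p\<^sup>2 / ((1 - v) / 2 * sin \<theta> / z))"
      unfolding g_def mz fv sk ..
    have \<Psi>z: "\<bar>\<Psi>' \<theta>\<bar> = inverse z / 2 * (inverse (dw v) * (p * sin \<theta> / (cos \<theta>)\<^sup>2))"
    proof -
      have "\<Psi>' \<theta> = inverse z / 2 * (inverse (dw v) * (p * sin \<theta> / (cos \<theta>)\<^sup>2))"
        by (simp add: \<Psi>'_def z_def \<Psi>_def v_def)
      moreover have "0 \<le> inverse z / 2 * (inverse (dw v) * (p * sin \<theta> / (cos \<theta>)\<^sup>2))"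
        using z(1) dwp[OF t] p sp[OF t] by (simp add: v_def)
      ultimately show ?thesis by (simp only: abs_of_nonneg)
    qed
    have alg: "inverse z / 2 * (inverse d * (p * s / c\<^sup>2)) * (2 * p * (e\<^sup>2 * c\<^sup>2 / p\<^sup>2 / (e / 2 * s / z))) = 2 * e / d"
      if "0 < z" "0 < d" "0 < s" "0 < c" "0 < e" for z d s c e :: real
      using that p by (simp add: field_simps power2_eq_square)
    have "\<bar>\<Psi>' \<theta>\<bar> * g z = 2 * (1 - v) / dw v"
      unfolding gz \<Psi>z by (rule alg) (use z(1) dwp[OF t] sp[OF t] c[OF t] v in \<open>auto simp: v_def\<close>)
    moreover have "D (X \<theta>) = 2 * (1 - v) / dw v" using Xr[OF t] p by (simp add: D_def v_def)
    ultimately show ?thesis by (simp add: z_def)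
  qed
  have inj: "inj_on \<Psi> {0<..<A}"
  proof (rule inj_onI)
    fix a b assume ab: "a \<in> {0<..<A}" "b \<in> {0<..<A}" "\<Psi> a = \<Psi> b"
    then have "om (X a) = om (X b)" by (simp add: \<Psi>_def)
    then have "w (om (X a)) = w (om (X b))" by (rule arg_cong)
    then have "X a = X b" unfolding omr(3)[OF ab(1)] omr(3)[OF ab(2)] .
    then have "cos a = cos b" using c(1)[OF ab(1)] c(1)[OF ab(2)] p by (simp add: X_def frac_eq_eq)
    moreover have "arccos (cos a) = a" "arccos (cos b) = b" using ab(1,2) A by (auto intro!: arccos_cos)
    ultimately show "a = b" by metis
  qed
  have img: "\<Psi> ` {0<..<A} = {0<..<Y}"
  proof (intro equalityI subsetI)
    fix z assume "z \<in> \<Psi> ` {0<..<A}"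
    then obtain \<theta> where t: "\<theta> \<in> {0<..<A}" "z = \<Psi> \<theta>" by blast
    show "z \<in> {0<..<Y}" using omr[OF t(1)] unfolding t(2) \<Psi>_def Y_def by simp
  next
    fix z assume z: "z \<in> {0<..<Y}"
    define v where "v = m + z\<^sup>2"
    have "z\<^sup>2 < Y\<^sup>2" using z by (intro power_strict_mono) auto
    then have v: "m < v" "v < 1" using z m by (auto simp: v_def Y_def)
    have wv: "p < w v" "w v < \<sigma>c" using w_less_iff[of m v] w_less[of v] v m by (auto simp: p_def)
    define \<theta> where "\<theta> = arccos (p / w v)"
    have r: "0 < p / w v" "p / w v < 1" "p / \<sigma>c < p / w v" using wv p by (auto intro!: divide_strict_left_mono)
    have "\<theta> < A" unfolding \<theta>_def A_def using r pr by (intro arccos_less_arccos) auto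
    then have t: "\<theta> \<in> {0<..<A}" using arccos_range(5)[of "p / w v"] r by (auto simp: \<theta>_def)
    have "cos \<theta> = p / w v" unfolding \<theta>_def by (rule arccos_range(3)) (rule less_imp_le[OF r(1)], rule less_imp_le[OF r(2)])
    then have "X \<theta> = w v" using p wv by (simp add: X_def)
    then have "\<Psi> \<theta> = z" using om_w[of v] v m z by (simp add: \<Psi>_def v_def)
    then show "z \<in> \<Psi> ` {0<..<A}" using t by force
  qed
  have Dint: "((\<lambda>\<theta>. D (X \<theta>)) has_integral S p) {0<..<A}"
  proof -
    have i: "(\<lambda>\<theta>. D (p / cos \<theta>)) integrable_on {0..A}" "(\<lambda>\<theta>. D (p / cos \<theta>)) integrable_on {0..pi/2}"
      using S_integrable[OF p(1)] A integrable_on_subinterval[of "\<lambda>\<theta>. D (p / cos \<theta>)" "{0..pi/2}" 0 A] by auto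
    have "integral {0..A} (\<lambda>\<theta>. D (p / cos \<theta>)) + integral {A..pi/2} (\<lambda>\<theta>. D (p / cos \<theta>)) = S p"
      unfolding S_def using A i by (intro Henstock_Kurzweil_Integration.integral_combine) auto
    moreover have "integral {A..pi/2} (\<lambda>\<theta>. D (p / cos \<theta>)) = 0"
    proof (intro integral_unique has_integral_is_0)
      fix t assume t: "t \<in> {A..pi/2}"
      have "D (p / cos t) \<le> D (p / cos A)" using t A p by (intro D_cos_antimono) auto
      also have "\<dots> = 0" using A p by (simp add: D_def)
      finally show "D (p / cos t) = 0" using D_nonneg[of "p / cos t"] by simp
    qed
    ultimately have "((\<lambda>\<theta>. D (X \<theta>)) has_integral S p) {0..A}"
      using integrable_integral[OF i(1)] by (simp add: X_def)
    then show ?thesis by (simp add: has_integral_Icc_iff_Ioo)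
  qed
  have vi: "((\<lambda>\<theta>. \<bar>\<Psi>' \<theta>\<bar> * g (\<Psi> \<theta>)) has_integral S p) {0<..<A}"
    by (rule has_integral_eq[rotated, OF Dint]) (simp add: val)
  have "0 \<le> \<bar>\<Psi>' \<theta>\<bar> * g (\<Psi> \<theta>)" if "\<theta> \<in> {0<..<A}" for \<theta>
    unfolding val[OF that] by (rule D_nonneg)
  then have "(\<lambda>\<theta>. \<bar>\<Psi>' \<theta>\<bar> * g (\<Psi> \<theta>)) absolutely_integrable_on {0<..<A}"
    using has_integral_integrable[OF vi] by (intro nonnegative_absolutely_integrable_1)
  then have "(\<lambda>\<theta>. \<bar>\<Psi>' \<theta>\<bar> * g (\<Psi> \<theta>)) absolutely_integrable_on {0<..<A} \<and> integral {0<..<A} (\<lambda>\<theta>. \<bar>\<Psi>' \<theta>\<bar> * g (\<Psi> \<theta>)) = S p"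
    using integral_unique[OF vi] by blast
  then have "g absolutely_integrable_on \<Psi> ` {0<..<A} \<and> integral (\<Psi> ` {0<..<A}) g = S p"
    by (subst (asm) has_absolute_integral_change_of_variables_1'[OF _ has_field_derivative_at_within[OF \<Psi>d] inj]) auto
  then have "integral {0..Y} g = S p" unfolding img by (simp add: integral_open_interval_real)
  then show ?thesis by (simp add: g_def[abs_def] Y_def p_def)
qed

end

context truncated
begin

text \<open>Dominated convergence: \<open>e v \<le> (1 - v)\<^sup>2 / p\<^sup>2\<close> and \<open>k \<ge> c (1 - v)\<^sup>2\<close> bound the integrand uniformly in
  \<open>\<epsilon>\<close>, and for fixed \<open>v < 1\<close> the truncation level eventually exceeds \<open>v\<close>.\<close>

lemma jump_converges:
  assumes m: "0 < m" "m < 1"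
    and ev: "eventually (\<lambda>\<epsilon>. 0 < \<epsilon> \<and> (1 + m) / 2 \<le> seps \<epsilon> \<and> qs \<epsilon> m < Q \<epsilon>) (at_right 0)"
    and Q: "(Q \<longlongrightarrow> (w m)\<^sup>2 / 4) (at_right 0)"
    and se_lim: "(seps \<longlongrightarrow> 1) (at_right 0)"
  shows "((\<lambda>\<epsilon>. 4 * sqrt (Q \<epsilon>) * integral {0..sqrt (1 - m)} (\<lambda>z. e \<epsilon> (m + z\<^sup>2) / sqrt (k \<epsilon> m (Q \<epsilon>) z)))
     \<longlongrightarrow> S (w m)) (at_right 0)"
proof -
  define Y where "Y = sqrt (1 - m)"
  define p where "p = w m"
  have p: "0 < p" using w_pos m by (simp add: p_def)
  define c where "c = dw m / (16 * \<sigma>c)"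
  have c: "0 < c" using dw_pos[of m] m \<sigma>c_pos by (simp add: c_def)
  define Fn where "Fn \<epsilon> z = e \<epsilon> (m + z\<^sup>2) / sqrt (k \<epsilon> m (Q \<epsilon>) z)" for \<epsilon> z
  \<comment> \<open>the value \<open>0\<close> at \<open>z = 0\<close> spares the limit of the difference quotient there\<close>
  define Gn where "Gn \<epsilon> z = (if z = 0 then 0 else Fn \<epsilon> z)" for \<epsilon> z
  have FG: "integral {0..Y} (Fn \<epsilon>) = integral {0..Y} (Gn \<epsilon>)" for \<epsilon>
    by (rule integral_spike[of "{0}"]) (auto simp: Gn_def)
  define F0 where "F0 z = (if z < Y \<and> z \<noteq> 0 then 1 / (f (m + z\<^sup>2))\<^sup>2 / sqrt (k0 m z) else 0)" for z
  have lim: "((\<lambda>\<epsilon>. integral {0..Y} (Gn \<epsilon>)) \<longlongrightarrow> integral {0..Y} F0) (at_right 0)"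
    unfolding tendsto_at_iff_sequentially
  proof (intro allI impI)
    \<comment> \<open>along a sequence of parameters; its first terms, where the hypotheses may fail, are discarded\<close>
    fix E :: "nat \<Rightarrow> real"
    assume E: "\<forall>i. E i \<in> {0<..} - {0}" and E0: "E \<longlonglongrightarrow> 0"
    have Elim: "filterlim E (at_right 0) sequentially"
    proof -
      have pos: "0 < E i" for i using E by simp
      have "E i \<noteq> 0" for i using pos[of i] by simp
      note this pos
      then show ?thesis using E0 by (simp add: filterlim_at)
    qed
    from eventually_compose_filterlim[OF ev Elim]
    obtain N where N: "\<And>n. n \<ge> N \<Longrightarrow> 0 < E n \<and> (1 + m) / 2 \<le> seps (E n) \<and> qs (E n) m < Q (E n)"
      by (auto simp: eventually_sequentially)
    define E' where "E' n = E (n + N)" for n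
    have E': "0 < E' n" "(1 + m) / 2 \<le> seps (E' n)" "qs (E' n) m < Q (E' n)" for n
      using N[of "n + N"] by (auto simp: E'_def)
    note P = E'(1) m E'(2)
    have E'lim: "filterlim E' (at_right 0) sequentially"
      unfolding E'_def by (rule filterlim_compose[OF Elim filterlim_add_const_nat_at_top])
    have E'0: "E' \<longlonglongrightarrow> 0" using E'lim by (simp add: filterlim_at)
    have Q': "(\<lambda>n. Q (E' n)) \<longlonglongrightarrow> p\<^sup>2 / 4" using filterlim_compose[OF Q E'lim] by (simp add: p_def)
    have se': "(\<lambda>n. seps (E' n)) \<longlonglongrightarrow> 1" using filterlim_compose[OF se_lim E'lim] .
    have zr: "m \<le> m + z\<^sup>2" "m + z\<^sup>2 \<le> 1" "0 < m + z\<^sup>2" "z \<in> {-Y..Y}" "\<bar>z\<bar> \<le> sqrt (1 - m)" if "z \<in> {0..Y}" for z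
      using that m y_range[OF P(1)[of 0] m P(4)[of 0], of z] by (auto simp: Y_def add_pos_nonneg)
    have kp: "0 < k (E' n) m (Q (E' n)) z" if "z \<in> {0..Y}" for n z
      using k_pos[OF P(1) m P(4) E'(3)] zr[OF that] by simp
    have kl: "c * (1 - (m + z\<^sup>2))\<^sup>2 \<le> k (E' n) m (Q (E' n)) z" if "z \<in> {0..Y}" for n z
      unfolding c_def using E'(3)[of n] zr[OF that] by (intro k_lower[OF P(1) m P(4)]) auto
    have "(\<lambda>n. integral {0..Y} (Gn (E' n))) \<longlonglongrightarrow> integral {0..Y} F0"
    proof (rule dominated_convergence(2))
      fix n
      have ec: "continuous_on {0..Y} (\<lambda>z. e (E' n) (m + z\<^sup>2))"
        by (rule continuous_on_compose2[OF e_cont[OF E'(1)]]) (use zr in \<open>auto intro!: continuous_intros\<close>)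
      have kc: "continuous_on {0..Y} (k (E' n) m (Q (E' n)))"
        by (rule continuous_on_subset[OF k_cont[OF P(1) m P(4)]]) (use m in \<open>auto simp: Y_def intro: order_trans[of _ 0]\<close>)
      have "Fn (E' n) integrable_on {0..Y}"
        unfolding Fn_def using kp[of _ n] by (intro integrable_continuous_real continuous_intros ec kc) force
      then show "Gn (E' n) integrable_on {0..Y}"
        by (rule integrable_spike[of _ _ "{0}"]) (auto simp: Gn_def)
    next
      show "(\<lambda>_. 1 / (p\<^sup>2 * sqrt c)) integrable_on {0..Y}" by (rule integrable_const_ivl)
    next
      fix n z assume z: "z \<in> {0..Y}"
      define v where "v = m + z\<^sup>2"
      have v: "m \<le> v" "v \<le> 1" "0 < v" using zr[OF z] by (auto simp: v_def)
      have e0: "0 \<le> e (E' n) v" "e (E' n) v \<le> (1 - v)\<^sup>2 / p\<^sup>2"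
        using e_nonneg[OF E'(1)] e_le_p[OF P(1) m P(4)] v by (auto simp: p_def)
      have "norm (Fn (E' n) z) \<le> 1 / (p\<^sup>2 * sqrt c)"
      proof (cases "v = 1")
        case True
        then have "Fn (E' n) z = 0" using e_1[OF E'(1)] by (simp add: Fn_def v_def)
        then show ?thesis using c by simp
      next
        case False
        then have v1: "0 < 1 - v" using v by simp
        have "sqrt (c * (1 - v)\<^sup>2) \<le> sqrt (k (E' n) m (Q (E' n)) z)"
          using kl[OF z, of n] by (intro real_sqrt_le_mono) (simp add: v_def)
        then have sk: "sqrt c * (1 - v) \<le> sqrt (k (E' n) m (Q (E' n)) z)" using v1 by (simp add: real_sqrt_mult)
        have "e (E' n) v / sqrt (k (E' n) m (Q (E' n)) z) \<le> ((1 - v)\<^sup>2 / p\<^sup>2) / (sqrt c * (1 - v))"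
          using e0 sk c v1 by (intro frac_le) auto
        also have "\<dots> = (1 - v) * (1 / (p\<^sup>2 * sqrt c))" using v1 by (simp add: power2_eq_square)
        also have "\<dots> \<le> 1 * (1 / (p\<^sup>2 * sqrt c))" using v v1 c m by (intro mult_right_mono) auto
        finally show ?thesis using e0 kp[OF z, of n] by (simp add: Fn_def v_def)
      qed
      then show "norm (Gn (E' n) z) \<le> 1 / (p\<^sup>2 * sqrt c)" using c by (simp add: Gn_def)
    next
      fix z assume z: "z \<in> {0..Y}"
      have "(\<lambda>n. Fn (E' n) z) \<longlonglongrightarrow> F0 z" if "z \<noteq> 0"
      proof (cases "z = Y")
        case True
        then have "m + z\<^sup>2 = 1" using m by (simp add: Y_def)
        then have "Fn (E' n) z = 0" for n using e_1[OF E'(1)] by (simp add: Fn_def)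
        then show ?thesis using True by (simp add: F0_def)
      next
        case False
        have zY: "0 < z" "z < Y" using z that False by auto
        define v where "v = m + z\<^sup>2"
        have "z\<^sup>2 < Y\<^sup>2" using zY by (intro power_strict_mono) auto
        then have "m < v" "v < 1" using zY m by (auto simp: v_def Y_def)
        then have v: "m < v" "v < 1" "0 < v" using m by auto
        have "eventually (\<lambda>n. v < seps (E' n)) sequentially" using order_tendstoD(1)[OF se' v(2)] .
        then have ev2: "eventually (\<lambda>n. e (E' n) v = 1 / (f v)\<^sup>2 - E' n \<and>
            k (E' n) m (Q (E' n)) z = Q (E' n) * ((1 / (f m)\<^sup>2 - 1 / (f v)\<^sup>2) / z\<^sup>2) - (2 * (1 - m) - z\<^sup>2) / 4) sequentially"
        proof eventually_elim
          case (elim n)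
          have 1: "e (E' n) v = 1 / (f v)\<^sup>2 - E' n" using e_low[OF E'(1)] v elim by simp
          then show ?case using e_m[OF P(1) m P(4), of n] zY
            by (simp add: k_def[OF P(1) m P(4)] B_def[OF P(1) m P(4)] v_def)
        qed
        have "(\<lambda>n. 1 / (f v)\<^sup>2 - E' n) \<longlonglongrightarrow> 1 / (f v)\<^sup>2 - 0" by (intro tendsto_intros E'0)
        then have l1: "(\<lambda>n. e (E' n) v) \<longlonglongrightarrow> 1 / (f v)\<^sup>2"
          unfolding diff_0_right by (rule Lim_transform_eventually) (use ev2 in eventually_elim, simp)
        have "(\<lambda>n. Q (E' n) * ((1 / (f m)\<^sup>2 - 1 / (f v)\<^sup>2) / z\<^sup>2) - (2 * (1 - m) - z\<^sup>2) / 4) \<longlonglongrightarrow>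
            p\<^sup>2 / 4 * ((1 / (f m)\<^sup>2 - 1 / (f v)\<^sup>2) / z\<^sup>2) - (2 * (1 - m) - z\<^sup>2) / 4" by (intro tendsto_intros Q') auto
        then have "(\<lambda>n. k (E' n) m (Q (E' n)) z) \<longlonglongrightarrow> p\<^sup>2 / 4 * ((1 / (f m)\<^sup>2 - 1 / (f v)\<^sup>2) / z\<^sup>2) - (2 * (1 - m) - z\<^sup>2) / 4"
          by (rule Lim_transform_eventually) (use ev2 in eventually_elim, simp)
        moreover have "p\<^sup>2 / 4 * ((1 / (f m)\<^sup>2 - 1 / (f v)\<^sup>2) / z\<^sup>2) - (2 * (1 - m) - z\<^sup>2) / 4 = k0 m z"
          by (simp add: k0_def p_def v_def)
        ultimately have l2: "(\<lambda>n. k (E' n) m (Q (E' n)) z) \<longlonglongrightarrow> k0 m z" by (simp only:)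
        have "c * (1 - v)\<^sup>2 \<le> k0 m z"
          by (rule tendsto_lowerbound[OF l2]) (use kl[OF z] in \<open>auto simp: v_def\<close>)
        moreover have "0 < c * (1 - v)\<^sup>2" using c v by simp
        ultimately have "0 < k0 m z" by linarith
        then have "(\<lambda>n. e (E' n) v / sqrt (k (E' n) m (Q (E' n)) z)) \<longlonglongrightarrow> 1 / (f v)\<^sup>2 / sqrt (k0 m z)"
          by (intro tendsto_intros l1 l2) auto
        then show ?thesis using zY by (simp add: Fn_def F0_def v_def)
      qed
      then show "(\<lambda>n. Gn (E' n) z) \<longlonglongrightarrow> F0 z" by (cases "z = 0") (auto simp: Gn_def F0_def)
    qed
    then show "((\<lambda>\<epsilon>. integral {0..Y} (Gn \<epsilon>)) \<circ> E) \<longlonglongrightarrow> integral {0..Y} F0"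
      by (simp add: E'_def comp_def LIMSEQ_offset)
  qed
  have sp: "sqrt (p\<^sup>2 / 4) = p / 2" using p by (simp add: real_sqrt_divide)
  have "((\<lambda>\<epsilon>. 4 * sqrt (Q \<epsilon>) * integral {0..Y} (Fn \<epsilon>)) \<longlongrightarrow> 4 * sqrt (p\<^sup>2 / 4) * integral {0..Y} F0) (at_right 0)"
    unfolding FG using Q by (intro tendsto_intros lim) (simp add: p_def)
  moreover have "4 * sqrt (p\<^sup>2 / 4) * integral {0..Y} F0 = S (w m)"
  proof -
    have "4 * sqrt (p\<^sup>2 / 4) * integral {0..Y} F0 = integral {0..Y} (\<lambda>z. 2 * p * F0 z)"
      unfolding sp by (subst integral_mult_right) simp
    also have "\<dots> = integral {0..Y} (\<lambda>z. 2 * w m * (1 / (f (m + z\<^sup>2))\<^sup>2 / sqrt (k0 m z)))"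
      by (rule integral_spike[of "{0, Y}"]) (auto simp: F0_def p_def)
    also have "\<dots> = S (w m)" unfolding Y_def using jump_integral[OF m] by simp
    finally show ?thesis .
  qed
  ultimately show ?thesis unfolding Fn_def[abs_def] Y_def by (simp only:)
qed

end

section \<open>Approximation of the three limits\<close>

lemma nn_integral_lebesgue_on_triangle:
  fixes u z z' :: "real \<Rightarrow> real"
  assumes "u \<in> borel_measurable (lebesgue_on {0<..<L})" "z \<in> borel_measurable borel" "0 \<le> K" "0 < L"
    and le: "\<And>x. x \<in> {0<..<L} \<Longrightarrow> \<bar>z x - z' x\<bar> \<le> K"
  shows "(\<integral>\<^sup>+x. ennreal \<bar>u x - z' x\<bar> \<partial>(lebesgue_on {0<..<L}))
    \<le> (\<integral>\<^sup>+x. ennreal \<bar>u x - z x\<bar> \<partial>(lebesgue_on {0<..<L})) + ennreal (K * L)"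
proof -
  have [measurable]: "u \<in> borel_measurable (lebesgue_on {0<..<L})" by fact
  have [measurable]: "z \<in> borel_measurable (lebesgue_on {0<..<L})"
    using assms(2) by (intro measurable_restrict_space1 measurable_completion) simp
  have "(\<integral>\<^sup>+x. ennreal \<bar>u x - z' x\<bar> \<partial>(lebesgue_on {0<..<L}))
     \<le> (\<integral>\<^sup>+x. ennreal \<bar>u x - z x\<bar> + ennreal K \<partial>(lebesgue_on {0<..<L}))"
  proof (rule nn_integral_mono)
    fix x assume "x \<in> space (lebesgue_on {0<..<L})"
    then have "\<bar>z x - z' x\<bar> \<le> K" using le by (simp add: space_restrict_space)
    then have "\<bar>u x - z' x\<bar> \<le> \<bar>u x - z x\<bar> + K" by linarith
    then have "ennreal \<bar>u x - z' x\<bar> \<le> ennreal (\<bar>u x - z x\<bar> + K)" by (rule ennreal_leI)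
    then show "ennreal \<bar>u x - z' x\<bar> \<le> ennreal \<bar>u x - z x\<bar> + ennreal K" using assms(3) by simp
  qed
  also have "\<dots> = (\<integral>\<^sup>+x. ennreal \<bar>u x - z x\<bar> \<partial>(lebesgue_on {0<..<L})) + (\<integral>\<^sup>+x. ennreal K \<partial>(lebesgue_on {0<..<L}))"
    by (rule nn_integral_add) auto
  also have "(\<integral>\<^sup>+x. ennreal K \<partial>(lebesgue_on {0<..<L})) = ennreal (K * L)"
    using assms(3,4) by (simp add: emeasure_restrict_space space_restrict_space ennreal_mult)
  finally show ?thesis .
qed

text \<open>For each \<open>\<epsilon>\<close> take an error within \<open>\<epsilon>\<close> of the infimum of the errors that can be achieved. If every
  error is eventually achieved, these infima tend to \<open>0\<close>.\<close>

lemma near_infimum_selection: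
  fixes A :: "real \<Rightarrow> real \<Rightarrow> 'b \<Rightarrow> bool"
  assumes ev: "\<And>\<delta>. 0 < \<delta> \<Longrightarrow> eventually (\<lambda>\<epsilon>. \<exists>x. A \<delta> \<epsilon> x) (at_right 0)"
  obtains \<epsilon>0 X r where "0 < \<epsilon>0" "\<And>\<epsilon>. 0 < \<epsilon> \<Longrightarrow> \<epsilon> < \<epsilon>0 \<Longrightarrow> 0 < r \<epsilon> \<and> A (r \<epsilon>) \<epsilon> (X \<epsilon>)"
    "(r \<longlongrightarrow> 0) (at_right 0)"
proof -
  define D where "D \<epsilon> = {\<delta>. 0 < \<delta> \<and> (\<exists>x. A \<delta> \<epsilon> x)}" for \<epsilon>
  have bdd: "bdd_below (D \<epsilon>)" for \<epsilon> by (auto simp: D_def bdd_below_def intro!: exI[of _ 0] less_imp_le)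
  obtain \<epsilon>0 where e0: "0 < \<epsilon>0" "\<And>\<epsilon>. 0 < \<epsilon> \<Longrightarrow> \<epsilon> < \<epsilon>0 \<Longrightarrow> \<exists>x. A 1 \<epsilon> x"
    using ev[of 1] unfolding eventually_at_right_field by auto
  have "\<exists>\<delta> x. \<delta> < Inf (D \<epsilon>) + \<epsilon> \<and> 0 < \<delta> \<and> A \<delta> \<epsilon> x" if "0 < \<epsilon>" "\<epsilon> < \<epsilon>0" for \<epsilon>
  proof -
    have "D \<epsilon> \<noteq> {}" using e0(2)[OF that] by (auto simp: D_def intro!: exI[of _ 1])
    moreover have "Inf (D \<epsilon>) < Inf (D \<epsilon>) + \<epsilon>" using that by simp
    ultimately obtain \<delta> where "\<delta> \<in> D \<epsilon>" "\<delta> < Inf (D \<epsilon>) + \<epsilon>" using cInf_lessD by blast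
    then show ?thesis by (auto simp: D_def)
  qed
  then obtain r X where rX: "\<And>\<epsilon>. 0 < \<epsilon> \<Longrightarrow> \<epsilon> < \<epsilon>0 \<Longrightarrow> r \<epsilon> < Inf (D \<epsilon>) + \<epsilon> \<and> 0 < r \<epsilon> \<and> A (r \<epsilon>) \<epsilon> (X \<epsilon>)"
    by metis
  have "(r \<longlongrightarrow> 0) (at_right 0)"
  proof (rule tendstoI)
    fix \<eta> :: real assume \<eta>: "0 < \<eta>"
    have "eventually (\<lambda>\<epsilon>::real. 0 < \<epsilon> \<and> \<epsilon> < min \<epsilon>0 (\<eta> / 2)) (at_right 0)"
      unfolding eventually_at_right_field using e0 \<eta> by (intro exI[of _ "min \<epsilon>0 (\<eta> / 2)"]) auto
    moreover have "eventually (\<lambda>\<epsilon>. \<exists>x. A (\<eta> / 2) \<epsilon> x) (at_right 0)" using ev \<eta> by simp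
    ultimately show "eventually (\<lambda>\<epsilon>. dist (r \<epsilon>) 0 < \<eta>) (at_right 0)"
    proof eventually_elim
      case (elim \<epsilon>)
      then have "\<eta> / 2 \<in> D \<epsilon>" using \<eta> by (auto simp: D_def)
      then have "Inf (D \<epsilon>) \<le> \<eta> / 2" using bdd by (rule cInf_lower)
      then show ?case using rX[of \<epsilon>] elim by (auto simp: dist_real_def)
    qed
  qed
  then show thesis using that[of \<epsilon>0 r X] e0(1) rX by blast
qed

context truncated
begin

text \<open>The bound \<open>C\<close> on the energy is independent of the error \<open>\<delta>\<close>, so that a diagonal choice keeps it.\<close>

definition approximates :: "real \<Rightarrow> real \<Rightarrow> (real \<Rightarrow> real) \<Rightarrow> real \<Rightarrow> real \<Rightarrow> real \<Rightarrow>
    (real \<Rightarrow> real) \<times> (real \<Rightarrow> real) \<times> real \<Rightarrow> bool" where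
  "approximates L a ubar C \<delta> \<epsilon> = (\<lambda>(u, v, b).
     critical_point L (trunc_f f seps \<psi> \<epsilon>) \<epsilon> b u v \<and> \<bar>b - a\<bar> \<le> \<delta> \<and>
     phase_field_energy L (trunc_f f seps \<psi> \<epsilon>) \<epsilon> u v \<le> ennreal C \<and>
     (\<integral>\<^sup>+x. ennreal \<bar>u x - ubar x\<bar> \<partial>(lebesgue_on {0<..<L})) \<le> ennreal \<delta>)"

lemma approximates_imp_recovery:
  assumes ev: "\<And>\<delta>. 0 < \<delta> \<Longrightarrow> eventually (\<lambda>\<epsilon>. \<exists>x. approximates L a ubar C \<delta> \<epsilon> x) (at_right 0)"
  shows "\<exists>\<epsilon>0>0. \<exists>(u :: real \<Rightarrow> real \<Rightarrow> real) (v :: real \<Rightarrow> real \<Rightarrow> real) (b :: real \<Rightarrow> real).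
     (\<forall>\<epsilon>\<in>{0<..<\<epsilon>0}. critical_point L (trunc_f f seps \<psi> \<epsilon>) \<epsilon> (b \<epsilon>) (u \<epsilon>) (v \<epsilon>)) \<and>
     (b \<longlongrightarrow> a) (at_right 0) \<and>
     (\<exists>C::real. \<forall>\<epsilon>\<in>{0<..<\<epsilon>0}.
        phase_field_energy L (trunc_f f seps \<psi> \<epsilon>) \<epsilon> (u \<epsilon>) (v \<epsilon>) \<le> ennreal C) \<and>
     ((\<lambda>\<epsilon>. \<integral>\<^sup>+x. ennreal \<bar>u \<epsilon> x - ubar x\<bar> \<partial>(lebesgue_on {0<..<L})) \<longlongrightarrow> 0) (at_right 0)"
proof -
  obtain \<epsilon>0 X r where e0: "0 < \<epsilon>0" and X: "\<And>\<epsilon>. 0 < \<epsilon> \<Longrightarrow> \<epsilon> < \<epsilon>0 \<Longrightarrow> 0 < r \<epsilon> \<and> approximates L a ubar C (r \<epsilon>) \<epsilon> (X \<epsilon>)"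
    and r: "(r \<longlongrightarrow> 0) (at_right 0)"
  proof (rule near_infimum_selection[where A = "approximates L a ubar C"])
    show "eventually (\<lambda>\<epsilon>. \<exists>x. approximates L a ubar C \<delta> \<epsilon> x) (at_right 0)" if "0 < \<delta>" for \<delta>
      using that by (rule ev)
  qed (rule that)
  define u v b where "u \<epsilon> = fst (X \<epsilon>)" and "v \<epsilon> = fst (snd (X \<epsilon>))" and "b \<epsilon> = snd (snd (X \<epsilon>))" for \<epsilon>
  have A: "critical_point L (trunc_f f seps \<psi> \<epsilon>) \<epsilon> (b \<epsilon>) (u \<epsilon>) (v \<epsilon>)" "\<bar>b \<epsilon> - a\<bar> \<le> r \<epsilon>"
     "phase_field_energy L (trunc_f f seps \<psi> \<epsilon>) \<epsilon> (u \<epsilon>) (v \<epsilon>) \<le> ennreal C"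
     "(\<integral>\<^sup>+x. ennreal \<bar>u \<epsilon> x - ubar x\<bar> \<partial>(lebesgue_on {0<..<L})) \<le> ennreal (r \<epsilon>)" if "0 < \<epsilon>" "\<epsilon> < \<epsilon>0" for \<epsilon>
    using X[OF that] by (auto simp: approximates_def u_def v_def b_def split: prod.splits)
  have ev0: "eventually (\<lambda>\<epsilon>. 0 < \<epsilon> \<and> \<epsilon> < \<epsilon>0) (at_right 0)"
    unfolding eventually_at_right_field using e0 by auto
  have "((\<lambda>\<epsilon>. b \<epsilon> - a) \<longlongrightarrow> 0) (at_right 0)"
    by (rule Lim_null_comparison[OF _ r]) (use ev0 in eventually_elim, use A(2) in auto)
  then have "(b \<longlongrightarrow> a) (at_right 0)" using Lim_null by blast
  moreover have "((\<lambda>\<epsilon>. \<integral>\<^sup>+x. ennreal \<bar>u \<epsilon> x - ubar x\<bar> \<partial>(lebesgue_on {0<..<L})) \<longlongrightarrow> 0) (at_right 0)"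
  proof (rule tendsto_sandwich[OF _ _ tendsto_const])
    show "((\<lambda>\<epsilon>. ennreal (r \<epsilon>)) \<longlongrightarrow> 0) (at_right 0)" using tendsto_ennrealI[OF r] by simp
    show "eventually (\<lambda>\<epsilon>. (\<integral>\<^sup>+x. ennreal \<bar>u \<epsilon> x - ubar x\<bar> \<partial>(lebesgue_on {0<..<L})) \<le> ennreal (r \<epsilon>)) (at_right 0)"
      using ev0 by eventually_elim (use A(4) in auto)
  qed simp
  ultimately show ?thesis using e0 A(1,3)
    by (intro exI[of _ \<epsilon>0] conjI exI[of _ u] exI[of _ v] exI[of _ b] exI[of _ C]) auto
qed

text \<open>Since \<open>h' 1 = 0\<close>, every term of the
  equation for \<open>v\<close> vanishes, and \<open>h\<^sup>2 u'\<close> is constant.\<close>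

lemma constant_critical_point:
  assumes L: "L > 0" and \<epsilon>: "\<epsilon> > 0" and ubar: "\<And>x. x \<in> {0<..<L} \<Longrightarrow> ubar x = a / L * x" and \<delta>: "0 < \<delta>"
  shows "approximates L a ubar (a\<^sup>2 / L) \<delta> \<epsilon> (\<lambda>x. a / L * x, \<lambda>x. 1, a)"
proof -
  define I where "I = {0<..<L}"
  have I: "open I" "is_interval I" "I \<noteq> {}" using L by (auto simp: I_def is_interval_oo)
  define u v where "u = (\<lambda>x. a / L * x)" and "v = (\<lambda>x::real. 1 :: real)"
  have hh: "trunc_f f seps \<psi> \<epsilon> = h \<epsilon>" by (simp add: h_def[OF \<epsilon>])
  have dh1: "deriv (h \<epsilon>) 1 = 0" using deriv_h[OF \<epsilon>, of 1] se[OF \<epsilon>] d\<psi>_1[OF \<epsilon>] by (simp add: dh_def[OF \<epsilon>])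
  have uc: "continuous_on {0..L} u" and vc: "continuous_on {0..L} v"
    unfolding u_def v_def using L by (auto intro!: continuous_intros)
  have sub: "I \<subseteq> {0..L}" by (auto simp: I_def)
  have cc: "continuous_on {0..L} (\<lambda>x. c)" for c :: real by (rule continuous_on_const)
  have wu: "has_weak_deriv_on u (\<lambda>x. a / L) I"
    by (rule has_weak_deriv_on_piecewise_C1[OF I continuous_on_subset[OF uc sub] finite.emptyI])
       (use continuous_on_interval_L2(2)[OF cc] in \<open>auto simp: u_def I_def intro!: derivative_eq_intros\<close>)
  have wc: "has_weak_deriv_on (\<lambda>x. c) (\<lambda>x. 0) I" for c
    by (rule has_weak_deriv_on_piecewise_C1[OF I continuous_on_subset[OF cc sub] finite.emptyI])
       (use continuous_on_interval_L2(2)[OF cc] in \<open>auto simp: I_def\<close>)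
  have wv: "has_weak_deriv_on v (\<lambda>x. 0) I" unfolding v_def by (rule wc)
  have H1: "u \<in> H1_on I" "v \<in> H1_on I"
    unfolding H1_on_def I_def
    using continuous_on_interval_L2(1)[OF uc] continuous_on_interval_L2(1)[OF vc] continuous_on_interval_L2(1)[OF cc] wu wv
    unfolding I_def by blast+
  note AEu = weak_deriv_on_AE_eq(2)[OF wu I] and AEv = weak_deriv_on_AE_eq(2)[OF wv I]
  have 1: "(LINT x:I|lebesgue. \<epsilon> * weak_deriv_on I v x * deriv \<phi> x
      + h \<epsilon> (v x) * deriv (h \<epsilon>) (v x) * (weak_deriv_on I u x)\<^sup>2 * \<phi> x + (v x - 1) / (4 * \<epsilon>) * \<phi> x) = 0" for \<phi>
  proof -
    have "(LINT x|lebesgue. indicator I x *\<^sub>R (\<epsilon> * weak_deriv_on I v x * deriv \<phi> x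
      + h \<epsilon> (v x) * deriv (h \<epsilon>) (v x) * (weak_deriv_on I u x)\<^sup>2 * \<phi> x + (v x - 1) / (4 * \<epsilon>) * \<phi> x))
      = integral\<^sup>L (lebesgue :: real measure) (\<lambda>x. 0 :: real)"
    proof (rule integral_cong_AE_integrable)
      show "AE x in lebesgue. indicator I x *\<^sub>R (\<epsilon> * weak_deriv_on I v x * deriv \<phi> x
      + h \<epsilon> (v x) * deriv (h \<epsilon>) (v x) * (weak_deriv_on I u x)\<^sup>2 * \<phi> x + (v x - 1) / (4 * \<epsilon>) * \<phi> x) = 0"
        using AEv by eventually_elim (auto simp: v_def dh1 indicator_def)
    qed simp
    then show ?thesis by (simp add: set_lebesgue_integral_def)
  qed
  have 2: "(LINT x:I|lebesgue. (h \<epsilon> (v x))\<^sup>2 * weak_deriv_on I u x * deriv \<phi> x) = 0" if t: "test_function I \<phi>" for \<phi>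
  proof -
    have l: "locally_integrable_on (\<lambda>x. a / L) I" using wc[of "a / L"] by (auto simp: has_weak_deriv_on_def)
    note si = set_integrable_times_test(2)[OF l I t]
    have "(LINT x:I|lebesgue. a / L * deriv \<phi> x) = - (LINT x:I|lebesgue. 0 * \<phi> x)"
      using wc[of "a / L"] t unfolding has_weak_deriv_on_def by blast
    then have "(LINT x:I|lebesgue. a / L * deriv \<phi> x) = 0" by (simp add: set_lebesgue_integral_def)
    moreover have "(LINT x:I|lebesgue. (h \<epsilon> (v x))\<^sup>2 * weak_deriv_on I u x * deriv \<phi> x) = (LINT x:I|lebesgue. a / L * deriv \<phi> x)"
      unfolding set_lebesgue_integral_def
    proof (rule integral_cong_AE_integrable)
      show "integrable lebesgue (\<lambda>x. indicator I x *\<^sub>R (a / L * deriv \<phi> x))" using si unfolding set_integrable_def .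
      show "AE x in lebesgue. indicator I x *\<^sub>R ((h \<epsilon> (v x))\<^sup>2 * weak_deriv_on I u x * deriv \<phi> x) = indicator I x *\<^sub>R (a / L * deriv \<phi> x)"
        using AEu by eventually_elim (auto simp: v_def h_1[OF \<epsilon>] indicator_def)
    qed
    ultimately show ?thesis by simp
  qed
  have cp: "critical_point L (h \<epsilon>) \<epsilon> a u v"
    unfolding critical_point_def Let_def I_def[symmetric]
    using 1 2 H1 uc vc L by (auto simp: v_def u_def)
  have "AE x in lebesgue_on I. 0 \<le> v x \<and> v x \<le> 1" by (simp add: v_def)
  then have "phase_field_energy L (h \<epsilon>) \<epsilon> u v = (\<integral>\<^sup>+x. ennreal ((h \<epsilon> (v x))\<^sup>2 * \<bar>weak_deriv_on I u x\<bar>\<^sup>2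
      + (1 - v x)\<^sup>2 / (4 * \<epsilon>) + \<epsilon> * \<bar>weak_deriv_on I v x\<bar>\<^sup>2) \<partial>(lebesgue_on I))"
    unfolding phase_field_energy_def Let_def I_def[symmetric] using H1 by simp
  also have "\<dots> = (\<integral>\<^sup>+x. ennreal ((a / L)\<^sup>2) \<partial>(lebesgue_on I))"
  proof (rule nn_integral_cong_AE)
    have "AE x in lebesgue. x \<in> I \<longrightarrow> weak_deriv_on I u x = a / L \<and> weak_deriv_on I v x = 0"
      using AEu AEv by eventually_elim auto
    then have "AE x in lebesgue_on I. weak_deriv_on I u x = a / L \<and> weak_deriv_on I v x = 0"
      by (subst AE_restrict_space_iff) (auto simp: I_def)
    then show "AE x in lebesgue_on I. ennreal ((h \<epsilon> (v x))\<^sup>2 * \<bar>weak_deriv_on I u x\<bar>\<^sup>2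
      + (1 - v x)\<^sup>2 / (4 * \<epsilon>) + \<epsilon> * \<bar>weak_deriv_on I v x\<bar>\<^sup>2) = ennreal ((a / L)\<^sup>2)"
      by eventually_elim (simp add: v_def h_1[OF \<epsilon>] power_divide)
  qed
  also have "\<dots> = ennreal ((a / L)\<^sup>2 * L)"
    using L by (simp add: I_def emeasure_restrict_space space_restrict_space ennreal_mult)
  also have "(a / L)\<^sup>2 * L = a\<^sup>2 / L" using L by (simp add: power2_eq_square)
  finally have en: "phase_field_energy L (h \<epsilon>) \<epsilon> u v \<le> ennreal (a\<^sup>2 / L)" by simp
  have "(\<integral>\<^sup>+x. ennreal \<bar>u x - ubar x\<bar> \<partial>(lebesgue_on {0<..<L})) = (\<integral>\<^sup>+x. 0 \<partial>(lebesgue_on {0<..<L}))"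
    by (rule nn_integral_cong) (use ubar in \<open>auto simp: space_restrict_space u_def\<close>)
  then show ?thesis using cp en \<delta> unfolding approximates_def hh by (simp add: u_def v_def)
qed

text \<open>Choose \<open>m\<close> with \<open>w m = p\<close> and, for each small \<open>\<epsilon>\<close>, some \<open>q\<close> between \<open>qs\<close> and \<open>qs + \<epsilon>\<close> with travel time
  \<open>L / 2\<close>. Since \<open>qs \<rightarrow> p\<^sup>2 / 4\<close>, the slope \<open>\<surd>q\<close> tends to \<open>p / 2\<close>, and the mass \<open>J\<close> tends to \<open>S p\<close>.\<close>

lemma cohesive_approximation:
  assumes L: "L > 0" and p: "0 < p" "p < \<sigma>c" and \<delta>: "0 < \<delta>"
  shows "eventually (\<lambda>\<epsilon>. \<exists>x. approximates L (p / 2 * L + S p)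
      (\<lambda>x. p / 2 * x + S p * indicator {L / 2<..<L} x) (p * (p / 2 * L + S p) + 2) \<delta> \<epsilon> x) (at_right 0)"
proof -
  define m where "m = om p"
  have m: "0 < m" "m < 1" and wm: "w m = p" using om_pos[OF p] om_props[of p] p by (auto simp: m_def)
  define Y where "Y = sqrt (1 - m)"
  have Y: "0 < Y" using m by (simp add: Y_def)
  define b where "b = (1 - m) / (2 * p\<^sup>2)"
  have b: "0 < b" using m p by (simp add: b_def)
  define c where "c = dw m / (16 * \<sigma>c)"
  have c: "0 < c" using dw_pos[of m] m \<sigma>c_pos by (simp add: c_def)
  have se_lim: "(seps \<longlongrightarrow> 1) (at_right 0)" using truncation unfolding truncation_data_def by blast
  have pos: "eventually (\<lambda>\<epsilon>::real. 0 < \<epsilon>) (at_right 0)" by (simp add: eventually_at_right_less)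
  have e1: "eventually (\<lambda>\<epsilon>. (1 + m) / 2 \<le> seps \<epsilon>) (at_right 0)"
    using order_tendstoD(1)[OF se_lim, of "(1 + m) / 2"] m by (auto elim: eventually_mono)
  have idlim: "((\<lambda>\<epsilon>::real. \<epsilon>) \<longlongrightarrow> 0) (at_right 0)" by (rule tendsto_ident_at)
  have e2: "eventually (\<lambda>\<epsilon>. 2 * \<epsilon> * (Y / sqrt (\<epsilon> * b)) \<le> L / 2) (at_right 0)"
  proof -
    have "((\<lambda>\<epsilon>. 2 * sqrt \<epsilon> * (Y / sqrt b)) \<longlongrightarrow> 2 * sqrt 0 * (Y / sqrt b)) (at_right 0)"
      by (intro tendsto_intros idlim)
    then have "eventually (\<lambda>\<epsilon>. 2 * sqrt \<epsilon> * (Y / sqrt b) < L / 2) (at_right 0)"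
      using L by (intro order_tendstoD(2)) auto
    then show ?thesis using pos
    proof eventually_elim
      case (elim \<epsilon>)
      have "\<epsilon> = sqrt \<epsilon> * sqrt \<epsilon>" using elim by simp
      then have "2 * \<epsilon> * (Y / sqrt (\<epsilon> * b)) = 2 * sqrt \<epsilon> * (Y / sqrt b)"
        using elim b by (simp add: real_sqrt_mult field_simps)
      then show ?case using elim by simp
    qed
  qed
  have good: "eventually (\<lambda>\<epsilon>. 0 < \<epsilon> \<and> (1 + m) / 2 \<le> seps \<epsilon> \<and> (\<exists>q. qs \<epsilon> m < q \<and> q \<le> qs \<epsilon> m + \<epsilon> \<and> T \<epsilon> m q = L / 2)) (at_right 0)"
    using pos e1 e2
  proof eventually_elim
    case (elim \<epsilon>)
    then show ?case using travel_time_attained[OF elim(1) m elim(2) L] by (simp add: wm Y_def b_def)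
  qed
  define Q where "Q \<epsilon> = (SOME q. qs \<epsilon> m < q \<and> q \<le> qs \<epsilon> m + \<epsilon> \<and> T \<epsilon> m q = L / 2)" for \<epsilon>
  have good2: "eventually (\<lambda>\<epsilon>. 0 < \<epsilon> \<and> (1 + m) / 2 \<le> seps \<epsilon> \<and> qs \<epsilon> m < Q \<epsilon> \<and> Q \<epsilon> \<le> qs \<epsilon> m + \<epsilon> \<and> T \<epsilon> m (Q \<epsilon>) = L / 2) (at_right 0)"
    using good
  proof eventually_elim
    case (elim \<epsilon>)
    then have "\<exists>q. qs \<epsilon> m < q \<and> q \<le> qs \<epsilon> m + \<epsilon> \<and> T \<epsilon> m q = L / 2" by blast
    from someI_ex[OF this, folded Q_def] show ?case using elim by blast
  qed
  have em: "eventually (\<lambda>\<epsilon>. e \<epsilon> m = 1 / (f m)\<^sup>2 - \<epsilon>) (at_right 0)"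
    using good2 by eventually_elim (use e_m m in auto)
  have fm: "0 < f m" using f_pos m by simp
  have em_lim: "((\<lambda>\<epsilon>. e \<epsilon> m) \<longlongrightarrow> 1 / (f m)\<^sup>2) (at_right 0)"
  proof -
    have "((\<lambda>\<epsilon>. 1 / (f m)\<^sup>2 - \<epsilon>) \<longlongrightarrow> 1 / (f m)\<^sup>2 - 0) (at_right 0)" by (intro tendsto_intros idlim)
    then have "((\<lambda>\<epsilon>. 1 / (f m)\<^sup>2 - \<epsilon>) \<longlongrightarrow> 1 / (f m)\<^sup>2) (at_right 0)" by simp
    then show ?thesis by (rule Lim_transform_eventually) (use em in \<open>auto elim: eventually_mono\<close>)
  qed
  have qs_lim: "((\<lambda>\<epsilon>. qs \<epsilon> m) \<longlongrightarrow> p\<^sup>2 / 4) (at_right 0)"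
  proof -
    have "((\<lambda>\<epsilon>. (1 - m)\<^sup>2 / (4 * e \<epsilon> m)) \<longlongrightarrow> (1 - m)\<^sup>2 / (4 * (1 / (f m)\<^sup>2))) (at_right 0)"
      using fm by (intro tendsto_intros em_lim) auto
    moreover have "(1 - m)\<^sup>2 / (4 * (1 / (f m)\<^sup>2)) = p\<^sup>2 / 4"
      unfolding wm[symmetric] w_def by (simp add: power_mult_distrib)
    ultimately have "((\<lambda>\<epsilon>. (1 - m)\<^sup>2 / (4 * e \<epsilon> m)) \<longlongrightarrow> p\<^sup>2 / 4) (at_right 0)" by simp
    then show ?thesis
      by (rule Lim_transform_eventually) (use good2 in eventually_elim, use qs_def m in auto)
  qed
  have Q_lim: "(Q \<longlongrightarrow> p\<^sup>2 / 4) (at_right 0)"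
  proof (rule tendsto_sandwich[OF _ _ qs_lim])
    have "((\<lambda>\<epsilon>. qs \<epsilon> m + \<epsilon>) \<longlongrightarrow> p\<^sup>2 / 4 + 0) (at_right 0)" by (intro tendsto_intros qs_lim idlim)
    then show "((\<lambda>\<epsilon>. qs \<epsilon> m + \<epsilon>) \<longlongrightarrow> p\<^sup>2 / 4) (at_right 0)" by simp
  qed (use good2 in \<open>auto elim: eventually_mono\<close>)
  define JJ where "JJ \<epsilon> = 4 * sqrt (Q \<epsilon>) * integral {0..sqrt (1 - m)} (\<lambda>z. e \<epsilon> (m + z\<^sup>2) / sqrt (k \<epsilon> m (Q \<epsilon>) z))" for \<epsilon>
  have J_lim: "(JJ \<longlongrightarrow> S p) (at_right 0)"
    unfolding JJ_def[abs_def] wm[symmetric]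
  proof (rule jump_converges[OF m _ _ se_lim])
    show "eventually (\<lambda>\<epsilon>. 0 < \<epsilon> \<and> (1 + m) / 2 \<le> seps \<epsilon> \<and> qs \<epsilon> m < Q \<epsilon>) (at_right 0)"
      using good2 by eventually_elim blast
    show "(Q \<longlongrightarrow> (w m)\<^sup>2 / 4) (at_right 0)" using Q_lim wm by simp
  qed
  have sQ: "((\<lambda>\<epsilon>. sqrt (Q \<epsilon>)) \<longlongrightarrow> p / 2) (at_right 0)"
    using tendsto_real_sqrt[OF Q_lim] p by (simp add: real_sqrt_divide)
  define bb where "bb \<epsilon> = sqrt (Q \<epsilon>) * L + JJ \<epsilon>" for \<epsilon>
  have b_lim: "(bb \<longlongrightarrow> p / 2 * L + S p) (at_right 0)" unfolding bb_def by (intro tendsto_intros sQ J_lim)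
  define En where "En \<epsilon> = 2 * sqrt (Q \<epsilon>) * bb \<epsilon> + 1 + 4 * sqrt (\<epsilon> * e \<epsilon> m)" for \<epsilon>
  have "(En \<longlongrightarrow> 2 * (p / 2) * (p / 2 * L + S p) + 1 + 4 * sqrt (0 * (1 / (f m)\<^sup>2))) (at_right 0)"
    unfolding En_def by (intro tendsto_intros sQ b_lim em_lim idlim)
  then have En_lim: "(En \<longlongrightarrow> p * (p / 2 * L + S p) + 1) (at_right 0)" by simp
  define M where "M \<epsilon> = sqrt (Q \<epsilon>) * 2 * Y / (sqrt c * p\<^sup>2) * (4 * \<epsilon> * Y / sqrt c)
     + (\<bar>sqrt (Q \<epsilon>) - p / 2\<bar> * L + \<bar>JJ \<epsilon> - S p\<bar>) * L" for \<epsilon>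
  have "(M \<longlongrightarrow> p / 2 * 2 * Y / (sqrt c * p\<^sup>2) * (4 * 0 * Y / sqrt c) + (\<bar>p / 2 - p / 2\<bar> * L + \<bar>S p - S p\<bar>) * L) (at_right 0)"
    unfolding M_def using c p by (intro tendsto_intros sQ J_lim idlim) auto
  then have M_lim: "(M \<longlongrightarrow> 0) (at_right 0)" by simp
  have f1: "eventually (\<lambda>\<epsilon>. M \<epsilon> < \<delta>) (at_right 0)" using order_tendstoD(2)[OF M_lim \<delta>] .
  have f2: "eventually (\<lambda>\<epsilon>. En \<epsilon> < p * (p / 2 * L + S p) + 2) (at_right 0)" using order_tendstoD(2)[OF En_lim] by simp
  have f3: "eventually (\<lambda>\<epsilon>. \<bar>bb \<epsilon> - (p / 2 * L + S p)\<bar> < \<delta>) (at_right 0)"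
    using tendstoD[OF b_lim \<delta>] by (simp add: dist_real_def)
  show ?thesis
    using good2 f1 f2 f3
  proof eventually_elim
    case (elim \<epsilon>)
    then have eps: "0 < \<epsilon>" and mse: "(1 + m) / 2 \<le> seps \<epsilon>" and q: "qs \<epsilon> m < Q \<epsilon>" "Q \<epsilon> \<le> qs \<epsilon> m + \<epsilon>"
      and TQ: "T \<epsilon> m (Q \<epsilon>) = L / 2" by auto
    note P = eps m mse q(1) L TQ
    define uu vv where "uu = u \<epsilon> m (Q \<epsilon>) L" and "vv = v \<epsilon> m (Q \<epsilon>) L"
    have JE: "J \<epsilon> m (Q \<epsilon>) = JJ \<epsilon>" by (simp add: J_def[OF P] JJ_def)
    have hh: "trunc_f f seps \<psi> \<epsilon> = h \<epsilon>" by (simp add: h_def[OF eps])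
    have uL: "uu L = bb \<epsilon>" unfolding uu_def u_L[OF P] bb_def JE ..
    have cp: "critical_point L (h \<epsilon>) \<epsilon> (bb \<epsilon>) uu vv"
      using critical[OF P] uL by (simp add: uu_def vv_def)
    have "phase_field_energy L (h \<epsilon>) \<epsilon> uu vv \<le> ennreal (2 * sqrt (Q \<epsilon>) * bb \<epsilon> + 1 + 4 * sqrt ((Q \<epsilon> - qs \<epsilon> m) * e \<epsilon> m))"
      using energy[OF P] uL by (simp add: uu_def vv_def)
    also have "\<dots> \<le> ennreal (p * (p / 2 * L + S p) + 2)"
    proof (rule ennreal_leI)
      have "(Q \<epsilon> - qs \<epsilon> m) * e \<epsilon> m \<le> \<epsilon> * e \<epsilon> m" using e_m_pos[OF eps m mse] q by (intro mult_right_mono) auto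
      then have "sqrt ((Q \<epsilon> - qs \<epsilon> m) * e \<epsilon> m) \<le> sqrt (\<epsilon> * e \<epsilon> m)" by (rule real_sqrt_le_mono)
      then show "2 * sqrt (Q \<epsilon>) * bb \<epsilon> + 1 + 4 * sqrt ((Q \<epsilon> - qs \<epsilon> m) * e \<epsilon> m) \<le> p * (p / 2 * L + S p) + 2"
        using elim(3) unfolding En_def by linarith
    qed
    finally have en: "phase_field_energy L (h \<epsilon>) \<epsilon> uu vv \<le> ennreal (p * (p / 2 * L + S p) + 2)" .
    have um: "uu \<in> borel_measurable (lebesgue_on {0<..<L})"
      using continuous_on_interval_L2(1)[OF u_cont[OF P]] by (simp add: L2_on_def uu_def)
    have q0: "0 \<le> sqrt (Q \<epsilon>)" using q qs_pos[OF eps m mse] by simp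
    have "(\<integral>\<^sup>+x. ennreal \<bar>uu x - (p / 2 * x + S p * indicator {L / 2<..<L} x)\<bar> \<partial>(lebesgue_on {0<..<L}))
      \<le> (\<integral>\<^sup>+x. ennreal \<bar>uu x - (sqrt (Q \<epsilon>) * x + JJ \<epsilon> * indicator {L / 2<..<L} x)\<bar> \<partial>(lebesgue_on {0<..<L}))
        + ennreal ((\<bar>sqrt (Q \<epsilon>) - p / 2\<bar> * L + \<bar>JJ \<epsilon> - S p\<bar>) * L)"
    proof (rule nn_integral_lebesgue_on_triangle[OF um _ _ L])
      show "0 \<le> \<bar>sqrt (Q \<epsilon>) - p / 2\<bar> * L + \<bar>JJ \<epsilon> - S p\<bar>" using L by simp
      fix x assume x: "x \<in> {0<..<L}"
      have "\<bar>(sqrt (Q \<epsilon>) * x + JJ \<epsilon> * indicator {L / 2<..<L} x) - (p / 2 * x + S p * indicator {L / 2<..<L} x)\<bar>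
        = \<bar>(sqrt (Q \<epsilon>) - p / 2) * x + (JJ \<epsilon> - S p) * indicator {L / 2<..<L} x\<bar>" by (simp add: algebra_simps)
      also have "\<dots> \<le> \<bar>(sqrt (Q \<epsilon>) - p / 2) * x\<bar> + \<bar>(JJ \<epsilon> - S p) * indicator {L / 2<..<L} x\<bar>" by (rule abs_triangle_ineq)
      also have "\<dots> \<le> \<bar>sqrt (Q \<epsilon>) - p / 2\<bar> * L + \<bar>JJ \<epsilon> - S p\<bar>"
        using x by (intro add_mono) (auto simp: abs_mult indicator_def intro!: mult_left_mono)
      finally show "\<bar>(sqrt (Q \<epsilon>) * x + JJ \<epsilon> * indicator {L / 2<..<L} x) - (p / 2 * x + S p * indicator {L / 2<..<L} x)\<bar>
        \<le> \<bar>sqrt (Q \<epsilon>) - p / 2\<bar> * L + \<bar>JJ \<epsilon> - S p\<bar>" .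
    qed measurable
    also have "(\<integral>\<^sup>+x. ennreal \<bar>uu x - (sqrt (Q \<epsilon>) * x + JJ \<epsilon> * indicator {L / 2<..<L} x)\<bar> \<partial>(lebesgue_on {0<..<L}))
       \<le> ennreal (sqrt (Q \<epsilon>) * 2 * Y / (sqrt c * p\<^sup>2) * (4 * \<epsilon> * Y / sqrt c))"
    proof -
      have "integral {0..L} (\<lambda>x. \<bar>x - L / 2\<bar> * \<rho> \<epsilon> m (Q \<epsilon>) L x) \<le> sqrt (Q \<epsilon>) * 2 * Y / (sqrt c * p\<^sup>2) * (4 * \<epsilon> * Y / sqrt c)"
        using moment_bound[OF P] by (simp add: ck_def[OF P] c_def Y_def wm)
      then show ?thesis
        using order_trans[OF L1_bound[OF P] ennreal_leI] by (simp add: uu_def JE)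
    qed
    also have "ennreal (sqrt (Q \<epsilon>) * 2 * Y / (sqrt c * p\<^sup>2) * (4 * \<epsilon> * Y / sqrt c))
        + ennreal ((\<bar>sqrt (Q \<epsilon>) - p / 2\<bar> * L + \<bar>JJ \<epsilon> - S p\<bar>) * L) = ennreal (M \<epsilon>)"
      unfolding M_def using q0 Y c eps L by (intro ennreal_plus[symmetric]) auto
    also have "\<dots> \<le> ennreal \<delta>" using elim(2) by (intro ennreal_leI) simp
    finally have l1: "(\<integral>\<^sup>+x. ennreal \<bar>uu x - (p / 2 * x + S p * indicator {L / 2<..<L} x)\<bar> \<partial>(lebesgue_on {0<..<L})) \<le> ennreal \<delta>"
      by (simp add: add_right_mono)
    show ?case
      unfolding approximates_def hh using cp en l1 elim(4)
      by (intro exI[of _ "(uu, vv, bb \<epsilon>)"]) simp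
  qed
qed

text \<open>Used with a limit that is itself only close to the desired one: in the fractured case the profiles
  for small \<open>p > 0\<close> stand in for the limit \<open>p = 0\<close>.\<close>

lemma approximates_perturb:
  assumes L: "L > 0" and ap: "approximates L a' z C' \<delta>' \<epsilon> x" and z: "z \<in> borel_measurable borel"
    and K: "0 \<le> K" "\<And>x. x \<in> {0<..<L} \<Longrightarrow> \<bar>z x - ubar x\<bar> \<le> K"
    and le: "0 \<le> \<delta>'" "\<bar>a' - a\<bar> + \<delta>' \<le> \<delta>" "K * L + \<delta>' \<le> \<delta>" "C' \<le> C"
  shows "approximates L a ubar C \<delta> \<epsilon> x"
proof -
  obtain u v b where x: "x = (u, v, b)" by (cases x) auto
  have A: "critical_point L (trunc_f f seps \<psi> \<epsilon>) \<epsilon> b u v" "\<bar>b - a'\<bar> \<le> \<delta>'"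
     "phase_field_energy L (trunc_f f seps \<psi> \<epsilon>) \<epsilon> u v \<le> ennreal C'"
     "(\<integral>\<^sup>+x. ennreal \<bar>u x - z x\<bar> \<partial>(lebesgue_on {0<..<L})) \<le> ennreal \<delta>'"
    using ap by (auto simp: approximates_def x)
  have um: "u \<in> borel_measurable (lebesgue_on {0<..<L})"
    using A(1) by (auto simp: critical_point_def Let_def H1_on_def L2_on_def)
  have "(\<integral>\<^sup>+x. ennreal \<bar>u x - ubar x\<bar> \<partial>(lebesgue_on {0<..<L})) \<le> ennreal \<delta>' + ennreal (K * L)"
    using nn_integral_lebesgue_on_triangle[OF um z K(1) L K(2)] A(4) by (meson add_right_mono order_trans)
  also have "\<dots> = ennreal (\<delta>' + K * L)" using le K L by simp
  also have "\<dots> \<le> ennreal \<delta>" using le by (intro ennreal_leI) simp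
  finally have "(\<integral>\<^sup>+x. ennreal \<bar>u x - ubar x\<bar> \<partial>(lebesgue_on {0<..<L})) \<le> ennreal \<delta>" .
  moreover have "phase_field_energy L (trunc_f f seps \<psi> \<epsilon>) \<epsilon> u v \<le> ennreal C"
    using A(3) ennreal_leI[OF le(4)] by (rule order_trans)
  moreover have "\<bar>b - a\<bar> \<le> \<delta>" using A(2) le by linarith
  ultimately show ?thesis using A(1) by (simp add: approximates_def x)
qed

end

theorem theorem1p8:
  fixes L \<sigma>c a :: real and f seps ubar :: "real \<Rightarrow> real" and \<psi> :: "real \<Rightarrow> real \<Rightarrow> real"
  assumes "L > 0" and "\<sigma>c > 0"
    and "cohesive_degradation \<sigma>c f"
    and "truncation_data f seps \<psi>"
    and "(a > 0 \<and> (\<forall>x\<in>{0<..<L}. ubar x = a / L * x))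
       \<or> (\<exists>c0. 0 < c0 \<and> c0 < \<sigma>c / 2 \<and> a - c0 * L \<ge> 0 \<and>
            (cohesive_density f has_real_derivative 2 * c0) (at (a - c0 * L) within {0..}) \<and>
            (\<forall>x\<in>{0<..<L}. ubar x = c0 * x + (a - c0 * L) * indicator {L/2<..<L} x))
       \<or> (ereal a = s_frac f \<and> (\<forall>x\<in>{0<..<L}. ubar x = a * indicator {L/2<..<L} x))"
  shows "\<exists>\<epsilon>0>0. \<exists>(u :: real \<Rightarrow> real \<Rightarrow> real) (v :: real \<Rightarrow> real \<Rightarrow> real) (b :: real \<Rightarrow> real).
     (\<forall>\<epsilon>\<in>{0<..<\<epsilon>0}. critical_point L (trunc_f f seps \<psi> \<epsilon>) \<epsilon> (b \<epsilon>) (u \<epsilon>) (v \<epsilon>)) \<and>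
     (b \<longlongrightarrow> a) (at_right 0) \<and>
     (\<exists>C::real. \<forall>\<epsilon>\<in>{0<..<\<epsilon>0}.
        phase_field_energy L (trunc_f f seps \<psi> \<epsilon>) \<epsilon> (u \<epsilon>) (v \<epsilon>) \<le> ennreal C) \<and>
     ((\<lambda>\<epsilon>. \<integral>\<^sup>+x. ennreal \<bar>u \<epsilon> x - ubar x\<bar> \<partial>(lebesgue_on {0<..<L})) \<longlongrightarrow> 0) (at_right 0)"
proof -
  interpret truncated f \<sigma>c seps \<psi>
    using assms(2-4) by unfold_locales
  have L: "L > 0" by fact
  consider (elastic) "\<forall>x\<in>{0<..<L}. ubar x = a / L * x"
    | (cohesive) c0 where "0 < c0" "c0 < \<sigma>c / 2" "a - c0 * L \<ge> 0"
        "(cohesive_density f has_real_derivative 2 * c0) (at (a - c0 * L) within {0..})"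
        "\<forall>x\<in>{0<..<L}. ubar x = c0 * x + (a - c0 * L) * indicator {L/2<..<L} x"
    | (fractured) "ereal a = s_frac f" "\<forall>x\<in>{0<..<L}. ubar x = a * indicator {L/2<..<L} x"
    using assms(5) by blast
  then have "\<exists>C. \<forall>\<delta>>0. eventually (\<lambda>\<epsilon>. \<exists>x. approximates L a ubar C \<delta> \<epsilon> x) (at_right 0)"
  proof cases
    case elastic
    have "eventually (\<lambda>\<epsilon>. \<exists>x. approximates L a ubar (a\<^sup>2 / L) \<delta> \<epsilon> x) (at_right 0)" if "0 < \<delta>" for \<delta>
      using eventually_at_right_less[of 0]
    proof eventually_elim
      case (elim \<epsilon>)
      show ?case using constant_critical_point[OF L elim, of ubar a \<delta>] elastic that by blast
    qed
    then show ?thesis by blast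
  next
    case cohesive
    define p where "p = 2 * c0"
    have p: "0 < p" "p < \<sigma>c" using cohesive by (auto simp: p_def)
    have Sp: "S p = a - c0 * L"
      unfolding p_def using cohesive by (intro density_deriv_imp_S) auto
    have "eventually (\<lambda>\<epsilon>. \<exists>x. approximates L a ubar (p * (p / 2 * L + S p) + 2) \<delta> \<epsilon> x) (at_right 0)" if \<delta>: "0 < \<delta>" for \<delta>
      using cohesive_approximation[OF L p \<delta>]
    proof eventually_elim
      case (elim \<epsilon>)
      then obtain x where "approximates L (p / 2 * L + S p) (\<lambda>x. p / 2 * x + S p * indicator {L / 2<..<L} x)
         (p * (p / 2 * L + S p) + 2) \<delta> \<epsilon> x" by blast
      then have "approximates L a ubar (p * (p / 2 * L + S p) + 2) \<delta> \<epsilon> x"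
        by (rule approximates_perturb[OF L, where K = 0]) (use cohesive(5) Sp \<delta> in \<open>auto simp: p_def\<close>)
      then show ?case by blast
    qed
    then show ?thesis by blast
  next
    case fractured
    define C where "C = \<sigma>c * (\<sigma>c * L + \<bar>a\<bar>) + 2"
    have "eventually (\<lambda>\<epsilon>. \<exists>x. approximates L a ubar C \<delta> \<epsilon> x) (at_right 0)" if \<delta>: "0 < \<delta>" for \<delta>
    proof -
      \<comment> \<open>small enough that slope and jump each change the limit by at most a fraction of \<open>\<delta>\<close>\<close>
      define \<eta> where "\<eta> = \<delta> / (2 * (L * L + 2 * L + 2))"
      have \<eta>: "0 < \<eta>" "\<eta> * (L * L + 2 * L + 2) = \<delta> / 2"
      proof -
        define A where "A = L * L + 2 * L + 2"
        have "0 < A" using L by (simp add: A_def add_pos_pos)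
        then show "0 < \<eta>" "\<eta> * (L * L + 2 * L + 2) = \<delta> / 2"
          using \<delta> unfolding \<eta>_def A_def[symmetric] by simp_all
      qed
      obtain p where p: "0 < p" "p < \<sigma>c" "p < \<eta>" "\<bar>S p - a\<bar> < \<eta>"
        using s_frac_limit(2)[OF fractured(1) \<eta>(1)] by blast
      have Sa: "S p \<le> a" using s_frac_limit(1)[OF fractured(1)] p by simp
      have Cle: "p * (p / 2 * L + S p) + 2 \<le> C"
      proof -
        have "p / 2 * L \<le> \<sigma>c * L" using p L by (intro mult_right_mono) auto
        then have "p * (p / 2 * L + S p) \<le> \<sigma>c * (\<sigma>c * L + \<bar>a\<bar>)"
          using p L Sa S_pos[OF p(1,2)] by (intro mult_mono add_mono) auto
        then show ?thesis by (simp add: C_def)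
      qed
      have pL: "p / 2 * L \<le> \<eta> * L" using p L by (intro mult_right_mono) auto
      have LL: "0 < \<eta> * L" "0 < \<eta> * (L * L)" using \<eta> L by auto
      have sum: "\<eta> * (L * L) + 2 * (\<eta> * L) + 2 * \<eta> = \<delta> / 2" using \<eta>(2) by (simp add: algebra_simps)
      have "eventually (\<lambda>\<epsilon>. \<exists>x. approximates L (p / 2 * L + S p)
        (\<lambda>x. p / 2 * x + S p * indicator {L / 2<..<L} x) (p * (p / 2 * L + S p) + 2) (\<delta> / 2) \<epsilon> x) (at_right 0)"
        using \<delta> by (intro cohesive_approximation[OF L p(1,2)]) simp
      then show ?thesis
      proof eventually_elim
        case (elim \<epsilon>)
        then obtain x where "approximates L (p / 2 * L + S p) (\<lambda>x. p / 2 * x + S p * indicator {L / 2<..<L} x)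
           (p * (p / 2 * L + S p) + 2) (\<delta> / 2) \<epsilon> x" by blast
        then have "approximates L a ubar C \<delta> \<epsilon> x"
        proof (rule approximates_perturb[OF L, where K = "\<eta> * L + \<eta>"])
          show "0 \<le> \<eta> * L + \<eta>" using \<eta> L by simp
          fix x assume x: "x \<in> {0<..<L}"
          have "p / 2 * x \<le> p / 2 * L" using x p by (intro mult_left_mono) auto
          moreover have "0 \<le> p / 2 * x" using x p by simp
          moreover have "\<bar>(S p - a) * indicator {L / 2<..<L} x\<bar> \<le> \<eta>" using p \<eta> by (auto simp: indicator_def)
          moreover have "p / 2 * x + S p * indicator {L / 2<..<L} x - ubar x = p / 2 * x + (S p - a) * indicator {L / 2<..<L} x"
            using fractured(2) x by (simp add: algebra_simps)
          ultimately show "\<bar>p / 2 * x + S p * indicator {L / 2<..<L} x - ubar x\<bar> \<le> \<eta> * L + \<eta>"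
            using pL by linarith
        next
          have "\<bar>p / 2 * L + S p - a\<bar> \<le> \<eta> * L + \<eta>"
          proof -
            have "0 \<le> p / 2 * L" using p L by simp
            then show ?thesis using pL p(4) by linarith
          qed
          then show "\<bar>p / 2 * L + S p - a\<bar> + \<delta> / 2 \<le> \<delta>" using sum LL \<eta>(1) by linarith
          have "(\<eta> * L + \<eta>) * L = \<eta> * (L * L) + \<eta> * L" by (simp add: algebra_simps)
          then show "(\<eta> * L + \<eta>) * L + \<delta> / 2 \<le> \<delta>" using sum LL \<eta>(1) by linarith
        qed (use \<delta> Cle in auto)
        then show ?case by blast
      qed
    qed
    then show ?thesis by blast
  qed
  then obtain C where "\<And>\<delta>. 0 < \<delta> \<Longrightarrow> eventually (\<lambda>\<epsilon>. \<exists>x. approximates L a ubar C \<delta> \<epsilon> x) (at_right 0)" by blast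
  then show ?thesis by (rule approximates_imp_recovery)
qed

end
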